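(* Let $T>0$ and let $b:[0,T]\times\mathbb{R}^d\to\mathbb{R}^d$ be measurable, with $|b(t,y)|\le C_0(t)(1+|y|)$ for a.e. $(t,y)$ for some nonnegative $C_0\in L^1([0,T])$, and $b(t,\cdot)$ increasing for a.e. $t\in[0,T]$. Consider the equation $$-\partial_tu-b(t,x)\cdot\nabla u=0\quad\text{in }(0,T)\times\mathbb{R}^d.\qquad(\mathrm{TE})$$ Then, for all $R>0$, there exists a modulus of continuity $\omega_R:[0,\infty)\to[0,\infty)$ such that, if $u,v:[0,T]\times\mathbb{R}^d\to\mathbb{R}$ are respectively a subsolution and a supersolution of (TE), then, for all $t\in[0,T]$ and $p\in[1,\infty)$, $$\int_{B_R}\big(u(t,x)-v(t,x)\big)_+^p\,dx\le\int_{B_{R+\omega_R(T-t)}}\big(u(T,x)-v(T,x)\big)_+^p\,dx.$$ In particular, for any decreasing $u_T:\mathbb{R}^d\to\mathbb{R}$, there exists a unique solution $u$ of (TE) with $u(T,\cdot)=u_T$, which is given by $u(t,\cdot)=S(t,T)u_T$, and which is continuous a.e. in $[0,T]\times\mathbb{R}^d$.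
   Context: For $x,y\in\mathbb{R}^n$, $x\le y$ means $x_i\le y_i$ for all $i$; a function on $\mathbb{R}^d$ is increasing (decreasing) if it preserves (reverses) this order. $\mathbf 1=(1,\dots,1)$. One-sided mollifiers: fix a smooth nonnegative $\rho$ with support in $[-1,1]^d$ and $\int\rho=1$; set $\rho_\varepsilon(z)=\varepsilon^{-d}\rho\big(\frac{z-\varepsilon\mathbf 1}{\varepsilon}\big)$ and $\rho^\varepsilon(z)=\varepsilon^{-d}\rho\big(\frac{z+\varepsilon\mathbf 1}{\varepsilon}\big)$. Sub/supersolutions: $u:[0,T]\times\mathbb{R}^d\to\mathbb{R}$ is a supersolution (resp. subsolution) of (TE) if $u(t,\cdot)$ is decreasing for all $t\in[0,T]$ and, for all $\varepsilon>0$, with $u_\varepsilon=u*\rho_\varepsilon$ and $u^\varepsilon=u*\rho^\varepsilon$ (convolution in $x$), $$-\partial_tu_\varepsilon-b(t,x)\cdot\nabla u_\varepsilon\ge0\qquad\big(\text{resp. }-\partial_tu^\varepsilon-b(t,x)\cdot\nabla u^\varepsilon\le0\big)\qquad\text{for a.e. }(t,x)\in[0,T]\times\mathbb{R}^d,$$ where it is understood that the regularized functions are absolutely continuous in $t\in[0,T]$. A solution is both a sub- and a supersolution. Solutions are identified when, for every $t$, they agree for a.e. $x$. Solution operator: $S(s,t)\bar u(x)=\bar u(\phi_{t,s}(x))$ for $0\le s\le t\le T$, where $\phi$ is the regular Lagrangian flow of $b$: for every $s$ and a.e. $x$, $t\mapsto\phi_{t,s}(x)$ is the unique absolutely continuous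 solution on $[s,T]$ of $\partial_t\phi_{t,s}(x)\in\prod_{i=1}^d[b^i_*(t,\phi_{t,s}(x)),b^{i,*}(t,\phi_{t,s}(x))]$ for a.e. $t$, $\phi_{s,s}(x)=x$, with $b_*,b^*$ the coordinatewise lower/upper semicontinuous envelopes of $b(t,\cdot)$. *)

theory Defs
  imports "HOL-Analysis.Analysis"
begin

text \<open>
  The order on \<open>real ^ 'd\<close> is the library's componentwise order, so increasing and decreasing
  functions are \<open>mono\<close> and \<open>antimono\<close> ones, and \<open>1 :: real ^ 'd\<close> is the vector \<open>(1, \<dots>, 1)\<close>.
  Decreasing functions on \<open>real ^ 'd\<close> are Lebesgue measurable but in general not Borel measurable,
  hence integrals and null sets refer to \<open>lebesgue\<close>, not to \<open>lborel\<close>.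
\<close>

subsection \<open>Analytic notions\<close>

definition modulus_of_continuity :: "(real \<Rightarrow> real) \<Rightarrow> bool" where
  "modulus_of_continuity \<omega> \<longleftrightarrow>
     \<omega> 0 = 0 \<and> mono_on {0..} \<omega> \<and> continuous_on {0..} \<omega>"

definition absolutely_continuous_on :: "real \<Rightarrow> real \<Rightarrow> (real \<Rightarrow> 'a::metric_space) \<Rightarrow> bool" where
  "absolutely_continuous_on a c f \<longleftrightarrow>
     (\<forall>e>0. \<exists>\<delta>>0. \<forall>(n::nat) l r.
        (\<forall>i<n. a \<le> l i \<and> l i \<le> r i \<and> r i \<le> c) \<longrightarrow>
        disjoint_family_on (\<lambda>i. {l i<..<r i}) {..<n} \<longrightarrow>
        (\<Sum>i<n. r i - l i) < \<delta> \<longrightarrow>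
        (\<Sum>i<n. dist (f (l i)) (f (r i))) < e)"

text \<open>On a finite-dimensional space, continuity of \<open>x \<mapsto> Df(x)v\<close> for each direction \<open>v\<close> is
  continuity of \<open>Df\<close>, so \<open>C_k k\<close> is the usual class of \<open>k\<close> times continuously differentiable
  functions.\<close>

primrec C_k :: "nat \<Rightarrow> ('a::euclidean_space \<Rightarrow> real) \<Rightarrow> bool" where
  "C_k 0 f \<longleftrightarrow> continuous_on UNIV f"
| "C_k (Suc k) f \<longleftrightarrow> (\<forall>x. f differentiable (at x)) \<and>
     (\<forall>v. C_k k (\<lambda>x. frechet_derivative f (at x) v))"

definition smooth :: "('a::euclidean_space \<Rightarrow> real) \<Rightarrow> bool" where
  "smooth f \<longleftrightarrow> (\<forall>k. C_k k f)"

text \<open>The filter \<open>nhds x\<close> includes the point \<open>x\<close> itself, as it must for an envelope.\<close>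

definition lsc_envelope :: "('a::topological_space \<Rightarrow> real) \<Rightarrow> 'a \<Rightarrow> ereal" where
  "lsc_envelope f x = Liminf (nhds x) (\<lambda>y. ereal (f y))"

definition usc_envelope :: "('a::topological_space \<Rightarrow> real) \<Rightarrow> 'a \<Rightarrow> ereal" where
  "usc_envelope f x = Limsup (nhds x) (\<lambda>y. ereal (f y))"

definition convolution :: "(real ^ 'd \<Rightarrow> real) \<Rightarrow> (real ^ 'd \<Rightarrow> real) \<Rightarrow> real ^ 'd \<Rightarrow> real" where
  "convolution f g x = (LINT y|lebesgue. f y * g (x - y))"

subsection \<open>One-sided mollifiers\<close>

definition mollifier :: "(real ^ 'd \<Rightarrow> real) \<Rightarrow> bool" where
  "mollifier \<rho> \<longleftrightarrow> smooth \<rho> \<and> (\<forall>z. 0 \<le> \<rho> z) \<and>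
     closure {z. \<rho> z \<noteq> 0} \<subseteq> cbox (- 1) 1 \<and> (LINT z|lebesgue. \<rho> z) = 1"

definition moll_lower :: "(real ^ 'd \<Rightarrow> real) \<Rightarrow> real \<Rightarrow> real ^ 'd \<Rightarrow> real" where
  "moll_lower \<rho> \<epsilon> z = \<rho> ((z - \<epsilon> *\<^sub>R 1) /\<^sub>R \<epsilon>) / \<epsilon> ^ CARD('d)"

definition moll_upper :: "(real ^ 'd \<Rightarrow> real) \<Rightarrow> real \<Rightarrow> real ^ 'd \<Rightarrow> real" where
  "moll_upper \<rho> \<epsilon> z = \<rho> ((z + \<epsilon> *\<^sub>R 1) /\<^sub>R \<epsilon>) / \<epsilon> ^ CARD('d)"

subsection \<open>Sub- and supersolutions of the transport equation\<close>

definition TE_supersolution ::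
  "(real ^ 'd \<Rightarrow> real) \<Rightarrow> real \<Rightarrow> (real \<Rightarrow> real ^ 'd \<Rightarrow> real ^ 'd) \<Rightarrow> (real \<Rightarrow> real ^ 'd \<Rightarrow> real) \<Rightarrow> bool" where
  "TE_supersolution \<rho> T b u \<longleftrightarrow>
     (\<forall>t\<in>{0..T}. antimono (u t)) \<and>
     (\<forall>\<epsilon>>0. let u\<^sub>\<epsilon> = (\<lambda>t. convolution (u t) (moll_lower \<rho> \<epsilon>)) in
        (\<forall>x. absolutely_continuous_on 0 T (\<lambda>t. u\<^sub>\<epsilon> t x)) \<and>
        (AE (t, x) in lebesgue_on ({0..T} \<times> UNIV).
           \<exists>dt grad. ((\<lambda>s. u\<^sub>\<epsilon> s x) has_real_derivative dt) (at t) \<and>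
             GDERIV (u\<^sub>\<epsilon> t) x :> grad \<and> - dt - b t x \<bullet> grad \<ge> 0))"

definition TE_subsolution ::
  "(real ^ 'd \<Rightarrow> real) \<Rightarrow> real \<Rightarrow> (real \<Rightarrow> real ^ 'd \<Rightarrow> real ^ 'd) \<Rightarrow> (real \<Rightarrow> real ^ 'd \<Rightarrow> real) \<Rightarrow> bool" where
  "TE_subsolution \<rho> T b u \<longleftrightarrow>
     (\<forall>t\<in>{0..T}. antimono (u t)) \<and>
     (\<forall>\<epsilon>>0. let u\<^sub>\<epsilon> = (\<lambda>t. convolution (u t) (moll_upper \<rho> \<epsilon>)) in
        (\<forall>x. absolutely_continuous_on 0 T (\<lambda>t. u\<^sub>\<epsilon> t x)) \<and>
        (AE (t, x) in lebesgue_on ({0..T} \<times> UNIV).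
           \<exists>dt grad. ((\<lambda>s. u\<^sub>\<epsilon> s x) has_real_derivative dt) (at t) \<and>
             GDERIV (u\<^sub>\<epsilon> t) x :> grad \<and> - dt - b t x \<bullet> grad \<le> 0))"

definition TE_solution ::
  "(real ^ 'd \<Rightarrow> real) \<Rightarrow> real \<Rightarrow> (real \<Rightarrow> real ^ 'd \<Rightarrow> real ^ 'd) \<Rightarrow> (real \<Rightarrow> real ^ 'd \<Rightarrow> real) \<Rightarrow> bool" where
  "TE_solution \<rho> T b u \<longleftrightarrow> TE_subsolution \<rho> T b u \<and> TE_supersolution \<rho> T b u"

subsection \<open>The regular Lagrangian flow and the solution operator\<close>

definition flow_curve ::
  "real \<Rightarrow> (real \<Rightarrow> real ^ 'd \<Rightarrow> real ^ 'd) \<Rightarrow> real \<Rightarrow> real ^ 'd \<Rightarrow> (real \<Rightarrow> real ^ 'd) \<Rightarrow> bool" where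
  "flow_curve T b s x \<gamma> \<longleftrightarrow>
     absolutely_continuous_on s T \<gamma> \<and> \<gamma> s = x \<and>
     (AE t in lebesgue_on {s..T}.
        \<exists>D. (\<gamma> has_vector_derivative D) (at t) \<and>
          (\<forall>i. lsc_envelope (\<lambda>y. b t y $ i) (\<gamma> t) \<le> ereal (D $ i) \<and>
               ereal (D $ i) \<le> usc_envelope (\<lambda>y. b t y $ i) (\<gamma> t)))"

text \<open>\<open>\<phi> t s x\<close> stands for the position \<open>\<phi>\<^bsub>t,s\<^esub>(x)\<close> at time \<open>t\<close> of the particle started in
  \<open>x\<close> at time \<open>s\<close>.\<close>

definition regular_lagrangian_flow ::
  "real \<Rightarrow> (real \<Rightarrow> real ^ 'd \<Rightarrow> real ^ 'd) \<Rightarrow> (real \<Rightarrow> real \<Rightarrow> real ^ 'd \<Rightarrow> real ^ 'd) \<Rightarrow> bool" where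
  "regular_lagrangian_flow T b \<phi> \<longleftrightarrow>
     (\<forall>s\<in>{0..T}. AE x in lebesgue.
        flow_curve T b s x (\<lambda>t. \<phi> t s x) \<and>
        (\<forall>\<gamma>. flow_curve T b s x \<gamma> \<longrightarrow> (\<forall>t\<in>{s..T}. \<gamma> t = \<phi> t s x)))"

definition solution_operator ::
  "(real \<Rightarrow> real \<Rightarrow> real ^ 'd \<Rightarrow> real ^ 'd) \<Rightarrow> real \<Rightarrow> real \<Rightarrow> (real ^ 'd \<Rightarrow> real) \<Rightarrow> real ^ 'd \<Rightarrow> real" where
  "solution_operator \<phi> s t f x = f (\<phi> t s x)"

end

theory Submission
  imports Defs
begin

text \<open>
  The proof is Lagrangian, and everything rests on two order properties: the velocity is increasing
  and the solutions are decreasing.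

  \<^emph>\<open>The flow.\<close> The field \<open>b\<close> is first replaced by its limit from the upper right, a field \<open>B\<close> that
  is increasing for every time and jointly Borel (\<open>ex_regularised_field\<close>). The Picard operator of
  an increasing field preserves the order of paths, so among the solutions of the integral equation
  from \<open>x\<close> there is a greatest one, \<open>flow s x\<close> (\<open>ex_greatest_path\<close>). If \<open>x \<le> y\<close>, then the path from
  \<open>y\<close> is always the faster one, whence \<open>y - x \<le> flow s y t - flow s x t\<close>. This
  expansion (\<open>flow_expanding\<close>) has three consequences. The map \<open>flow s \<sqdot> t\<close> is increasing, hence
  continuous almost everywhere. Each solution of the differential inclusion from \<open>x\<close> lies between
  \<open>flow s (x - \<tau>) + \<tau>\<close> and \<open>flow s x\<close>, so it equals the flow wherever the flow is continuous in
  \<open>x\<close> (\<open>flow_regular_lagrangian\<close>). Finally the flow does not decrease distances along the axes, so it can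
  only spread mass out: \<open>\<integral> g (flow s x t) dx \<le> \<integral> g\<close> for lower semicontinuous \<open>g \<ge> 0\<close>. The last
  claim is proved on a scheme that moves one coordinate at a time (\<open>nn_integral_flow_le\<close>).

  \<^emph>\<open>Sub- and supersolutions along the flow.\<close> The inequality for a mollified supersolution holds only
  for almost every point, and a single path may avoid all of these. But the gradient of the
  mollification is \<open>\<le> 0\<close>, so at points slightly below the path, where \<open>b\<close> is at most the speed of
  the path, the inequality gives a decrease also with the speed of the path in place of \<open>b\<close>. Hence
  the mollified supersolution decreases along the flow, and symmetrically the mollified subsolution
  increases (\<open>lagrangian_monotone\<close>). The positive part of the difference of sub- and supersolution at
  \<open>(t, x)\<close> is therefore at most the one at \<open>(T, flow t x T)\<close>. Gronwall's lemma bounds how far the flow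
  leaves a ball, the bound on \<open>\<integral> g (flow s x t) dx\<close> gives the integral inequality, and the mollification is
  removed with Fatou's lemma (\<open>comparison\<close>).

  \<^emph>\<open>Existence, uniqueness, continuity.\<close> For decreasing \<open>g\<close> put \<open>u t x = g (flow t x T)\<close>. By expansion
  the one-sided mollifications of \<open>u\<close> are monotone along translates of a path, and differentiating in
  time at Lebesgue points of the velocity gives the two inequalities (\<open>transported_solution\<close>). Conversely
  monotonicity along the flow squeezes every solution between neighbouring values of this one
  (\<open>solution_unique\<close>). A solution is continuous at \<open>(t, x)\<close> as soon as \<open>u t\<close> is continuous at \<open>x\<close>, because
  the mollifications are continuous in time and bound \<open>u\<close> from both sides (\<open>solution_continuous_ae\<close>).
\<close>

section \<open>Absolutely continuous functions\<close>

lemma AC_subinterval: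
  assumes "absolutely_continuous_on a c f" "a \<le> a'" "c' \<le> c"
  shows "absolutely_continuous_on a' c' f"
  unfolding absolutely_continuous_on_def
proof (intro allI impI)
  fix e :: real assume "e > 0"
  then obtain d where d: "d > 0" "\<And>(n::nat) l r. \<lbrakk>\<forall>i<n. a \<le> l i \<and> l i \<le> r i \<and> r i \<le> c;
     disjoint_family_on (\<lambda>i. {l i<..<r i}) {..<n}; (\<Sum>i<n. r i - l i) < d\<rbrakk> \<Longrightarrow>
     (\<Sum>i<n. dist (f (l i)) (f (r i))) < e"
    using assms(1) unfolding absolutely_continuous_on_def by blast
  show "\<exists>\<delta>>0. \<forall>(n::nat) l r. (\<forall>i<n. a' \<le> l i \<and> l i \<le> r i \<and> r i \<le> c') \<longrightarrow>
        disjoint_family_on (\<lambda>i. {l i<..<r i}) {..<n} \<longrightarrow> (\<Sum>i<n. r i - l i) < \<delta> \<longrightarrow>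
        (\<Sum>i<n. dist (f (l i)) (f (r i))) < e"
    by (rule exI[of _ d]) (use d assms(2,3) in \<open>auto intro!: d(2) intro: order_trans\<close>)
qed

lemma AC_dominated:
  assumes AC: "absolutely_continuous_on a c f" and "K > 0"
    and dom: "\<And>u v. a \<le> u \<Longrightarrow> u \<le> v \<Longrightarrow> v \<le> c \<Longrightarrow> dist (g u) (g v) \<le> K * dist (f u) (f v)"
  shows "absolutely_continuous_on a c g"
  unfolding absolutely_continuous_on_def
proof (intro allI impI)
  fix e :: real assume "e > 0"
  then have "e / K > 0" using \<open>K > 0\<close> by simp
  then obtain d where d: "d > 0" "\<And>(n::nat) l r. \<lbrakk>\<forall>i<n. a \<le> l i \<and> l i \<le> r i \<and> r i \<le> c;
     disjoint_family_on (\<lambda>i. {l i<..<r i}) {..<n}; (\<Sum>i<n. r i - l i) < d\<rbrakk> \<Longrightarrow>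
     (\<Sum>i<n. dist (f (l i)) (f (r i))) < e / K"
    using AC unfolding absolutely_continuous_on_def by blast
  have "(\<Sum>i<n. dist (g (l i)) (g (r i))) < e"
    if "\<forall>i<n. a \<le> l i \<and> l i \<le> r i \<and> r i \<le> c"
     "disjoint_family_on (\<lambda>i. {l i<..<r i}) {..<n}" "(\<Sum>i<n. r i - l i) < d" for n :: nat and l r
  proof -
    have "(\<Sum>i<n. dist (g (l i)) (g (r i))) \<le> (\<Sum>i<n. K * dist (f (l i)) (f (r i)))"
      using that(1) by (intro sum_mono dom) auto
    also have "\<dots> = K * (\<Sum>i<n. dist (f (l i)) (f (r i)))" by (simp add: sum_distrib_left)
    also have "\<dots> < K * (e / K)" using d(2)[OF that] \<open>K > 0\<close> by (intro mult_strict_left_mono)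
    finally show ?thesis using \<open>K > 0\<close> by simp
  qed
  then show "\<exists>\<delta>>0. \<forall>(n::nat) l r. (\<forall>i<n. a \<le> l i \<and> l i \<le> r i \<and> r i \<le> c) \<longrightarrow>
        disjoint_family_on (\<lambda>i. {l i<..<r i}) {..<n} \<longrightarrow> (\<Sum>i<n. r i - l i) < \<delta> \<longrightarrow>
        (\<Sum>i<n. dist (g (l i)) (g (r i))) < e"
    using d(1) by blast
qed

lemma AC_diff:
  fixes f g :: "real \<Rightarrow> real"
  assumes "absolutely_continuous_on a c f" "absolutely_continuous_on a c g"
  shows "absolutely_continuous_on a c (\<lambda>t. f t - g t)"
  unfolding absolutely_continuous_on_def
proof (intro allI impI)
  fix e :: real assume "e > 0"
  then have e2: "e / 2 > 0" by simp
  obtain d where d: "d > 0" "\<And>(n::nat) l r. \<lbrakk>\<forall>i<n. a \<le> l i \<and> l i \<le> r i \<and> r i \<le> c;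
     disjoint_family_on (\<lambda>i. {l i<..<r i}) {..<n}; (\<Sum>i<n. r i - l i) < d\<rbrakk> \<Longrightarrow>
     (\<Sum>i<n. dist (f (l i)) (f (r i))) < e / 2"
    using assms(1) e2 unfolding absolutely_continuous_on_def by blast
  obtain d' where d': "d' > 0" "\<And>(n::nat) l r. \<lbrakk>\<forall>i<n. a \<le> l i \<and> l i \<le> r i \<and> r i \<le> c;
     disjoint_family_on (\<lambda>i. {l i<..<r i}) {..<n}; (\<Sum>i<n. r i - l i) < d'\<rbrakk> \<Longrightarrow>
     (\<Sum>i<n. dist (g (l i)) (g (r i))) < e / 2"
    using assms(2) e2 unfolding absolutely_continuous_on_def by blast
  have "(\<Sum>i<n. dist (f (l i) - g (l i)) (f (r i) - g (r i))) < e"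
    if "\<forall>i<n. a \<le> l i \<and> l i \<le> r i \<and> r i \<le> c"
     "disjoint_family_on (\<lambda>i. {l i<..<r i}) {..<n}" "(\<Sum>i<n. r i - l i) < min d d'" for n :: nat and l r
  proof -
    have "(\<Sum>i<n. dist (f (l i) - g (l i)) (f (r i) - g (r i)))
       \<le> (\<Sum>i<n. dist (f (l i)) (f (r i)) + dist (g (l i)) (g (r i)))"
      by (intro sum_mono) (auto simp: dist_real_def)
    also have "\<dots> < e / 2 + e / 2"
      using d(2)[OF that(1,2)] d'(2)[OF that(1,2)] that(3) by (simp add: sum.distrib)
    finally show ?thesis by simp
  qed
  then show "\<exists>\<delta>>0. \<forall>(n::nat) l r. (\<forall>i<n. a \<le> l i \<and> l i \<le> r i \<and> r i \<le> c) \<longrightarrow>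
        disjoint_family_on (\<lambda>i. {l i<..<r i}) {..<n} \<longrightarrow> (\<Sum>i<n. r i - l i) < \<delta> \<longrightarrow>
        (\<Sum>i<n. dist (f (l i) - g (l i)) (f (r i) - g (r i))) < e"
    using d(1) d'(1) by (intro exI[of _ "min d d'"]) auto
qed

lemma AC_continuous_on:
  assumes "absolutely_continuous_on a c f"
  shows "continuous_on {a..c} f"
  unfolding continuous_on_iff
proof (intro ballI allI impI)
  fix x e :: real assume x: "x \<in> {a..c}" and "e > 0"
  then obtain d where d: "d > 0" "\<And>(n::nat) l r. \<lbrakk>\<forall>i<n. a \<le> l i \<and> l i \<le> r i \<and> r i \<le> c;
     disjoint_family_on (\<lambda>i. {l i<..<r i}) {..<n}; (\<Sum>i<n. r i - l i) < d\<rbrakk> \<Longrightarrow>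
     (\<Sum>i<n. dist (f (l i)) (f (r i))) < e"
    using assms unfolding absolutely_continuous_on_def by blast
  have "dist (f y) (f x) < e" if "y \<in> {a..c}" "dist y x < d" for y
    using d(2)[of 1 "\<lambda>_. min x y" "\<lambda>_. max x y"] that x
    by (cases "x \<le> y") (auto simp: disjoint_family_on_def dist_real_def min_def max_def dist_commute)
  with d(1) show "\<exists>d>0. \<forall>x'\<in>{a..c}. dist x' x < d \<longrightarrow> dist (f x') (f x) < e" by blast
qed

lemma sum_list_lengths_eq_measure:
  fixes xs :: "(real \<times> real) list"
  assumes "sorted_wrt (\<lambda>p q. snd p \<le> fst q) xs" "\<And>p. p \<in> set xs \<Longrightarrow> fst p \<le> snd p"
  shows "ennreal (\<Sum>p\<leftarrow>xs. snd p - fst p) = emeasure lborel (\<Union>p\<in>set xs. {fst p<..<snd p})"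
  using assms
proof (induction xs)
  case (Cons p xs)
  have "{fst p<..<snd p} \<inter> (\<Union>p\<in>set xs. {fst p<..<snd p}) = {}"
    using Cons.prems by fastforce
  then have "emeasure lborel (\<Union>p\<in>set (p # xs). {fst p<..<snd p}) =
      emeasure lborel {fst p<..<snd p} + emeasure lborel (\<Union>p\<in>set xs. {fst p<..<snd p})"
    by (subst plus_emeasure) auto
  also have "\<dots> = ennreal (snd p - fst p) + ennreal (\<Sum>p\<leftarrow>xs. snd p - fst p)"
    using Cons by simp
  also have "\<dots> = ennreal (\<Sum>p\<leftarrow>p # xs. snd p - fst p)"
    using Cons.prems by (subst ennreal_plus[symmetric]) (auto intro!: sum_list_nonneg)
  finally show ?case by simp
qed simp

text \<open>
  Lists of intervals in increasing order can be concatenated, which is what gluing partitions of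
  adjacent intervals needs; indexed families cannot.
\<close>

lemma AC_sum_list:
  assumes "absolutely_continuous_on a c f" "e > 0"
  obtains \<delta> where "\<delta> > 0" "\<And>xs. \<lbrakk>sorted_wrt (\<lambda>p q. snd p \<le> fst q) xs;
     \<And>p. p \<in> set xs \<Longrightarrow> a \<le> fst p \<and> fst p \<le> snd p \<and> snd p \<le> c; (\<Sum>p\<leftarrow>xs. snd p - fst p) < \<delta>\<rbrakk>
     \<Longrightarrow> (\<Sum>p\<leftarrow>xs. dist (f (fst p)) (f (snd p))) < e"
proof -
  obtain d where d: "d > 0" "\<And>(n::nat) l r. \<lbrakk>\<forall>i<n. a \<le> l i \<and> l i \<le> r i \<and> r i \<le> c;
     disjoint_family_on (\<lambda>i. {l i<..<r i}) {..<n}; (\<Sum>i<n. r i - l i) < d\<rbrakk> \<Longrightarrow>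
     (\<Sum>i<n. dist (f (l i)) (f (r i))) < e"
    using assms unfolding absolutely_continuous_on_def by blast
  have "(\<Sum>p\<leftarrow>xs. dist (f (fst p)) (f (snd p))) < e"
    if xs: "sorted_wrt (\<lambda>p q. snd p \<le> fst q) xs"
     "\<And>p. p \<in> set xs \<Longrightarrow> a \<le> fst p \<and> fst p \<le> snd p \<and> snd p \<le> c" "(\<Sum>p\<leftarrow>xs. snd p - fst p) < d"
   for xs :: "(real \<times> real) list"
  proof -
    have "disjoint_family_on (\<lambda>i. {fst (xs ! i)<..<snd (xs ! i)}) {..<length xs}"
      unfolding disjoint_family_on_def
    proof (intro ballI impI)
      fix m n assume mn: "m \<in> {..<length xs}" "n \<in> {..<length xs}" "m \<noteq> n"
      then consider "m < n" | "n < m" by linarith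
      then show "{fst (xs ! m)<..<snd (xs ! m)} \<inter> {fst (xs ! n)<..<snd (xs ! n)} = {}"
      proof cases
        case 1 then have "snd (xs ! m) \<le> fst (xs ! n)" using xs(1) mn sorted_wrt_nth_less by blast
        then show ?thesis by auto
      next
        case 2 then have "snd (xs ! n) \<le> fst (xs ! m)" using xs(1) mn sorted_wrt_nth_less by blast
        then show ?thesis by auto
      qed
    qed
    then show ?thesis
      using d(2)[of "length xs" "\<lambda>i. fst (xs ! i)" "\<lambda>i. snd (xs ! i)"] xs
      by (simp add: sum_list_sum_nth atLeast0LessThan)
  qed
  with d(1) show ?thesis using that by blast
qed

lemma null_set_if_AE_not_in:
  assumes "AE t in lebesgue. t \<notin> N"
  shows "N \<in> null_sets lebesgue"
proof -
  obtain N' where "\<And>t. t \<in> space lebesgue - N' \<Longrightarrow> t \<notin> N" "N' \<in> null_sets lebesgue"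
    using AE_E3[OF assms] by blast
  then show ?thesis by (intro null_sets_completion_subset[of N N']) auto
qed

text \<open>
  The exceptional null set has a neighbourhood \<open>U\<close> of small measure, on which absolute continuity
  bounds the variation of \<open>f\<close>. At all other points the derivative bounds the decrease of \<open>f\<close> over
  short intervals. Bolzano's lemma glues the local statements to one on \<open>[a, c]\<close>.
\<close>

lemma AC_deriv_nonneg_imp_le:
  fixes f :: "real \<Rightarrow> real"
  assumes AC: "absolutely_continuous_on a c f" and "a \<le> c"
    and AE: "AE t in lborel. a < t \<and> t < c \<longrightarrow> (\<exists>D\<ge>0. (f has_real_derivative D) (at t))"
  shows "f a \<le> f c"
proof -
  define N where "N = {t. \<not> (a < t \<and> t < c \<longrightarrow> (\<exists>D\<ge>0. (f has_real_derivative D) (at t)))} \<union> {a, c}"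
  have "AE t in lebesgue. t \<notin> N"
    unfolding N_def using AE_completion[OF AE] AE_completion[OF AE_lborel_singleton[of a]]
      AE_completion[OF AE_lborel_singleton[of c]] by eventually_elim auto
  then have N: "N \<in> null_sets lebesgue"
    by (rule null_set_if_AE_not_in)
  have main: "f a - f c \<le> e * (c - a) + e" if "e > 0" for e
  proof -
    obtain \<delta> where \<delta>: "\<delta> > 0" "\<And>xs. \<lbrakk>sorted_wrt (\<lambda>p q. snd p \<le> fst q) xs;
     \<And>p. p \<in> set xs \<Longrightarrow> a \<le> fst p \<and> fst p \<le> snd p \<and> snd p \<le> c; (\<Sum>p\<leftarrow>xs. snd p - fst p) < \<delta>\<rbrakk>
     \<Longrightarrow> (\<Sum>p\<leftarrow>xs. dist (f (fst p)) (f (snd p))) < e"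
      using AC_sum_list[OF AC \<open>e > 0\<close>] by blast
    obtain U where U: "open U" "N \<subseteq> U" "emeasure lebesgue (U - N) < ennreal \<delta>"
      using sets_lebesgue_outer_open[of N \<delta>] N \<delta>(1) by blast
    have "emeasure lebesgue U \<le> emeasure lebesgue ((U - N) \<union> N)"
      using U N by (intro emeasure_mono) auto
    also have "\<dots> \<le> emeasure lebesgue (U - N) + emeasure lebesgue N"
      using U N by (intro emeasure_subadditive) auto
    also have "\<dots> < ennreal \<delta>" using N U(3) by (simp add: null_setsD1)
    finally have Um: "emeasure lborel U < ennreal \<delta>" using U(1) by simp
    \<comment> \<open>the decrease of \<open>f\<close> on \<open>[u, v]\<close>, up to \<open>e * (v - u)\<close>, is paid for by the variation over intervals inside \<open>U\<close>\<close>
    define Q where "Q u v xs \<longleftrightarrow> sorted_wrt (\<lambda>p q. snd p \<le> fst q) xs \<and>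
       (\<forall>p\<in>set xs. u \<le> fst p \<and> fst p \<le> snd p \<and> snd p \<le> v \<and> {fst p<..<snd p} \<subseteq> U) \<and>
       f u - f v \<le> e * (v - u) + (\<Sum>p\<leftarrow>xs. dist (f (fst p)) (f (snd p)))" for u v xs
    define P where "P u v \<longleftrightarrow> (a \<le> u \<and> u \<le> v \<and> v \<le> c \<longrightarrow> (\<exists>xs. Q u v xs))" for u v
    have "P a c"
      using \<open>a \<le> c\<close>
    proof (induction rule: Bolzano)
      case (trans u v w)
      show ?case unfolding P_def
      proof
        assume "a \<le> u \<and> u \<le> w \<and> w \<le> c"
        with trans obtain xs ys where xy: "Q u v xs" "Q v w ys" by (auto simp: P_def)
        have "Q u w (xs @ ys)"
          using xy trans(3,4) unfolding Q_def
          by (auto simp: sorted_wrt_append algebra_simps intro: order_trans)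
        then show "\<exists>xs. Q u w xs" by blast
      qed
    next
      case (local x)
      show ?case
      proof (cases "x \<in> N")
        case True
        then obtain d where d: "d > 0" "ball x d \<subseteq> U" using U(1,2) openE by blast
        have "Q u v [(u, v)]" if "u \<le> x" "x \<le> v" "v - u < d" for u v
        proof -
          have "{u<..<v} \<subseteq> ball x d" using that by (auto simp: dist_real_def)
          moreover have "0 \<le> e * (v - u)" using that \<open>e > 0\<close> by simp
          ultimately show ?thesis using d(2) that unfolding Q_def by (auto simp: dist_real_def)
        qed
        then show ?thesis using d(1) unfolding P_def by blast
      next
        case False
        then obtain D where D: "D \<ge> 0" "(f has_real_derivative D) (at x)"
          using local unfolding N_def by auto
        then obtain d where d: "d > 0" "\<And>y. y \<noteq> x \<Longrightarrow> dist y x < d \<Longrightarrow> \<bar>(f y - f x) / (y - x) - D\<bar> < e"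
          using \<open>e > 0\<close> unfolding has_field_derivative_iff LIM_def dist_real_def by auto
        have key: "\<bar>(f y - f x) - D * (y - x)\<bar> \<le> e * \<bar>y - x\<bar>" if "dist y x < d" for y
        proof (cases "y = x")
          case False
          then have "\<bar>((f y - f x) / (y - x) - D) * (y - x)\<bar> \<le> e * \<bar>y - x\<bar>"
            unfolding abs_mult using d(2)[OF False that] by (intro mult_right_mono) auto
          moreover have "((f y - f x) / (y - x) - D) * (y - x) = (f y - f x) - D * (y - x)"
            using False by (simp add: left_diff_distrib[where a = "(f y - f x) / (y - x)"])
          ultimately show ?thesis by simp
        qed simp
        have "Q u v []" if "u \<le> x" "x \<le> v" "v - u < d" for u v
        proof -
          have "f u - f x \<le> D * (u - x) + e * (x - u)" using key[of u] that by (auto simp: dist_real_def)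
          moreover have "f x - f v \<le> - D * (v - x) + e * (v - x)"
            using key[of v] that by (auto simp: dist_real_def)
          moreover have "D * (u - x) \<le> 0" "- D * (v - x) \<le> 0"
            using D(1) that by (auto simp: mult_nonneg_nonpos)
          ultimately show ?thesis unfolding Q_def by (simp add: algebra_simps)
        qed
        then show ?thesis using d(1) unfolding P_def by blast
      qed
    qed
    then obtain xs where xs: "Q a c xs" using \<open>a \<le> c\<close> by (auto simp: P_def)
    have "ennreal (\<Sum>p\<leftarrow>xs. snd p - fst p) = emeasure lborel (\<Union>p\<in>set xs. {fst p<..<snd p})"
      using xs unfolding Q_def by (intro sum_list_lengths_eq_measure) auto
    also have "\<dots> \<le> emeasure lborel U"
      using xs U(1) unfolding Q_def by (intro emeasure_mono) auto
    also have "\<dots> < ennreal \<delta>" by (fact Um)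
    finally have "(\<Sum>p\<leftarrow>xs. snd p - fst p) < \<delta>" by (metis ennreal_leI not_le)
    then have "(\<Sum>p\<leftarrow>xs. dist (f (fst p)) (f (snd p))) < e"
      using xs unfolding Q_def by (intro \<delta>(2)) auto
    then show ?thesis using xs unfolding Q_def by auto
  qed
  have "f a - f c \<le> 0"
  proof (rule field_le_epsilon)
    fix e :: real assume "e > 0"
    have "e / (c - a + 1) > 0" using \<open>e > 0\<close> \<open>a \<le> c\<close> by simp
    from main[OF this] have "f a - f c \<le> e / (c - a + 1) * (c - a + 1)" by (simp only: distrib_left mult_1_right)
    then show "f a - f c \<le> 0 + e" using \<open>a \<le> c\<close> by simp
  qed
  then show ?thesis by simp
qed

text \<open>
  The exceptional null set does not depend on the base point \<open>a\<close>. The differentiation theorem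
  \<open>integrable_ccontinuous_explicit\<close> treats quotients to the right; the ones to the left are quotients
  to the right of the reflected function.
\<close>

lemma has_real_derivative_indefinite_integral_ae:
  fixes f :: "real \<Rightarrow> real"
  assumes int: "\<And>a b. f integrable_on {a..b}"
  shows "AE t in lborel. \<forall>a<t. ((\<lambda>t. integral {a..t} f) has_real_derivative f t) (at t)"
proof -
  have int': "(\<lambda>t. f (-t)) integrable_on {a..b}" for a b
    using int[of "-b" "-a"] Henstock_Kurzweil_Integration.integrable_reflect_real[where f = f and a = "-b" and b = "-a"] by simp
  obtain N1 where N1: "negligible N1" "\<And>x e. \<lbrakk>x \<notin> N1; 0 < e\<rbrakk> \<Longrightarrow>
      \<exists>d>0. \<forall>h. 0 < h \<and> h < d \<longrightarrow> \<bar>integral {x..x + h} f / h - f x\<bar> < e"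
    using integrable_ccontinuous_explicit[of f] int by (auto simp: divide_inverse mult.commute)
  obtain N2 where N2: "negligible N2" "\<And>x e. \<lbrakk>x \<notin> N2; 0 < e\<rbrakk> \<Longrightarrow>
      \<exists>d>0. \<forall>h. 0 < h \<and> h < d \<longrightarrow> \<bar>integral {x..x + h} (\<lambda>t. f (-t)) / h - f (-x)\<bar> < e"
    using integrable_ccontinuous_explicit[of "\<lambda>t. f (-t)"] int' by (auto simp: divide_inverse mult.commute)
  have "negligible (uminus ` N2)" using N2(1)
    by (intro negligible_differentiable_image_negligible) (auto simp: differentiable_on_def)
  then have N: "negligible (N1 \<union> uminus ` N2)" using N1(1) by (rule negligible_Un[rotated])
  have main: "((\<lambda>t. integral {a..t} f) has_real_derivative f t) (at t)" if t: "t \<notin> N1 \<union> uminus ` N2" "a < t" for t a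
    unfolding has_field_derivative_iff LIM_def
  proof (intro allI impI)
    fix e :: real assume "e > 0"
    obtain d1 where d1: "d1 > 0" "\<And>h. 0 < h \<Longrightarrow> h < d1 \<Longrightarrow> \<bar>integral {t..t + h} f / h - f t\<bar> < e"
      using N1(2)[of t e] t \<open>e > 0\<close> by auto
    have "- t \<notin> N2" using t by force
    then obtain d2 where d2: "d2 > 0" "\<And>h. 0 < h \<Longrightarrow> h < d2 \<Longrightarrow>
        \<bar>integral {-t..-t + h} (\<lambda>t. f (-t)) / h - f t\<bar> < e"
      using N2(2)[of "-t" e] \<open>e > 0\<close> by auto
    have "dist ((integral {a..y} f - integral {a..t} f) / (y - t)) (f t) < e"
      if y: "y \<noteq> t" "dist y t < min (t - a) (min d1 d2)" for y
    proof (cases "y > t")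
      case True
      have "integral {a..y} f = integral {a..t} f + integral {t..y} f"
        using Henstock_Kurzweil_Integration.integral_combine[of a t y f] t True int by simp
      then show ?thesis using d1(2)[of "y - t"] True y by (simp add: dist_real_def)
    next
      case False
      then have ya: "a < y" "y < t" using y by (auto simp: dist_real_def)
      have *: "integral {a..t} f = integral {a..y} f + integral {y..t} f"
        using Henstock_Kurzweil_Integration.integral_combine[of a y t f] ya int by simp
      have "integral {-t..-y} (\<lambda>t. f (-t)) = integral {y..t} f"
        by (rule Henstock_Kurzweil_Integration.integral_reflect_real)
      then have "\<bar>integral {y..t} f / (t - y) - f t\<bar> < e"
        using d2(2)[of "t - y"] ya y by (simp add: dist_real_def)
      moreover have "(integral {a..y} f - integral {a..t} f) / (y - t) = integral {y..t} f / (t - y)"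
        using * ya by (simp add: field_simps divide_simps)
      ultimately show ?thesis by (simp add: dist_real_def)
    qed
    then show "\<exists>s>0. \<forall>x. x \<noteq> t \<and> dist x t < s \<longrightarrow>
        dist ((integral {a..x} f - integral {a..t} f) / (x - t)) (f t) < e"
      using d1(1) d2(1) t by (intro exI[of _ "min (t - a) (min d1 d2)"]) auto
  qed
  have "AE t in lebesgue. t \<notin> N1 \<union> uminus ` N2"
    using N unfolding negligible_iff_null_sets by (rule AE_not_in)
  then have "AE t in lebesgue. \<forall>a<t. ((\<lambda>t. integral {a..t} f) has_real_derivative f t) (at t)"
    by (rule eventually_mono) (use main in auto)
  then show ?thesis by (simp add: AE_completion_iff)
qed

text \<open>
  A compact set is the intersection of its neighbourhoods made of cells of finer and finer grids,
  which gives the inequality for compact sets; inner regularity gives it for Borel sets.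
\<close>

lemma measure_le_if_interval_measure_le:
  fixes M N :: "real measure"
  assumes sM: "sets M = sets borel" and sN: "sets N = sets borel"
    and finN: "emeasure N UNIV < \<infinity>"
    and le: "\<And>a b. a < b \<Longrightarrow> emeasure M {a<..b} \<le> emeasure N {a<..b}"
    and A: "A \<in> sets borel"
  shows "emeasure M A \<le> emeasure N A"
proof -
  \<comment> \<open>the \<open>k\<close>-th cell of the grid of width \<open>1 / (n + 1)\<close>\<close>
  define D where "D n k = {real_of_int k / real (Suc n)<..(real_of_int k + 1) / real (Suc n)}" for n and k :: int
  have Dmeas: "D n k \<in> sets borel" for n k unfolding D_def by simp
  have Ddisj: "disjoint_family (D n)" for n
    unfolding disjoint_family_on_def
  proof (intro ballI impI)
    fix k l :: int assume "k \<noteq> l"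
    then consider "k + 1 \<le> l" | "l + 1 \<le> k" by linarith
    then have "(real_of_int k + 1) / real (Suc n) \<le> real_of_int l / real (Suc n)
       \<or> (real_of_int l + 1) / real (Suc n) \<le> real_of_int k / real (Suc n)"
    proof cases
      case 1
      then have "real_of_int k + 1 \<le> real_of_int l" by linarith
      then show ?thesis by (intro disjI1 divide_right_mono) auto
    next
      case 2
      then have "real_of_int l + 1 \<le> real_of_int k" by linarith
      then show ?thesis by (intro disjI2 divide_right_mono) auto
    qed
    then show "D n k \<inter> D n l = {}" unfolding D_def by auto
  qed
  have Dcover: "x \<in> D n (\<lceil>x * real (Suc n)\<rceil> - 1)" for x n
  proof -
    have "real_of_int (\<lceil>x * real (Suc n)\<rceil> - 1) < x * real (Suc n)"
      "x * real (Suc n) \<le> real_of_int (\<lceil>x * real (Suc n)\<rceil> - 1) + 1" by linarith+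
    then show ?thesis unfolding D_def by (simp add: field_simps)
  qed
  have Dclose: "\<bar>x - y\<bar> \<le> 1 / real (Suc n)" if "x \<in> D n k" "y \<in> D n k" for x y n k
    using that unfolding D_def by (auto simp: add_divide_distrib)
  have union: "emeasure M (\<Union>k\<in>I. D n k) \<le> emeasure N (\<Union>k\<in>I. D n k)" for I n
  proof -
    have "emeasure M (D n k) \<le> emeasure N (D n k)" for k
      unfolding D_def by (intro le) (simp add: divide_strict_right_mono)
    moreover have "disjoint_family_on (D n) I" using Ddisj[of n] by (auto simp: disjoint_family_on_def)
    ultimately show ?thesis
      using Dmeas sM sN by (subst (1 2) emeasure_UN_countable) (auto intro!: nn_integral_mono)
  qed
  have finM: "emeasure M UNIV < \<infinity>"
  proof -
    have "(\<Union>k. D 0 k) = UNIV" using Dcover[of _ 0] by auto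
    then have "emeasure M UNIV \<le> emeasure N UNIV" using union[of 0 UNIV] by simp
    then show ?thesis using finN by (rule order_le_less_trans)
  qed
  have compact: "emeasure M K \<le> emeasure N K" if "compact K" for K
  proof (cases "K = {}")
    case False
    define V where "V n = {x. infdist x K \<le> 1 / real (Suc n)}" for n
    have Vmeas: "V n \<in> sets N" for n
      unfolding V_def sN by (intro borel_closed closed_Collect_le continuous_intros)
    have "emeasure M K \<le> emeasure N (V n)" for n
    proof -
      let ?I = "{k. D n k \<inter> K \<noteq> {}}"
      have "emeasure M K \<le> emeasure M (\<Union>k\<in>?I. D n k)"
      proof (rule emeasure_mono)
        show "K \<subseteq> (\<Union>k\<in>?I. D n k)" using Dcover[of _ n] by fastforce
        show "(\<Union>k\<in>?I. D n k) \<in> sets M" using Dmeas sM by (intro sets.countable_UN') auto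
      qed
      also have "\<dots> \<le> emeasure N (\<Union>k\<in>?I. D n k)" by (rule union)
      also have "\<dots> \<le> emeasure N (V n)"
      proof (rule emeasure_mono[OF _ Vmeas])
        show "(\<Union>k\<in>?I. D n k) \<subseteq> V n"
        proof
          fix x assume "x \<in> (\<Union>k\<in>?I. D n k)"
          then obtain k y where ky: "x \<in> D n k" "y \<in> D n k" "y \<in> K" by blast
          then have "infdist x K \<le> dist x y" by (intro infdist_le)
          also have "\<dots> \<le> 1 / real (Suc n)" using Dclose[OF ky(1,2)] by (simp add: dist_real_def)
          finally show "x \<in> V n" unfolding V_def by simp
        qed
      qed
      finally show ?thesis .
    qed
    moreover have "(\<lambda>n. emeasure N (V n)) \<longlonglongrightarrow> emeasure N (\<Inter>n. V n)"
    proof (rule Lim_emeasure_decseq)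
      show "range V \<subseteq> sets N" using Vmeas by auto
      show "decseq V" unfolding decseq_def
      proof (intro allI impI subsetI)
        fix m n :: nat and x assume "m \<le> n" "x \<in> V n"
        moreover have "1 / real (Suc n) \<le> 1 / real (Suc m)" using \<open>m \<le> n\<close> by (intro divide_left_mono) auto
        ultimately show "x \<in> V m" unfolding V_def mem_Collect_eq by linarith
      qed
      show "emeasure N (V i) \<noteq> \<infinity>" for i
        using emeasure_mono[of "V i" UNIV N] finN sN by (auto simp: top_unique)
    qed
    moreover have "(\<Inter>n. V n) = K"
    proof -
      have "x \<in> K" if "\<And>n. infdist x K \<le> 1 / real (Suc n)" for x
      proof -
        have "infdist x K \<le> 0"
          by (rule LIMSEQ_le_const[OF lim_inverse_n'[THEN LIMSEQ_Suc]]) (use that in auto)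
        then have "infdist x K = 0" using infdist_nonneg[of x K] by linarith
        then show ?thesis using in_closed_iff_infdist_zero[of K x] False compact_imp_closed[OF \<open>compact K\<close>] by auto
      qed
      then show ?thesis unfolding V_def by (auto simp: infdist_zero)
    qed
    ultimately show ?thesis by (intro LIMSEQ_le_const) auto
  qed simp
  have "emeasure M A = (SUP K \<in> {K. K \<subseteq> A \<and> compact K}. emeasure M K)"
    using finM sM A by (intro inner_regular) (auto simp: sets_eq_imp_space_eq[OF sM])
  also have "\<dots> \<le> emeasure N A"
    using compact A sN by (intro SUP_least) (auto intro: order_trans[OF compact emeasure_mono])
  finally show ?thesis .
qed

lemma ae_derivative_if_integral:
  fixes K k :: "real \<Rightarrow> real"
  assumes int: "\<And>a b. k integrable_on {a..b}"
    and K: "\<And>a b. a \<le> b \<Longrightarrow> K b - K a = integral {a..b} k"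
  shows "AE t in lborel. (K has_real_derivative k t) (at t)"
  using has_real_derivative_indefinite_integral_ae[OF int]
proof (rule eventually_mono)
  fix t assume "\<forall>a<t. ((\<lambda>t. integral {a..t} k) has_real_derivative k t) (at t)"
  then have "((\<lambda>s. integral {t - 1..s} k) has_real_derivative k t) (at t)" by simp
  then have "((\<lambda>s. K (t - 1) + integral {t - 1..s} k) has_real_derivative 0 + k t) (at t)"
    by (intro DERIV_add DERIV_const)
  moreover have "K (t - 1) + integral {t - 1..s} k = K s" if "s \<in> {t - 1<..}" for s
    using K[of "t - 1" s] that by simp
  ultimately show "(K has_real_derivative k t) (at t)"
    using has_field_derivative_transform_within_open[where S = "{t - 1<..}" and g = K] by fastforce
qed

lemma integral_eq_lborel_integral:
  fixes G :: "real \<Rightarrow> real"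
  assumes "integrable lborel G"
  shows "G integrable_on {u..v}" "integral {u..v} G = (LINT r|lborel. indicator {u..v} r * G r)"
    "integral {u..v} G = (LINT r|lborel. indicator {u<..v} r * G r)"
proof -
  have si: "set_integrable lborel {u..v} G"
    using assms unfolding set_integrable_def by (intro integrable_mult_indicator) auto
  show "G integrable_on {u..v}" using set_borel_integral_eq_integral(1)[OF si] .
  show *: "integral {u..v} G = (LINT r|lborel. indicator {u..v} r * G r)"
    using set_borel_integral_eq_integral(2)[OF si] by (simp add: set_lebesgue_integral_def)
  have [measurable]: "G \<in> borel_measurable borel" using assms by auto
  have "(LINT r|lborel. indicator {u..v} r * G r) = (LINT r|lborel. indicator {u<..v} r * G r)"
  proof (rule integral_cong_AE)
    show "AE r in lborel. indicator {u..v} r * G r = indicator {u<..v} r * G r"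
      using AE_lborel_singleton[of u] by eventually_elim (auto simp: indicator_def)
  qed auto
  with * show "integral {u..v} G = (LINT r|lborel. indicator {u<..v} r * G r)" by simp
qed

lemma tendsto_integral_at_right:
  fixes G :: "real \<Rightarrow> real"
  assumes "\<And>v. G integrable_on {a..v}"
  shows "((\<lambda>v. integral {a..v} G) \<longlongrightarrow> 0) (at_right a)"
proof -
  have "continuous_on {a..a+1} (\<lambda>x. integral {a..x} G)"
    by (rule indefinite_integral_continuous_1[OF assms])
  then have "((\<lambda>x. integral {a..x} G) \<longlongrightarrow> integral {a..a} G) (at a within {a..a+1})"
    unfolding continuous_on_def by (rule bspec) auto
  then show ?thesis by (simp add: at_within_Icc_at_right)
qed

text \<open>
  Adding the indefinite integral of \<open>G\<close> makes \<open>f\<close> increasing. The Stieltjes measure of the result is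
  at most \<open>2 G\<close> times Lebesgue measure, and its Radon-Nikodym density is the derivative.
\<close>

lemma ae_differentiable_if_dominated:
  fixes f G :: "real \<Rightarrow> real"
  assumes G: "integrable lborel G" and G0: "\<And>t. 0 \<le> G t"
    and dom: "\<And>u v. u \<le> v \<Longrightarrow> \<bar>f v - f u\<bar> \<le> integral {u..v} G"
  shows "AE t in lborel. \<exists>D. (f has_real_derivative D) (at t)"
proof -
  note GI = integral_eq_lborel_integral[OF G]
  have Gm[measurable]: "G \<in> borel_measurable borel" using G by auto
  define I where "I t = (LINT r|lborel. indicator {..t} r * G r)" for t
  have I: "I b - I a = integral {a..b} G" if "a \<le> b" for a b
  proof -
    have ii: "integrable lborel (\<lambda>r. indicator {..t} r * G r)" for t
      using integrable_mult_indicator[of "{..t}" lborel G] G by simp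
    have "I b - I a = (LINT r|lborel. indicator {..b} r * G r - indicator {..a} r * G r)"
      unfolding I_def by (rule Bochner_Integration.integral_diff[symmetric]) (fact ii)+
    also have "\<dots> = (LINT r|lborel. indicator {a<..b} r * G r)"
      using that by (intro Bochner_Integration.integral_cong) (auto simp: indicator_def)
    finally show ?thesis using GI(3) by simp
  qed
  define F where "F t = f t + I t" for t
  have F_up: "F b - F a \<le> 2 * integral {a..b} G" and F_lo: "F a \<le> F b" if "a \<le> b" for a b
    using dom[OF that] I[OF that] unfolding F_def by linarith+
  have F_cont: "continuous (at_right a) F" for a
  proof -
    have lim: "((\<lambda>v. F a + 2 * integral {a..v} G) \<longlongrightarrow> F a + 2 * 0) (at_right a)"
      by (intro tendsto_intros tendsto_integral_at_right GI(1))
    have "(F \<longlongrightarrow> F a) (at_right a)"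
    proof (rule tendsto_sandwich[OF _ _ tendsto_const[of "F a"]])
      show "\<forall>\<^sub>F n in at_right a. F a \<le> F n"
        using F_lo by (auto simp: eventually_at_right_field intro!: exI[of _ "a + 1"])
      show "\<forall>\<^sub>F n in at_right a. F n \<le> F a + 2 * integral {a..n} G"
        using F_up by (auto simp: eventually_at_right_field algebra_simps intro!: exI[of _ "a + 1"])
      show "((\<lambda>v. F a + 2 * integral {a..v} G) \<longlongrightarrow> F a) (at_right a)" using lim by simp
    qed
    then show ?thesis by (simp add: continuous_within)
  qed
  define M where "M = interval_measure F"
  define N where "N = density lborel (\<lambda>t. ennreal (2 * G t))"
  have sM: "sets M = sets borel" and sN: "sets N = sets borel" unfolding M_def N_def by auto
  have MI: "emeasure M {a<..b} = ennreal (F b - F a)" if "a \<le> b" for a b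
    unfolding M_def using F_lo F_cont that by (intro emeasure_interval_measure_Ioc)
  have Nfin: "emeasure N UNIV < \<infinity>"
  proof -
    have "emeasure N UNIV = (\<integral>\<^sup>+t. ennreal (2 * G t) \<partial>lborel)"
      unfolding N_def by (subst emeasure_density) auto
    also have "\<dots> = ennreal (LINT t|lborel. 2 * G t)"
      using G G0 by (intro nn_integral_eq_integral) auto
    finally show ?thesis by simp
  qed
  have MN: "emeasure M A \<le> emeasure N A" if "A \<in> sets borel" for A
  proof (rule measure_le_if_interval_measure_le[OF sM sN Nfin _ that])
    fix a b :: real assume "a < b"
    have "emeasure N {a<..b} = (\<integral>\<^sup>+t. ennreal (2 * G t) * indicator {a<..b} t \<partial>lborel)"
      unfolding N_def by (subst emeasure_density) auto
    also have "\<dots> = (\<integral>\<^sup>+t. ennreal (2 * (indicator {a<..b} t * G t)) \<partial>lborel)"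
      by (intro nn_integral_cong) (auto simp: indicator_def)
    also have "\<dots> = ennreal (LINT t|lborel. 2 * (indicator {a<..b} t * G t))"
      using integrable_mult_indicator[of "{a<..b}" lborel G] G G0
      by (intro nn_integral_eq_integral) (auto simp: indicator_def)
    also have "\<dots> = ennreal (2 * integral {a..b} G)" using GI(3)[of a b] by simp
    finally show "emeasure M {a<..b} \<le> emeasure N {a<..b}"
      using MI[of a b] F_up[of a b] \<open>a < b\<close> by (simp add: ennreal_leI)
  qed
  have ac: "absolutely_continuous lborel M"
    unfolding absolutely_continuous_def
  proof
    fix A :: "real set" assume A: "A \<in> null_sets lborel"
    then have "A \<in> null_sets N" unfolding N_def
      using absolutely_continuousI_density[of "\<lambda>t. ennreal (2 * G t)" lborel]
      by (auto simp: absolutely_continuous_def)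
    then show "A \<in> null_sets M" using MN[of A] A sM by (auto simp: null_sets_def)
  qed
  obtain h where h: "h \<in> borel_measurable lborel" "density lborel h = M"
    using sigma_finite_measure.Radon_Nikodym[OF sigma_finite_lborel ac] sM by auto
  then have [measurable]: "h \<in> borel_measurable borel" by simp
  have "(\<integral>\<^sup>+t. h t \<partial>lborel) = emeasure M UNIV"
    unfolding h(2)[symmetric] by (subst emeasure_density) auto
  also have "\<dots> < \<infinity>" using MN[of UNIV] Nfin by (auto intro: order_le_less_trans)
  finally have hfin: "(\<integral>\<^sup>+t. h t \<partial>lborel) < \<infinity>" .
  define k where "k t = enn2real (h t)" for t
  have hk: "AE t in lborel. h t = ennreal (k t)"
    using nn_integral_PInf_AE[of h lborel] hfin unfolding k_def by (auto simp: less_top)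
  have [measurable]: "k \<in> borel_measurable borel" unfolding k_def by measurable
  have k0: "0 \<le> k t" for t unfolding k_def by simp
  have kint: "integrable lborel k"
  proof (rule integrableI_nonneg)
    have "(\<integral>\<^sup>+t. ennreal (k t) \<partial>lborel) = (\<integral>\<^sup>+t. h t \<partial>lborel)"
      using hk by (intro nn_integral_cong_AE) auto
    then show "(\<integral>\<^sup>+t. ennreal (k t) \<partial>lborel) < \<infinity>" using hfin by simp
  qed (auto simp: k0)
  note kI = integral_eq_lborel_integral[OF kint]
  have Fk: "F b - F a = integral {a..b} k" if "a \<le> b" for a b
  proof -
    have "ennreal (F b - F a) = (\<integral>\<^sup>+t. h t * indicator {a<..b} t \<partial>lborel)"
      unfolding MI[OF that, symmetric] h(2)[symmetric] by (subst emeasure_density) auto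
    also have "\<dots> = (\<integral>\<^sup>+t. ennreal (indicator {a<..b} t * k t) \<partial>lborel)"
      using hk by (intro nn_integral_cong_AE) (auto simp: indicator_def)
    also have "\<dots> = ennreal (LINT t|lborel. indicator {a<..b} t * k t)"
      using integrable_mult_indicator[of "{a<..b}" lborel k] kint k0
      by (intro nn_integral_eq_integral) (auto simp: indicator_def)
    finally have "ennreal (F b - F a) = ennreal (integral {a..b} k)" using kI(3) by simp
    then show ?thesis
      using F_lo[OF that] k0 by (subst (asm) ennreal_inj) (auto intro: Henstock_Kurzweil_Integration.integral_nonneg kI(1))
  qed
  have "AE t in lborel. (F has_real_derivative k t) (at t)"
    by (rule ae_derivative_if_integral[OF kI(1) Fk])
  moreover have "AE t in lborel. (I has_real_derivative G t) (at t)"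
    by (rule ae_derivative_if_integral[OF GI(1) I])
  ultimately show ?thesis
  proof eventually_elim
    case (elim t)
    then have "((\<lambda>t. F t - I t) has_real_derivative k t - G t) (at t)" by (intro DERIV_diff)
    then show ?case by (auto simp: F_def)
  qed
qed

text \<open>
  This is the absolute continuity of the integral: \<open>G\<close> is split at a height \<open>n\<close> above which it has
  integral less than \<open>e / 2\<close>, and the part below is bounded by \<open>n\<close> times the total length.
\<close>

lemma AC_if_dominated:
  fixes f :: "real \<Rightarrow> 'a::metric_space"
  assumes G: "integrable lborel G" and G0: "\<And>t. 0 \<le> G t"
    and dom: "\<And>u v. a \<le> u \<Longrightarrow> u \<le> v \<Longrightarrow> v \<le> c \<Longrightarrow> dist (f u) (f v) \<le> integral {u..v} G"
  shows "absolutely_continuous_on a c f"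
  unfolding absolutely_continuous_on_def
proof (intro allI impI)
  fix e :: real assume "e > 0"
  note GI = integral_eq_lborel_integral[OF G]
  have Gm[measurable]: "G \<in> borel_measurable borel" using G by auto
  have "(\<lambda>n. LINT t|lborel. G t - min (G t) (real n)) \<longlonglongrightarrow> (LINT t::real|lborel. 0)"
  proof (rule integral_dominated_convergence[where w = G])
    show "AE t in lborel. (\<lambda>n. G t - min (G t) (real n)) \<longlonglongrightarrow> 0"
    proof (intro AE_I2)
      fix t
      have "\<forall>\<^sub>F n in sequentially. G t - min (G t) (real n) = 0"
        using eventually_ge_at_top[of "nat \<lceil>G t\<rceil>"]
      proof eventually_elim
        case (elim n)
        then have "G t \<le> real n" by linarith
        then show ?case by simp
      qed
      then show "(\<lambda>n. G t - min (G t) (real n)) \<longlonglongrightarrow> 0" by (rule tendsto_eventually)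
    qed
    show "AE t in lborel. norm (G t - min (G t) (real n)) \<le> G t" for n
      using G0 by (intro AE_I2) (auto simp: min_def)
  qed (use G in auto)
  then have "\<forall>\<^sub>F n in sequentially. (LINT t|lborel. G t - min (G t) (real n)) < e / 2"
    by (rule order_tendstoD(2)) (use \<open>e > 0\<close> in simp)
  then obtain n where n: "(LINT t|lborel. G t - min (G t) (real n)) < e / 2"
    using eventually_happens'[OF sequentially_bot] by blast
  have i1: "integrable lborel (\<lambda>t. G t - min (G t) (real n))"
    by (rule Bochner_Integration.integrable_bound[OF G]) (use G0 in \<open>auto simp: min_def\<close>)
  have small: "(\<Sum>i<m. dist (f (l i)) (f (r i))) < e"
    if lr: "\<forall>i<m. a \<le> l i \<and> l i \<le> r i \<and> r i \<le> c"
      and dis: "disjoint_family_on (\<lambda>i. {l i<..<r i}) {..<m}"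
      and len: "(\<Sum>i<m. r i - l i) < e / (2 * (real n + 1))" for m :: nat and l r
  proof -
    define A where "A = (\<Union>i<m. {l i<..<r i})"
    have ind: "(\<Sum>i<m. indicator {l i<..<r i} t) = (indicator A t :: real)" for t
      unfolding A_def using dis by (subst indicator_UN_disjoint) auto
    have ii: "integrable lborel (\<lambda>t. indicator {l i<..<r i} t * H t)" if "integrable lborel H" for i and H :: "real \<Rightarrow> real"
      using integrable_mult_indicator[of "{l i<..<r i}" lborel H] that by simp
    have Io: "integral {u..v} G = (LINT t|lborel. indicator {u<..<v} t * G t)" for u v
      unfolding GI(3)
    proof (rule integral_cong_AE)
      show "AE t in lborel. indicator {u<..v} t * G t = indicator {u<..<v} t * G t"
        using AE_lborel_singleton[of v] by eventually_elim (auto simp: indicator_def)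
    qed auto
    have "(\<Sum>i<m. dist (f (l i)) (f (r i))) \<le> (\<Sum>i<m. integral {l i..r i} G)"
      using lr by (intro sum_mono dom) auto
    also have "\<dots> \<le> (\<Sum>i<m. (LINT t|lborel. indicator {l i<..<r i} t * (G t - min (G t) (real n))) + real n * (r i - l i))"
    proof (rule sum_mono)
      fix i assume "i \<in> {..<m}"
      have "integral {l i..r i} G \<le> (LINT t|lborel. indicator {l i<..<r i} t * (G t - min (G t) (real n)) + indicator {l i<..<r i} t * real n)"
        unfolding Io
      proof (rule integral_mono)
        have "integrable lborel (\<lambda>t. indicator {l i<..<r i} t * real n)"
          using lr \<open>i \<in> {..<m}\<close> by (intro integrable_mult_left integrable_real_indicator) auto
        then show "integrable lborel (\<lambda>t. indicator {l i<..<r i} t * (G t - min (G t) (real n)) + indicator {l i<..<r i} t * real n)"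
          by (intro Bochner_Integration.integrable_add ii[OF i1])
        show "integrable lborel (\<lambda>t. indicator {l i<..<r i} t * G t)" by (rule ii[OF G])
      qed (auto simp: indicator_def min_def)
      also have "\<dots> = (LINT t|lborel. indicator {l i<..<r i} t * (G t - min (G t) (real n))) + real n * (r i - l i)"
        using ii[OF i1, of i] lr \<open>i \<in> {..<m}\<close>
        by (subst Bochner_Integration.integral_add) auto
      finally show "integral {l i..r i} G \<le> \<dots>" .
    qed
    also have "\<dots> = (LINT t|lborel. indicator A t * (G t - min (G t) (real n))) + real n * (\<Sum>i<m. r i - l i)"
      unfolding ind[symmetric] sum_distrib_right
      by (subst Bochner_Integration.integral_sum) (auto simp: sum.distrib sum_distrib_left intro!: ii i1)
    also have "\<dots> \<le> (LINT t|lborel. G t - min (G t) (real n)) + real n * (e / (2 * (real n + 1)))"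
    proof (rule add_mono)
      show "(LINT t|lborel. indicator A t * (G t - min (G t) (real n))) \<le> (LINT t|lborel. G t - min (G t) (real n))"
        using i1 integrable_mult_indicator[of A lborel, OF _ i1]
        by (intro integral_mono) (auto simp: indicator_def min_def A_def)
      show "real n * (\<Sum>i<m. r i - l i) \<le> real n * (e / (2 * (real n + 1)))"
        using len by (intro mult_left_mono) auto
    qed
    also have "\<dots> < e / 2 + e / 2"
    proof (rule add_less_le_mono[OF n])
      have "real n * (e / (2 * (real n + 1))) = (real n / (real n + 1)) * (e / 2)" by simp
      also have "\<dots> \<le> 1 * (e / 2)" using \<open>e > 0\<close> by (intro mult_right_mono) auto
      finally show "real n * (e / (2 * (real n + 1))) \<le> e / 2" by simp
    qed
    finally show ?thesis by simp
  qed
  show "\<exists>\<delta>>0. \<forall>(n::nat) l r. (\<forall>i<n. a \<le> l i \<and> l i \<le> r i \<and> r i \<le> c) \<longrightarrow>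
        disjoint_family_on (\<lambda>i. {l i<..<r i}) {..<n} \<longrightarrow> (\<Sum>i<n. r i - l i) < \<delta> \<longrightarrow>
        (\<Sum>i<n. dist (f (l i)) (f (r i))) < e"
    using small \<open>e > 0\<close> by (intro exI[of _ "e / (2 * (real n + 1))"]) auto
qed

section \<open>Null sets and monotone functions on Euclidean space\<close>

lemma AE_lebesgue_sections:
  fixes P :: "real \<times> 'a::euclidean_space \<Rightarrow> bool"
  assumes "AE z in lebesgue. P z"
  shows "AE t in lborel. AE x in lborel. P (t, x)" "AE x in lborel. AE t in lborel. P (t, x)"
proof -
  have "AE z in lborel. P z" using assms by (simp add: AE_completion_iff)
  then obtain N where N: "\<And>z. z \<in> space lborel - N \<Longrightarrow> P z" "N \<in> null_sets lborel"
    using AE_E3 by blast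
  have Nm: "N \<in> sets (lborel \<Otimes>\<^sub>M lborel)" using N(2) unfolding lborel_prod by auto
  have "AE z in lborel. z \<notin> N" by (rule AE_not_in[OF N(2)])
  then have AE: "AE z in lborel \<Otimes>\<^sub>M lborel. z \<notin> N" unfolding lborel_prod .
  have 1: "AE t in lborel. AE x in lborel. (t, x) \<notin> N"
    using lborel_pair.AE_pair[OF AE] .
  have 2: "AE x in lborel. AE t in lborel. (t, x) \<notin> N"
  proof (subst lborel_pair.AE_commute[symmetric])
    have "{x \<in> space (lborel \<Otimes>\<^sub>M lborel). (fst x, snd x) \<notin> N} = space (lborel \<Otimes>\<^sub>M lborel) - N" by auto
    also have "\<dots> \<in> sets (lborel \<Otimes>\<^sub>M lborel)" by (rule sets.compl_sets[OF Nm])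
    finally show "{x \<in> space (lborel \<Otimes>\<^sub>M lborel). (fst x, snd x) \<notin> N} \<in> sets (lborel \<Otimes>\<^sub>M lborel)" .
  qed (fact 1)
  show "AE t in lborel. AE x in lborel. P (t, x)"
    using 1 by (rule eventually_mono) (erule eventually_mono, use N(1) in auto)
  show "AE x in lborel. AE t in lborel. P (t, x)"
    using 2 by (rule eventually_mono) (erule eventually_mono, use N(1) in auto)
qed

lemma emeasure_translate:
  fixes A :: "'a::euclidean_space set"
  assumes "A \<in> sets borel"
  shows "emeasure lborel ((\<lambda>x. x + c) -` A) = emeasure lborel A"
proof -
  have "emeasure lborel A = emeasure (distr lborel borel ((+) c)) A" by (simp add: lborel_distr_plus)
  also have "\<dots> = emeasure lborel ((+) c -` A)"
    using assms by (subst emeasure_distr) auto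
  also have "(+) c -` A = (\<lambda>x. x + c) -` A" by (auto simp: add.commute)
  finally show ?thesis by simp
qed

text \<open>
  Averaging over all translates of a segment replaces Fubini's theorem in adapted coordinates, and so
  works for segments in any direction \<open>e\<close>.
\<close>

lemma emeasure_by_lines:
  fixes A :: "'a::euclidean_space set" and a c :: real
  assumes A: "A \<in> sets borel" and "a \<le> c"
  shows "(\<integral>\<^sup>+x. emeasure lborel {\<tau>\<in>{a..c}. x + \<tau> *\<^sub>R e \<in> A} \<partial>lborel) = ennreal (c - a) * emeasure lborel A"
proof -
  define F :: "'a \<Rightarrow> real \<Rightarrow> ennreal" where
    "F x \<tau> = indicator {a..c} \<tau> * indicator A (x + \<tau> *\<^sub>R e)" for x \<tau>
  have [measurable]: "A \<in> sets borel" by fact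
  have "(\<lambda>z. snd z + fst z *\<^sub>R e) \<in> borel_measurable (borel \<Otimes>\<^sub>M borel :: (real \<times> 'a) measure)"
    by (intro borel_measurable_add borel_measurable_scaleR) auto
  have Fm: "(\<lambda>z. F (fst z) (snd z)) \<in> borel_measurable (lborel \<Otimes>\<^sub>M lborel)"
    unfolding F_def by measurable
  have "(\<integral>\<^sup>+x. emeasure lborel {\<tau>\<in>{a..c}. x + \<tau> *\<^sub>R e \<in> A} \<partial>lborel) = (\<integral>\<^sup>+x. \<integral>\<^sup>+\<tau>. F x \<tau> \<partial>lborel \<partial>lborel)"
  proof (rule nn_integral_cong)
    fix x :: 'a
    have "{\<tau>\<in>{a..c}. x + \<tau> *\<^sub>R e \<in> A} \<in> sets lborel" by measurable
    then have "emeasure lborel {\<tau>\<in>{a..c}. x + \<tau> *\<^sub>R e \<in> A} = (\<integral>\<^sup>+\<tau>. indicator {\<tau>\<in>{a..c}. x + \<tau> *\<^sub>R e \<in> A} \<tau> \<partial>lborel)"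
      by simp
    also have "\<dots> = (\<integral>\<^sup>+\<tau>. F x \<tau> \<partial>lborel)"
      unfolding F_def by (intro nn_integral_cong) (auto simp: indicator_def)
    finally show "emeasure lborel {\<tau>\<in>{a..c}. x + \<tau> *\<^sub>R e \<in> A} = (\<integral>\<^sup>+\<tau>. F x \<tau> \<partial>lborel)" .
  qed
  also have "\<dots> = (\<integral>\<^sup>+\<tau>. \<integral>\<^sup>+x. F x \<tau> \<partial>lborel \<partial>lborel)"
    using lborel_pair.Fubini'[of F] Fm by (simp add: case_prod_unfold)
  also have "\<dots> = (\<integral>\<^sup>+\<tau>. indicator {a..c} \<tau> * emeasure lborel A \<partial>lborel)"
  proof (rule nn_integral_cong)
    fix \<tau> :: real
    have "(\<integral>\<^sup>+x. F x \<tau> \<partial>lborel) = indicator {a..c} \<tau> * (\<integral>\<^sup>+x. indicator ((\<lambda>x. x + \<tau> *\<^sub>R e) -` A) x \<partial>lborel)"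
      unfolding F_def by (subst nn_integral_cmult) (auto simp: indicator_def intro!: nn_integral_cong arg_cong2[where f = "(*)"])
    also have "(\<integral>\<^sup>+x. indicator ((\<lambda>x. x + \<tau> *\<^sub>R e) -` A) x \<partial>lborel) = emeasure lborel ((\<lambda>x. x + \<tau> *\<^sub>R e) -` A)"
    proof (rule nn_integral_indicator)
      show "(\<lambda>x. x + \<tau> *\<^sub>R e) -` A \<in> sets lborel"
        using measurable_sets[of "\<lambda>x. x + \<tau> *\<^sub>R e" lborel borel A] by simp
    qed
    also have "\<dots> = emeasure lborel A" by (rule emeasure_translate[OF A])
    finally show "(\<integral>\<^sup>+x. F x \<tau> \<partial>lborel) = indicator {a..c} \<tau> * emeasure lborel A" .
  qed
  also have "\<dots> = (\<integral>\<^sup>+\<tau>. indicator {a..c} \<tau> \<partial>lborel) * emeasure lborel A"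
    by (rule nn_integral_multc) auto
  also have "(\<integral>\<^sup>+\<tau>. indicator {a..c} \<tau> \<partial>lborel) = ennreal (c - a)" using \<open>a \<le> c\<close> by simp
  finally show ?thesis .
qed

lemma null_set_if_countable_on_lines:
  fixes N :: "'a::euclidean_space set"
  assumes N: "N \<in> sets borel" and "\<And>x. countable {\<tau>. x + \<tau> *\<^sub>R e \<in> N}"
  shows "N \<in> null_sets lborel"
proof -
  have "emeasure lborel {\<tau>\<in>{0..1}. x + \<tau> *\<^sub>R e \<in> N} = 0" for x
    by (rule emeasure_lborel_countable) (rule countable_subset[OF _ assms(2)[of x]], auto)
  then have "emeasure lborel N = 0"
    using emeasure_by_lines[OF N, of 0 1 e] by simp
  then show ?thesis using N by auto
qed

text \<open>
  On each line in direction \<open>(1, \<dots>, 1)\<close> the function is increasing in one variable, so it has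
  countably many discontinuities there. Continuity along the line implies continuity in all
  directions, since the points near \<open>x\<close> lie between two points of the line in the order.
\<close>

lemma isCont_ae_if_mono:
  fixes f :: "real ^ 'd \<Rightarrow> real"
  assumes mono: "\<And>x y. x \<le> y \<Longrightarrow> f x \<le> f y"
  shows "AE x in lborel. isCont f x"
proof -
  define N where "N = {x. \<not> isCont f x}"
  have "{x. isCont f x} \<in> sets borel" by (rule isCont_borel)
  then have "space borel - {x. isCont f x} \<in> sets borel" by (rule sets.compl_sets)
  moreover have "space borel - {x. isCont f x} = N" unfolding N_def by auto
  ultimately have N: "N \<in> sets borel" by metis
  have "countable {\<tau>. x + \<tau> *\<^sub>R 1 \<in> N}" for x
  proof -
    define g where "g \<tau> = f (x + \<tau> *\<^sub>R 1)" for \<tau>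
    have "g a \<le> g b" if "a \<le> b" for a b
      unfolding g_def using that by (intro mono) (simp add: less_eq_vec_def)
    then have "mono g" by (intro monoI)
    then have "countable {\<tau>. \<not> isCont g \<tau>}" by (rule mono_ctble_discont)
    moreover have "isCont f (x + \<tau> *\<^sub>R 1)" if iC: "isCont g \<tau>" for \<tau>
      unfolding continuous_at_eps_delta
    proof (intro allI impI)
      fix e :: real assume "e > 0"
      then obtain d where d: "d > 0" "\<And>s. dist s \<tau> < d \<Longrightarrow> dist (g s) (g \<tau>) < e"
        using iC[unfolded continuous_at_eps_delta, rule_format, OF \<open>e > 0\<close>] by auto
      have "dist (f y) (f (x + \<tau> *\<^sub>R 1)) < e" if y: "dist y (x + \<tau> *\<^sub>R 1) < d / 4" for y
      proof -
        have yi: "\<bar>y $ i - (x $ i + \<tau>)\<bar> < d / 4" for i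
          using component_le_norm_cart[of "y - (x + \<tau> *\<^sub>R 1)" i] y by (simp add: dist_norm)
        have below: "x $ i + (\<tau> - d / 2) \<le> y $ i" and above: "y $ i \<le> x $ i + (\<tau> + d / 2)" for i
          using yi[of i] d(1) by linarith+
        have "g (\<tau> - d / 2) \<le> f y" unfolding g_def
          using below by (intro mono) (simp add: less_eq_vec_def)
        moreover have "f y \<le> g (\<tau> + d / 2)" unfolding g_def
          using above by (intro mono) (simp add: less_eq_vec_def)
        moreover have "dist (g (\<tau> - d / 2)) (g \<tau>) < e"
          by (rule d(2)) (use d(1) in \<open>simp add: dist_real_def\<close>)
        moreover have "dist (g (\<tau> + d / 2)) (g \<tau>) < e"
          by (rule d(2)) (use d(1) in \<open>simp add: dist_real_def\<close>)
        ultimately show ?thesis unfolding g_def dist_real_def by linarith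
      qed
      then show "\<exists>d>0. \<forall>x'. dist x' (x + \<tau> *\<^sub>R 1) < d \<longrightarrow> dist (f x') (f (x + \<tau> *\<^sub>R 1)) < e"
        using d(1) by (intro exI[of _ "d / 4"]) simp
    qed
    then have "{\<tau>. x + \<tau> *\<^sub>R 1 \<in> N} \<subseteq> {\<tau>. \<not> isCont g \<tau>}" unfolding N_def by blast
    ultimately show ?thesis by (rule countable_subset[rotated])
  qed
  then have "N \<in> null_sets lborel" by (rule null_set_if_countable_on_lines[OF N])
  then have "AE x in lborel. x \<notin> N" by (rule AE_not_in)
  then show ?thesis unfolding N_def by simp
qed

text \<open>
  A monotone function need not be Borel, but it agrees almost everywhere with this Borel function.
\<close>

lemma borel_measurable_on_continuity_set:
  fixes f :: "'a::euclidean_space \<Rightarrow> real"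
  shows "(\<lambda>x. indicator {x. isCont f x} x * f x) \<in> borel_measurable borel"
proof (rule borel_measurableI_greater)
  fix a :: real
  let ?C = "{x. isCont f x}"
  have C: "?C \<in> sets borel" by (rule isCont_borel)
  have "?C \<inter> {x. a < f x} = ?C \<inter> interior {x. a < f x}"
  proof -
    have "x \<in> interior {x. a < f x}" if "isCont f x" "a < f x" for x
    proof -
      have "\<forall>\<^sub>F y in nhds x. a < f y"
        using that by (metis order_tendstoD(1) tendsto_at_iff_tendsto_nhds continuous_at)
      then show ?thesis unfolding interior_def eventually_nhds by auto
    qed
    then show ?thesis using interior_subset by auto
  qed
  then have 1: "?C \<inter> {x. a < f x} \<in> sets borel" using C by simp
  have "{x \<in> space borel. a < indicator ?C x * f x} = (?C \<inter> {x. a < f x}) \<union> (if a < 0 then - ?C else {})"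
    by (auto simp: indicator_def)
  then show "{x \<in> space borel. a < indicator ?C x * f x} \<in> sets borel" using 1 C by auto
qed

lemma borel_measurable_lebesgue_if_isCont_ae:
  fixes f :: "'a::euclidean_space \<Rightarrow> real"
  assumes "AE x in lborel. isCont f x"
  shows "f \<in> borel_measurable lebesgue"
proof (rule borel_measurable_AE)
  have "(\<lambda>x. indicator {x. isCont f x} x * f x) \<in> borel_measurable lborel"
    using borel_measurable_on_continuity_set[of f] by simp
  then show "(\<lambda>x. indicator {x. isCont f x} x * f x) \<in> borel_measurable lebesgue"
    by (rule measurable_completion)
  show "AE x in lebesgue. indicator {x. isCont f x} x * f x = f x"
    using AE_completion[OF assms] by eventually_elim simp
qed

section \<open>The greatest flow of a bounded increasing field\<close>

lemma continuous_if_dominated: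
  fixes f G :: "real \<Rightarrow> real"
  assumes G: "integrable lborel G" and G0: "\<And>t. 0 \<le> G t"
    and dom: "\<And>u v. u \<le> v \<Longrightarrow> \<bar>f v - f u\<bar> \<le> integral {u..v} G"
  shows "continuous_on UNIV f"
proof -
  have "isCont f t" for t
  proof -
    have "absolutely_continuous_on (t - 1) (t + 1) f"
      using dom by (intro AC_if_dominated[OF G G0]) (simp add: dist_real_def abs_minus_commute)
    then have "continuous_on {t - 1..t + 1} f" by (rule AC_continuous_on)
    then show ?thesis by (rule continuous_on_interior) auto
  qed
  then show ?thesis by (simp add: continuous_on_eq_continuous_at)
qed

lemma borel_measurable_vec_nth:
  fixes f :: "'a \<Rightarrow> real ^ 'd"
  assumes "f \<in> borel_measurable M"
  shows "(\<lambda>r. f r $ i) \<in> borel_measurable M"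
proof (rule measurable_compose[OF assms])
  show "(\<lambda>v::real ^ 'd. v $ i) \<in> borel_measurable borel"
    by (intro borel_measurable_continuous_onI continuous_intros)
qed

locale bounded_field =
  fixes B :: "real \<Rightarrow> real ^ 'd \<Rightarrow> real ^ 'd" and C :: "real \<Rightarrow> real"
  assumes B_meas: "(\<lambda>z. B (fst z) (snd z)) \<in> borel_measurable borel"
    and B_mono: "\<And>t x y. x \<le> y \<Longrightarrow> B t x \<le> B t y"
    and B_bound: "\<And>t y i. \<bar>B t y $ i\<bar> \<le> C t"
    and C_int: "integrable lborel C"
begin

lemma C_nonneg: "0 \<le> C t"
  using B_bound[of t 0 undefined] by linarith

lemma C_on: "C integrable_on {u..v}"
  by (rule integral_eq_lborel_integral(1)[OF C_int])

lemma CI_nonneg: "0 \<le> integral {u..v} C"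
  by (intro Henstock_Kurzweil_Integration.integral_nonneg C_on C_nonneg)

lemma CI_mono: "u' \<le> u \<Longrightarrow> v \<le> v' \<Longrightarrow> integral {u..v} C \<le> integral {u'..v'} C"
  by (intro integral_subset_le C_on) (auto simp: C_nonneg)

lemma B_path_integrable:
  assumes "continuous_on UNIV \<gamma>"
  shows "integrable lborel (\<lambda>r. B r (\<gamma> r) $ i)"
proof (rule Bochner_Integration.integrable_bound[OF C_int])
  have "(\<lambda>r. (r, \<gamma> r)) \<in> borel_measurable borel"
    using assms by (intro borel_measurable_continuous_onI continuous_intros)
  from measurable_compose[OF this B_meas] have "(\<lambda>r. B r (\<gamma> r)) \<in> borel_measurable borel" by simp
  then show "(\<lambda>r. B r (\<gamma> r) $ i) \<in> borel_measurable lborel" by (simp add: borel_measurable_vec_nth)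
  show "AE r in lborel. norm (B r (\<gamma> r) $ i) \<le> norm (C r)"
    using B_bound C_nonneg by (intro AE_I2) (simp add: abs_of_nonneg)
qed

lemma B_path_on: "continuous_on UNIV \<gamma> \<Longrightarrow> (\<lambda>r. B r (\<gamma> r) $ i) integrable_on {u..v}"
  by (rule integral_eq_lborel_integral(1)[OF B_path_integrable])

lemma B_path_integral_bound:
  assumes "continuous_on UNIV \<gamma>"
  shows "\<bar>integral {u..v} (\<lambda>r. B r (\<gamma> r) $ i)\<bar> \<le> integral {u..v} C"
  using integral_norm_bound_integral[OF B_path_on[OF assms] C_on, of u v i] B_bound by simp

text \<open>
  The Picard operator for paths that rest in \<open>x\<close> until time \<open>s\<close>.
\<close>

definition drift :: "real \<Rightarrow> real ^ 'd \<Rightarrow> (real \<Rightarrow> real ^ 'd) \<Rightarrow> real \<Rightarrow> real ^ 'd" where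
  "drift s x \<gamma> t = (\<chi> i. x $ i + integral {s..t} (\<lambda>r. B r (\<gamma> r) $ i))"

lemma drift_before: "t \<le> s \<Longrightarrow> drift s x \<gamma> t = x"
  unfolding drift_def by (cases "t = s") (auto simp: vec_eq_iff)

lemma drift_diff:
  assumes "continuous_on UNIV \<gamma>" "s \<le> u" "u \<le> v"
  shows "drift s x \<gamma> v $ i - drift s x \<gamma> u $ i = integral {u..v} (\<lambda>r. B r (\<gamma> r) $ i)"
  using Henstock_Kurzweil_Integration.integral_combine[OF assms(2,3) B_path_on[OF assms(1)], of i]
  unfolding drift_def by simp

lemma drift_modulus:
  assumes "continuous_on UNIV \<gamma>" "u \<le> v"
  shows "\<bar>drift s x \<gamma> v $ i - drift s x \<gamma> u $ i\<bar> \<le> integral {u..v} C"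
proof (cases "s \<le> v")
  case True
  have "drift s x \<gamma> u = drift s x \<gamma> (max s u)" by (cases "s \<le> u") (auto simp: drift_before)
  then have "\<bar>drift s x \<gamma> v $ i - drift s x \<gamma> u $ i\<bar> = \<bar>integral {max s u..v} (\<lambda>r. B r (\<gamma> r) $ i)\<bar>"
    using drift_diff[OF assms(1), of s "max s u" v x i] True assms(2) by simp
  also have "\<dots> \<le> integral {max s u..v} C" by (rule B_path_integral_bound[OF assms(1)])
  also have "\<dots> \<le> integral {u..v} C" by (rule CI_mono) auto
  finally show ?thesis .
next
  case False
  then show ?thesis using assms(2) CI_nonneg[of u v] by (simp add: drift_before)
qed

lemma continuous_if_modulus:
  assumes "\<And>u v i. u \<le> v \<Longrightarrow> \<bar>\<gamma> v $ i - \<gamma> u $ i\<bar> \<le> integral {u..v} C"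
  shows "continuous_on UNIV (\<gamma> :: real \<Rightarrow> real ^ 'd)"
proof -
  have "continuous_on UNIV (\<lambda>t. \<gamma> t $ i)" for i
    by (rule continuous_if_dominated[OF C_int C_nonneg assms])
  then have "continuous_on UNIV (\<lambda>t. \<chi> i. \<gamma> t $ i)" by (intro continuous_on_vec_lambda)
  then show ?thesis by simp
qed

lemma drift_continuous: "continuous_on UNIV \<gamma> \<Longrightarrow> continuous_on UNIV (drift s x \<gamma>)"
  by (rule continuous_if_modulus) (rule drift_modulus)

lemma drift_mono:
  assumes "continuous_on UNIV \<gamma>" "continuous_on UNIV \<gamma>'" "\<And>r. \<gamma> r \<le> \<gamma>' r" "x \<le> x'"
  shows "drift s x \<gamma> t \<le> drift s x' \<gamma>' t"
  unfolding less_eq_vec_def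
proof
  fix i
  have "integral {s..t} (\<lambda>r. B r (\<gamma> r) $ i) \<le> integral {s..t} (\<lambda>r. B r (\<gamma>' r) $ i)"
    using B_mono[OF assms(3)] by (intro integral_le B_path_on assms) (auto simp: less_eq_vec_def)
  then show "drift s x \<gamma> t $ i \<le> drift s x' \<gamma>' t $ i"
    using assms(4) unfolding drift_def by (simp add: less_eq_vec_def add_mono)
qed

text \<open>
  The Knaster-Tarski argument: the greatest fixed point of the increasing Picard operator is the
  supremum of all paths that lie below their image. Suprema of arbitrary paths need not even be
  measurable, but the modulus \<open>\<integral>\<^sub>u\<^sup>v C\<close> of the image of any path is inherited by suprema, so it may be
  imposed from the start.
\<close>

lemma ex_greatest_path:
  "\<exists>\<gamma>. continuous_on UNIV \<gamma> \<and> (\<forall>t. \<gamma> t = drift s x \<gamma> t) \<and>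
     (\<forall>\<gamma>'. continuous_on UNIV \<gamma>' \<and> (\<forall>t. \<gamma>' t \<le> drift s x \<gamma>' t) \<longrightarrow> (\<forall>t. \<gamma>' t \<le> \<gamma> t))"
proof -
  define \<F> where "\<F> = {\<gamma> :: real \<Rightarrow> real ^ 'd. (\<forall>t. \<gamma> t \<le> drift s x \<gamma> t) \<and>
     (\<forall>u v i. u \<le> v \<longrightarrow> \<bar>\<gamma> v $ i - \<gamma> u $ i\<bar> \<le> integral {u..v} C)}"
  have cont: "continuous_on UNIV \<gamma>" if "\<gamma> \<in> \<F>" for \<gamma>
    using that unfolding \<F>_def by (intro continuous_if_modulus) auto
  have up: "drift s x \<gamma> \<in> \<F>" if "continuous_on UNIV \<gamma>" "\<And>t. \<gamma> t \<le> drift s x \<gamma> t" for \<gamma>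
    unfolding \<F>_def using that drift_mono[OF that(1) drift_continuous[OF that(1)] that(2) order_refl]
      drift_modulus[OF that(1)] by auto
  \<comment> \<open>descends with the greatest possible speed, so it lies below its image\<close>
  define \<gamma>0 where "\<gamma>0 t = (\<chi> i. x $ i - integral {s..t} C)" for t :: real
  have \<gamma>0_eq: "\<gamma>0 t $ i = x $ i - integral {s..t} C" for t i unfolding \<gamma>0_def by simp
  have \<gamma>0_mod: "\<bar>\<gamma>0 v $ i - \<gamma>0 u $ i\<bar> \<le> integral {u..v} C" if "u \<le> v" for u v i
  proof (cases "s \<le> u")
    case True
    then show ?thesis using Henstock_Kurzweil_Integration.integral_combine[OF True that C_on] CI_nonneg[of u v]
      unfolding \<gamma>0_eq by simp
  next
    case False
    then show ?thesis using CI_mono[of u s v v] CI_nonneg[of s v] unfolding \<gamma>0_eq by simp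
  qed
  have \<gamma>0: "\<gamma>0 \<in> \<F>"
  proof -
    have "\<gamma>0 t \<le> drift s x \<gamma>0 t" for t
      unfolding less_eq_vec_def
    proof
      fix i show "\<gamma>0 t $ i \<le> drift s x \<gamma>0 t $ i"
        using B_path_integral_bound[OF continuous_if_modulus[OF \<gamma>0_mod], of s t i]
        unfolding \<gamma>0_eq drift_def by simp
    qed
    then show ?thesis unfolding \<F>_def using \<gamma>0_mod by auto
  qed
  have bdd: "bdd_above ((\<lambda>\<gamma>. \<gamma> t $ i) ` \<F>)" for t i
  proof (rule bdd_aboveI2)
    fix \<gamma> assume g: "\<gamma> \<in> \<F>"
    then have "\<gamma> t $ i \<le> drift s x \<gamma> t $ i" unfolding \<F>_def by (auto simp: less_eq_vec_def)
    also have "\<dots> \<le> x $ i + integral {s..t} C"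
      using B_path_integral_bound[OF cont[OF g], of s t i] unfolding drift_def by simp
    finally show "\<gamma> t $ i \<le> x $ i + integral {s..t} C" .
  qed
  define \<Gamma> where "\<Gamma> t = (\<chi> i. SUP \<gamma>\<in>\<F>. \<gamma> t $ i)" for t
  have \<Gamma>_eq: "\<Gamma> t $ i = (SUP \<gamma>\<in>\<F>. \<gamma> t $ i)" for t i unfolding \<Gamma>_def by simp
  have \<Gamma>_up: "\<gamma> t \<le> \<Gamma> t" if "\<gamma> \<in> \<F>" for \<gamma> t
    unfolding less_eq_vec_def \<Gamma>_eq using cSUP_upper[OF that bdd] by auto
  have \<Gamma>_le: "\<Gamma> t $ i \<le> c" if "\<And>\<gamma>. \<gamma> \<in> \<F> \<Longrightarrow> \<gamma> t $ i \<le> c" for t i c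
    unfolding \<Gamma>_eq using \<gamma>0 that by (intro cSUP_least) auto
  have \<Gamma>_mod: "\<bar>\<Gamma> v $ i - \<Gamma> u $ i\<bar> \<le> integral {u..v} C" if uv: "u \<le> v" for u v i
  proof -
    have "\<Gamma> v $ i \<le> \<Gamma> u $ i + integral {u..v} C"
    proof (rule \<Gamma>_le)
      fix \<gamma> assume g: "\<gamma> \<in> \<F>"
      then have "\<bar>\<gamma> v $ i - \<gamma> u $ i\<bar> \<le> integral {u..v} C" using uv unfolding \<F>_def by auto
      then show "\<gamma> v $ i \<le> \<Gamma> u $ i + integral {u..v} C"
        using \<Gamma>_up[OF g, of u] unfolding less_eq_vec_def abs_le_iff by (smt (verit))
    qed
    moreover have "\<Gamma> u $ i \<le> \<Gamma> v $ i + integral {u..v} C"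
    proof (rule \<Gamma>_le)
      fix \<gamma> assume g: "\<gamma> \<in> \<F>"
      then have "\<bar>\<gamma> v $ i - \<gamma> u $ i\<bar> \<le> integral {u..v} C" using uv unfolding \<F>_def by auto
      then show "\<gamma> u $ i \<le> \<Gamma> v $ i + integral {u..v} C"
        using \<Gamma>_up[OF g, of v] unfolding less_eq_vec_def abs_le_iff by (smt (verit))
    qed
    ultimately show ?thesis by linarith
  qed
  have \<Gamma>_cont: "continuous_on UNIV \<Gamma>" by (rule continuous_if_modulus[OF \<Gamma>_mod])
  have \<Gamma>_sub: "\<Gamma> t \<le> drift s x \<Gamma> t" for t
    unfolding less_eq_vec_def
  proof
    fix i show "\<Gamma> t $ i \<le> drift s x \<Gamma> t $ i"
    proof (rule \<Gamma>_le)
      fix \<gamma> assume g: "\<gamma> \<in> \<F>"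
      then have "\<gamma> t \<le> drift s x \<gamma> t" unfolding \<F>_def by auto
      also have "\<dots> \<le> drift s x \<Gamma> t"
        by (rule drift_mono[OF cont[OF g] \<Gamma>_cont \<Gamma>_up[OF g] order_refl])
      finally show "\<gamma> t $ i \<le> drift s x \<Gamma> t $ i" by (simp add: less_eq_vec_def)
    qed
  qed
  have "drift s x \<Gamma> t \<le> \<Gamma> t" for t
    by (rule \<Gamma>_up[OF up[OF \<Gamma>_cont \<Gamma>_sub]])
  then have fixp: "\<Gamma> t = drift s x \<Gamma> t" for t
    using \<Gamma>_sub by (intro antisym) auto
  have "\<gamma>' t \<le> \<Gamma> t" if "continuous_on UNIV \<gamma>'" "\<forall>t. \<gamma>' t \<le> drift s x \<gamma>' t" for \<gamma>' t
    using that \<Gamma>_up[OF up[of \<gamma>'], of t] order_trans by blast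
  with \<Gamma>_cont fixp show ?thesis by blast
qed

text \<open>
  The field may be discontinuous, so the integral equation may have several solutions. The greatest
  one is monotone in the initial point.
\<close>

definition flow :: "real \<Rightarrow> real ^ 'd \<Rightarrow> real \<Rightarrow> real ^ 'd" where
  "flow s x = (SOME \<gamma>. continuous_on UNIV \<gamma> \<and> (\<forall>t. \<gamma> t = drift s x \<gamma> t) \<and>
     (\<forall>\<gamma>'. continuous_on UNIV \<gamma>' \<and> (\<forall>t. \<gamma>' t \<le> drift s x \<gamma>' t) \<longrightarrow> (\<forall>t. \<gamma>' t \<le> \<gamma> t)))"

lemma flow_continuous: "continuous_on UNIV (flow s x)"
  and flow_fixpoint: "flow s x t = drift s x (flow s x) t"
  and flow_greatest: "continuous_on UNIV \<gamma>' \<Longrightarrow> (\<And>t. \<gamma>' t \<le> drift s x \<gamma>' t) \<Longrightarrow> \<gamma>' t \<le> flow s x t"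
  using someI_ex[OF ex_greatest_path[of s x]] unfolding flow_def[symmetric] by blast+

lemma flow_start: "t \<le> s \<Longrightarrow> flow s x t = x"
  using flow_fixpoint[of s x t] drift_before by simp

lemma flow_component:
  "s \<le> u \<Longrightarrow> u \<le> v \<Longrightarrow> flow s x v $ i - flow s x u $ i = integral {u..v} (\<lambda>r. B r (flow s x r) $ i)"
  using drift_diff[OF flow_continuous[of s x], of s u v x i] flow_fixpoint[of s x] by simp

lemma flow_modulus: "u \<le> v \<Longrightarrow> \<bar>flow s x v $ i - flow s x u $ i\<bar> \<le> integral {u..v} C"
  using drift_modulus[OF flow_continuous[of s x], of u v s x i] flow_fixpoint[of s x] by simp

lemma flow_mono: "x \<le> y \<Longrightarrow> flow s x t \<le> flow s y t"
proof (rule flow_greatest[OF flow_continuous])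
  fix t assume "x \<le> y"
  then show "flow s x t \<le> drift s y (flow s x) t"
    using flow_fixpoint[of s x t] drift_mono[OF flow_continuous[of s x] flow_continuous[of s x] order_refl, of x y s t] by simp
qed

text \<open>
  The path from the larger point stays above the other one, so it always moves at least as fast.
\<close>

lemma flow_expanding:
  assumes "x \<le> y"
  shows "y - x \<le> flow s y t - flow s x t"
  unfolding less_eq_vec_def
proof
  fix i
  have "integral {s..t} (\<lambda>r. B r (flow s x r) $ i) \<le> integral {s..t} (\<lambda>r. B r (flow s y r) $ i)"
    using B_mono[OF flow_mono[OF assms]]
    by (intro integral_le B_path_on flow_continuous) (auto simp: less_eq_vec_def)
  moreover have "flow s y t $ i = y $ i + integral {s..t} (\<lambda>r. B r (flow s y r) $ i)"
    by (subst flow_fixpoint) (simp add: drift_def)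
  moreover have "flow s x t $ i = x $ i + integral {s..t} (\<lambda>r. B r (flow s x r) $ i)"
    by (subst flow_fixpoint) (simp add: drift_def)
  ultimately show "(y - x) $ i \<le> (flow s y t - flow s x t) $ i" by simp
qed

lemma flow_isCont_ae: "AE x in lborel. \<forall>i. isCont (\<lambda>y. flow s y t $ i) x"
  by (rule eventually_all_finite, rule isCont_ae_if_mono) (use flow_mono in \<open>auto simp: less_eq_vec_def\<close>)

end

section \<open>The flow spreads volume out\<close>

text \<open>
  Under a map that does not decrease distances, the preimage of an interval has at most the diameter,
  hence at most the measure, of the interval. Intervals determine the inequality for Borel sets.
\<close>

lemma emeasure_expanding_preimage_le:
  fixes m :: "real \<Rightarrow> real"
  assumes m: "m \<in> borel_measurable borel"
    and expand: "\<And>\<tau> \<tau>'. a \<le> \<tau> \<Longrightarrow> \<tau> \<le> \<tau>' \<Longrightarrow> \<tau>' \<le> c \<Longrightarrow> \<tau>' - \<tau> \<le> m \<tau>' - m \<tau>"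
    and range: "\<And>\<tau>. \<tau> \<in> {a..c} \<Longrightarrow> m \<tau> \<in> {a'..c'}"
    and A: "A \<in> sets borel"
  shows "emeasure lborel {\<tau>\<in>{a..c}. m \<tau> \<in> A} \<le> emeasure lborel ({a'..c'} \<inter> A)"
proof -
  define M where "M = distr (density lborel (indicator {a..c})) borel m"
  define N where "N = density lborel (indicator {a'..c'} :: real \<Rightarrow> ennreal)"
  have M: "emeasure M D = emeasure lborel {\<tau>\<in>{a..c}. m \<tau> \<in> D}" if "D \<in> sets borel" for D
  proof -
    have mD: "m -` D \<in> sets borel" using measurable_sets[OF m that] by simp
    have "emeasure M D = emeasure (density lborel (indicator {a..c})) (m -` D)"
      unfolding M_def using m that by (subst emeasure_distr) auto
    also have "\<dots> = (\<integral>\<^sup>+x. indicator {a..c} x * indicator (m -` D) x \<partial>lborel)"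
      using mD by (subst emeasure_density) auto
    also have "\<dots> = (\<integral>\<^sup>+x. indicator ({a..c} \<inter> m -` D) x \<partial>lborel)"
      by (simp add: indicator_inter_arith)
    also have "\<dots> = emeasure lborel ({a..c} \<inter> m -` D)" using mD by (subst nn_integral_indicator) auto
    also have "{a..c} \<inter> m -` D = {\<tau>\<in>{a..c}. m \<tau> \<in> D}" by auto
    finally show ?thesis .
  qed
  have N: "emeasure N D = emeasure lborel ({a'..c'} \<inter> D)" if "D \<in> sets borel" for D
  proof -
    have "emeasure N D = (\<integral>\<^sup>+x. indicator {a'..c'} x * indicator D x \<partial>lborel)"
      unfolding N_def using that by (subst emeasure_density) auto
    also have "\<dots> = (\<integral>\<^sup>+x. indicator ({a'..c'} \<inter> D) x \<partial>lborel)"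
      by (simp add: indicator_inter_arith)
    also have "\<dots> = emeasure lborel ({a'..c'} \<inter> D)" using that by (subst nn_integral_indicator) auto
    finally show ?thesis .
  qed
  have "emeasure M A \<le> emeasure N A"
  proof (rule measure_le_if_interval_measure_le)
    show "emeasure N UNIV < \<infinity>" using N[of UNIV] emeasure_mono[of "{a'..c'} \<inter> UNIV" "{a'..c'}" lborel]
      by (cases "a' \<le> c'") auto
    fix u v :: real assume "u < v"
    let ?D = "{\<tau>\<in>{a..c}. m \<tau> \<in> {u<..v}}"
    show "emeasure M {u<..v} \<le> emeasure N {u<..v}"
    proof (cases "?D = {}")
      case True
      have "emeasure M {u<..v} = emeasure lborel ?D" by (rule M) simp
      then show ?thesis unfolding True by simp
    next
      case False
      define l where "l = min v c' - max u a'"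
      have diam: "\<tau>' - \<tau> \<le> l" if "\<tau> \<in> ?D" "\<tau>' \<in> ?D" for \<tau> \<tau>'
      proof (cases "\<tau> \<le> \<tau>'")
        case True
        then have "\<tau>' - \<tau> \<le> m \<tau>' - m \<tau>" using that by (intro expand) auto
        also have "\<dots> \<le> l" using that range[of \<tau>] range[of \<tau>'] unfolding l_def by auto
        finally show ?thesis .
      next
        case False
        then have "\<tau>' - \<tau> \<le> 0" by simp
        also have "0 \<le> l" using that(1) range[of \<tau>] unfolding l_def by auto
        finally show ?thesis .
      qed
      have l0: "0 \<le> l" using False diam by fastforce
      have bdd: "bdd_below ?D" by (rule bdd_belowI[of _ a]) auto
      have "?D \<subseteq> {Inf ?D..Inf ?D + l}"
      proof
        fix \<tau> assume t: "\<tau> \<in> ?D"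
        have "\<tau> - l \<le> Inf ?D" using False diam[OF _ t] by (intro cInf_greatest) (auto simp: algebra_simps)
        moreover have "Inf ?D \<le> \<tau>" by (rule cInf_lower[OF t bdd])
        ultimately show "\<tau> \<in> {Inf ?D..Inf ?D + l}" by simp
      qed
      then have "emeasure M {u<..v} \<le> emeasure lborel {Inf ?D..Inf ?D + l}"
        by (subst M) (auto intro!: emeasure_mono)
      also have "\<dots> = ennreal l" using l0 by simp
      also have "\<dots> = emeasure lborel {max u a'<..min v c'}" using l0 unfolding l_def by simp
      also have "\<dots> \<le> emeasure lborel ({a'..c'} \<inter> {u<..v})" by (rule emeasure_mono) auto
      also have "\<dots> = emeasure N {u<..v}" by (subst N) auto
      finally show ?thesis .
    qed
  qed (auto simp: M_def N_def A)
  then show ?thesis using M[OF A] N[OF A] by simp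
qed

definition vol_nonincreasing :: "('a::euclidean_space \<Rightarrow> 'a) \<Rightarrow> bool" where
  "vol_nonincreasing S \<longleftrightarrow> S \<in> borel_measurable borel \<and>
     (\<forall>A\<in>sets borel. emeasure lborel (S -` A) \<le> emeasure lborel A)"

lemma vol_nonincreasing_id: "vol_nonincreasing (\<lambda>x. x)"
  unfolding vol_nonincreasing_def by auto

lemma vol_nonincreasing_comp:
  assumes "vol_nonincreasing S" "vol_nonincreasing S'"
  shows "vol_nonincreasing (\<lambda>x. S (S' x))"
  unfolding vol_nonincreasing_def
proof (intro conjI ballI)
  have S: "S \<in> borel_measurable borel" and S': "S' \<in> borel_measurable borel"
    using assms unfolding vol_nonincreasing_def by auto
  show "(\<lambda>x. S (S' x)) \<in> borel_measurable borel" by (rule measurable_compose[OF S' S])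
  fix A :: "'a set" assume A: "A \<in> sets borel"
  have SA: "S -` A \<in> sets borel" using measurable_sets[OF S A] by simp
  have "emeasure lborel ((\<lambda>x. S (S' x)) -` A) = emeasure lborel (S' -` (S -` A))"
    by (simp add: vimage_def)
  also have "\<dots> \<le> emeasure lborel (S -` A)" using assms(2) SA unfolding vol_nonincreasing_def by blast
  also have "\<dots> \<le> emeasure lborel A" using assms(1) A unfolding vol_nonincreasing_def by blast
  finally show "emeasure lborel ((\<lambda>x. S (S' x)) -` A) \<le> emeasure lborel A" .
qed

lemma nn_integral_vol_nonincreasing:
  assumes "vol_nonincreasing S" and g: "g \<in> borel_measurable borel"
  shows "(\<integral>\<^sup>+x. g (S x) \<partial>lborel) \<le> (\<integral>\<^sup>+x. g x \<partial>lborel)"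
proof -
  have S: "S \<in> borel_measurable borel" using assms(1) unfolding vol_nonincreasing_def by auto
  have "(\<integral>\<^sup>+x. g (S x) \<partial>lborel) = (\<integral>\<^sup>+x. g x \<partial>distr lborel borel S)"
    using S g by (intro nn_integral_distr[symmetric]) auto
  also have "\<dots> \<le> (\<integral>\<^sup>+x. g x \<partial>lborel)"
  proof (rule nn_integral_mono_measure)
    show "distr lborel borel S \<le> lborel"
    proof (subst le_measure, goal_cases)
      case 2
      show ?case
      proof
        fix A assume "A \<in> sets (distr lborel borel S)"
        then have A: "A \<in> sets borel" by simp
        have "emeasure (distr lborel borel S) A = emeasure lborel (S -` A)"
          using S A by (subst emeasure_distr) auto
        also have "\<dots> \<le> emeasure lborel A" using assms(1) A unfolding vol_nonincreasing_def by blast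
        finally show "emeasure (distr lborel borel S) A \<le> emeasure lborel A" .
      qed
    qed simp
  qed simp
  finally show ?thesis .
qed

context bounded_field
begin

text \<open>
  Only the coordinate \<open>i\<close> moves, during the times \<open>[a, c]\<close>, with the velocity frozen at \<open>z\<close>.
\<close>

definition shear :: "real \<Rightarrow> real \<Rightarrow> 'd \<Rightarrow> real ^ 'd \<Rightarrow> real ^ 'd" where
  "shear a c i z = z + integral {a..c} (\<lambda>r. B r z $ i) *\<^sub>R axis i 1"

lemma frozen_integral_measurable:
  "(\<lambda>z. integral {a..c} (\<lambda>r. B r z $ i)) \<in> borel_measurable borel"
proof -
  have eq: "integral {a..c} (\<lambda>r. B r z $ i) = (LINT r|lborel. indicator {a..c} r * B r z $ i)" for z
    by (rule integral_eq_lborel_integral(2)[OF B_path_integrable]) simp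
  have "(\<lambda>(z, r). indicator {a..c} r * B r z $ i) \<in> borel_measurable (borel \<Otimes>\<^sub>M lborel)"
  proof -
    have "(\<lambda>p::(real ^ 'd) \<times> real. (snd p, fst p)) \<in> borel_measurable borel"
      by (intro borel_measurable_continuous_onI continuous_intros)
    from measurable_compose[OF this B_meas]
    have "(\<lambda>p. B (snd p) (fst p)) \<in> borel_measurable (borel :: ((real ^ 'd) \<times> real) measure)" by simp
    then have "(\<lambda>p. B (snd p) (fst p) $ i) \<in> borel_measurable (borel \<Otimes>\<^sub>M borel)"
      unfolding borel_prod by (rule borel_measurable_vec_nth)
    then have [measurable]: "(\<lambda>p. B (snd p) (fst p) $ i) \<in> borel_measurable (borel \<Otimes>\<^sub>M lborel)"
      by (simp cong: measurable_cong_sets)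
    show ?thesis unfolding case_prod_unfold by measurable
  qed
  then show ?thesis unfolding eq by (rule lborel.borel_measurable_lebesgue_integral)
qed

text \<open>
  On each line parallel to the axis \<open>i\<close> the shear adds an increasing function to the parameter, so it
  expands the line. It moves points by at most \<open>\<eta>\<close>, so segments of length \<open>L\<close> land in segments of
  length \<open>L + 2 \<eta>\<close>; averaging over all lines gives the claim up to a factor
  \<open>(L + 2 \<eta>) / L\<close>, and \<open>L\<close> is arbitrary.
\<close>

lemma shear_vol_nonincreasing: "vol_nonincreasing (shear a c i)"
  unfolding vol_nonincreasing_def
proof (intro conjI ballI)
  define p where "p z = integral {a..c} (\<lambda>r. B r z $ i)" for z
  have pm: "p \<in> borel_measurable borel" unfolding p_def by (rule frozen_integral_measurable)
  have shear_eq: "shear a c i z = z + p z *\<^sub>R axis i 1" for z unfolding shear_def p_def ..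
  have "(\<lambda>z. z + p z *\<^sub>R axis i 1) \<in> borel_measurable borel"
    using pm by (intro borel_measurable_add borel_measurable_scaleR) auto
  then show Sm: "shear a c i \<in> borel_measurable borel" unfolding shear_eq[abs_def] .
  fix A :: "(real ^ 'd) set" assume A: "A \<in> sets borel"
  define \<eta> where "\<eta> = integral {a..c} C"
  have \<eta>0: "0 \<le> \<eta>" unfolding \<eta>_def by (rule CI_nonneg)
  have p_bound: "\<bar>p z\<bar> \<le> \<eta>" for z
    unfolding p_def \<eta>_def by (rule B_path_integral_bound) simp
  have p_mono: "p z \<le> p z'" if "z \<le> z'" for z z'
    unfolding p_def using B_mono[OF that] by (intro integral_le B_path_on) (auto simp: less_eq_vec_def)
  have SA: "shear a c i -` A \<in> sets borel" using measurable_sets[OF Sm A] by simp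
  have key: "ennreal L * emeasure lborel (shear a c i -` A) \<le> ennreal (L + 2 * \<eta>) * emeasure lborel A"
    if L: "L > 0" for L
  proof -
    have "ennreal L * emeasure lborel (shear a c i -` A)
        = (\<integral>\<^sup>+z. emeasure lborel {\<tau>\<in>{0..L}. z + \<tau> *\<^sub>R axis i 1 \<in> shear a c i -` A} \<partial>lborel)"
      using emeasure_by_lines[OF SA, of 0 L "axis i 1"] L by simp
    also have "\<dots> \<le> (\<integral>\<^sup>+z. emeasure lborel {\<tau>\<in>{-\<eta>..L + \<eta>}. z + \<tau> *\<^sub>R axis i 1 \<in> A} \<partial>lborel)"
    proof (rule nn_integral_mono)
      fix z :: "real ^ 'd"
      define m where "m \<tau> = \<tau> + p (z + \<tau> *\<^sub>R axis i 1)" for \<tau>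
      have line: "(\<lambda>\<tau>. z + \<tau> *\<^sub>R axis i 1) \<in> borel_measurable borel"
        by (intro borel_measurable_continuous_onI continuous_intros)
      have mm: "m \<in> borel_measurable borel"
        unfolding m_def[abs_def] using measurable_compose[OF line pm] by simp
      have AL: "(\<lambda>\<tau>. z + \<tau> *\<^sub>R axis i 1) -` A \<in> sets borel" using measurable_sets[OF line A] by simp
      have "emeasure lborel {\<tau>\<in>{0..L}. m \<tau> \<in> (\<lambda>\<tau>. z + \<tau> *\<^sub>R axis i 1) -` A}
          \<le> emeasure lborel ({-\<eta>..L + \<eta>} \<inter> (\<lambda>\<tau>. z + \<tau> *\<^sub>R axis i 1) -` A)"
      proof (rule emeasure_expanding_preimage_le[OF mm _ _ AL])
        fix \<tau> \<tau>' :: real assume "\<tau> \<le> \<tau>'"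
        then have "z + \<tau> *\<^sub>R axis i 1 \<le> z + \<tau>' *\<^sub>R axis i 1" by (simp add: less_eq_vec_def axis_def)
        then show "\<tau>' - \<tau> \<le> m \<tau>' - m \<tau>" using p_mono unfolding m_def by simp
      next
        fix \<tau> :: real assume "\<tau> \<in> {0..L}"
        then show "m \<tau> \<in> {- \<eta>..L + \<eta>}"
          using p_bound[of "z + \<tau> *\<^sub>R axis i 1"] unfolding m_def by auto
      qed
      also have "{-\<eta>..L + \<eta>} \<inter> (\<lambda>\<tau>. z + \<tau> *\<^sub>R axis i 1) -` A = {\<tau>\<in>{-\<eta>..L + \<eta>}. z + \<tau> *\<^sub>R axis i 1 \<in> A}" by auto
      also have "{\<tau>\<in>{0..L}. m \<tau> \<in> (\<lambda>\<tau>. z + \<tau> *\<^sub>R axis i 1) -` A} = {\<tau>\<in>{0..L}. z + \<tau> *\<^sub>R axis i 1 \<in> shear a c i -` A}"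
        unfolding shear_eq m_def by (simp add: scaleR_add_left add.assoc)
      finally show "emeasure lborel {\<tau>\<in>{0..L}. z + \<tau> *\<^sub>R axis i 1 \<in> shear a c i -` A}
        \<le> emeasure lborel {\<tau>\<in>{-\<eta>..L + \<eta>}. z + \<tau> *\<^sub>R axis i 1 \<in> A}" .
    qed
    also have "\<dots> = ennreal (L + 2 * \<eta>) * emeasure lborel A"
      using emeasure_by_lines[OF A, of "-\<eta>" "L + \<eta>" "axis i 1"] L \<eta>0 by (simp add: algebra_simps)
    finally show ?thesis .
  qed
  show "emeasure lborel (shear a c i -` A) \<le> emeasure lborel A"
  proof (cases "emeasure lborel A = \<infinity>")
    case False
    then obtain q where q: "emeasure lborel A = ennreal q" "0 \<le> q" by (cases "emeasure lborel A") auto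
    have "emeasure lborel (shear a c i -` A) \<le> ennreal (1 + 2 * \<eta>) * ennreal q" using key[of 1] q(1) by simp
    also have "\<dots> < \<infinity>" by (simp add: ennreal_mult_less_top)
    finally obtain r where r: "emeasure lborel (shear a c i -` A) = ennreal r" "0 \<le> r"
      by (cases "emeasure lborel (shear a c i -` A)") auto
    have L: "L * r \<le> (L + 2 * \<eta>) * q" if "L > 0" for L
    proof -
      have "ennreal (L * r) \<le> ennreal ((L + 2 * \<eta>) * q)"
        using key[OF that] q r that \<eta>0 by (simp add: ennreal_mult)
      then show ?thesis using that q(2) \<eta>0 by (subst (asm) ennreal_le_iff) auto
    qed
    have "r \<le> q"
    proof (rule ccontr)
      assume "\<not> r \<le> q"
      then have d: "r - q > 0" by simp
      \<comment> \<open>large enough to contradict \<open>L * r \<le> (L + 2 * \<eta>) * q\<close>\<close>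
      define L where "L = (2 * \<eta> * q + 1) / (r - q)"
      have "L > 0" unfolding L_def using d q(2) \<eta>0 by (intro divide_pos_pos add_nonneg_pos) auto
      from L[OF this] have "L * (r - q) \<le> 2 * \<eta> * q" by (simp add: algebra_simps)
      moreover have "L * (r - q) = 2 * \<eta> * q + 1" unfolding L_def using d by simp
      ultimately show False by simp
    qed
    then show ?thesis using q r by (simp add: ennreal_leI)
  qed simp
qed

definition shears :: "real \<Rightarrow> real \<Rightarrow> 'd list \<Rightarrow> real ^ 'd \<Rightarrow> real ^ 'd" where
  "shears a c is = fold (shear a c) is"

lemma shears_vol_nonincreasing: "vol_nonincreasing (shears a c is)"
proof (induction "is")
  case (Cons i "is")
  have "shears a c (i # is) = (\<lambda>z. shears a c is (shear a c i z))" by (simp add: shears_def fun_eq_iff)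
  then show ?case using vol_nonincreasing_comp[OF Cons shear_vol_nonincreasing] by simp
qed (simp add: shears_def vol_nonincreasing_id id_def)

text \<open>
  The points \<open>z'\<close> at which the velocities are frozen differ from coordinate to coordinate, but all are
  close to the starting point \<open>z\<close>.
\<close>

lemma shears_component:
  assumes "distinct is"
  shows "(j \<notin> set is \<longrightarrow> shears a c is z $ j = z $ j) \<and>
    (j \<in> set is \<longrightarrow> (\<exists>z'. (\<forall>k. \<bar>z' $ k - z $ k\<bar> \<le> integral {a..c} C \<and> (k \<notin> set is \<longrightarrow> z' $ k = z $ k)) \<and>
       shears a c is z $ j = z $ j + integral {a..c} (\<lambda>r. B r z' $ j)))"
  using assms
proof (induction "is" arbitrary: z)
  case (Cons i "is")
  define z1 where "z1 = shear a c i z"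
  have z1: "z1 $ k = (if k = i then z $ k + integral {a..c} (\<lambda>r. B r z $ i) else z $ k)" for k
    unfolding z1_def shear_def by (auto simp: axis_def)
  have z1_close: "\<bar>z1 $ k - z $ k\<bar> \<le> integral {a..c} C" for k
    using B_path_integral_bound[of "\<lambda>_. z" a c i] CI_nonneg[of a c] unfolding z1 by auto
  have step: "shears a c (i # is) z = shears a c is z1" by (simp add: shears_def z1_def)
  have i: "i \<notin> set is" "distinct is" using Cons.prems by auto
  note IH = Cons.IH[OF i(2), of z1]
  show ?case
  proof (intro conjI impI)
    assume "j \<notin> set (i # is)"
    then show "shears a c (i # is) z $ j = z $ j" unfolding step using IH z1 by auto
  next
    assume j: "j \<in> set (i # is)"
    show "\<exists>z'. (\<forall>k. \<bar>z' $ k - z $ k\<bar> \<le> integral {a..c} C \<and> (k \<notin> set (i # is) \<longrightarrow> z' $ k = z $ k)) \<and>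
       shears a c (i # is) z $ j = z $ j + integral {a..c} (\<lambda>r. B r z' $ j)"
    proof (cases "j = i")
      case True
      then have "shears a c (i # is) z $ j = z $ j + integral {a..c} (\<lambda>r. B r z $ j)"
        unfolding step using IH i(1) z1 by auto
      then show ?thesis using CI_nonneg[of a c] by (intro exI[of _ z]) auto
    next
      case False
      then have "j \<in> set is" using j by auto
      then obtain z' where z': "\<And>k. \<bar>z' $ k - z1 $ k\<bar> \<le> integral {a..c} C"
          "\<And>k. k \<notin> set is \<Longrightarrow> z' $ k = z1 $ k"
          "shears a c is z1 $ j = z1 $ j + integral {a..c} (\<lambda>r. B r z' $ j)"
        using IH by blast
      have "\<bar>z' $ k - z $ k\<bar> \<le> integral {a..c} C" for k
      proof (cases "k = i")
        case True then show ?thesis using z'(2)[of k] i(1) z1_close[of k] by auto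
      next
        case False then show ?thesis using z'(1)[of k] z1[of k] by auto
      qed
      moreover have "z' $ k = z $ k" if "k \<notin> set (i # is)" for k
        using that z'(2)[of k] z1[of k] by auto
      moreover have "shears a c (i # is) z $ j = z $ j + integral {a..c} (\<lambda>r. B r z' $ j)"
        unfolding step using z'(3) z1[of j] False by simp
      ultimately show ?thesis by blast
    qed
  qed
qed (auto simp: shears_def)

definition coords :: "'d list" where "coords = (SOME is. distinct is \<and> set is = UNIV)"

lemma coords: "distinct coords" "set coords = UNIV"
proof -
  have "\<exists>is :: 'd list. distinct is \<and> set is = UNIV"
    using finite_distinct_list[of "UNIV :: 'd set"] by auto
  from someI_ex[OF this] show "distinct coords" "set coords = UNIV" unfolding coords_def by auto
qed

text \<open>
  The Euler scheme with step \<open>h\<close>, with each step split into its coordinates so that every factor is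
  a shear.
\<close>

primrec split_euler :: "real \<Rightarrow> real \<Rightarrow> nat \<Rightarrow> real ^ 'd \<Rightarrow> real ^ 'd" where
  "split_euler s h 0 x = x"
| "split_euler s h (Suc k) x = shears (s + real k * h) (s + real (Suc k) * h) coords (split_euler s h k x)"

lemma split_euler_vol_nonincreasing: "vol_nonincreasing (split_euler s h k)"
proof (induction k)
  case (Suc k)
  have "split_euler s h (Suc k) = (\<lambda>x. shears (s + real k * h) (s + real (Suc k) * h) coords (split_euler s h k x))"
    by (simp add: fun_eq_iff)
  then show ?case using vol_nonincreasing_comp[OF shears_vol_nonincreasing Suc] by simp
qed (simp add: vol_nonincreasing_id)

text \<open>
  The scheme stays between the flows from two points shifted by \<open>\<delta>\<close>. The distance \<open>\<delta>\<close> leaves room for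
  all movements within one step, so during the step the frozen point lies between the two paths, and
  then monotonicity of the field compares the velocities: the error does not accumulate.
\<close>

lemma split_euler_between:
  assumes h: "0 \<le> h" and small: "\<And>k. k < n \<Longrightarrow> 2 * integral {s + real k * h..s + real (Suc k) * h} C \<le> \<delta>"
    and k: "k \<le> n"
  shows "split_euler s h k x $ j + \<delta> \<le> flow s (x + \<delta> *\<^sub>R 1) (s + real k * h) $ j \<and>
    flow s (x - \<delta> *\<^sub>R 1) (s + real k * h) $ j \<le> split_euler s h k x $ j - \<delta>"
  using k
proof (induction k arbitrary: j)
  case 0
  then show ?case by (simp add: flow_start)
next
  case (Suc k)
  let ?a = "s + real k * h" and ?c = "s + real (Suc k) * h"
  let ?U = "flow s (x + \<delta> *\<^sub>R 1)" and ?L = "flow s (x - \<delta> *\<^sub>R 1)" and ?z = "split_euler s h k x"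
  have IH: "?z $ j + \<delta> \<le> ?U ?a $ j" "?L ?a $ j \<le> ?z $ j - \<delta>" for j
    using Suc.IH[of j] Suc.prems by auto
  have ac: "s \<le> ?a" "?a \<le> ?c" using h by (auto simp: mult_right_mono)
  obtain z' where z': "\<And>l. \<bar>z' $ l - ?z $ l\<bar> \<le> integral {?a..?c} C"
      "split_euler s h (Suc k) x $ j = ?z $ j + integral {?a..?c} (\<lambda>r. B r z' $ j)"
    using shears_component[OF coords(1), of j ?a ?c ?z] coords(2) by auto
  have sm: "2 * integral {?a..?c} C \<le> \<delta>" using small[of k] Suc.prems by simp
  have U: "z' \<le> ?U r" if "r \<in> {?a..?c}" for r
    unfolding less_eq_vec_def
  proof
    fix l
    have "\<bar>?U r $ l - ?U ?a $ l\<bar> \<le> integral {?a..r} C" using that by (intro flow_modulus) auto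
    also have "\<dots> \<le> integral {?a..?c} C" using that by (intro CI_mono) auto
    finally show "z' $ l \<le> ?U r $ l" using IH(1)[of l] z'(1)[of l] sm by linarith
  qed
  have L: "?L r \<le> z'" if "r \<in> {?a..?c}" for r
    unfolding less_eq_vec_def
  proof
    fix l
    have "\<bar>?L r $ l - ?L ?a $ l\<bar> \<le> integral {?a..r} C" using that by (intro flow_modulus) auto
    also have "\<dots> \<le> integral {?a..?c} C" using that by (intro CI_mono) auto
    finally show "?L r $ l \<le> z' $ l" using IH(2)[of l] z'(1)[of l] sm by linarith
  qed
  have "integral {?a..?c} (\<lambda>r. B r z' $ j) \<le> integral {?a..?c} (\<lambda>r. B r (?U r) $ j)"
  proof (rule integral_le)
    show "(\<lambda>r. B r z' $ j) integrable_on {?a..?c}" by (rule B_path_on) simp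
    show "(\<lambda>r. B r (?U r) $ j) integrable_on {?a..?c}" by (rule B_path_on[OF flow_continuous])
  qed (use B_mono[OF U] in \<open>auto simp: less_eq_vec_def\<close>)
  moreover have "integral {?a..?c} (\<lambda>r. B r (?L r) $ j) \<le> integral {?a..?c} (\<lambda>r. B r z' $ j)"
  proof (rule integral_le)
    show "(\<lambda>r. B r z' $ j) integrable_on {?a..?c}" by (rule B_path_on) simp
    show "(\<lambda>r. B r (?L r) $ j) integrable_on {?a..?c}" by (rule B_path_on[OF flow_continuous])
  qed (use B_mono[OF L] in \<open>auto simp: less_eq_vec_def\<close>)
  ultimately show ?case
    using flow_component[OF ac, of "x + \<delta> *\<^sub>R 1" j] flow_component[OF ac, of "x - \<delta> *\<^sub>R 1" j]
      IH(1)[of j] IH(2)[of j] z'(2) by linarith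
qed

lemma split_euler_tendsto:
  assumes st: "s \<le> t" and cont: "\<And>j. isCont (\<lambda>y. flow s y t $ j) x"
  shows "(\<lambda>n. split_euler s ((t - s) / real (Suc n)) (Suc n) x) \<longlonglongrightarrow> flow s x t"
proof (rule vec_tendstoI)
  fix j
  have small: "\<forall>\<^sub>F n in sequentially. \<forall>k<Suc n.
      2 * integral {s + real k * ((t - s) / real (Suc n))..s + real (Suc k) * ((t - s) / real (Suc n))} C \<le> \<delta>"
    if "\<delta> > 0" for \<delta>
  proof -
    \<comment> \<open>steps so small that \<open>C\<close> has integral at most \<open>\<delta> / 2\<close> over each of them\<close>
    define K where "K v = integral {s..v} C" for v
    have "continuous_on {s..t} K" unfolding K_def by (rule indefinite_integral_continuous_1[OF C_on])
    then have "uniformly_continuous_on {s..t} K" by (rule compact_uniformly_continuous) simp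
    then obtain d where d: "d > 0" "\<And>u v. u \<in> {s..t} \<Longrightarrow> v \<in> {s..t} \<Longrightarrow> dist v u < d \<Longrightarrow> dist (K v) (K u) < \<delta> / 2"
      using \<open>\<delta> > 0\<close> unfolding uniformly_continuous_on_def by (meson half_gt_zero)
    obtain N where N: "real N > (t - s) / d" using reals_Archimedean2 by blast
    show ?thesis
      unfolding eventually_sequentially
    proof (intro exI[of _ N] allI impI)
      fix n k assume nk: "N \<le> n" "k < Suc n"
      define h where "h = (t - s) / real (Suc n)"
      have h0: "0 \<le> h" using st unfolding h_def by simp
      have hn: "h * real (Suc n) = t - s" unfolding h_def by simp
      have "(t - s) / d < real (Suc n)" using N nk(1) by linarith
      then have hd: "h < d" using d(1) unfolding h_def by (simp add: field_simps)
      have "real (Suc k) * h \<le> real (Suc n) * h" using nk(2) h0 by (intro mult_right_mono) auto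
      then have c: "s + real (Suc k) * h \<le> t" using hn by (simp add: mult.commute)
      have a: "s \<le> s + real k * h" "s + real k * h \<le> s + real (Suc k) * h"
        using h0 by (auto simp: mult_right_mono)
      have "dist (K (s + real (Suc k) * h)) (K (s + real k * h)) < \<delta> / 2"
        using a c hd h0 by (intro d(2)) (auto simp: dist_real_def algebra_simps)
      moreover have "K (s + real (Suc k) * h) - K (s + real k * h) = integral {s + real k * h..s + real (Suc k) * h} C"
        using Henstock_Kurzweil_Integration.integral_combine[OF a C_on] unfolding K_def by simp
      ultimately show "2 * integral {s + real k * ((t - s) / real (Suc n))..s + real (Suc k) * ((t - s) / real (Suc n))} C \<le> \<delta>"
        unfolding h_def[symmetric] dist_real_def by linarith
    qed
  qed
  show "(\<lambda>n. split_euler s ((t - s) / real (Suc n)) (Suc n) x $ j) \<longlonglongrightarrow> flow s x t $ j"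
  proof (rule tendstoI)
    fix e :: real assume "e > 0"
    obtain d where d: "d > 0" "\<And>y. dist y x < d \<Longrightarrow> dist (flow s y t $ j) (flow s x t $ j) < e"
      using cont[of j, unfolded continuous_at_eps_delta, rule_format, OF \<open>e > 0\<close>] by auto
    have pos: "norm (1 :: real ^ 'd) + 1 > 0" by (simp add: add_nonneg_pos)
    define \<delta> where "\<delta> = d / (2 * (norm (1 :: real ^ 'd) + 1))"
    have \<delta>: "\<delta> > 0" unfolding \<delta>_def using d(1) by (intro divide_pos_pos) (auto simp: add_nonneg_pos)
    have "\<delta> * norm (1 :: real ^ 'd) \<le> \<delta> * (norm (1 :: real ^ 'd) + 1)" using \<delta> by (intro mult_left_mono) auto
    also have "\<dots> = d / 2" using pos unfolding \<delta>_def times_divide_eq_left by (intro frac_eq_eq[THEN iffD2]) auto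
    finally have n1: "\<delta> * norm (1 :: real ^ 'd) < d" using d(1) by linarith
    have close: "dist (flow s (x + \<delta> *\<^sub>R 1) t $ j) (flow s x t $ j) < e"
      "dist (flow s (x - \<delta> *\<^sub>R 1) t $ j) (flow s x t $ j) < e"
      by (rule d(2), use n1 \<delta> in \<open>simp add: dist_norm\<close>)+
    show "\<forall>\<^sub>F n in sequentially. dist (split_euler s ((t - s) / real (Suc n)) (Suc n) x $ j) (flow s x t $ j) < e"
      using small[OF \<delta>]
    proof eventually_elim
      case (elim n)
      have "s + real (Suc n) * ((t - s) / real (Suc n)) = t" by simp
      then show ?case
        using split_euler_between[of "(t - s) / real (Suc n)" "Suc n" s \<delta> "Suc n" x j] elim st close \<delta>
        unfolding dist_real_def by simp linarith
    qed
  qed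
qed

text \<open>
  Each Euler approximation satisfies the inequality, and converges to the flow where the flow is
  continuous in the initial point. Lower semicontinuity of \<open>g\<close> and Fatou's lemma pass to the limit.
\<close>

proposition nn_integral_flow_le:
  assumes st: "s \<le> t" and g: "g \<in> borel_measurable borel"
    and lsc: "\<And>y e. e < g y \<Longrightarrow> \<forall>\<^sub>F z in nhds y. e < (g z :: ennreal)"
  shows "(\<integral>\<^sup>+x. g (flow s x t) \<partial>lborel) \<le> (\<integral>\<^sup>+x. g x \<partial>lborel)"
proof -
  define E where "E n = split_euler s ((t - s) / real (Suc n)) (Suc n)" for n
  have E: "vol_nonincreasing (E n)" for n unfolding E_def by (rule split_euler_vol_nonincreasing)
  then have Em: "E n \<in> borel_measurable borel" for n unfolding vol_nonincreasing_def by blast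
  have "(\<integral>\<^sup>+x. g (flow s x t) \<partial>lborel) \<le> (\<integral>\<^sup>+x. liminf (\<lambda>n. g (E n x)) \<partial>lborel)"
  proof (rule nn_integral_mono_AE)
    show "AE x in lborel. g (flow s x t) \<le> liminf (\<lambda>n. g (E n x))"
      using flow_isCont_ae[of s t]
    proof eventually_elim
      case (elim x)
      then have "(\<lambda>n. E n x) \<longlonglongrightarrow> flow s x t" unfolding E_def by (intro split_euler_tendsto st) auto
      then show ?case
        unfolding le_Liminf_iff using lsc by (auto simp: filterlim_iff)
    qed
  qed
  also have "\<dots> \<le> liminf (\<lambda>n. \<integral>\<^sup>+x. g (E n x) \<partial>lborel)"
    using measurable_compose[OF Em g] by (intro nn_integral_liminf) simp
  also have "\<dots> \<le> liminf (\<lambda>n. \<integral>\<^sup>+x. g x \<partial>lborel)"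
    by (intro Liminf_mono always_eventually allI nn_integral_vol_nonincreasing[OF E g])
  also have "\<dots> = (\<integral>\<^sup>+x. g x \<partial>lborel)" by (simp add: Liminf_const)
  finally show ?thesis .
qed

end

section \<open>Increasing fields of linear growth\<close>

lemma norm_le_card_mult:
  fixes v :: "real ^ 'd"
  assumes "\<And>i. \<bar>v $ i\<bar> \<le> m"
  shows "norm v \<le> real CARD('d) * m"
proof -
  have "norm v \<le> (\<Sum>i\<in>UNIV. \<bar>v $ i\<bar>)" by (rule norm_le_l1_cart)
  also have "\<dots> \<le> (\<Sum>i\<in>(UNIV :: 'd set). m)" by (rule sum_mono) (rule assms)
  finally show ?thesis by simp
qed

lemma abs_ln_diff_le:
  fixes u v :: real
  assumes "1 \<le> u" "1 \<le> v"
  shows "\<bar>ln u - ln v\<bar> \<le> \<bar>u - v\<bar>"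
proof -
  have *: "ln b - ln a \<le> b - a" if "1 \<le> a" "a \<le> b" for a b :: real
  proof -
    have "ln b - ln a = ln (b / a)" using that by (simp add: ln_div)
    also have "\<dots> \<le> b / a - 1" using that by (intro ln_le_minus_one) auto
    also have "\<dots> = (b - a) / a" using that by (simp add: diff_divide_distrib)
    also have "\<dots> \<le> (b - a) / 1" using that by (intro divide_left_mono) auto
    finally show ?thesis by simp
  qed
  show ?thesis
  proof (cases "u \<le> v")
    case True
    then have "ln u \<le> ln v" using assms by simp
    then show ?thesis using *[OF assms(1) True] by simp
  next
    case False
    then have "ln v \<le> ln u" using assms by simp
    then show ?thesis using *[OF assms(2)] False by simp
  qed
qed

text \<open>
  The right-hand side \<open>G\<close> of the hypothesis is absolutely continuous with \<open>G' \<le> C G\<close> almost everywhere, so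
  \<open>\<integral> C - ln G\<close> is increasing.
\<close>

lemma gronwall:
  fixes g C :: "real \<Rightarrow> real"
  assumes C: "integrable lborel C" "\<And>t. 0 \<le> C t" and st: "s \<le> t" and a: "1 \<le> a"
    and g: "continuous_on {s..t} g" "\<And>r. r \<in> {s..t} \<Longrightarrow> 0 \<le> g r"
    and le: "\<And>r. r \<in> {s..t} \<Longrightarrow> g r \<le> a + integral {s..r} (\<lambda>r. C r * g r)"
  shows "g t \<le> a * exp (integral {s..t} C)"
proof -
  define k where "k r = C r * (if r \<in> {s..t} then g r else 0)" for r
  have "compact (g ` {s..t})" using g(1) by (intro compact_continuous_image) auto
  then obtain M where M: "\<And>r. r \<in> {s..t} \<Longrightarrow> \<bar>g r\<bar> \<le> M"
    using compact_imp_bounded bounded_iff by (metis imageI real_norm_def)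
  have [measurable]: "C \<in> borel_measurable borel" using C(1) by auto
  have "(\<lambda>r. if r \<in> {s..t} then g r else 0) \<in> borel_measurable borel"
    using g(1) by (intro borel_measurable_continuous_on_if) auto
  then have km: "k \<in> borel_measurable borel" unfolding k_def by simp
  have kint: "integrable lborel k"
  proof (rule Bochner_Integration.integrable_bound)
    show "integrable lborel (\<lambda>r. M * C r)" using C(1) by simp
    show "AE r in lborel. norm (k r) \<le> norm (M * C r)"
    proof (rule AE_I2)
      fix r
      have "\<bar>if r \<in> {s..t} then g r else 0\<bar> \<le> \<bar>M\<bar>" using M[of r] by auto
      then have "\<bar>C r\<bar> * \<bar>if r \<in> {s..t} then g r else 0\<bar> \<le> \<bar>C r\<bar> * \<bar>M\<bar>" by (rule mult_left_mono) simp
      then show "norm (k r) \<le> norm (M * C r)" unfolding k_def real_norm_def abs_mult by (simp only: mult.commute)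
    qed
  qed (use km in simp)
  have k0: "0 \<le> k r" for r unfolding k_def using C(2) g(2) by auto
  note kI = integral_eq_lborel_integral(1)[OF kint] and CI = integral_eq_lborel_integral(1)[OF C(1)]
  define G where "G r = a + integral {s..r} k" for r
  have gG: "g r \<le> G r" if r: "r \<in> {s..t}" for r
  proof -
    have "integral {s..r} (\<lambda>r. C r * g r) = integral {s..r} k"
      using r unfolding k_def by (intro Henstock_Kurzweil_Integration.integral_cong) auto
    then show ?thesis using le[OF r] unfolding G_def by simp
  qed
  have G1: "1 \<le> G r" for r
    using a Henstock_Kurzweil_Integration.integral_nonneg[OF kI[of s r]] k0 unfolding G_def by fastforce
  have G_AC: "absolutely_continuous_on s t G"
  proof (rule AC_if_dominated[OF kint k0])
    fix u v assume uv: "s \<le> u" "u \<le> v" "v \<le> t"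
    then show "dist (G u) (G v) \<le> integral {u..v} k"
      using Henstock_Kurzweil_Integration.integral_combine[OF uv(1,2) kI]
        Henstock_Kurzweil_Integration.integral_nonneg[OF kI[of u v]] k0
      unfolding G_def dist_real_def by simp
  qed
  have L_AC: "absolutely_continuous_on s t (\<lambda>r. ln (G r))"
    by (rule AC_dominated[OF G_AC, of 1]) (use abs_ln_diff_le G1 in \<open>auto simp: dist_real_def\<close>)
  have K_AC: "absolutely_continuous_on s t (\<lambda>r. integral {s..r} C)"
  proof (rule AC_if_dominated[OF C])
    fix u v assume uv: "s \<le> u" "u \<le> v" "v \<le> t"
    then show "dist (integral {s..u} C) (integral {s..v} C) \<le> integral {u..v} C"
      using Henstock_Kurzweil_Integration.integral_combine[OF uv(1,2) CI]
        Henstock_Kurzweil_Integration.integral_nonneg[OF CI[of u v]] C(2)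
      unfolding dist_real_def by simp
  qed
  have "integral {s..s} C - ln (G s) \<le> integral {s..t} C - ln (G t)"
  proof (rule AC_deriv_nonneg_imp_le[OF AC_diff[OF K_AC L_AC] st])
    show "AE r in lborel. s < r \<and> r < t \<longrightarrow> (\<exists>D\<ge>0. ((\<lambda>r. integral {s..r} C - ln (G r)) has_real_derivative D) (at r))"
      using has_real_derivative_indefinite_integral_ae[OF CI] has_real_derivative_indefinite_integral_ae[OF kI]
    proof eventually_elim
      case (elim r)
      show ?case
      proof
        assume r: "s < r \<and> r < t"
        have Gr: "(G has_real_derivative k r) (at r)"
          using elim(2) r DERIV_add[OF DERIV_const[of a], of "\<lambda>t. integral {s..t} k" "k r" r] unfolding G_def[abs_def] by simp
        have "(ln has_real_derivative inverse (G r)) (at (G r))" using G1[of r] by (intro DERIV_ln) auto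
        from DERIV_chain2[OF this Gr] have "((\<lambda>r. ln (G r)) has_real_derivative inverse (G r) * k r) (at r)" .
        moreover have "((\<lambda>r. integral {s..r} C) has_real_derivative C r) (at r)" using elim(1) r by blast
        ultimately have "((\<lambda>r. integral {s..r} C - ln (G r)) has_real_derivative C r - inverse (G r) * k r) (at r)"
          by (intro DERIV_diff)
        moreover have "inverse (G r) * k r \<le> C r"
        proof -
          have "k r \<le> C r * G r" unfolding k_def using gG[of r] r C(2)[of r] by (auto intro: mult_left_mono)
          then show ?thesis using G1[of r] by (simp add: field_simps)
        qed
        ultimately show "\<exists>D\<ge>0. ((\<lambda>r. integral {s..r} C - ln (G r)) has_real_derivative D) (at r)"
          by (intro exI[of _ "C r - inverse (G r) * k r"]) auto
      qed
    qed
  qed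
  then have "ln (G t) \<le> integral {s..t} C + ln a" unfolding G_def by simp
  then have "exp (ln (G t)) \<le> exp (integral {s..t} C + ln a)" by simp
  then have "G t \<le> a * exp (integral {s..t} C)" using G1[of t] a by (simp add: exp_add mult.commute)
  then show ?thesis using gG[of t] st by simp
qed

definition clamp_vec :: "real \<Rightarrow> real ^ 'd \<Rightarrow> real ^ 'd" where
  "clamp_vec R y = (\<chi> i. max (- R) (min R (y $ i)))"

lemma clamp_vec_mono: "x \<le> y \<Longrightarrow> clamp_vec R x \<le> clamp_vec R y"
  unfolding clamp_vec_def less_eq_vec_def vec_lambda_beta by (intro allI max.mono min.mono order_refl) (rule spec)

lemma clamp_vec_id:
  assumes "norm y \<le> R"
  shows "clamp_vec R y = y"
  unfolding vec_eq_iff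
proof
  fix i
  have "\<bar>y $ i\<bar> \<le> R" using component_le_norm_cart[of y i] assms by linarith
  then show "clamp_vec R y $ i = y $ i" unfolding clamp_vec_def by (simp add: min_def max_def abs_le_iff)
qed

lemma norm_clamp_vec_le:
  assumes "0 \<le> R"
  shows "norm (clamp_vec R y) \<le> norm y"
  by (rule norm_le_componentwise_cart) (use assms in \<open>auto simp: clamp_vec_def max_def min_def abs_if\<close>)

lemma norm_clamp_vec_bound:
  fixes y :: "real ^ 'd"
  assumes "0 \<le> R"
  shows "norm (clamp_vec R y) \<le> real CARD('d) * R"
  by (rule norm_le_card_mult) (use assms in \<open>auto simp: clamp_vec_def max_def min_def abs_if\<close>)

lemma continuous_on_clamp_vec: "continuous_on UNIV (clamp_vec R)"
  unfolding clamp_vec_def[abs_def] by (intro continuous_on_vec_lambda continuous_intros)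

text \<open>
  The growth of the sum of the components, rather than of the norm, is what integrates to a bound for
  the norm of a path when velocities are integrated component by component.
\<close>

locale growth_field =
  fixes B :: "real \<Rightarrow> real ^ 'd \<Rightarrow> real ^ 'd" and C :: "real \<Rightarrow> real"
  assumes B_meas: "(\<lambda>z. B (fst z) (snd z)) \<in> borel_measurable borel"
    and B_mono: "\<And>t x y. x \<le> y \<Longrightarrow> B t x \<le> B t y"
    and B_growth: "\<And>t y. (\<Sum>i\<in>UNIV. \<bar>B t y $ i\<bar>) \<le> C t * (1 + norm y)"
    and C_int: "integrable lborel C"
    and C_nonneg: "\<And>t. 0 \<le> C t"
begin

lemma B_comp_growth: "\<bar>B t y $ i\<bar> \<le> C t * (1 + norm y)"
  using member_le_sum[of i UNIV "\<lambda>i. \<bar>B t y $ i\<bar>"] B_growth[of t y] by simp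

text \<open>
  Composition with the projection to a cube makes the field bounded without affecting it on the ball of
  radius \<open>\<bar>R\<bar>\<close>. The absolute value makes this a bounded increasing field for every \<open>R\<close>.
\<close>

abbreviation BR :: "real \<Rightarrow> real \<Rightarrow> real ^ 'd \<Rightarrow> real ^ 'd" where
  "BR R t y \<equiv> B t (clamp_vec \<bar>R\<bar> y)"

sublocale bf: bounded_field "BR R" "\<lambda>t. (1 + real CARD('d) * \<bar>R\<bar>) * C t" for R
proof
  have "(\<lambda>z::real \<times> (real ^ 'd). (fst z, clamp_vec \<bar>R\<bar> (snd z))) \<in> borel_measurable borel"
    by (intro borel_measurable_continuous_onI continuous_intros
        continuous_on_compose2[OF continuous_on_clamp_vec]) auto
  from measurable_compose[OF this B_meas]
  show "(\<lambda>z. BR R (fst z) (snd z)) \<in> borel_measurable borel" by simp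
  show "BR R t x \<le> BR R t y" if "x \<le> y" for t x y using B_mono clamp_vec_mono that by blast
  show "\<bar>BR R t y $ i\<bar> \<le> (1 + real CARD('d) * \<bar>R\<bar>) * C t" for t y i
  proof -
    have "\<bar>BR R t y $ i\<bar> \<le> C t * (1 + norm (clamp_vec \<bar>R\<bar> y))" by (rule B_comp_growth)
    also have "\<dots> \<le> C t * (1 + real CARD('d) * \<bar>R\<bar>)"
      using norm_clamp_vec_bound[of "\<bar>R\<bar>" y] C_nonneg[of t] by (intro mult_left_mono) auto
    finally show ?thesis by (simp add: mult.commute)
  qed
  show "integrable lborel (\<lambda>t. (1 + real CARD('d) * \<bar>R\<bar>) * C t)" using C_int by simp
qed

lemma C_on: "C integrable_on {u..v}"
  by (rule integral_eq_lborel_integral(1)[OF C_int])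

lemma CI_nonneg: "0 \<le> integral {u..v} C"
  by (intro Henstock_Kurzweil_Integration.integral_nonneg C_on C_nonneg)

lemma CI_mono: "u' \<le> u \<Longrightarrow> v \<le> v' \<Longrightarrow> integral {u..v} C \<le> integral {u'..v'} C"
  by (intro integral_subset_le C_on) (auto simp: C_nonneg)

definition Ctot :: real where "Ctot = (LINT t|lborel. C t)"

lemma CI_le_Ctot: "integral {u..v} C \<le> Ctot"
  unfolding Ctot_def integral_eq_lborel_integral(2)[OF C_int]
  using integrable_mult_indicator[of "{u..v}" lborel C] C_int C_nonneg
  by (intro integral_mono) (auto simp: indicator_def)

text \<open>
  A priori bound for all paths from \<open>x\<close>, at all times.
\<close>

definition rad :: "real ^ 'd \<Rightarrow> real" where "rad x = (1 + norm x) * exp Ctot"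

lemma rad_nonneg: "0 \<le> rad x" unfolding rad_def by simp

lemma bf_fixpoint_bound:
  assumes cont: "continuous_on UNIV \<gamma>" and fixp: "\<And>t. \<gamma> t = bf.drift R s x \<gamma> t" and st: "s \<le> t"
  shows "1 + norm (\<gamma> t) \<le> (1 + norm x) * exp (integral {s..t} C)"
proof (rule gronwall[OF C_int C_nonneg st, of "1 + norm x" "\<lambda>r. 1 + norm (\<gamma> r)"])
  show "continuous_on {s..t} (\<lambda>r. 1 + norm (\<gamma> r))"
    by (intro continuous_intros continuous_on_subset[OF cont]) auto
  fix r assume "r \<in> {s..t}"
  have ci: "(\<lambda>r. C r * (1 + norm (\<gamma> r))) integrable_on {s..r}"
  proof -
    have "compact ((\<lambda>r. 1 + norm (\<gamma> r)) ` {s..r})"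
      by (intro compact_continuous_image continuous_intros continuous_on_subset[OF cont]) auto
    then have bdd: "bounded ((\<lambda>r. 1 + norm (\<gamma> r)) ` {s..r})" by (rule compact_imp_bounded)
    have "(\<lambda>r. (1 + norm (\<gamma> r)) * C r) absolutely_integrable_on {s..r}"
    proof (rule absolutely_integrable_bounded_measurable_product_real[OF _ _ bdd])
      show "(\<lambda>r. 1 + norm (\<gamma> r)) \<in> borel_measurable (lebesgue_on {s..r})"
        by (intro continuous_imp_measurable_on_sets_lebesgue continuous_intros continuous_on_subset[OF cont]) auto
      show "C absolutely_integrable_on {s..r}"
        using C_on C_nonneg by (intro nonnegative_absolutely_integrable_1) auto
    qed auto
    then show ?thesis by (simp add: mult.commute set_lebesgue_integral_eq_integral(1))
  qed
  have "norm (\<gamma> r) \<le> norm x + norm (\<chi> i. integral {s..r} (\<lambda>r. BR R r (\<gamma> r) $ i))"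
  proof -
    have "\<gamma> r = x + (\<chi> i. integral {s..r} (\<lambda>r. BR R r (\<gamma> r) $ i))"
      by (subst fixp) (simp add: bf.drift_def vec_eq_iff)
    then show ?thesis by (metis norm_triangle_ineq)
  qed
  also have "norm (\<chi> i. integral {s..r} (\<lambda>r. BR R r (\<gamma> r) $ i)) \<le> (\<Sum>i\<in>UNIV. \<bar>integral {s..r} (\<lambda>r. BR R r (\<gamma> r) $ i)\<bar>)"
    using norm_le_l1_cart[of "\<chi> i. integral {s..r} (\<lambda>r. BR R r (\<gamma> r) $ i)"] by simp
  also have "\<dots> \<le> (\<Sum>i\<in>UNIV. integral {s..r} (\<lambda>r. \<bar>BR R r (\<gamma> r) $ i\<bar>))"
  proof (rule sum_mono)
    fix i
    have "norm (integral {s..r} (\<lambda>r. BR R r (\<gamma> r) $ i)) \<le> integral {s..r} (\<lambda>r. \<bar>BR R r (\<gamma> r) $ i\<bar>)"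
      by (intro integral_norm_bound_integral bf.B_path_on[OF cont]
          integral_eq_lborel_integral(1)[OF integrable_abs[OF bf.B_path_integrable[OF cont]]]) simp
    then show "\<bar>integral {s..r} (\<lambda>r. BR R r (\<gamma> r) $ i)\<bar> \<le> integral {s..r} (\<lambda>r. \<bar>BR R r (\<gamma> r) $ i\<bar>)"
      by simp
  qed
  also have "\<dots> = integral {s..r} (\<lambda>r. \<Sum>i\<in>UNIV. \<bar>BR R r (\<gamma> r) $ i\<bar>)"
    using integral_eq_lborel_integral(1)[OF integrable_abs[OF bf.B_path_integrable[OF cont]]]
    by (intro Henstock_Kurzweil_Integration.integral_sum[symmetric]) auto
  also have "\<dots> \<le> integral {s..r} (\<lambda>r. C r * (1 + norm (\<gamma> r)))"
  proof (rule integral_le[OF _ ci])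
    show "(\<lambda>r. \<Sum>i\<in>UNIV. \<bar>BR R r (\<gamma> r) $ i\<bar>) integrable_on {s..r}"
      using integral_eq_lborel_integral(1)[OF integrable_abs[OF bf.B_path_integrable[OF cont]]]
      by (intro integrable_sum) auto
    fix r
    have "(\<Sum>i\<in>UNIV. \<bar>BR R r (\<gamma> r) $ i\<bar>) \<le> C r * (1 + norm (clamp_vec \<bar>R\<bar> (\<gamma> r)))" by (rule B_growth)
    also have "\<dots> \<le> C r * (1 + norm (\<gamma> r))"
      using norm_clamp_vec_le[of "\<bar>R\<bar>" "\<gamma> r"] C_nonneg by (intro mult_left_mono) auto
    finally show "(\<Sum>i\<in>UNIV. \<bar>BR R r (\<gamma> r) $ i\<bar>) \<le> C r * (1 + norm (\<gamma> r))" .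
  qed
  finally show "1 + norm (\<gamma> r) \<le> 1 + norm x + integral {s..r} (\<lambda>r. C r * (1 + norm (\<gamma> r)))" by simp
qed auto

lemma bf_fixpoint_rad:
  assumes cont: "continuous_on UNIV \<gamma>" and fixp: "\<And>t. \<gamma> t = bf.drift R s x \<gamma> t"
  shows "norm (\<gamma> t) \<le> rad x"
proof (cases "s \<le> t")
  case True
  have "1 + norm (\<gamma> t) \<le> (1 + norm x) * exp (integral {s..t} C)"
    by (rule bf_fixpoint_bound[OF cont fixp True])
  also have "\<dots> \<le> rad x" unfolding rad_def using CI_le_Ctot by (intro mult_left_mono) auto
  finally show ?thesis by simp
next
  case False
  then have "\<gamma> t = x" by (subst fixp) (simp add: bf.drift_before)
  moreover have "1 * (1 + norm x) \<le> exp Ctot * (1 + norm x)"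
    using CI_nonneg[of 0 0] CI_le_Ctot[of 0 0] by (intro mult_right_mono) auto
  ultimately show ?thesis unfolding rad_def by (simp add: mult.commute)
qed

lemma drift_clamp_irrelevant:
  assumes "\<And>r. r \<in> {s..t} \<Longrightarrow> norm (\<gamma> r) \<le> \<bar>R\<bar>"
  shows "bf.drift R s x \<gamma> t $ i = x $ i + integral {s..t} (\<lambda>r. B r (\<gamma> r) $ i)"
proof -
  have "integral {s..t} (\<lambda>r. BR R r (\<gamma> r) $ i) = integral {s..t} (\<lambda>r. B r (\<gamma> r) $ i)"
    using assms by (intro Henstock_Kurzweil_Integration.integral_cong) (simp add: clamp_vec_id)
  then show ?thesis by (simp add: bf.drift_def)
qed

definition flow :: "real \<Rightarrow> real ^ 'd \<Rightarrow> real \<Rightarrow> real ^ 'd" where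
  "flow s x = bf.flow (rad x) s x"

text \<open>
  Paths from \<open>x\<close> never reach the truncation, so the greatest path for one truncation is admissible for
  the other.
\<close>

lemma flow_eq_bf_flow:
  assumes "rad x \<le> R"
  shows "bf.flow R s x = flow s x"
proof
  fix t
  have R: "\<bar>R\<bar> = R" "\<bar>rad x\<bar> = rad x" using assms rad_nonneg[of x] by auto
  let ?g = "bf.flow (rad x) s x" and ?h = "bf.flow R s x"
  have gb: "norm (?g r) \<le> rad x" for r by (rule bf_fixpoint_rad[OF bf.flow_continuous bf.flow_fixpoint])
  have hb: "norm (?h r) \<le> rad x" for r by (rule bf_fixpoint_rad[OF bf.flow_continuous bf.flow_fixpoint])
  have bound: "norm (?g r) \<le> \<bar>R\<bar>" "norm (?g r) \<le> \<bar>rad x\<bar>" "norm (?h r) \<le> \<bar>R\<bar>" "norm (?h r) \<le> \<bar>rad x\<bar>" for r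
    using gb[of r] hb[of r] assms unfolding R by linarith+
  have "bf.drift R s x ?g r = bf.drift (rad x) s x ?g r" for r
    unfolding vec_eq_iff drift_clamp_irrelevant[OF bound(1)] drift_clamp_irrelevant[OF bound(2)] by simp
  then have "?g r \<le> bf.drift R s x ?g r" for r
    using bf.flow_fixpoint[of "rad x" s x r] by (metis order_refl)
  then have "?g t \<le> ?h t" by (rule bf.flow_greatest[OF bf.flow_continuous])
  moreover have "bf.drift (rad x) s x ?h r = bf.drift R s x ?h r" for r
    unfolding vec_eq_iff drift_clamp_irrelevant[OF bound(3)] drift_clamp_irrelevant[OF bound(4)] by simp
  then have "?h r \<le> bf.drift (rad x) s x ?h r" for r
    using bf.flow_fixpoint[of R s x r] by (metis order_refl)
  then have "?h t \<le> ?g t" by (rule bf.flow_greatest[OF bf.flow_continuous])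
  ultimately show "?h t = flow s x t" unfolding flow_def by simp
qed

lemma flow_continuous: "continuous_on UNIV (flow s x)"
  unfolding flow_def by (rule bf.flow_continuous)

lemma norm_flow_le_rad: "norm (flow s x t) \<le> rad x"
  unfolding flow_def by (rule bf_fixpoint_rad[OF bf.flow_continuous bf.flow_fixpoint])

lemma flow_bound: "s \<le> t \<Longrightarrow> 1 + norm (flow s x t) \<le> (1 + norm x) * exp (integral {s..t} C)"
  unfolding flow_def by (rule bf_fixpoint_bound[OF bf.flow_continuous bf.flow_fixpoint])

lemma flow_start: "t \<le> s \<Longrightarrow> flow s x t = x"
  unfolding flow_def by (rule bf.flow_start)

lemma BR_flow: "rad x \<le> R \<Longrightarrow> BR R r (flow s x r) = B r (flow s x r)"
  using norm_flow_le_rad[of s x r] rad_nonneg[of x] by (simp add: clamp_vec_id)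

lemma flow_B_integrable: "integrable lborel (\<lambda>r. B r (flow s x r) $ i)"
  using bf.B_path_integrable[OF flow_continuous, of "rad x" s x i] by (simp add: BR_flow)

lemma flow_B_on: "(\<lambda>r. B r (flow s x r) $ i) integrable_on {u..v}"
  by (rule integral_eq_lborel_integral(1)[OF flow_B_integrable])

lemma flow_eq: "flow s x t $ i = x $ i + integral {s..t} (\<lambda>r. B r (flow s x r) $ i)"
proof -
  have "flow s x t $ i = bf.drift (rad x) s x (flow s x) t $ i"
    unfolding flow_def using bf.flow_fixpoint[of "rad x" s x t] by simp
  then show ?thesis
    using norm_flow_le_rad rad_nonneg by (subst (asm) drift_clamp_irrelevant) auto
qed

lemma flow_component:
  "s \<le> u \<Longrightarrow> u \<le> v \<Longrightarrow> flow s x v $ i - flow s x u $ i = integral {u..v} (\<lambda>r. B r (flow s x r) $ i)"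
  using Henstock_Kurzweil_Integration.integral_combine[of s u v, OF _ _ flow_B_on, of s x i]
    flow_eq[of s x u i] flow_eq[of s x v i] by simp

lemma B_flow_bound: "\<bar>B r (flow s x r) $ i\<bar> \<le> (1 + rad x) * C r"
proof -
  have "\<bar>B r (flow s x r) $ i\<bar> \<le> C r * (1 + norm (flow s x r))" by (rule B_comp_growth)
  also have "\<dots> \<le> C r * (1 + rad x)" using norm_flow_le_rad C_nonneg by (intro mult_left_mono) auto
  finally show ?thesis by (simp add: mult.commute)
qed

lemma flow_modulus:
  assumes "s \<le> u" "u \<le> v"
  shows "\<bar>flow s x v $ i - flow s x u $ i\<bar> \<le> (1 + rad x) * integral {u..v} C"
proof -
  have "norm (integral {u..v} (\<lambda>r. B r (flow s x r) $ i)) \<le> integral {u..v} (\<lambda>r. (1 + rad x) * C r)"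
    using B_flow_bound by (intro integral_norm_bound_integral flow_B_on integrable_on_mult_right C_on) auto
  then show ?thesis using flow_component[OF assms, of x i] by simp
qed

lemma flow_mono: "x \<le> y \<Longrightarrow> flow s x t \<le> flow s y t"
  using bf.flow_mono[of x y "max (rad x) (rad y)" s t] flow_eq_bf_flow[of x "max (rad x) (rad y)" s]
    flow_eq_bf_flow[of y "max (rad x) (rad y)" s] by simp

lemma flow_expanding: "x \<le> y \<Longrightarrow> y - x \<le> flow s y t - flow s x t"
  using bf.flow_expanding[of x y "max (rad x) (rad y)" s t] flow_eq_bf_flow[of x "max (rad x) (rad y)" s]
    flow_eq_bf_flow[of y "max (rad x) (rad y)" s] by simp

lemma flow_isCont_ae: "AE x in lborel. \<forall>i. isCont (\<lambda>y. flow s y t $ i) x"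
  by (rule eventually_all_finite, rule isCont_ae_if_mono) (use flow_mono in \<open>auto simp: less_eq_vec_def\<close>)

lemma flow_deriv_ae:
  "AE r in lborel. \<forall>i. s < r \<longrightarrow> ((\<lambda>r. flow s x r $ i) has_real_derivative B r (flow s x r) $ i) (at r)"
proof -
  have "AE r in lborel. s < r \<longrightarrow> ((\<lambda>r. flow s x r $ i) has_real_derivative B r (flow s x r) $ i) (at r)" for i
    using has_real_derivative_indefinite_integral_ae[OF flow_B_on[of s x i]]
  proof eventually_elim
    case (elim r)
    show ?case
    proof
      assume "s < r"
      then have "((\<lambda>t. x $ i + integral {s..t} (\<lambda>r. B r (flow s x r) $ i)) has_real_derivative 0 + B r (flow s x r) $ i) (at r)"
        using elim by (intro DERIV_add DERIV_const) auto
      then show "((\<lambda>r. flow s x r $ i) has_real_derivative B r (flow s x r) $ i) (at r)"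
        unfolding flow_eq[of s x _ i, symmetric] by simp
    qed
  qed
  then show ?thesis by (subst AE_all_countable) auto
qed

lemma flow_AC: "absolutely_continuous_on s S (flow s x)"
proof (rule AC_if_dominated)
  show "integrable lborel (\<lambda>t. real CARD('d) * ((1 + rad x) * C t))" using C_int by simp
  show "0 \<le> real CARD('d) * ((1 + rad x) * C t)" for t using C_nonneg rad_nonneg[of x] by simp
  fix u v assume uv: "s \<le> u" "u \<le> v"
  have "dist (flow s x u) (flow s x v) \<le> (\<Sum>i\<in>UNIV. \<bar>(flow s x v - flow s x u) $ i\<bar>)"
    unfolding dist_norm norm_minus_commute[of "flow s x u"] by (rule norm_le_l1_cart)
  also have "\<dots> \<le> (\<Sum>i\<in>(UNIV :: 'd set). (1 + rad x) * integral {u..v} C)"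
    using flow_modulus[OF uv] by (intro sum_mono) auto
  also have "\<dots> = integral {u..v} (\<lambda>t. real CARD('d) * ((1 + rad x) * C t))" by simp
  finally show "dist (flow s x u) (flow s x v) \<le> \<dots>" .
qed

end

context growth_field
begin

text \<open>
  The greatest path was compared with paths defined for all times. So \<open>\<gamma>\<close> is extended by rest before
  \<open>s\<close> and by the steepest possible descent after \<open>S\<close>, which keeps it below its image under the Picard
  operator.
\<close>

lemma subsolution_le_flow:
  assumes cont: "continuous_on {s..S} \<gamma>"
    and sub: "\<And>t i. t \<in> {s..S} \<Longrightarrow> \<gamma> t $ i \<le> x $ i + integral {s..t} (\<lambda>r. B r (\<gamma> r) $ i)"
    and t: "t \<in> {s..S}"
  shows "\<gamma> t \<le> flow s x t"
proof -
  have sS: "s \<le> S" using t by simp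
  have "compact (\<gamma> ` {s..S})" using cont by (intro compact_continuous_image) auto
  then obtain M where M: "\<And>r. r \<in> {s..S} \<Longrightarrow> norm (\<gamma> r) \<le> M"
    using compact_imp_bounded bounded_iff by (metis imageI)
  define R where "R = max (rad x) M"
  have R0: "\<bar>R\<bar> = R" "rad x \<le> R" using rad_nonneg[of x] unfolding R_def by auto
  have MR: "norm (\<gamma> r) \<le> \<bar>R\<bar>" if "r \<in> {s..S}" for r using M[OF that] unfolding R0(1) unfolding R_def by simp
  define c where "c r = max s (min S r)" for r
  have c: "c r \<in> {s..S}" for r unfolding c_def using sS by auto
  define CR where "CR r = (1 + real CARD('d) * \<bar>R\<bar>) * C r" for r
  define g where "g r = (\<chi> i. \<gamma> (c r) $ i - integral {S..r} CR)" for r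
  have g_eq: "g r $ i = \<gamma> (c r) $ i - integral {S..r} CR" for r i unfolding g_def by simp
  have CRint: "integrable lborel CR" unfolding CR_def using C_int by simp
  have CR0: "0 \<le> CR r" for r unfolding CR_def using C_nonneg by simp
  note CRon = integral_eq_lborel_integral(1)[OF CRint]
  have CRnn: "0 \<le> integral {u..v} CR" for u v by (intro Henstock_Kurzweil_Integration.integral_nonneg CRon CR0)
  have "continuous_on UNIV (\<lambda>r. integral {S..r} CR)"
  proof (rule continuous_if_dominated[OF CRint CR0])
    fix u v :: real assume uv: "u \<le> v"
    show "\<bar>integral {S..v} CR - integral {S..u} CR\<bar> \<le> integral {u..v} CR"
    proof (cases "S \<le> u")
      case True
      then show ?thesis using Henstock_Kurzweil_Integration.integral_combine[OF True uv CRon] CRnn[of u v] by simp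
    next
      case False
      then have "integral {S..v} CR \<le> integral {u..v} CR"
        by (intro integral_subset_le CRon) (auto simp: CR0)
      then show ?thesis using False CRnn[of S v] by simp
    qed
  qed
  moreover have "continuous_on UNIV (\<lambda>r. \<gamma> (c r))"
  proof (rule continuous_on_compose2[OF cont])
    show "continuous_on UNIV c" unfolding c_def[abs_def] by (intro continuous_intros)
  qed (use c in auto)
  ultimately have gcont: "continuous_on UNIV g"
    unfolding g_def[abs_def] by (intro continuous_on_vec_lambda continuous_intros)
  have gin: "g r = \<gamma> r" if "r \<in> {s..S}" for r
  proof -
    have "integral {S..r} CR = 0" using that by (cases "r = S") auto
    then show ?thesis using that unfolding vec_eq_iff g_eq c_def by simp
  qed
  have inner: "g r \<le> bf.drift R s x g r" if "r \<in> {s..S}" for r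
    unfolding less_eq_vec_def
  proof
    fix i
    have "integral {s..r} (\<lambda>r. B r (g r) $ i) = integral {s..r} (\<lambda>r. B r (\<gamma> r) $ i)"
      using that by (intro Henstock_Kurzweil_Integration.integral_cong) (simp add: gin)
    moreover have "bf.drift R s x g r $ i = x $ i + integral {s..r} (\<lambda>r. B r (g r) $ i)"
      by (rule drift_clamp_irrelevant) (use MR gin that in auto)
    ultimately show "g r $ i \<le> bf.drift R s x g r $ i" using sub[OF that, of i] gin[OF that] by simp
  qed
  have "g r \<le> bf.drift R s x g r" for r
  proof -
    consider "r < s" | "r \<in> {s..S}" | "S < r" by fastforce
    then show ?thesis
    proof cases
      case 1
      have "g r = \<gamma> s" unfolding vec_eq_iff g_eq using 1 sS by (simp add: c_def)
      also have "\<dots> \<le> bf.drift R s x g s" using inner[of s] gin[of s] sS by simp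
      also have "\<dots> = bf.drift R s x g r" using 1 by (simp add: bf.drift_before)
      finally show ?thesis .
    next
      case 2 then show ?thesis by (rule inner)
    next
      case 3
      show ?thesis unfolding less_eq_vec_def
      proof
        fix i
        have "g r $ i = g S $ i - integral {S..r} CR" unfolding g_eq using 3 sS by (simp add: c_def)
        also have "\<dots> \<le> bf.drift R s x g S $ i - integral {S..r} CR"
          using inner[of S] sS by (simp add: less_eq_vec_def)
        also have "\<dots> \<le> bf.drift R s x g r $ i"
          using bf.drift_modulus[OF gcont, of S r R s x i] 3 unfolding CR_def by (simp add: abs_le_iff)
        finally show "g r $ i \<le> bf.drift R s x g r $ i" .
      qed
    qed
  qed
  then have "g t \<le> bf.flow R s x t" by (rule bf.flow_greatest[OF gcont])
  then show ?thesis using gin[OF t] flow_eq_bf_flow[OF R0(2), of s] by simp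
qed

text \<open>
  The concatenation of the two paths solves the integral equation from \<open>x\<close> and hence lies below
  \<open>flow s x\<close>; the end of \<open>flow s x\<close> solves it from \<open>flow s x t\<close>.
\<close>

lemma flow_semigroup:
  assumes st: "s \<le> t" and tu: "t \<le> u"
  shows "flow t (flow s x t) u = flow s x u"
proof (rule antisym)
  define \<gamma> where "\<gamma> r = (if r \<le> t then flow s x r else flow t (flow s x t) r)" for r
  have "continuous_on ({..t} \<union> {t..}) \<gamma>"
    unfolding \<gamma>_def
    by (rule continuous_on_If) (auto intro: continuous_on_subset[OF flow_continuous] simp: flow_start)
  then have cont: "continuous_on {s..u} \<gamma>" by (rule continuous_on_subset) auto
  have "\<gamma> u \<le> flow s x u"
  proof (rule subsolution_le_flow[OF cont])
    fix r i assume r: "r \<in> {s..u}"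
    show "\<gamma> r $ i \<le> x $ i + integral {s..r} (\<lambda>r. B r (\<gamma> r) $ i)"
    proof (cases "r \<le> t")
      case True
      have "integral {s..r} (\<lambda>r. B r (\<gamma> r) $ i) = integral {s..r} (\<lambda>r. B r (flow s x r) $ i)"
        using True by (intro Henstock_Kurzweil_Integration.integral_cong) (auto simp: \<gamma>_def)
      then show ?thesis using flow_eq[of s x r i] True by (simp add: \<gamma>_def)
    next
      case False
      have 1: "((\<lambda>r. B r (\<gamma> r) $ i) has_integral integral {s..t} (\<lambda>r. B r (flow s x r) $ i)) {s..t}"
        by (rule has_integral_eq[OF _ integrable_integral[OF flow_B_on[of s x i]]]) (auto simp: \<gamma>_def)
      have 2: "((\<lambda>r. B r (\<gamma> r) $ i) has_integral integral {t..r} (\<lambda>r. B r (flow t (flow s x t) r) $ i)) {t..r}"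
        by (rule has_integral_eq[OF _ integrable_integral[OF flow_B_on[of t "flow s x t" i]]])
          (auto simp: \<gamma>_def flow_start)
      have "((\<lambda>r. B r (\<gamma> r) $ i) has_integral integral {s..t} (\<lambda>r. B r (flow s x r) $ i)
          + integral {t..r} (\<lambda>r. B r (flow t (flow s x t) r) $ i)) {s..r}"
        using False st by (intro has_integral_combine[OF _ _ 1 2]) auto
      then have "integral {s..r} (\<lambda>r. B r (\<gamma> r) $ i) = integral {s..t} (\<lambda>r. B r (flow s x r) $ i)
          + integral {t..r} (\<lambda>r. B r (flow t (flow s x t) r) $ i)" by (rule integral_unique)
      then show ?thesis
        using False flow_eq[of s x t i] flow_eq[of t "flow s x t" r i] by (simp add: \<gamma>_def)
    qed
  qed (use st tu in auto)
  then show "flow t (flow s x t) u \<le> flow s x u"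
    using tu flow_start[of t t "flow s x t"] by (cases "u = t") (auto simp: \<gamma>_def)
  show "flow s x u \<le> flow t (flow s x t) u"
  proof (rule subsolution_le_flow[where S = u])
    show "continuous_on {t..u} (flow s x)" by (rule continuous_on_subset[OF flow_continuous]) auto
    fix r i assume r: "r \<in> {t..u}"
    then show "flow s x r $ i \<le> flow s x t $ i + integral {t..r} (\<lambda>r. B r (flow s x r) $ i)"
      using flow_component[of s t r x i] st by simp
  qed (use tu in auto)
qed

text \<open>
  While the flow is strictly below \<open>\<gamma>\<close>, it is slower than \<open>\<gamma>\<close>, so the initial distance \<open>\<tau>\<close> is
  preserved and the flow is kept from reaching \<open>\<gamma>\<close>. Strictness matters since the derivative of \<open>\<gamma>\<close>
  is compared with the field at points strictly below \<open>\<gamma>\<close> only.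
\<close>

lemma flow_below_curve:
  fixes \<gamma> :: "real \<Rightarrow> real ^ 'd"
  assumes AC: "absolutely_continuous_on s S \<gamma>" and \<tau>: "\<tau> > 0" and start: "x + \<tau> *\<^sub>R 1 \<le> \<gamma> s"
    and deriv: "AE r in lborel. s < r \<and> r < S \<longrightarrow> (\<exists>D. (\<gamma> has_vector_derivative D) (at r) \<and>
        (\<forall>y \<delta>. \<delta> > 0 \<longrightarrow> y + \<delta> *\<^sub>R 1 \<le> \<gamma> r \<longrightarrow> B r y \<le> D))"
    and t: "t \<in> {s..S}"
  shows "flow s x t + \<tau> *\<^sub>R 1 \<le> \<gamma> t"
proof -
  have step: "flow s x u + \<tau> *\<^sub>R 1 \<le> \<gamma> u"
    if u: "u \<in> {s..S}" and below: "\<And>r. s \<le> r \<Longrightarrow> r < u \<Longrightarrow> \<exists>\<delta>>0. flow s x r + \<delta> *\<^sub>R 1 \<le> \<gamma> r" for u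
    unfolding less_eq_vec_def
  proof
    fix i
    have ACi: "absolutely_continuous_on s u (\<lambda>r. \<gamma> r $ i - flow s x r $ i)"
    proof (rule AC_diff)
      have g: "absolutely_continuous_on s u \<gamma>" using AC u by (rule_tac AC_subinterval) auto
      show "absolutely_continuous_on s u (\<lambda>r. \<gamma> r $ i)"
        by (rule AC_dominated[OF g zero_less_one]) (simp add: dist_vec_nth_le)
      show "absolutely_continuous_on s u (\<lambda>r. flow s x r $ i)"
        by (rule AC_dominated[OF flow_AC[of s u x] zero_less_one]) (simp add: dist_vec_nth_le)
    qed
    have "\<gamma> s $ i - flow s x s $ i \<le> \<gamma> u $ i - flow s x u $ i"
    proof (rule AC_deriv_nonneg_imp_le[OF ACi])
      show "AE r in lborel. s < r \<and> r < u \<longrightarrow>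
          (\<exists>D\<ge>0. ((\<lambda>r. \<gamma> r $ i - flow s x r $ i) has_real_derivative D) (at r))"
        using deriv flow_deriv_ae[of s x]
      proof eventually_elim
        case (elim r)
        show ?case
        proof
          assume r: "s < r \<and> r < u"
          then obtain D where D: "(\<gamma> has_vector_derivative D) (at r)"
            "\<And>y \<delta>. \<delta> > 0 \<Longrightarrow> y + \<delta> *\<^sub>R 1 \<le> \<gamma> r \<Longrightarrow> B r y \<le> D"
            using elim(1) u by auto
          obtain \<delta> where "\<delta> > 0" "flow s x r + \<delta> *\<^sub>R 1 \<le> \<gamma> r" using below[of r] r by auto
          then have "B r (flow s x r) \<le> D" by (rule D(2))
          then have le: "B r (flow s x r) $ i \<le> D $ i" by (simp add: less_eq_vec_def)
          have "((\<lambda>r. \<gamma> r $ i) has_vector_derivative D $ i) (at r)"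
            using bounded_linear.has_vector_derivative[OF bounded_linear_vec_nth D(1)] .
          then have "((\<lambda>r. \<gamma> r $ i) has_real_derivative D $ i) (at r)"
            by (simp add: has_real_derivative_iff_has_vector_derivative)
          then have "((\<lambda>r. \<gamma> r $ i - flow s x r $ i) has_real_derivative D $ i - B r (flow s x r) $ i) (at r)"
            using elim(2) r by (intro DERIV_diff) auto
          then show "\<exists>D\<ge>0. ((\<lambda>r. \<gamma> r $ i - flow s x r $ i) has_real_derivative D) (at r)"
            using le by (intro exI[of _ "D $ i - B r (flow s x r) $ i"]) auto
        qed
      qed
    qed (use u in auto)
    moreover have "x $ i + \<tau> \<le> \<gamma> s $ i" using start by (simp add: less_eq_vec_def)
    ultimately show "(flow s x u + \<tau> *\<^sub>R 1) $ i \<le> \<gamma> u $ i" by (simp add: flow_start)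
  qed
  \<comment> \<open>the first time at which the distance is less than \<open>\<tau>\<close> cannot exist, as the distance exceeds \<open>\<tau> / 2\<close> for a while longer\<close>
  define Bad where "Bad = {r \<in> {s..S}. \<not> flow s x r + \<tau> *\<^sub>R 1 \<le> \<gamma> r}"
  have "Bad = {}"
  proof (rule ccontr)
    assume ne: "Bad \<noteq> {}"
    define t0 where "t0 = Inf Bad"
    have bdd: "bdd_below Bad" unfolding Bad_def by (rule bdd_belowI[of _ s]) auto
    have t0: "s \<le> t0" unfolding t0_def by (rule cInf_greatest[OF ne]) (auto simp: Bad_def)
    obtain b where b: "b \<in> Bad" using ne by blast
    have "t0 \<le> b" unfolding t0_def by (rule cInf_lower[OF b bdd])
    then have t0S: "t0 \<in> {s..S}" using t0 b unfolding Bad_def by auto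
    have good: "flow s x r + \<tau> *\<^sub>R 1 \<le> \<gamma> r" if "s \<le> r" "r < t0" for r
      using that t0S cInf_lower[OF _ bdd, of r] unfolding Bad_def t0_def by fastforce
    have good0: "flow s x t0 + \<tau> *\<^sub>R 1 \<le> \<gamma> t0" using good \<tau> by (intro step[OF t0S]) blast
    have "\<exists>d>0. \<forall>r\<in>{s..S}. dist r t0 < d \<longrightarrow> (\<gamma> r - flow s x r) $ i > \<tau> / 2" for i
    proof -
      have "continuous_on {s..S} (\<lambda>r. (\<gamma> r - flow s x r) $ i)"
        by (intro continuous_intros AC_continuous_on[OF AC] continuous_on_subset[OF flow_continuous]) auto
      then obtain d where d: "d > 0" "\<And>r. r \<in> {s..S} \<Longrightarrow> dist r t0 < d \<Longrightarrow>
          dist ((\<gamma> r - flow s x r) $ i) ((\<gamma> t0 - flow s x t0) $ i) < \<tau> / 2"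
        using t0S \<tau> unfolding continuous_on_iff by (meson half_gt_zero)
      have "(\<gamma> t0 - flow s x t0) $ i \<ge> \<tau>" using good0 by (simp add: less_eq_vec_def algebra_simps)
      then have "(\<gamma> r - flow s x r) $ i > \<tau> / 2" if "r \<in> {s..S}" "dist r t0 < d" for r
        using d(2)[OF that] unfolding dist_real_def by linarith
      with d(1) show ?thesis by blast
    qed
    then obtain d where d: "\<And>i. d i > 0" "\<And>i r. r \<in> {s..S} \<Longrightarrow> dist r t0 < d i \<Longrightarrow> (\<gamma> r - flow s x r) $ i > \<tau> / 2"
      by metis
    define d0 where "d0 = Min (range d)"
    have d0: "d0 > 0" "\<And>i. d0 \<le> d i" unfolding d0_def using d(1) by auto
    have near: "flow s x r + (\<tau> / 2) *\<^sub>R 1 \<le> \<gamma> r" if "r \<in> {s..S}" "dist r t0 < d0" for r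
      unfolding less_eq_vec_def
    proof
      fix i
      have "dist r t0 < d i" using that(2) d0(2)[of i] by linarith
      then show "(flow s x r + (\<tau> / 2) *\<^sub>R 1) $ i \<le> \<gamma> r $ i" using d(2)[OF that(1), of i] by simp
    qed
    obtain b' where b': "b' \<in> Bad" "b' < t0 + d0"
      using cInf_lessD[OF ne, of "t0 + d0"] d0(1) unfolding t0_def by auto
    have t0b: "t0 \<le> b'" unfolding t0_def by (rule cInf_lower[OF b'(1) bdd])
    have "flow s x b' + \<tau> *\<^sub>R 1 \<le> \<gamma> b'"
    proof (rule step)
      show b'S: "b' \<in> {s..S}" using b' unfolding Bad_def by auto
      fix r assume r: "s \<le> r" "r < b'"
      show "\<exists>\<delta>>0. flow s x r + \<delta> *\<^sub>R 1 \<le> \<gamma> r"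
      proof (cases "r < t0")
        case True then show ?thesis using good[OF r(1)] \<tau> by blast
      next
        case False
        then have "flow s x r + (\<tau> / 2) *\<^sub>R 1 \<le> \<gamma> r"
          using r b'(2) b'S by (intro near) (auto simp: dist_real_def)
        then show ?thesis using \<tau> by (intro exI[of _ "\<tau> / 2"]) auto
      qed
    qed
    then show False using b'(1) unfolding Bad_def by simp
  qed
  then show ?thesis using t unfolding Bad_def by blast
qed

text \<open>
  One truncation of the field serves all paths that start in the ball.
\<close>

lemma nn_integral_flow_ball_le:
  assumes st: "s \<le> t" and g: "g \<in> borel_measurable borel"
    and lsc: "\<And>y e. e < g y \<Longrightarrow> \<forall>\<^sub>F z in nhds y. e < (g z :: ennreal)"
  shows "(\<integral>\<^sup>+x. indicator (ball 0 \<rho>) x * g (flow s x t) \<partial>lborel) \<le> (\<integral>\<^sup>+x. g x \<partial>lborel)"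
proof -
  define R where "R = (1 + \<bar>\<rho>\<bar>) * exp Ctot"
  have "rad x \<le> R" if "x \<in> ball 0 \<rho>" for x
    unfolding rad_def R_def using that by (intro mult_right_mono) (auto simp: dist_norm)
  then have "(\<integral>\<^sup>+x. indicator (ball 0 \<rho>) x * g (flow s x t) \<partial>lborel) \<le> (\<integral>\<^sup>+x. g (bf.flow R s x t) \<partial>lborel)"
    using flow_eq_bf_flow[of _ R s] by (intro nn_integral_mono) (auto simp: indicator_def)
  also have "\<dots> \<le> (\<integral>\<^sup>+x. g x \<partial>lborel)" by (rule bf.nn_integral_flow_le[OF st g lsc])
  finally show ?thesis .
qed

end

section \<open>One-sided mollification of decreasing functions\<close>

lemma antimono_isCont_ae:
  fixes f :: "real ^ 'd \<Rightarrow> real"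
  assumes "antimono f"
  shows "AE x in lborel. isCont f x"
proof -
  have "AE x in lborel. isCont (\<lambda>x. - f x) x"
    using assms by (intro isCont_ae_if_mono) (simp add: antimonoD)
  then show ?thesis by eventually_elim (drule isCont_minus, simp)
qed

lemma antimono_lebesgue_measurable:
  fixes f :: "real ^ 'd \<Rightarrow> real"
  shows "antimono f \<Longrightarrow> f \<in> borel_measurable lebesgue"
  by (intro borel_measurable_lebesgue_if_isCont_ae antimono_isCont_ae)

lemma vec_one_bounds:
  fixes y :: "real ^ 'd"
  assumes "norm y \<le> Q"
  shows "y \<le> Q *\<^sub>R 1" "- (Q *\<^sub>R 1) \<le> y"
  using component_le_norm_cart[of y] assms
  by (auto simp: less_eq_vec_def abs_le_iff intro: order_trans) (smt (verit))

lemma antimono_bounded: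
  fixes f :: "real ^ 'd \<Rightarrow> real"
  assumes "antimono f" "norm y \<le> Q"
  shows "\<bar>f y\<bar> \<le> max \<bar>f (Q *\<^sub>R 1)\<bar> \<bar>f (- (Q *\<^sub>R 1))\<bar>"
  using antimonoD[OF assms(1) vec_one_bounds(1)[OF assms(2)]]
    antimonoD[OF assms(1) vec_one_bounds(2)[OF assms(2)]] by linarith

lemma integral_bounded_support:
  fixes f g :: "real ^ 'd \<Rightarrow> real"
  assumes f: "f \<in> borel_measurable lebesgue" and fM: "\<And>y. norm y \<le> Q \<Longrightarrow> \<bar>f y\<bar> \<le> M"
    and g: "g \<in> borel_measurable borel" and gc: "\<And>y. \<bar>g y\<bar> \<le> c" and g0: "\<And>y. Q < norm y \<Longrightarrow> g y = 0"
    and M: "0 \<le> M"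
  shows "integrable lebesgue (\<lambda>y. f y * g y)"
    "\<bar>LINT y|lebesgue. f y * g y\<bar> \<le> M * c * measure lborel (cball (0 :: real ^ 'd) Q)"
proof -
  have c: "0 \<le> c" using gc[of 0] by linarith
  have i: "integrable lebesgue (\<lambda>y. (M * c) * indicator (cball (0 :: real ^ 'd) Q) y)"
    using emeasure_compact_finite[of "cball (0 :: real ^ 'd) Q"]
    by (intro integrable_mult_right integrable_real_indicator) auto
  have bound: "norm (f y * g y) \<le> (M * c) * indicator (cball 0 Q) y" for y
  proof (cases "norm y \<le> Q")
    case True
    then show ?thesis using mult_mono[OF fM[OF True] gc[of y] M] by (simp add: abs_mult)
  qed (use g0[of y] in simp)
  have "g \<in> borel_measurable lebesgue" using g by (intro measurable_completion) simp
  then have m: "(\<lambda>y. f y * g y) \<in> borel_measurable lebesgue" using f by simp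
  show int: "integrable lebesgue (\<lambda>y. f y * g y)"
    by (rule Bochner_Integration.integrable_bound[OF i m]) (intro AE_I2 order_trans[OF bound], simp)
  have "norm (LINT y|lebesgue. f y * g y) \<le> (LINT y|lebesgue. norm (f y * g y))"
    by (rule integral_norm_bound)
  also have "\<dots> \<le> (LINT y|lebesgue. (M * c) * indicator (cball (0 :: real ^ 'd) Q) y)"
    by (rule Bochner_Integration.integral_mono[OF integrable_norm[OF int] i]) (rule bound)
  also have "\<dots> = M * c * measure lborel (cball (0 :: real ^ 'd) Q)" by (simp add: measure_completion)
  finally show "\<bar>LINT y|lebesgue. f y * g y\<bar> \<le> M * c * measure lborel (cball (0 :: real ^ 'd) Q)" by simp
qed

lemma lborel_integral_translate:
  fixes F :: "'a::euclidean_space \<Rightarrow> real"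
  assumes "F \<in> borel_measurable borel"
  shows "(LINT y|lborel. F (c + y)) = (LINT y|lborel. F y)"
proof -
  have "(LINT y|lborel. F y) = (LINT y|distr lborel borel ((+) c). F y)" by (simp add: lborel_distr_plus)
  also have "\<dots> = (LINT y|lborel. F (c + y))" using assms by (intro integral_distr) auto
  finally show ?thesis ..
qed

lemma AE_lborel_translate:
  fixes P :: "'a::euclidean_space \<Rightarrow> bool"
  assumes "AE y in lborel. P y"
  shows "AE y in lborel. P (c + y)"
proof -
  have "AE y in distr lborel borel ((+) c). P y" using assms unfolding lborel_distr_plus .
  then show ?thesis by (rule AE_distrD[rotated]) simp
qed

text \<open>
  Translation invariance is applied to the Borel function that agrees with \<open>f\<close> on the set of its
  continuity points.
\<close>

lemma convolution_translate:
  fixes f :: "real ^ 'd \<Rightarrow> real"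
  assumes f: "AE x in lborel. isCont f x" and \<psi>: "continuous_on UNIV \<psi>"
  shows "convolution (\<lambda>y. f (c + y)) \<psi> x = convolution f \<psi> (c + x)"
proof -
  define g where "g y = indicator {x. isCont f x} y * f y" for y
  have gm: "g \<in> borel_measurable borel" unfolding g_def by (rule borel_measurable_on_continuity_set)
  have fm: "f \<in> borel_measurable lebesgue" by (rule borel_measurable_lebesgue_if_isCont_ae[OF f])
  have fg: "AE y in lborel. f y = g y" using f by eventually_elim (simp add: g_def)
  have fg': "AE y in lborel. f (c + y) = g (c + y)" by (rule AE_lborel_translate[OF fg])
  have \<psi>m: "(\<lambda>y. \<psi> (z - y)) \<in> borel_measurable borel" for z
    by (intro borel_measurable_continuous_onI continuous_on_compose2[OF \<psi>] continuous_intros) auto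
  have gcm: "(\<lambda>y. g (c + y)) \<in> borel_measurable borel"
    by (rule measurable_compose[OF _ gm]) simp
  have gcl: "(\<lambda>y. g (c + y)) \<in> borel_measurable lebesgue" using gcm by (intro measurable_completion) simp
  have fcm: "(\<lambda>y. f (c + y)) \<in> borel_measurable lebesgue"
    by (rule borel_measurable_AE[OF gcl]) (use AE_completion[OF fg'] in eventually_elim, simp)
  have \<psi>l: "(\<lambda>y. \<psi> (z - y)) \<in> borel_measurable lebesgue" for z using \<psi>m by (intro measurable_completion) simp
  have gl: "g \<in> borel_measurable lebesgue" using gm by (intro measurable_completion) simp
  have "convolution (\<lambda>y. f (c + y)) \<psi> x = (LINT y|lebesgue. g (c + y) * \<psi> (x - y))"
    unfolding convolution_def
  proof (rule integral_cong_AE)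
    show "AE y in lebesgue. f (c + y) * \<psi> (x - y) = g (c + y) * \<psi> (x - y)"
      using AE_completion[OF fg'] by eventually_elim simp
  qed (use fcm gcl \<psi>l in auto)
  also have "\<dots> = (LINT y|lborel. g (c + y) * \<psi> (x - y))"
    using gcm \<psi>m by (intro integral_completion) simp
  also have "\<dots> = (LINT y|lborel. (\<lambda>y. g y * \<psi> (c + x - y)) (c + y))" by simp
  also have "\<dots> = (LINT y|lborel. g y * \<psi> (c + x - y))"
    using gm \<psi>m by (intro lborel_integral_translate) simp
  also have "\<dots> = (LINT y|lebesgue. g y * \<psi> (c + x - y))"
    using gm \<psi>m by (intro integral_completion[symmetric]) simp
  also have "\<dots> = convolution f \<psi> (c + x)"
    unfolding convolution_def
  proof (rule integral_cong_AE)
    show "AE y in lebesgue. g y * \<psi> (c + x - y) = f y * \<psi> (c + x - y)"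
      using AE_completion[OF fg] by eventually_elim simp
  qed (use fm gl \<psi>l in auto)
  finally show ?thesis .
qed

definition kernel_grad :: "(real ^ 'd \<Rightarrow> real) \<Rightarrow> real ^ 'd \<Rightarrow> real ^ 'd" where
  "kernel_grad \<psi> z = (\<chi> i. frechet_derivative \<psi> (at z) (axis i 1))"

text \<open>
  The properties of the scaled and shifted mollifiers on which the argument relies: they are densities
  with Lipschitz gradient and support in a cube \<open>[a, b]\<^sup>d\<close>, whose position relative to the origin makes
  the mollification one-sided.
\<close>

definition kernel :: "(real ^ 'd \<Rightarrow> real) \<Rightarrow> real \<Rightarrow> real \<Rightarrow> bool" where
  "kernel \<psi> a b \<longleftrightarrow> (\<forall>z. 0 \<le> \<psi> z) \<and> (\<forall>z. \<psi> z \<noteq> 0 \<longrightarrow> a *\<^sub>R 1 \<le> z \<and> z \<le> b *\<^sub>R 1) \<and>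
     (LINT z|lborel. \<psi> z) = 1 \<and> (\<exists>K\<ge>0. (\<forall>z. GDERIV \<psi> z :> kernel_grad \<psi> z) \<and>
       (\<forall>z z'. \<bar>\<psi> z - \<psi> z'\<bar> \<le> K * norm (z - z')) \<and>
       (\<forall>z z'. norm (kernel_grad \<psi> z - kernel_grad \<psi> z') \<le> K * norm (z - z')))"

lemma gderiv_kernel_grad:
  fixes \<psi> :: "real ^ 'd \<Rightarrow> real"
  assumes "(\<psi> has_derivative \<psi>') (at z)"
  shows "GDERIV \<psi> z :> kernel_grad \<psi> z" "kernel_grad \<psi> z $ i = \<psi>' (axis i 1)"
proof -
  have eq: "frechet_derivative \<psi> (at z) = \<psi>'" by (rule frechet_derivative_at[OF assms, symmetric])
  have lin: "linear \<psi>'" using assms by (rule has_derivative_linear)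
  have "\<psi>' h = h \<bullet> kernel_grad \<psi> z" for h
  proof -
    have "\<psi>' h = \<psi>' (\<Sum>i\<in>UNIV. (h $ i) *\<^sub>R axis i 1)"
      using basis_expansion[of h] by (simp add: scalar_mult_eq_scaleR)
    also have "\<dots> = (\<Sum>i\<in>UNIV. (h $ i) * \<psi>' (axis i 1))" using lin by (simp add: linear_sum linear_scale)
    also have "\<dots> = h \<bullet> kernel_grad \<psi> z" by (simp add: inner_vec_def kernel_grad_def eq)
    finally show ?thesis .
  qed
  then have "\<psi>' = (\<lambda>h. h \<bullet> kernel_grad \<psi> z)" by auto
  then show "GDERIV \<psi> z :> kernel_grad \<psi> z" using assms unfolding gderiv_def by simp
  show "kernel_grad \<psi> z $ i = \<psi>' (axis i 1)" by (simp add: kernel_grad_def eq)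
qed

lemma derivative_zero_outside:
  fixes \<phi> :: "real ^ 'd \<Rightarrow> real"
  assumes "(\<phi> has_derivative \<phi>') (at z)" and zero: "\<And>y. r < norm y \<Longrightarrow> \<phi> y = 0" and "r < norm z"
  shows "\<phi>' = (\<lambda>h. 0)"
proof -
  have op: "open {y :: real ^ 'd. r < norm y}" by (intro open_Collect_less continuous_intros)
  have "((\<lambda>_. 0) has_derivative \<phi>') (at z)"
    by (rule has_derivative_transform_within_open[OF assms(1) op]) (use assms in auto)
  then show ?thesis using has_derivative_unique[OF _ has_derivative_const] by blast
qed

text \<open>
  The gradient is bounded on a ball by compactness and vanishes outside it.
\<close>

lemma C1_bounded_support_lipschitz:
  fixes \<phi> :: "real ^ 'd \<Rightarrow> real"
  assumes C1: "C_k (Suc 0) \<phi>" and zero: "\<And>y. r < norm y \<Longrightarrow> \<phi> y = 0"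
  shows "\<exists>K\<ge>0. \<forall>z z'. \<bar>\<phi> z - \<phi> z'\<bar> \<le> K * norm (z - z')"
proof -
  have der: "(\<phi> has_derivative frechet_derivative \<phi> (at z)) (at z)" for z
    using C1 frechet_derivative_works by auto
  have "\<exists>M\<ge>0. \<forall>z. \<bar>kernel_grad \<phi> z $ i\<bar> \<le> M" for i
  proof -
    have "continuous_on (cball 0 r) (\<lambda>z. kernel_grad \<phi> z $ i)"
      using C1 unfolding kernel_grad_def by (auto intro: continuous_on_subset)
    then have "compact ((\<lambda>z. kernel_grad \<phi> z $ i) ` cball 0 r)" by (intro compact_continuous_image) auto
    then obtain M where M: "\<And>z. z \<in> cball 0 r \<Longrightarrow> \<bar>kernel_grad \<phi> z $ i\<bar> \<le> M"
      using compact_imp_bounded bounded_iff by (metis imageI real_norm_def)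
    have "\<bar>kernel_grad \<phi> z $ i\<bar> \<le> max M 0" for z
    proof (cases "norm z \<le> r")
      case True then show ?thesis using M[of z] by simp
    next
      case False
      then have "frechet_derivative \<phi> (at z) = (\<lambda>h. 0)" by (intro derivative_zero_outside[OF der zero]) auto
      then show ?thesis by (simp add: kernel_grad_def)
    qed
    then show ?thesis by (intro exI[of _ "max M 0"]) auto
  qed
  then obtain M where M: "\<And>i. M i \<ge> 0" "\<And>i z. \<bar>kernel_grad \<phi> z $ i\<bar> \<le> M i" by metis
  define K where "K = (\<Sum>i\<in>UNIV. M i)"
  have gK: "norm (kernel_grad \<phi> z) \<le> K" for z
    unfolding K_def using M(2) by (intro order_trans[OF norm_le_l1_cart] sum_mono)
  have "norm (\<phi> z - \<phi> z') \<le> K * norm (z - z')" for z z'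
  proof (rule differentiable_bound[where S = UNIV and f' = "\<lambda>z h. h \<bullet> kernel_grad \<phi> z"])
    fix x
    show "(\<phi> has_derivative (\<lambda>h. h \<bullet> kernel_grad \<phi> x)) (at x within UNIV)"
      using gderiv_kernel_grad(1)[OF der] unfolding gderiv_def by simp
    have "norm (h \<bullet> kernel_grad \<phi> x) \<le> K * norm h" for h
    proof -
      have "norm (h \<bullet> kernel_grad \<phi> x) \<le> norm h * norm (kernel_grad \<phi> x)" by (simp add: Cauchy_Schwarz_ineq2)
      also have "\<dots> \<le> norm h * K" using gK by (intro mult_left_mono) auto
      finally show ?thesis by (simp add: mult.commute)
    qed
    then show "onorm (\<lambda>h. h \<bullet> kernel_grad \<phi> x) \<le> K" by (rule onorm_le)
  qed auto
  moreover have "0 \<le> K" unfolding K_def using M(1) by (simp add: sum_nonneg)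
  ultimately show ?thesis by auto
qed

lemma mollifier_support:
  fixes \<rho> :: "real ^ 'd \<Rightarrow> real"
  assumes "mollifier \<rho>" "\<rho> z \<noteq> 0"
  shows "- 1 \<le> z $ i" "z $ i \<le> 1"
proof -
  have "z \<in> closure {z. \<rho> z \<noteq> 0}" using assms(2) by (intro subsetD[OF closure_subset]) simp
  moreover have "closure {z. \<rho> z \<noteq> 0} \<subseteq> cbox (- 1) 1" using assms(1) unfolding mollifier_def by simp
  ultimately have "z \<in> cbox (- 1) 1" by (rule subsetD[rotated])
  then show "- 1 \<le> z $ i" "z $ i \<le> 1" by (simp_all add: mem_box_cart)
qed

lemma mollifier_lipschitz:
  fixes \<rho> :: "real ^ 'd \<Rightarrow> real"
  assumes "mollifier \<rho>"
  shows "\<exists>K\<ge>0. (\<forall>z. GDERIV \<rho> z :> kernel_grad \<rho> z) \<and>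
       (\<forall>z z'. \<bar>\<rho> z - \<rho> z'\<bar> \<le> K * norm (z - z')) \<and>
       (\<forall>z z'. norm (kernel_grad \<rho> z - kernel_grad \<rho> z') \<le> K * norm (z - z'))"
proof -
  have sm: "C_k k \<rho>" for k using assms unfolding mollifier_def smooth_def by simp
  have der: "(\<rho> has_derivative frechet_derivative \<rho> (at z)) (at z)" for z
  proof -
    have "\<rho> differentiable (at z)" using sm[of "Suc 0"] unfolding C_k.simps(2) by blast
    then show ?thesis by (rule frechet_derivative_works[THEN iffD1])
  qed
  have zero: "\<rho> y = 0" if "real CARD('d) < norm y" for y
  proof (rule ccontr)
    assume "\<rho> y \<noteq> 0"
    then have y1: "\<bar>y $ i\<bar> \<le> 1" for i using mollifier_support[OF assms, of y i] by (simp add: abs_le_iff)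
    show False using norm_le_card_mult[of y 1, OF y1] that by simp
  qed
  have gz: "frechet_derivative \<rho> (at y) v = 0" if "real CARD('d) < norm y" for y v
    using derivative_zero_outside[OF der zero that] by simp
  obtain K0 where K0: "K0 \<ge> 0" "\<And>z z'. \<bar>\<rho> z - \<rho> z'\<bar> \<le> K0 * norm (z - z')"
    using C1_bounded_support_lipschitz[OF sm zero] by blast
  have "\<exists>K\<ge>0. \<forall>z z'. \<bar>kernel_grad \<rho> z $ i - kernel_grad \<rho> z' $ i\<bar> \<le> K * norm (z - z')" for i
  proof -
    have "C_k (Suc 0) (\<lambda>z. frechet_derivative \<rho> (at z) (axis i 1))"
      using sm[of "Suc (Suc 0)"] unfolding C_k.simps(2)[of "Suc 0"] by blast
    from C1_bounded_support_lipschitz[OF this gz] show ?thesis by (simp add: kernel_grad_def)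
  qed
  then have "\<forall>i. \<exists>K. K \<ge> 0 \<and> (\<forall>z z'. \<bar>kernel_grad \<rho> z $ i - kernel_grad \<rho> z' $ i\<bar> \<le> K * norm (z - z'))" by blast
  from choice[OF this] obtain Ki where
    Ki: "\<And>i. Ki i \<ge> 0" "\<And>i z z'. \<bar>kernel_grad \<rho> z $ i - kernel_grad \<rho> z' $ i\<bar> \<le> Ki i * norm (z - z')" by blast
  define K1 where "K1 = (\<Sum>i\<in>UNIV. Ki i)"
  have K1: "K1 \<ge> 0" unfolding K1_def using Ki(1) by (simp add: sum_nonneg)
  have g: "norm (kernel_grad \<rho> z - kernel_grad \<rho> z') \<le> K1 * norm (z - z')" for z z'
    unfolding K1_def sum_distrib_right
    by (intro order_trans[OF norm_le_l1_cart] sum_mono) (simp add: Ki(2))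
  show ?thesis
  proof (intro exI[of _ "K0 + K1"] conjI allI)
    show "0 \<le> K0 + K1" using K0(1) K1 by simp
    show "GDERIV \<rho> z :> kernel_grad \<rho> z" for z by (rule gderiv_kernel_grad(1)[OF der])
    show "\<bar>\<rho> z - \<rho> z'\<bar> \<le> (K0 + K1) * norm (z - z')" for z z'
      by (rule order_trans[OF K0(2)], rule mult_right_mono) (use K1 in auto)
    show "norm (kernel_grad \<rho> z - kernel_grad \<rho> z') \<le> (K0 + K1) * norm (z - z')" for z z'
      by (rule order_trans[OF g], rule mult_right_mono) (use K0 in auto)
  qed
qed

lemma kernel_if_mollifier:
  fixes \<rho> :: "real ^ 'd \<Rightarrow> real"
  assumes \<rho>: "mollifier \<rho>" and \<epsilon>: "\<epsilon> > 0"
  shows "kernel (\<lambda>z. \<rho> ((z - c *\<^sub>R 1) /\<^sub>R \<epsilon>) / \<epsilon> ^ CARD('d)) (c - \<epsilon>) (c + \<epsilon>)" (is "kernel ?\<psi> _ _")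
proof -
  obtain K where K: "K \<ge> 0" "\<And>z. GDERIV \<rho> z :> kernel_grad \<rho> z"
       "\<And>z z'. \<bar>\<rho> z - \<rho> z'\<bar> \<le> K * norm (z - z')"
       "\<And>z z'. norm (kernel_grad \<rho> z - kernel_grad \<rho> z') \<le> K * norm (z - z')"
    using mollifier_lipschitz[OF \<rho>] by blast
  define n where "n = CARD('d)"
  define L where "L z = (z - c *\<^sub>R 1) /\<^sub>R \<epsilon>" for z :: "real ^ 'd"
  have Ldiff: "norm (L z - L z') = norm (z - z') / \<epsilon>" for z z'
  proof -
    have "L z - L z' = (z - z') /\<^sub>R \<epsilon>" unfolding L_def by (simp flip: scaleR_diff_right)
    then show ?thesis using \<epsilon> by (simp add: divide_inverse mult.commute)
  qed
  have en: "\<epsilon> ^ n > 0" using \<epsilon> by simp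
  have der: "(?\<psi> has_derivative (\<lambda>h. (h /\<^sub>R \<epsilon>) \<bullet> kernel_grad \<rho> (L z) / \<epsilon> ^ n)) (at z)" for z
  proof -
    have "(L has_derivative (\<lambda>h. h /\<^sub>R \<epsilon>)) (at z)"
      unfolding L_def[abs_def] by (auto intro!: derivative_eq_intros)
    moreover have "(\<rho> has_derivative (\<lambda>h. h \<bullet> kernel_grad \<rho> (L z))) (at (L z))"
      using K(2)[of "L z"] unfolding gderiv_def .
    ultimately have "((\<lambda>z. \<rho> (L z)) has_derivative (\<lambda>h. (h /\<^sub>R \<epsilon>) \<bullet> kernel_grad \<rho> (L z))) (at z)"
      by (rule has_derivative_compose)
    then have "((\<lambda>z. \<rho> (L z) / \<epsilon> ^ n) has_derivative (\<lambda>h. (h /\<^sub>R \<epsilon>) \<bullet> kernel_grad \<rho> (L z) / \<epsilon> ^ n)) (at z)"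
      by (rule bounded_linear.has_derivative[OF bounded_linear_divide])
    then show ?thesis unfolding L_def n_def .
  qed
  have grad: "kernel_grad ?\<psi> z = kernel_grad \<rho> (L z) /\<^sub>R (\<epsilon> * \<epsilon> ^ n)" for z
    unfolding vec_eq_iff using gderiv_kernel_grad(2)[OF der[of z]] \<epsilon>
    by (auto simp: inner_axis' field_simps)
  define K' where "K' = K / \<epsilon> / \<epsilon> ^ n + K / \<epsilon> / (\<epsilon> * \<epsilon> ^ n)"
  have K'0: "K / \<epsilon> / \<epsilon> ^ n \<ge> 0" "K / \<epsilon> / (\<epsilon> * \<epsilon> ^ n) \<ge> 0" using K(1) \<epsilon> by auto
  have "\<bar>?\<psi> z - ?\<psi> z'\<bar> \<le> K' * norm (z - z')" for z z'
  proof -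
    have "\<bar>?\<psi> z - ?\<psi> z'\<bar> = \<bar>\<rho> (L z) - \<rho> (L z')\<bar> / \<epsilon> ^ n"
      unfolding L_def[symmetric] n_def[symmetric] using en by (simp flip: diff_divide_distrib add: abs_divide)
    also have "\<dots> \<le> (K * (norm (z - z') / \<epsilon>)) / \<epsilon> ^ n"
      using K(3)[of "L z" "L z'"] en unfolding Ldiff by (intro divide_right_mono) auto
    also have "\<dots> = (K / \<epsilon> / \<epsilon> ^ n) * norm (z - z')" by simp
    also have "\<dots> \<le> K' * norm (z - z')" unfolding K'_def using K'0 by (intro mult_right_mono) auto
    finally show ?thesis .
  qed
  moreover have "norm (kernel_grad ?\<psi> z - kernel_grad ?\<psi> z') \<le> K' * norm (z - z')" for z z'
  proof -
    have "norm (kernel_grad ?\<psi> z - kernel_grad ?\<psi> z') = norm (kernel_grad \<rho> (L z) - kernel_grad \<rho> (L z')) / (\<epsilon> * \<epsilon> ^ n)"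
      unfolding grad scaleR_diff_right[symmetric] using \<epsilon> en by (simp add: divide_inverse mult.commute abs_mult)
    also have "\<dots> \<le> (K * (norm (z - z') / \<epsilon>)) / (\<epsilon> * \<epsilon> ^ n)"
      using K(4)[of "L z" "L z'"] en \<epsilon> unfolding Ldiff by (intro divide_right_mono) auto
    also have "\<dots> = (K / \<epsilon> / (\<epsilon> * \<epsilon> ^ n)) * norm (z - z')" by simp
    also have "\<dots> \<le> K' * norm (z - z')" unfolding K'_def using K'0 by (intro mult_right_mono) auto
    finally show ?thesis .
  qed
  moreover have "GDERIV ?\<psi> z :> kernel_grad ?\<psi> z" for z by (rule gderiv_kernel_grad(1)[OF der])
  moreover have "K' \<ge> 0" unfolding K'_def using K'0 by simp
  moreover have "0 \<le> ?\<psi> z" for z using \<rho> \<epsilon> unfolding mollifier_def by simp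
  moreover have "(c - \<epsilon>) *\<^sub>R 1 \<le> z \<and> z \<le> (c + \<epsilon>) *\<^sub>R 1" if "?\<psi> z \<noteq> 0" for z
  proof -
    have "\<rho> (L z) \<noteq> 0" using that unfolding L_def by auto
    then have "- 1 \<le> L z $ i \<and> L z $ i \<le> 1" for i using mollifier_support[OF \<rho>, of "L z" i] by simp
    then have "- 1 \<le> (z $ i - c) / \<epsilon> \<and> (z $ i - c) / \<epsilon> \<le> 1" for i
      unfolding L_def by (simp add: divide_inverse mult.commute)
    then have "c - \<epsilon> \<le> z $ i \<and> z $ i \<le> c + \<epsilon>" for i using \<epsilon> by (simp add: field_simps)
    then show ?thesis by (auto simp: less_eq_vec_def)
  qed
  moreover have "(LINT z|lborel. ?\<psi> z) = 1"
  proof -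
    have "C_k 0 \<rho>" using \<rho> unfolding mollifier_def smooth_def by simp
    then have cont: "continuous_on UNIV \<rho>" by simp
    have rm: "\<rho> \<in> borel_measurable borel" by (rule borel_measurable_continuous_onI[OF cont])
    have psim: "?\<psi> \<in> borel_measurable borel"
      by (intro borel_measurable_continuous_onI continuous_intros continuous_on_compose2[OF cont]) (use \<epsilon> in auto)
    have T: "(\<lambda>x. c *\<^sub>R 1 + \<epsilon> *\<^sub>R x) \<in> borel_measurable (borel :: (real ^ 'd) measure)"
      by (intro borel_measurable_continuous_onI continuous_intros)
    have psim2: "(\<lambda>z. (\<bar>\<epsilon>\<bar> ^ DIM(real ^ 'd)) *\<^sub>R ?\<psi> z) \<in> borel_measurable borel"
      using psim by (intro borel_measurable_scaleR borel_measurable_const)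
    have "(LINT z|lborel. ?\<psi> z) = (LINT z|density (distr lborel borel (\<lambda>x. c *\<^sub>R 1 + \<epsilon> *\<^sub>R x)) (\<lambda>_. ennreal (\<bar>\<epsilon>\<bar> ^ DIM(real ^ 'd))). ?\<psi> z)"
      using lborel_affine[of \<epsilon> "c *\<^sub>R 1 :: real ^ 'd"] \<epsilon> by simp
    also have "\<dots> = (LINT z|distr lborel borel (\<lambda>x. c *\<^sub>R 1 + \<epsilon> *\<^sub>R x). (\<bar>\<epsilon>\<bar> ^ DIM(real ^ 'd)) *\<^sub>R ?\<psi> z)"
      using psim by (intro integral_density) auto
    also have "\<dots> = (LINT w|lborel. (\<bar>\<epsilon>\<bar> ^ DIM(real ^ 'd)) *\<^sub>R ?\<psi> (c *\<^sub>R 1 + \<epsilon> *\<^sub>R w))"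
      using psim2 T by (intro integral_distr) auto
    also have "\<dots> = (LINT w|lborel. \<rho> w)"
      using \<epsilon> by (intro Bochner_Integration.integral_cong) (auto simp: DIM_cart)
    also have "\<dots> = (LINT w|lebesgue. \<rho> w)" using rm by (intro integral_completion[symmetric]) simp
    also have "\<dots> = 1" using \<rho> unfolding mollifier_def by simp
    finally show ?thesis .
  qed
  ultimately show ?thesis unfolding kernel_def by blast
qed

lemma kernel_moll_lower:
  fixes \<rho> :: "real ^ 'd \<Rightarrow> real"
  assumes "mollifier \<rho>" "\<epsilon> > 0"
  shows "kernel (moll_lower \<rho> \<epsilon>) 0 (2 * \<epsilon>)"
  using kernel_if_mollifier[OF assms, of \<epsilon>] unfolding moll_lower_def[abs_def] by simp

lemma kernel_moll_upper:
  fixes \<rho> :: "real ^ 'd \<Rightarrow> real"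
  assumes "mollifier \<rho>" "\<epsilon> > 0"
  shows "kernel (moll_upper \<rho> \<epsilon>) (- 2 * \<epsilon>) 0"
  using kernel_if_mollifier[OF assms, of "- \<epsilon>"] unfolding moll_upper_def[abs_def] by simp

lemma kernel_bounds:
  fixes \<psi> :: "real ^ 'd \<Rightarrow> real"
  assumes "kernel \<psi> a b"
  obtains K Q where "0 \<le> K" "0 \<le> Q"
    "\<And>z. Q < norm z \<Longrightarrow> \<psi> z = 0" "\<And>z. Q < norm z \<Longrightarrow> kernel_grad \<psi> z = 0"
    "\<And>z. \<bar>\<psi> z\<bar> \<le> K" "\<And>z. norm (kernel_grad \<psi> z) \<le> K"
    "\<And>z z'. \<bar>\<psi> z - \<psi> z'\<bar> \<le> K * norm (z - z')"
    "\<And>z z'. norm (kernel_grad \<psi> z - kernel_grad \<psi> z') \<le> K * norm (z - z')"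
    "\<And>z h. \<bar>\<psi> (z + h) - \<psi> z - h \<bullet> kernel_grad \<psi> z\<bar> \<le> K * norm h ^ 2"
proof -
  have supp: "\<And>z. \<psi> z \<noteq> 0 \<Longrightarrow> a *\<^sub>R 1 \<le> z \<and> z \<le> b *\<^sub>R 1"
    using assms unfolding kernel_def by simp
  obtain K where K: "K \<ge> 0" "\<And>z. GDERIV \<psi> z :> kernel_grad \<psi> z"
       "\<And>z z'. \<bar>\<psi> z - \<psi> z'\<bar> \<le> K * norm (z - z')"
       "\<And>z z'. norm (kernel_grad \<psi> z - kernel_grad \<psi> z') \<le> K * norm (z - z')"
    using assms unfolding kernel_def by auto
  define Q where "Q = real CARD('d) * (\<bar>a\<bar> + \<bar>b\<bar>)"
  have Q0: "0 \<le> Q" unfolding Q_def by simp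
  have z0: "\<psi> z = 0" if "Q < norm z" for z
  proof (rule ccontr)
    assume "\<psi> z \<noteq> 0"
    then have z: "a \<le> z $ i \<and> z $ i \<le> b" for i using supp[of z] by (simp add: less_eq_vec_def)
    have "\<bar>z $ i\<bar> \<le> \<bar>a\<bar> + \<bar>b\<bar>" for i using z[of i] by linarith
    from norm_le_card_mult[OF this] show False using that unfolding Q_def by simp
  qed
  have g0: "kernel_grad \<psi> z = 0" if "Q < norm z" for z
  proof -
    have "(\<psi> has_derivative (\<lambda>h. h \<bullet> kernel_grad \<psi> z)) (at z)" using K(2)[of z] unfolding gderiv_def .
    from derivative_zero_outside[OF this z0 that] have "(\<lambda>h. h \<bullet> kernel_grad \<psi> z) = (\<lambda>h. 0)" .
    from fun_cong[OF this, of "kernel_grad \<psi> z"] show ?thesis by simp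
  qed
  \<comment> \<open>a point outside the support, from which Lipschitz bounds become bounds for the values\<close>
  define z1 :: "real ^ 'd" where "z1 = (Q + 1) *\<^sub>R axis undefined 1"
  have z1: "norm z1 = Q + 1" unfolding z1_def using Q0 by simp
  define K' where "K' = K * (2 * Q + 1) + K"
  have KK: "0 \<le> K * (2 * Q + 1)" "0 \<le> K'" "K \<le> K'" "K * (2 * Q + 1) \<le> K'" using K(1) Q0 unfolding K'_def by auto
  have far: "K * norm (z - z1) \<le> K'" if "norm z \<le> Q" for z
  proof -
    have "norm (z - z1) \<le> 2 * Q + 1" using norm_triangle_ineq4[of z z1] that z1 by linarith
    then have "K * norm (z - z1) \<le> K * (2 * Q + 1)" using K(1) by (rule mult_left_mono)
    then show ?thesis using KK(4) by linarith
  qed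
  have b1: "\<bar>\<psi> z\<bar> \<le> K'" for z
    using far[of z] K(3)[of z z1] z0[of z] z0[of z1] z1 KK(2) by (cases "norm z \<le> Q") auto
  have b2: "norm (kernel_grad \<psi> z) \<le> K'" for z
    using far[of z] K(4)[of z z1] g0[of z] g0[of z1] z1 KK(2) by (cases "norm z \<le> Q") auto
  have taylor: "\<bar>\<psi> (z + h) - \<psi> z - h \<bullet> kernel_grad \<psi> z\<bar> \<le> K * norm h ^ 2" for z h
  proof -
    define w where "w x = \<psi> x - x \<bullet> kernel_grad \<psi> z" for x
    have "norm (w (z + h) - w z) \<le> (K * norm h) * norm (z + h - z)"
    proof (rule differentiable_bound[where S = "closed_segment z (z + h)"
          and f' = "\<lambda>x k. k \<bullet> kernel_grad \<psi> x - k \<bullet> kernel_grad \<psi> z"])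
      fix x assume x: "x \<in> closed_segment z (z + h)"
      have "(\<psi> has_derivative (\<lambda>k. k \<bullet> kernel_grad \<psi> x)) (at x within closed_segment z (z + h))"
        using K(2)[of x] unfolding gderiv_def by (rule has_derivative_at_withinI)
      then show "(w has_derivative (\<lambda>k. k \<bullet> kernel_grad \<psi> x - k \<bullet> kernel_grad \<psi> z)) (at x within closed_segment z (z + h))"
        unfolding w_def[abs_def] by (intro has_derivative_diff has_derivative_inner_left has_derivative_ident)
      have xz: "norm (x - z) \<le> norm h"
        using segment_bound1[OF x] by (simp add: norm_minus_commute)
      have "norm (k \<bullet> kernel_grad \<psi> x - k \<bullet> kernel_grad \<psi> z) \<le> K * norm h * norm k" for k
      proof -
        have "norm (k \<bullet> kernel_grad \<psi> x - k \<bullet> kernel_grad \<psi> z) = \<bar>k \<bullet> (kernel_grad \<psi> x - kernel_grad \<psi> z)\<bar>"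
          by (simp add: inner_diff_right)
        also have "\<dots> \<le> norm k * norm (kernel_grad \<psi> x - kernel_grad \<psi> z)" by (rule Cauchy_Schwarz_ineq2)
        also have "\<dots> \<le> norm k * (K * norm h)"
        proof (rule mult_left_mono)
          show "norm (kernel_grad \<psi> x - kernel_grad \<psi> z) \<le> K * norm h"
            using K(4)[of x z] mult_left_mono[OF xz K(1)] by linarith
        qed simp
        finally show ?thesis by (simp add: mult.commute mult.left_commute)
      qed
      then show "onorm (\<lambda>k. k \<bullet> kernel_grad \<psi> x - k \<bullet> kernel_grad \<psi> z) \<le> K * norm h" by (rule onorm_le)
    qed auto
    moreover have "w (z + h) - w z = \<psi> (z + h) - \<psi> z - h \<bullet> kernel_grad \<psi> z"
      unfolding w_def by (simp add: inner_add_left)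
    ultimately show ?thesis by (simp add: power2_eq_square)
  qed
  show ?thesis
  proof (rule that[of K' Q])
    show "\<bar>\<psi> z - \<psi> z'\<bar> \<le> K' * norm (z - z')" for z z'
      using K(3)[of z z'] mult_right_mono[OF KK(3), of "norm (z - z')"] by simp
    show "norm (kernel_grad \<psi> z - kernel_grad \<psi> z') \<le> K' * norm (z - z')" for z z'
      using K(4)[of z z'] mult_right_mono[OF KK(3), of "norm (z - z')"] by simp
    show "\<bar>\<psi> (z + h) - \<psi> z - h \<bullet> kernel_grad \<psi> z\<bar> \<le> K' * norm h ^ 2" for z h
      using taylor[of z h] mult_right_mono[OF KK(3), of "norm h ^ 2"] by simp
  qed (fact KK(2) Q0 z0 g0 b1 b2)+
qed

definition conv_grad :: "(real ^ 'd \<Rightarrow> real) \<Rightarrow> (real ^ 'd \<Rightarrow> real) \<Rightarrow> real ^ 'd \<Rightarrow> real ^ 'd" where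
  "conv_grad f \<psi> x = (\<chi> i. convolution f (\<lambda>z. kernel_grad \<psi> z $ i) x)"

lemma kernel_continuous:
  fixes \<psi> :: "real ^ 'd \<Rightarrow> real"
  assumes "kernel \<psi> a b"
  shows "continuous_on UNIV \<psi>" "continuous_on UNIV (kernel_grad \<psi>)"
proof -
  obtain K where K: "0 \<le> K" "\<And>z z'. \<bar>\<psi> z - \<psi> z'\<bar> \<le> K * norm (z - z')"
    "\<And>z z'. norm (kernel_grad \<psi> z - kernel_grad \<psi> z') \<le> K * norm (z - z')"
    using assms unfolding kernel_def by auto
  have "K-lipschitz_on UNIV \<psi>" using K by (intro lipschitz_onI) (auto simp: dist_norm)
  then show "continuous_on UNIV \<psi>" by (rule lipschitz_on_continuous_on)
  have "K-lipschitz_on UNIV (kernel_grad \<psi>)" using K by (intro lipschitz_onI) (auto simp: dist_norm)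
  then show "continuous_on UNIV (kernel_grad \<psi>)" by (rule lipschitz_on_continuous_on)
qed

text \<open>
  The estimates depend on \<open>f\<close> only through its measurability and a bound on a ball. This makes them
  uniform for families of locally bounded functions, such as \<open>u t\<close> for \<open>t\<close> in \<open>[0, T]\<close>.
\<close>

lemma conv_estimates:
  fixes \<psi> :: "real ^ 'd \<Rightarrow> real"
  assumes ker: "kernel \<psi> a b"
  obtains L Q where "0 \<le> L" "0 \<le> Q"
    "\<And>f M r x. \<lbrakk>f \<in> borel_measurable lebesgue; 0 \<le> M; \<And>y. norm y \<le> r + Q \<Longrightarrow> \<bar>f y\<bar> \<le> M; norm x \<le> r\<rbrakk> \<Longrightarrow>
       integrable lebesgue (\<lambda>y. f y * \<psi> (x - y))"
    "\<And>f M r x x'. \<lbrakk>f \<in> borel_measurable lebesgue; 0 \<le> M; \<And>y. norm y \<le> r + Q \<Longrightarrow> \<bar>f y\<bar> \<le> M; norm x \<le> r; norm x' \<le> r\<rbrakk> \<Longrightarrow>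
       \<bar>convolution f \<psi> x - convolution f \<psi> x'\<bar> \<le> M * L * measure lborel (cball (0 :: real ^ 'd) (r + Q)) * norm (x - x')"
    "\<And>f M r x x' i. \<lbrakk>f \<in> borel_measurable lebesgue; 0 \<le> M; \<And>y. norm y \<le> r + Q \<Longrightarrow> \<bar>f y\<bar> \<le> M; norm x \<le> r; norm x' \<le> r\<rbrakk> \<Longrightarrow>
       \<bar>conv_grad f \<psi> x $ i - conv_grad f \<psi> x' $ i\<bar> \<le> M * L * measure lborel (cball (0 :: real ^ 'd) (r + Q)) * norm (x - x')"
    "\<And>f M r x h. \<lbrakk>f \<in> borel_measurable lebesgue; 0 \<le> M; \<And>y. norm y \<le> r + Q \<Longrightarrow> \<bar>f y\<bar> \<le> M; norm x \<le> r; norm (x + h) \<le> r\<rbrakk> \<Longrightarrow>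
       \<bar>convolution f \<psi> (x + h) - convolution f \<psi> x - h \<bullet> conv_grad f \<psi> x\<bar>
         \<le> M * L * measure lborel (cball (0 :: real ^ 'd) (r + Q)) * norm h ^ 2"
proof -
  obtain K Q where K: "0 \<le> K" "0 \<le> Q"
    "\<And>z. Q < norm z \<Longrightarrow> \<psi> z = 0" "\<And>z. Q < norm z \<Longrightarrow> kernel_grad \<psi> z = 0"
    "\<And>z. \<bar>\<psi> z\<bar> \<le> K" "\<And>z. norm (kernel_grad \<psi> z) \<le> K"
    "\<And>z z'. \<bar>\<psi> z - \<psi> z'\<bar> \<le> K * norm (z - z')"
    "\<And>z z'. norm (kernel_grad \<psi> z - kernel_grad \<psi> z') \<le> K * norm (z - z')"
    "\<And>z h. \<bar>\<psi> (z + h) - \<psi> z - h \<bullet> kernel_grad \<psi> z\<bar> \<le> K * norm h ^ 2"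
    by (rule kernel_bounds[OF ker]) blast
  have far: "Q < norm (x - y)" if "norm x \<le> r" "r + Q < norm y" for x y :: "real ^ 'd" and r
    using norm_triangle_ineq2[of y x] that by (simp add: norm_minus_commute)
  have m1: "(\<lambda>y. \<psi> (x - y)) \<in> borel_measurable borel" for x
    by (intro borel_measurable_continuous_onI continuous_on_compose2[OF kernel_continuous(1)[OF ker]] continuous_intros) auto
  have m2': "(\<lambda>y. kernel_grad \<psi> (x - y)) \<in> borel_measurable borel" for x
    by (intro borel_measurable_continuous_onI continuous_on_compose2[OF kernel_continuous(2)[OF ker]] continuous_intros) auto
  have m2: "(\<lambda>y. kernel_grad \<psi> (x - y) $ i) \<in> borel_measurable borel" for x i
    by (rule borel_measurable_vec_nth[OF m2'])
  show ?thesis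
  proof (rule that[OF K(1,2)])
    fix f :: "real ^ 'd \<Rightarrow> real" and M r :: real and x :: "real ^ 'd"
    assume f: "f \<in> borel_measurable lebesgue" and M: "0 \<le> M" "\<And>y. norm y \<le> r + Q \<Longrightarrow> \<bar>f y\<bar> \<le> M"
      and x: "norm x \<le> r"
    have i1: "integrable lebesgue (\<lambda>y. f y * \<psi> (z - y))" if "norm z \<le> r" for z
      by (rule integral_bounded_support(1)[OF f M(2) m1 K(5) _ M(1)]) (use far[OF that] K(3) in auto)
    have i2: "integrable lebesgue (\<lambda>y. f y * kernel_grad \<psi> (z - y) $ i)" if "norm z \<le> r" for z i
    proof (rule integral_bounded_support(1)[OF f M(2) m2 _ _ M(1)])
      show "\<bar>kernel_grad \<psi> (z - y) $ i\<bar> \<le> K" for y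
        using component_le_norm_cart[of "kernel_grad \<psi> (z - y)" i] K(6)[of "z - y"] by linarith
      show "kernel_grad \<psi> (z - y) $ i = 0" if "r + Q < norm y" for y
        using K(4)[OF far[OF \<open>norm z \<le> r\<close> that]] by simp
    qed
    show "integrable lebesgue (\<lambda>y. f y * \<psi> (x - y))" by (rule i1[OF x])
    show "\<bar>convolution f \<psi> x - convolution f \<psi> x'\<bar> \<le> M * K * measure lborel (cball (0 :: real ^ 'd) (r + Q)) * norm (x - x')"
      if x': "norm x' \<le> r" for x'
    proof -
      have "convolution f \<psi> x - convolution f \<psi> x' = (LINT y|lebesgue. f y * (\<psi> (x - y) - \<psi> (x' - y)))"
        unfolding convolution_def using i1[OF x] i1[OF x'] by (simp add: right_diff_distrib)
      also have "\<bar>\<dots>\<bar> \<le> M * (K * norm (x - x')) * measure lborel (cball (0 :: real ^ 'd) (r + Q))"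
      proof (rule integral_bounded_support(2)[OF f M(2) _ _ _ M(1)])
        show "(\<lambda>y. \<psi> (x - y) - \<psi> (x' - y)) \<in> borel_measurable borel" using m1 by simp
        show "\<bar>\<psi> (x - y) - \<psi> (x' - y)\<bar> \<le> K * norm (x - x')" for y using K(7)[of "x - y" "x' - y"] by simp
        show "\<psi> (x - y) - \<psi> (x' - y) = 0" if "r + Q < norm y" for y
          using K(3)[OF far[OF x that]] K(3)[OF far[OF x' that]] by simp
      qed
      finally show ?thesis by (simp add: mult.commute mult.left_commute)
    qed
    show "\<bar>conv_grad f \<psi> x $ i - conv_grad f \<psi> x' $ i\<bar> \<le> M * K * measure lborel (cball (0 :: real ^ 'd) (r + Q)) * norm (x - x')"
      if x': "norm x' \<le> r" for x' i
    proof -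
      have "conv_grad f \<psi> x $ i - conv_grad f \<psi> x' $ i = (LINT y|lebesgue. f y * (kernel_grad \<psi> (x - y) $ i - kernel_grad \<psi> (x' - y) $ i))"
        unfolding conv_grad_def convolution_def using i2[OF x] i2[OF x'] by (simp add: right_diff_distrib)
      also have "\<bar>\<dots>\<bar> \<le> M * (K * norm (x - x')) * measure lborel (cball (0 :: real ^ 'd) (r + Q))"
      proof (rule integral_bounded_support(2)[OF f M(2) _ _ _ M(1)])
        show "(\<lambda>y. kernel_grad \<psi> (x - y) $ i - kernel_grad \<psi> (x' - y) $ i) \<in> borel_measurable borel" using m2 by simp
        show "\<bar>kernel_grad \<psi> (x - y) $ i - kernel_grad \<psi> (x' - y) $ i\<bar> \<le> K * norm (x - x')" for y
          using K(8)[of "x - y" "x' - y"] component_le_norm_cart[of "kernel_grad \<psi> (x - y) - kernel_grad \<psi> (x' - y)" i] by simp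
        show "kernel_grad \<psi> (x - y) $ i - kernel_grad \<psi> (x' - y) $ i = 0" if "r + Q < norm y" for y
          using K(4)[OF far[OF x that]] K(4)[OF far[OF x' that]] by simp
      qed
      finally show ?thesis by (simp add: mult.commute mult.left_commute)
    qed
    show "\<bar>convolution f \<psi> (x + h) - convolution f \<psi> x - h \<bullet> conv_grad f \<psi> x\<bar>
         \<le> M * K * measure lborel (cball (0 :: real ^ 'd) (r + Q)) * norm h ^ 2" if xh: "norm (x + h) \<le> r" for h
    proof -
      have "h \<bullet> conv_grad f \<psi> x = (\<Sum>i\<in>UNIV. h $ i * (LINT y|lebesgue. f y * kernel_grad \<psi> (x - y) $ i))"
        by (simp add: inner_vec_def conv_grad_def convolution_def)
      also have "\<dots> = (\<Sum>i\<in>UNIV. (LINT y|lebesgue. h $ i * (f y * kernel_grad \<psi> (x - y) $ i)))"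
        by simp
      also have "\<dots> = (LINT y|lebesgue. (\<Sum>i\<in>UNIV. h $ i * (f y * kernel_grad \<psi> (x - y) $ i)))"
        using i2[OF x] by (intro Bochner_Integration.integral_sum[symmetric] integrable_mult_right) auto
      also have "\<dots> = (LINT y|lebesgue. f y * (h \<bullet> kernel_grad \<psi> (x - y)))"
        by (intro Bochner_Integration.integral_cong) (auto simp: inner_vec_def sum_distrib_left mult.left_commute)
      finally have 1: "h \<bullet> conv_grad f \<psi> x = (LINT y|lebesgue. f y * (h \<bullet> kernel_grad \<psi> (x - y)))" .
      have i3: "integrable lebesgue (\<lambda>y. f y * (h \<bullet> kernel_grad \<psi> (x - y)))"
      proof -
        have "integrable lebesgue (\<lambda>y. \<Sum>i\<in>UNIV. h $ i * (f y * kernel_grad \<psi> (x - y) $ i))"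
          using i2[OF x] by (intro Bochner_Integration.integrable_sum integrable_mult_right) auto
        then show ?thesis by (simp add: inner_vec_def sum_distrib_left mult.left_commute)
      qed
      have "convolution f \<psi> (x + h) - convolution f \<psi> x - h \<bullet> conv_grad f \<psi> x
          = (LINT y|lebesgue. f y * (\<psi> (x + h - y) - \<psi> (x - y) - h \<bullet> kernel_grad \<psi> (x - y)))"
        unfolding convolution_def 1 using i1[OF xh] i1[OF x] i3 by (simp add: right_diff_distrib)
      also have "\<bar>\<dots>\<bar> \<le> M * (K * norm h ^ 2) * measure lborel (cball (0 :: real ^ 'd) (r + Q))"
      proof (rule integral_bounded_support(2)[OF f M(2) _ _ _ M(1)])
        show "(\<lambda>y. \<psi> (x + h - y) - \<psi> (x - y) - h \<bullet> kernel_grad \<psi> (x - y)) \<in> borel_measurable borel"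
          using m1 m2' by simp
        show "\<bar>\<psi> (x + h - y) - \<psi> (x - y) - h \<bullet> kernel_grad \<psi> (x - y)\<bar> \<le> K * norm h ^ 2" for y
          using K(9)[of "x - y" h] by (simp add: algebra_simps)
        show "\<psi> (x + h - y) - \<psi> (x - y) - h \<bullet> kernel_grad \<psi> (x - y) = 0" if "r + Q < norm y" for y
          using K(3)[OF far[OF x that]] K(3)[OF far[OF xh that]] K(4)[OF far[OF x that]] by simp
      qed
      finally show ?thesis by (simp add: mult.commute mult.left_commute)
    qed
  qed
qed

lemma antimono_locally_bounded:
  fixes f :: "real ^ 'd \<Rightarrow> real"
  assumes "antimono f"
  obtains M where "0 \<le> M" "\<And>y. norm y \<le> Q \<Longrightarrow> \<bar>f y\<bar> \<le> M"
  using antimono_bounded[OF assms, of _ Q] that[of "max \<bar>f (Q *\<^sub>R 1)\<bar> \<bar>f (- (Q *\<^sub>R 1))\<bar>"] by auto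

lemma conv_integrable:
  fixes f :: "real ^ 'd \<Rightarrow> real"
  assumes ker: "kernel \<psi> a b" and f: "antimono f"
  shows "integrable lebesgue (\<lambda>y. f y * \<psi> (x - y))"
proof -
  obtain L Q where LQ: "\<And>f M r x. \<lbrakk>f \<in> borel_measurable lebesgue; 0 \<le> M; \<And>y. norm y \<le> r + Q \<Longrightarrow> \<bar>f y\<bar> \<le> M; norm x \<le> r\<rbrakk> \<Longrightarrow>
       integrable lebesgue (\<lambda>y. f y * \<psi> (x - y))"
    by (rule conv_estimates[OF ker]) blast
  obtain M where M: "0 \<le> M" "\<And>y. norm y \<le> norm x + Q \<Longrightarrow> \<bar>f y\<bar> \<le> M"
    by (rule antimono_locally_bounded[OF f, where Q = "norm x + Q"]) blast
  show ?thesis by (rule LQ[OF antimono_lebesgue_measurable[OF f] M order_refl])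
qed

lemma conv_mono:
  fixes f g :: "real ^ 'd \<Rightarrow> real"
  assumes ker: "kernel \<psi> a b" and f: "antimono f" and g: "antimono g"
    and le: "\<And>y. \<psi> (x - y) \<noteq> 0 \<Longrightarrow> f y \<le> g y"
  shows "convolution f \<psi> x \<le> convolution g \<psi> x"
  unfolding convolution_def
proof (rule Bochner_Integration.integral_mono[OF conv_integrable[OF ker f] conv_integrable[OF ker g]])
  fix y
  have "0 \<le> \<psi> (x - y)" using ker unfolding kernel_def by simp
  then show "f y * \<psi> (x - y) \<le> g y * \<psi> (x - y)"
    using le[of y] by (cases "\<psi> (x - y) = 0") (auto intro: mult_right_mono)
qed

lemma conv_const:
  fixes \<psi> :: "real ^ 'd \<Rightarrow> real"
  assumes ker: "kernel \<psi> a b"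
  shows "convolution (\<lambda>_. c) \<psi> x = c"
proof -
  have pm: "\<psi> \<in> borel_measurable borel" by (rule borel_measurable_continuous_onI[OF kernel_continuous(1)[OF ker]])
  have pm': "(\<lambda>y. \<psi> (x - y)) \<in> borel_measurable borel" by (rule measurable_compose[OF _ pm]) simp
  have "(LINT y|lebesgue. \<psi> (x - y)) = (LINT y|lborel. \<psi> (x - y))"
    using pm' by (intro integral_completion) simp
  also have "\<dots> = (LINT y|density (distr lborel borel (\<lambda>y. x + (-1) *\<^sub>R y)) (\<lambda>_. ennreal (\<bar>- 1\<bar> ^ DIM(real ^ 'd))). \<psi> (x - y))"
    using lborel_affine[of "-1" x] by simp
  also have "\<dots> = (LINT y|distr lborel borel (\<lambda>y. x + (-1) *\<^sub>R y). \<psi> (x - y))"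
    by (simp add: density_1)
  also have "\<dots> = (LINT y|lborel. \<psi> (x - (x + (-1) *\<^sub>R y)))"
    using pm' by (intro integral_distr) auto
  also have "\<dots> = 1" using ker unfolding kernel_def by simp
  finally show ?thesis unfolding convolution_def by simp
qed

lemma antimono_const_vec: "antimono (\<lambda>_ :: real ^ 'd. c :: real)"
  by (simp add: antimono_def)

text \<open>
  A decreasing function is bounded on the support of the kernel by its values at the two extreme
  corners.
\<close>

lemma conv_between:
  fixes f :: "real ^ 'd \<Rightarrow> real"
  assumes ker: "kernel \<psi> a b" and f: "antimono f"
  shows "f (x - a *\<^sub>R 1) \<le> convolution f \<psi> x" "convolution f \<psi> x \<le> f (x - b *\<^sub>R 1)"
proof -
  have supp: "x - b *\<^sub>R 1 \<le> y \<and> y \<le> x - a *\<^sub>R 1" if "\<psi> (x - y) \<noteq> 0" for y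
    using ker that unfolding kernel_def less_eq_vec_def by (force simp: algebra_simps)
  have "convolution (\<lambda>_. f (x - a *\<^sub>R 1)) \<psi> x \<le> convolution f \<psi> x"
    using supp by (intro conv_mono[OF ker antimono_const_vec f]) (blast intro: antimonoD[OF f])
  then show "f (x - a *\<^sub>R 1) \<le> convolution f \<psi> x" using conv_const[OF ker] by simp
  have "convolution f \<psi> x \<le> convolution (\<lambda>_. f (x - b *\<^sub>R 1)) \<psi> x"
    using supp by (intro conv_mono[OF ker f antimono_const_vec]) (blast intro: antimonoD[OF f])
  then show "convolution f \<psi> x \<le> f (x - b *\<^sub>R 1)" using conv_const[OF ker] by simp
qed

lemma antimono_translate: "antimono f \<Longrightarrow> antimono (\<lambda>y :: real ^ 'd. (f (c + y) :: real))"
  by (simp add: antimono_def)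

lemma conv_translate:
  fixes f :: "real ^ 'd \<Rightarrow> real"
  assumes "kernel \<psi> a b" "antimono f"
  shows "convolution (\<lambda>y. f (c + y)) \<psi> x = convolution f \<psi> (c + x)"
  by (rule convolution_translate[OF antimono_isCont_ae[OF assms(2)] kernel_continuous(1)[OF assms(1)]])

lemma conv_antimono:
  fixes f :: "real ^ 'd \<Rightarrow> real"
  assumes ker: "kernel \<psi> a b" and f: "antimono f"
  shows "antimono (convolution f \<psi>)"
proof (rule antimonoI)
  fix x y :: "real ^ 'd" assume "x \<le> y"
  then have "z \<le> (y - x) + z" for z by (simp add: less_eq_vec_def)
  then have "convolution (\<lambda>z. f ((y - x) + z)) \<psi> x \<le> convolution f \<psi> x"
    by (intro conv_mono[OF ker antimono_translate[OF f] f] antimonoD[OF f])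
  then show "convolution f \<psi> y \<le> convolution f \<psi> x" using conv_translate[OF ker f, of "y - x" x] by simp
qed

lemma conv_taylor:
  fixes f :: "real ^ 'd \<Rightarrow> real"
  assumes ker: "kernel \<psi> a b" and f: "antimono f"
  obtains L where "0 \<le> L" "\<And>h. norm h \<le> 1 \<Longrightarrow>
    \<bar>convolution f \<psi> (x + h) - convolution f \<psi> x - h \<bullet> conv_grad f \<psi> x\<bar> \<le> L * norm h ^ 2"
proof -
  obtain L Q where LQ: "0 \<le> L" "\<And>f M r x h. \<lbrakk>f \<in> borel_measurable lebesgue; 0 \<le> M; \<And>y. norm y \<le> r + Q \<Longrightarrow> \<bar>f y\<bar> \<le> M; norm x \<le> r; norm (x + h) \<le> r\<rbrakk> \<Longrightarrow>
       \<bar>convolution f \<psi> (x + h) - convolution f \<psi> x - h \<bullet> conv_grad f \<psi> x\<bar>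
         \<le> M * L * measure lborel (cball (0 :: real ^ 'd) (r + Q)) * norm h ^ 2"
    by (rule conv_estimates[OF ker]) blast
  define r where "r = norm x + 1"
  obtain M where M: "0 \<le> M" "\<And>y. norm y \<le> r + Q \<Longrightarrow> \<bar>f y\<bar> \<le> M"
    by (rule antimono_locally_bounded[OF f, where Q = "r + Q"]) blast
  show ?thesis
  proof (rule that[of "M * L * measure lborel (cball (0 :: real ^ 'd) (r + Q))"])
    show "0 \<le> M * L * measure lborel (cball (0 :: real ^ 'd) (r + Q))" using M LQ(1) by simp
    fix h :: "real ^ 'd" assume "norm h \<le> 1"
    then have "norm (x + h) \<le> r" using norm_triangle_ineq[of x h] unfolding r_def by linarith
    then show "\<bar>convolution f \<psi> (x + h) - convolution f \<psi> x - h \<bullet> conv_grad f \<psi> x\<bar>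
        \<le> M * L * measure lborel (cball (0 :: real ^ 'd) (r + Q)) * norm h ^ 2"
      by (intro LQ(2)[OF antimono_lebesgue_measurable[OF f] M]) (auto simp: r_def)
  qed
qed

lemma gderiv_if_taylor:
  fixes F :: "real ^ 'd \<Rightarrow> real"
  assumes L: "0 \<le> L" "\<And>h. norm h \<le> 1 \<Longrightarrow> \<bar>F (x + h) - F x - h \<bullet> G\<bar> \<le> L * norm h ^ 2"
  shows "GDERIV F x :> G"
  unfolding gderiv_def has_derivative_at_alt
proof (intro conjI allI impI)
  show "bounded_linear (\<lambda>h. h \<bullet> G)" by (rule bounded_linear_inner_left)
  fix e :: real assume e: "e > 0"
  show "\<exists>d>0. \<forall>y. norm (y - x) < d \<longrightarrow> norm (F y - F x - (y - x) \<bullet> G) \<le> e * norm (y - x)"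
  proof (intro exI[of _ "min 1 (e / (L + 1))"] conjI allI impI)
    show "0 < min 1 (e / (L + 1))" using e L(1) by simp
    fix y assume y: "norm (y - x) < min 1 (e / (L + 1))"
    then have "norm (F y - F x - (y - x) \<bullet> G) \<le> L * norm (y - x) ^ 2" using L(2)[of "y - x"] by simp
    also have "\<dots> = (L * norm (y - x)) * norm (y - x)" by (simp add: power2_eq_square)
    also have "\<dots> \<le> e * norm (y - x)"
    proof (rule mult_right_mono)
      have "L * norm (y - x) \<le> (L + 1) * norm (y - x)" by (intro mult_right_mono) auto
      also have "\<dots> \<le> (L + 1) * (e / (L + 1))" using y L(1) by (intro mult_left_mono) auto
      also have "\<dots> = e" using L(1) by simp
      finally show "L * norm (y - x) \<le> e" .
    qed simp
    finally show "norm (F y - F x - (y - x) \<bullet> G) \<le> e * norm (y - x)" .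
  qed
qed

lemma conv_gderiv:
  fixes f :: "real ^ 'd \<Rightarrow> real"
  assumes "kernel \<psi> a b" "antimono f"
  shows "GDERIV (convolution f \<psi>) x :> conv_grad f \<psi> x"
  using conv_taylor[OF assms, of x] gderiv_if_taylor by metis

lemma conv_grad_nonpos:
  fixes f :: "real ^ 'd \<Rightarrow> real"
  assumes ker: "kernel \<psi> a b" and f: "antimono f"
  shows "conv_grad f \<psi> x $ i \<le> 0"
proof (rule ccontr)
  assume "\<not> conv_grad f \<psi> x $ i \<le> 0"
  then have g: "conv_grad f \<psi> x $ i > 0" (is "?g > 0") by simp
  obtain L where L: "0 \<le> L" "\<And>h. norm h \<le> 1 \<Longrightarrow>
    \<bar>convolution f \<psi> (x + h) - convolution f \<psi> x - h \<bullet> conv_grad f \<psi> x\<bar> \<le> L * norm h ^ 2"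
    by (rule conv_taylor[OF ker f, where x = x]) blast
  define P where "P = L + 1"
  have P: "P > 0" "L \<le> P" using L(1) unfolding P_def by auto
  define \<tau> where "\<tau> = min 1 (?g / (2 * P))"
  have \<tau>: "\<tau> > 0" "\<tau> \<le> 1" unfolding \<tau>_def using g P by auto
  have "x \<le> x + \<tau> *\<^sub>R axis i 1" using \<tau> by (simp add: less_eq_vec_def axis_def)
  then have "convolution f \<psi> (x + \<tau> *\<^sub>R axis i 1) \<le> convolution f \<psi> x"
    by (rule antimonoD[OF conv_antimono[OF ker f]])
  moreover have "\<bar>convolution f \<psi> (x + \<tau> *\<^sub>R axis i 1) - convolution f \<psi> x - \<tau> * ?g\<bar> \<le> L * \<tau> ^ 2"
    using L(2)[of "\<tau> *\<^sub>R axis i 1"] \<tau> by (simp add: inner_axis')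
  ultimately have "\<tau> * ?g \<le> L * \<tau> ^ 2" by linarith
  then have "\<tau> * ?g \<le> \<tau> * (L * \<tau>)" by (simp add: power2_eq_square mult.commute mult.left_commute)
  then have "?g \<le> L * \<tau>" using \<tau>(1) by simp
  also have "\<dots> \<le> P * (?g / (2 * P))"
    using P \<tau> unfolding \<tau>_def by (intro mult_mono) auto
  also have "\<dots> = ?g / 2" using P(1) by simp
  finally show False using g by simp
qed

text \<open>
  For a small fixed step \<open>h\<close>, difference quotients approximate the gradient uniformly in time, and they
  are continuous in time by hypothesis.
\<close>

lemma conv_grad_continuous_in_time:
  fixes u :: "real \<Rightarrow> real ^ 'd \<Rightarrow> real"
  assumes ker: "kernel \<psi> a b" and u: "\<And>t. t \<in> S \<Longrightarrow> antimono (u t)"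
    and bdd: "\<And>r. \<exists>M. \<forall>t\<in>S. \<forall>y. norm y \<le> r \<longrightarrow> \<bar>u t y\<bar> \<le> M"
    and cont: "\<And>y. continuous (at \<tau> within S) (\<lambda>t. convolution (u t) \<psi> y)"
    and \<tau>: "\<tau> \<in> S" and \<eta>: "\<eta> > 0"
  shows "\<exists>d>0. \<forall>t\<in>S. \<forall>y. dist t \<tau> < d \<longrightarrow> dist y x < d \<longrightarrow>
    (\<forall>i. \<bar>conv_grad (u t) \<psi> y $ i - conv_grad (u \<tau>) \<psi> x $ i\<bar> < \<eta>)"
proof -
  obtain L Q where LQ: "0 \<le> L" "0 \<le> Q"
    "\<And>f M r x x' i. \<lbrakk>f \<in> borel_measurable lebesgue; 0 \<le> M; \<And>y. norm y \<le> r + Q \<Longrightarrow> \<bar>f y\<bar> \<le> M; norm x \<le> r; norm x' \<le> r\<rbrakk> \<Longrightarrow>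
       \<bar>conv_grad f \<psi> x $ i - conv_grad f \<psi> x' $ i\<bar> \<le> M * L * measure lborel (cball (0 :: real ^ 'd) (r + Q)) * norm (x - x')"
    "\<And>f M r x h. \<lbrakk>f \<in> borel_measurable lebesgue; 0 \<le> M; \<And>y. norm y \<le> r + Q \<Longrightarrow> \<bar>f y\<bar> \<le> M; norm x \<le> r; norm (x + h) \<le> r\<rbrakk> \<Longrightarrow>
       \<bar>convolution f \<psi> (x + h) - convolution f \<psi> x - h \<bullet> conv_grad f \<psi> x\<bar>
         \<le> M * L * measure lborel (cball (0 :: real ^ 'd) (r + Q)) * norm h ^ 2"
    by (rule conv_estimates[OF ker]) blast
  define r where "r = norm x + 1"
  obtain M0 where M0: "\<forall>t\<in>S. \<forall>y. norm y \<le> r + Q \<longrightarrow> \<bar>u t y\<bar> \<le> M0" using bdd by blast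
  define M where "M = max M0 0"
  have M: "0 \<le> M" "\<And>t y. t \<in> S \<Longrightarrow> norm y \<le> r + Q \<Longrightarrow> \<bar>u t y\<bar> \<le> M"
    using M0 unfolding M_def by (auto simp: le_max_iff_disj)
  define A where "A = M * L * measure lborel (cball (0 :: real ^ 'd) (r + Q)) + 1"
  have A: "A > 0" "M * L * measure lborel (cball (0 :: real ^ 'd) (r + Q)) \<le> A"
    unfolding A_def using M(1) LQ(1) by (auto simp: add_nonneg_pos)
  note meas = antimono_lebesgue_measurable[OF u]
  define h where "h = min 1 (\<eta> / (8 * A))"
  have h: "h > 0" "h \<le> 1" "A * h \<le> \<eta> / 8" unfolding h_def using A(1) \<eta> by (auto simp: min_def field_simps)
  have quot: "\<bar>(convolution (u t) \<psi> (x + h *\<^sub>R axis i 1) - convolution (u t) \<psi> x) / h - conv_grad (u t) \<psi> x $ i\<bar> \<le> \<eta> / 8"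
    if t: "t \<in> S" for t i
  proof -
    have "norm (x + h *\<^sub>R axis i 1) \<le> r" unfolding r_def using norm_triangle_ineq[of x "h *\<^sub>R axis i 1"] h by simp
    then have "\<bar>convolution (u t) \<psi> (x + h *\<^sub>R axis i 1) - convolution (u t) \<psi> x - (h *\<^sub>R axis i 1) \<bullet> conv_grad (u t) \<psi> x\<bar>
        \<le> M * L * measure lborel (cball (0 :: real ^ 'd) (r + Q)) * norm (h *\<^sub>R axis i 1 :: real ^ 'd) ^ 2"
      by (intro LQ(4)[OF meas[OF t] M(1) M(2)[OF t]]) (auto simp: r_def)
    also have "\<dots> \<le> A * h ^ 2" using A(2) h(1) by (simp add: mult_right_mono)
    finally have "\<bar>convolution (u t) \<psi> (x + h *\<^sub>R axis i 1) - convolution (u t) \<psi> x - h * conv_grad (u t) \<psi> x $ i\<bar> \<le> (A * h) * h"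
      by (simp add: inner_axis' power2_eq_square)
    also have "\<dots> \<le> (\<eta> / 8) * h" using h by (intro mult_right_mono) auto
    finally have "\<bar>convolution (u t) \<psi> (x + h *\<^sub>R axis i 1) - convolution (u t) \<psi> x - h * conv_grad (u t) \<psi> x $ i\<bar> / h \<le> \<eta> / 8"
      using h(1) by (simp add: pos_divide_le_eq)
    also have "\<bar>convolution (u t) \<psi> (x + h *\<^sub>R axis i 1) - convolution (u t) \<psi> x - h * conv_grad (u t) \<psi> x $ i\<bar> / h
      = \<bar>(convolution (u t) \<psi> (x + h *\<^sub>R axis i 1) - convolution (u t) \<psi> x - h * conv_grad (u t) \<psi> x $ i) / h\<bar>"
      using h(1) by (simp add: abs_divide)
    also have "(convolution (u t) \<psi> (x + h *\<^sub>R axis i 1) - convolution (u t) \<psi> x - h * conv_grad (u t) \<psi> x $ i) / h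
      = (convolution (u t) \<psi> (x + h *\<^sub>R axis i 1) - convolution (u t) \<psi> x) / h - conv_grad (u t) \<psi> x $ i"
      using h(1) by (simp add: diff_divide_distrib)
    finally show ?thesis .
  qed
  have "\<exists>d>0. \<forall>t\<in>S. dist t \<tau> < d \<longrightarrow> \<bar>conv_grad (u t) \<psi> x $ i - conv_grad (u \<tau>) \<psi> x $ i\<bar> < \<eta> / 2" for i
  proof -
    define q where "q t = (convolution (u t) \<psi> (x + h *\<^sub>R axis i 1) - convolution (u t) \<psi> x) / h" for t
    have "continuous (at \<tau> within S) q" unfolding q_def[abs_def] using h(1) by (intro continuous_intros cont) auto
    then obtain d where d: "d > 0" "\<And>t. t \<in> S \<Longrightarrow> dist t \<tau> < d \<Longrightarrow> dist (q t) (q \<tau>) < \<eta> / 8"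
      unfolding continuous_within_eps_delta using \<eta> by (metis divide_pos_pos zero_less_numeral)
    have "\<bar>conv_grad (u t) \<psi> x $ i - conv_grad (u \<tau>) \<psi> x $ i\<bar> < \<eta> / 2" if "t \<in> S" "dist t \<tau> < d" for t
      using quot[OF that(1), of i] quot[OF \<tau>, of i] d(2)[OF that] \<eta> unfolding q_def[symmetric] dist_real_def by linarith
    with d(1) show ?thesis by blast
  qed
  then have "\<forall>i. \<exists>d>0. \<forall>t\<in>S. dist t \<tau> < d \<longrightarrow> \<bar>conv_grad (u t) \<psi> x $ i - conv_grad (u \<tau>) \<psi> x $ i\<bar> < \<eta> / 2" by blast
  from choice[OF this] obtain d where d: "\<And>i. d i > 0"
    "\<And>i t. t \<in> S \<Longrightarrow> dist t \<tau> < d i \<Longrightarrow> \<bar>conv_grad (u t) \<psi> x $ i - conv_grad (u \<tau>) \<psi> x $ i\<bar> < \<eta> / 2" by blast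
  define d0 where "d0 = min (Min (range d)) (min 1 (\<eta> / (4 * A)))"
  have dd: "d0 \<le> d i" for i unfolding d0_def by (intro min.coboundedI1 Min_le) auto
  have "0 < Min (range d)" using d(1) by (subst Min_gr_iff) auto
  then have d0: "d0 > 0" "d0 \<le> 1" unfolding d0_def using \<eta> A(1) by auto
  have "d0 \<le> \<eta> / (4 * A)" unfolding d0_def by simp
  then have "A * d0 \<le> A * (\<eta> / (4 * A))" using A(1) by (intro mult_left_mono) auto
  also have "\<dots> = \<eta> / 4" using A(1) by simp
  finally have d0A: "A * d0 \<le> \<eta> / 4" .
  have "\<bar>conv_grad (u t) \<psi> y $ i - conv_grad (u \<tau>) \<psi> x $ i\<bar> < \<eta>" if t: "t \<in> S" "dist t \<tau> < d0" and y: "dist y x < d0" for t y i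
  proof -
    have "norm y \<le> norm x + norm (y - x)" using norm_triangle_ineq[of x "y - x"] by simp
    then have "norm y \<le> r" using y d0(2) unfolding r_def dist_norm by linarith
    then have "\<bar>conv_grad (u t) \<psi> y $ i - conv_grad (u t) \<psi> x $ i\<bar>
        \<le> M * L * measure lborel (cball (0 :: real ^ 'd) (r + Q)) * norm (y - x)"
      by (intro LQ(3)[OF meas[OF t(1)] M(1) M(2)[OF t(1)]]) (auto simp: r_def)
    also have "\<dots> \<le> A * d0" using A y by (intro mult_mono) (auto simp: dist_norm)
    finally have "\<bar>conv_grad (u t) \<psi> y $ i - conv_grad (u t) \<psi> x $ i\<bar> \<le> \<eta> / 4" using d0A by linarith
    moreover have "\<bar>conv_grad (u t) \<psi> x $ i - conv_grad (u \<tau>) \<psi> x $ i\<bar> < \<eta> / 2"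
      using t dd[of i] by (intro d(2)) auto
    ultimately show ?thesis using \<eta> by linarith
  qed
  with d0(1) show ?thesis by blast
qed

section \<open>The regular Lagrangian flow\<close>

text \<open>
  \<open>B y\<close> is the limit of \<open>b (y + \<delta> *\<^sub>R 1)\<close> as \<open>\<delta>\<close> decreases to \<open>0\<close>, written without limits. The increasing
  functions \<open>b\<close> and \<open>B\<close> have the same envelopes.
\<close>

definition regularises_at :: "(real ^ 'd \<Rightarrow> real ^ 'd) \<Rightarrow> (real ^ 'd \<Rightarrow> real ^ 'd) \<Rightarrow> bool" where
  "regularises_at B b \<longleftrightarrow> mono b \<and> (\<forall>y. b y \<le> B y) \<and>
     (\<forall>y y' \<delta>. \<delta> > 0 \<longrightarrow> y + \<delta> *\<^sub>R 1 \<le> y' \<longrightarrow> B y \<le> b y') \<and>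
     (\<forall>y i e. e > 0 \<longrightarrow> (\<exists>q \<delta>. \<delta> > 0 \<and> y + \<delta> *\<^sub>R 1 \<le> q \<and> b q $ i < B y $ i + e))"

lemma norm_le_if_in_unit_box:
  fixes y z :: "real ^ 'd"
  assumes "\<And>i. \<bar>z $ i - y $ i\<bar> \<le> 1"
  shows "norm z \<le> norm y + real CARD('d)"
  using norm_le_card_mult[of "z - y" 1] assms norm_triangle_ineq[of y "z - y"] by simp

lemma ae_meets_open:
  fixes U :: "'a::euclidean_space set"
  assumes "AE x in lborel. P x" and "open U" "U \<noteq> {}"
  shows "\<exists>x\<in>U. P x"
proof (rule ccontr)
  assume "\<not> ?thesis"
  then have sub: "U \<subseteq> {x \<in> space lborel. \<not> P x}" by auto
  obtain N where N: "{x \<in> space lborel. \<not> P x} \<subseteq> N" "N \<in> null_sets lborel"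
    using AE_E[OF assms(1)] by (metis null_setsI)
  have "emeasure lborel U \<le> emeasure lborel N" using sub N by (intro emeasure_mono) auto
  then have "emeasure lborel U = 0" using N by auto
  then have "U \<in> null_sets lebesgue" using assms(2) by (intro null_sets_completionI null_setsI) auto
  then have "negligible U" by (simp add: negligible_iff_null_sets)
  then show False using open_not_negligible assms(2,3) by blast
qed

lemma ae_meets_box:
  fixes y z :: "real ^ 'd"
  assumes "AE x in lborel. P x" and "\<And>i. y $ i < z $ i"
  shows "\<exists>x\<in>box y z. P x"
proof (rule ae_meets_open[OF assms(1) open_box])
  have "(\<chi> i. (y $ i + z $ i) / 2) \<in> box y z" using assms(2) by (auto simp: mem_box_cart)
  then show "box y z \<noteq> {}" by blast
qed

lemma AE_lebesgue_on_if_AE_lborel: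
  fixes P :: "'a::euclidean_space \<Rightarrow> bool"
  assumes "A \<in> sets lebesgue" "AE t in lborel. t \<in> A \<longrightarrow> P t"
  shows "AE t in lebesgue_on A. P t"
  using AE_completion[OF assms(2)] assms(1) by (subst AE_restrict_space_iff) auto

lemma AE_lborel_if_AE_lebesgue_on:
  fixes P :: "'a::euclidean_space \<Rightarrow> bool"
  assumes "A \<in> sets lebesgue" "AE t in lebesgue_on A. P t"
  shows "AE t in lborel. t \<in> A \<longrightarrow> P t"
proof -
  have "AE t in lebesgue. t \<in> A \<longrightarrow> P t"
    using assms by (subst (asm) AE_restrict_space_iff) auto
  then show ?thesis by (simp add: AE_completion_iff)
qed

lemma Icc_sets_lebesgue: "{a..c :: real} \<in> sets lebesgue" by simp

text \<open>
  \<open>B t y\<close> is the infimum of \<open>b t q\<close> over the points \<open>q > y\<close> of a countable dense set \<open>D\<close>, so it is jointly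
  Borel as soon as all \<open>b \<sqdot> q\<close> with \<open>q \<in> D\<close> are Borel in time. A section of \<open>b\<close> may be non-measurable,
  but almost every section agrees almost everywhere with a section of a Borel function \<open>g\<close>, and \<open>D\<close> is
  chosen among the points where this is so. The growth bound, which holds for almost all points, is
  carried over to all points by monotonicity: each \<open>y\<close> lies between two good points at distance at
  most \<open>1\<close> in each coordinate.
\<close>

lemma ex_regularised_field:
  fixes b :: "real \<Rightarrow> real ^ 'd \<Rightarrow> real ^ 'd"
  assumes T: "T > 0"
    and meas: "(\<lambda>(t, y). b t y) \<in> borel_measurable (lebesgue_on ({0..T} \<times> UNIV))"
    and C0: "\<forall>t\<in>{0..T}. 0 \<le> C0 t" "integrable (lebesgue_on {0..T}) C0"
    and growth: "AE (t, y) in lebesgue_on ({0..T} \<times> UNIV). norm (b t y) \<le> C0 t * (1 + norm y)"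
    and mono: "AE t in lebesgue_on {0..T}. mono (b t)"
  shows "\<exists>B C. growth_field B C \<and>
    (AE t in lborel. t \<in> {0..T} \<longrightarrow> regularises_at (B t) (b t))"
proof -
  let ?I = "{0..T} \<times> (UNIV :: (real ^ 'd) set)"
  have Im: "?I \<in> sets lebesgue"
    by (intro sets_completionI_sets) (simp add: borel_closed closed_Times)
  define b' where "b' z = (if z \<in> ?I then b (fst z) (snd z) else 0)" for z
  have b'm: "b' \<in> borel_measurable lebesgue"
    using meas Im unfolding b'_def case_prod_unfold by (simp add: borel_measurable_if)
  have "\<forall>i. \<exists>g. g \<in> borel_measurable lborel \<and> (AE z in lborel. b' z $ i = g z)"
    using completion_ex_borel_measurable_real[OF borel_measurable_vec_nth[OF b'm]] by blast
  from choice[OF this] obtain g where g: "\<And>i. g i \<in> borel_measurable lborel" "\<And>i. AE z in lborel. b' z $ i = g i z"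
    by blast
  have "AE z in lborel. \<forall>i. b' z $ i = g i z" using g(2) by (subst AE_all_countable) auto
  then have "AE z in lebesgue. \<forall>i. b' z $ i = g i z" by (rule AE_completion)
  from AE_lebesgue_sections(2)[OF this]
  have aeY: "AE y in lborel. AE t in lborel. \<forall>i. b' (t, y) $ i = g i (t, y)" .
  define Y where "Y = {y. AE t in lborel. \<forall>i. b' (t, y) $ i = g i (t, y)}"
  obtain D where D: "countable D" "D \<subseteq> Y" "Y \<subseteq> closure D" by (rule separable[of Y])
  have dense: "\<exists>q\<in>D. (\<forall>j. y $ j < q $ j) \<and> (\<forall>j. q $ j < z $ j)" if yz: "\<And>j. y $ j < z $ j" for y z
  proof -
    have "\<exists>x\<in>box y z. AE t in lborel. \<forall>i. b' (t, x) $ i = g i (t, x)" by (rule ae_meets_box[OF aeY yz])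
    then obtain x where "x \<in> box y z" "x \<in> Y" unfolding Y_def by blast
    then have "box y z \<inter> closure D \<noteq> {}" using D(3) by blast
    then have "box y z \<inter> D \<noteq> {}" using open_Int_closure_eq_empty[OF open_box] by blast
    then obtain q where q: "q \<in> box y z" "q \<in> D" by blast
    from q(1) have "(\<forall>j. y $ j < q $ j) \<and> (\<forall>j. q $ j < z $ j)" by (simp add: mem_box_cart)
    with q(2) show ?thesis by blast
  qed
  have gD: "AE t in lborel. \<forall>q\<in>D. \<forall>i. b' (t, q) $ i = g i (t, q)"
    using D(2) unfolding Y_def by (subst AE_ball_countable[OF D(1)]) auto
  have growth': "AE t in lborel. AE y in lborel. t \<in> {0..T} \<longrightarrow> norm (b t y) \<le> C0 t * (1 + norm y)"
  proof -
    have "AE z in lebesgue. z \<in> ?I \<longrightarrow> (case z of (t, y) \<Rightarrow> norm (b t y) \<le> C0 t * (1 + norm y))"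
      using growth Im by (subst (asm) AE_restrict_space_iff) auto
    from AE_lebesgue_sections(1)[OF this] show ?thesis by simp
  qed
  have mono': "AE t in lborel. t \<in> {0..T} \<longrightarrow> mono (b t)"
    by (rule AE_lborel_if_AE_lebesgue_on[OF _ mono]) simp
  have hint: "integrable lebesgue (\<lambda>t. indicator {0..T} t *\<^sub>R C0 t)"
    using C0(2) by (subst (asm) integrable_restrict_space) auto
  then obtain C1 where C1: "C1 \<in> borel_measurable lborel" "AE t in lborel. indicator {0..T} t *\<^sub>R C0 t = C1 t"
    using completion_ex_borel_measurable_real[OF borel_measurable_integrable[OF hint]] by blast
  have "integrable lebesgue C1"
  proof (rule integrable_cong_AE_imp[OF hint])
    show "C1 \<in> borel_measurable lebesgue" using C1(1) by (rule measurable_completion)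
    show "AE t in lebesgue. indicator {0..T} t *\<^sub>R C0 t = C1 t"
      using AE_completion[OF C1(2)] by eventually_elim simp
  qed
  then have C1int: "integrable lborel C1" using C1(1) by (simp add: integrable_completion)
  define good where "good t \<longleftrightarrow> mono (b t) \<and> (\<forall>q\<in>D. \<forall>i. b' (t, q) $ i = g i (t, q)) \<and>
      (AE y in lborel. norm (b t y) \<le> C0 t * (1 + norm y)) \<and> C0 t = C1 t" for t
  have "AE t in lborel. t \<in> {0..T} \<longrightarrow> good t"
    using gD growth' mono' C1(2)
  proof eventually_elim
    case (elim t)
    show ?case
    proof
      assume t: "t \<in> {0..T}"
      have "AE y in lborel. norm (b t y) \<le> C0 t * (1 + norm y)" using elim(2) by (rule eventually_mono) (use t in simp)
      then show "good t" unfolding good_def using elim t by simp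
    qed
  qed
  then obtain N where N: "\<And>t. t \<in> space lborel - N \<Longrightarrow> t \<in> {0..T} \<longrightarrow> good t" "N \<in> null_sets lborel"
    using AE_E3 by blast
  \<comment> \<open>off the good times \<open>G\<close> the field is \<open>0\<close>, so that it is Borel and increasing without exception\<close>
  define G where "G = {0..T} - N"
  have Gm: "G \<in> sets borel" using N(2) unfolding G_def by auto
  have good: "good t" "t \<in> {0..T}" if "t \<in> G" for t using that N(1) unfolding G_def by auto
  define n where "n = real CARD('d)"
  have n0: "0 \<le> n" unfolding n_def by simp
  have b_bound: "\<bar>b t y $ i\<bar> \<le> C1 t * ((1 + n) * (1 + norm y))" and C1nn: "0 \<le> C1 t" if t: "t \<in> G" for t y i
  proof -
    have gt: "mono (b t)" "AE y in lborel. norm (b t y) \<le> C0 t * (1 + norm y)" "C0 t = C1 t"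
      using good(1)[OF t] unfolding good_def by auto
    show C1t: "0 \<le> C1 t" using bspec[OF C0(1) good(2)[OF t]] unfolding gt(3) .
    have near: "\<bar>b t z $ i\<bar> \<le> C1 t * ((1 + n) * (1 + norm y))"
      if "norm (b t z) \<le> C0 t * (1 + norm z)" "\<And>j. \<bar>z $ j - y $ j\<bar> \<le> 1" for z
    proof -
      have "\<bar>b t z $ i\<bar> \<le> C1 t * (1 + norm z)" using that(1) gt(3) component_le_norm_cart[of "b t z" i] by simp
      also have "\<dots> \<le> C1 t * ((1 + n) * (1 + norm y))"
      proof (rule mult_left_mono[OF _ C1t])
        have "1 + norm z \<le> (1 + norm y) + n * 1" using norm_le_if_in_unit_box[of z y] that(2) unfolding n_def by simp
        also have "\<dots> \<le> (1 + norm y) + n * (1 + norm y)" using n0 by (intro add_left_mono mult_left_mono) auto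
        finally show "1 + norm z \<le> (1 + n) * (1 + norm y)" by (simp add: algebra_simps)
      qed
      finally show ?thesis .
    qed
    have "\<exists>z\<in>box y (y + 1). norm (b t z) \<le> C0 t * (1 + norm z)" by (rule ae_meets_box[OF gt(2)]) simp
    then obtain z where z: "z \<in> box y (y + 1)" "norm (b t z) \<le> C0 t * (1 + norm z)" by blast
    have "\<exists>z\<in>box (y - 1) y. norm (b t z) \<le> C0 t * (1 + norm z)" by (rule ae_meets_box[OF gt(2)]) simp
    then obtain w where w: "w \<in> box (y - 1) y" "norm (b t w) \<le> C0 t * (1 + norm w)" by blast
    have zj: "y $ j < z $ j \<and> z $ j < y $ j + 1" for j using z(1) by (simp add: mem_box_cart)
    have wj: "y $ j - 1 < w $ j \<and> w $ j < y $ j" for j using w(1) by (simp add: mem_box_cart)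
    have "\<bar>z $ j - y $ j\<bar> \<le> 1" for j using zj[of j] by linarith
    note bz = near[OF z(2) this]
    have "\<bar>w $ j - y $ j\<bar> \<le> 1" for j using wj[of j] by linarith
    note bw = near[OF w(2) this]
    have "y \<le> z" "w \<le> y" using zj wj by (auto simp: less_eq_vec_def less_imp_le)
    then have "b t y \<le> b t z" "b t w \<le> b t y" using gt(1) by (auto dest: monoD)
    then have "b t y $ i \<le> b t z $ i" "b t w $ i \<le> b t y $ i" by (auto simp: less_eq_vec_def)
    then show "\<bar>b t y $ i\<bar> \<le> C1 t * ((1 + n) * (1 + norm y))" using bz bw by linarith
  qed
  define B where "B t y = (\<chi> i. if t \<in> G then (INF q\<in>{q\<in>D. \<forall>j. y $ j < q $ j}. b t q $ i) else 0)" for t y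
  have B_eq: "B t y $ i = (INF q\<in>{q\<in>D. \<forall>j. y $ j < q $ j}. b t q $ i)" if "t \<in> G" for t y i
    using that unfolding B_def by simp
  have B_0: "B t y $ i = 0" if "t \<notin> G" for t y i using that unfolding B_def by simp
  have ne: "{q\<in>D. \<forall>j. y $ j < q $ j} \<noteq> {}" for y :: "real ^ 'd"
  proof -
    have "y $ j < (y + 1) $ j" for j by simp
    from dense[OF this] show ?thesis by blast
  qed
  have bmono: "b t y $ i \<le> b t q $ i" if "t \<in> G" "\<And>j. y $ j \<le> q $ j" for t y q i
  proof -
    have "y \<le> q" using that(2) by (simp add: less_eq_vec_def)
    moreover have "mono (b t)" using good(1)[OF that(1)] unfolding good_def by simp
    ultimately have "b t y \<le> b t q" by (rule monoD[rotated])
    then show ?thesis by (simp add: less_eq_vec_def)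
  qed
  have bdd: "bdd_below ((\<lambda>q. b t q $ i) ` {q\<in>D. \<forall>j. y $ j < q $ j})" if "t \<in> G" for t y i
    by (rule bdd_belowI2[of _ "b t y $ i"]) (use bmono[OF that] in \<open>auto simp: less_imp_le\<close>)
  have B_lower: "b t y $ i \<le> B t y $ i" if "t \<in> G" for t y i
    unfolding B_eq[OF that] using bmono[OF that] by (intro cINF_greatest[OF ne]) (auto simp: less_imp_le)
  have B_upper: "B t y $ i \<le> b t q $ i" if "t \<in> G" "q \<in> D" "\<And>j. y $ j < q $ j" for t y q i
    unfolding B_eq[OF that(1)] using that by (intro cINF_lower[OF bdd]) auto
  have reg: "regularises_at (B t) (b t)" if t: "t \<in> G" for t
    unfolding regularises_at_def
  proof (intro conjI allI impI)
    show "mono (b t)" using good(1)[OF t] unfolding good_def by simp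
    show "b t y \<le> B t y" for y using B_lower[OF t] by (simp add: less_eq_vec_def)
    show "B t y \<le> b t y'" if d: "\<delta> > 0" "y + \<delta> *\<^sub>R 1 \<le> y'" for y y' \<delta>
      unfolding less_eq_vec_def
    proof
      fix i
      have yd: "y $ j + \<delta> \<le> y' $ j" for j using d(2) by (simp add: less_eq_vec_def)
      have "y $ j < y' $ j" for j using yd[of j] d(1) by linarith
      then obtain q where q: "q \<in> D" "\<And>j. y $ j < q $ j" "\<And>j. q $ j < y' $ j" using dense[of y y'] by blast
      have "B t y $ i \<le> b t q $ i" by (rule B_upper[OF t q(1,2)])
      also have "\<dots> \<le> b t y' $ i" using q(3) by (intro bmono[OF t]) (simp add: less_imp_le)
      finally show "B t y $ i \<le> b t y' $ i" .
    qed
    fix y :: "real ^ 'd" and i and e :: real assume "e > 0"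
    then have "(INF q\<in>{q\<in>D. \<forall>j. y $ j < q $ j}. b t q $ i) < B t y $ i + e" unfolding B_eq[OF t] by simp
    then have "\<exists>v\<in>(\<lambda>q. b t q $ i) ` {q\<in>D. \<forall>j. y $ j < q $ j}. v < B t y $ i + e"
      by (rule cInf_lessD[rotated]) (use ne in simp)
    then obtain q where q: "\<And>j. y $ j < q $ j" "b t q $ i < B t y $ i + e" by auto
    define \<delta> where "\<delta> = Min (range (\<lambda>j. q $ j - y $ j))"
    have "\<delta> > 0" unfolding \<delta>_def using q(1) by (subst Min_gr_iff) auto
    moreover have "\<delta> \<le> q $ j - y $ j" for j unfolding \<delta>_def by (rule Min_le) auto
    then have "y + \<delta> *\<^sub>R 1 \<le> q" unfolding less_eq_vec_def by (simp add: algebra_simps)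
    ultimately show "\<exists>q \<delta>. \<delta> > 0 \<and> y + \<delta> *\<^sub>R 1 \<le> q \<and> b t q $ i < B t y $ i + e" using q(2) by blast
  qed
  define K where "K = n * ((1 + n) * (1 + n))"
  define C where "C t = K * (if t \<in> G then C1 t else 0)" for t
  have field: "growth_field B C"
  proof
    have comp: "(\<lambda>z. B (fst z) (snd z) $ i) \<in> borel_measurable borel" for i
    proof (rule borel_measurableI_less)
      fix a :: real
      have m1: "{z :: real \<times> (real ^ 'd). fst z \<in> G} \<in> sets borel"
      proof -
        have "fst \<in> borel_measurable (borel :: (real \<times> (real ^ 'd)) measure)"
          by (intro borel_measurable_continuous_onI continuous_intros)
        from measurable_sets[OF this Gm] show ?thesis by (simp add: vimage_def)
      qed
      have m2: "{z :: real \<times> (real ^ 'd). \<forall>j. snd z $ j < q $ j} \<in> sets borel" for q :: "real ^ 'd"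
      proof -
        have "open (\<Inter>j. {z :: real \<times> (real ^ 'd). snd z $ j < q $ j})"
          by (intro open_INT ballI open_Collect_less continuous_intros) simp
        moreover have "{z :: real \<times> (real ^ 'd). \<forall>j. snd z $ j < q $ j} = (\<Inter>j. {z. snd z $ j < q $ j})" by auto
        ultimately show ?thesis by (simp only: borel_open)
      qed
      have m3: "{z :: real \<times> (real ^ 'd). g i (fst z, q) < a} \<in> sets borel" for q
      proof -
        have "(\<lambda>z :: real \<times> (real ^ 'd). (fst z, q)) \<in> borel_measurable borel"
          by (intro borel_measurable_continuous_onI continuous_intros)
        from measurable_compose[OF this, of "g i" borel] g(1)[of i]
        have "(\<lambda>z :: real \<times> (real ^ 'd). g i (fst z, q)) \<in> borel_measurable borel" by simp
        from borel_measurable_less[OF this borel_measurable_const, of a] show ?thesis by simp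
      qed
      have "{z \<in> space borel. B (fst z) (snd z) $ i < a} =
        (\<Union>q\<in>D. {z. fst z \<in> G} \<inter> {z. \<forall>j. snd z $ j < q $ j} \<inter> {z. g i (fst z, q) < a}) \<union>
        (if 0 < a then - {z. fst z \<in> G} else {})" (is "?L = ?R")
      proof (rule set_eqI)
        fix z :: "real \<times> (real ^ 'd)"
        show "z \<in> ?L \<longleftrightarrow> z \<in> ?R"
        proof (cases "fst z \<in> G")
          case True
          have gb: "g i (fst z, q) = b (fst z) q $ i" if "q \<in> D" for q
            using good[OF True] that unfolding good_def b'_def by simp
          have "z \<in> ?L \<longleftrightarrow> (\<exists>q\<in>{q\<in>D. \<forall>j. snd z $ j < q $ j}. b (fst z) q $ i < a)"
          proof -
            have "(INF q\<in>{q\<in>D. \<forall>j. snd z $ j < q $ j}. b (fst z) q $ i) < a \<longleftrightarrow>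
                (\<exists>q\<in>{q\<in>D. \<forall>j. snd z $ j < q $ j}. b (fst z) q $ i < a)"
              by (rule cINF_less_iff[OF ne bdd[OF True]])
            moreover have "B (fst z) (snd z) $ i = (INF q\<in>{q\<in>D. \<forall>j. snd z $ j < q $ j}. b (fst z) q $ i)"
              by (rule B_eq[OF True])
            ultimately show ?thesis by simp
          qed
          then show ?thesis using True gb by auto
        next
          case False
          then show ?thesis using B_0[OF False] by auto
        qed
      qed
      also have "\<dots> \<in> sets borel"
      proof (rule sets.Un)
        show "(\<Union>q\<in>D. {z. fst z \<in> G} \<inter> {z. \<forall>j. snd z $ j < q $ j} \<inter> {z. g i (fst z, q) < a}) \<in> sets borel"
          using m1 m2 m3 by (intro sets.countable_UN'[OF D(1)] image_subsetI sets.Int) auto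
        show "(if 0 < a then - {z :: real \<times> (real ^ 'd). fst z \<in> G} else {}) \<in> sets borel"
          using sets.compl_sets[OF m1] by (simp add: Compl_eq_Diff_UNIV)
      qed
      finally show "{z \<in> space borel. B (fst z) (snd z) $ i < a} \<in> sets borel" .
    qed
    have "(\<lambda>z. \<Sum>i\<in>UNIV. (B (fst z) (snd z) $ i) *\<^sub>R (axis i 1 :: real ^ 'd)) \<in> borel_measurable borel"
      by (intro borel_measurable_sum borel_measurable_scaleR comp borel_measurable_const)
    moreover have "(\<Sum>i\<in>UNIV. (v $ i) *\<^sub>R axis i 1) = v" for v :: "real ^ 'd"
      using basis_expansion[of v] by (simp add: scalar_mult_eq_scaleR)
    ultimately show "(\<lambda>z. B (fst z) (snd z)) \<in> borel_measurable borel" by simp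
    show "B t x \<le> B t y" if xy: "x \<le> y" for t x y
      unfolding less_eq_vec_def
    proof
      fix i
      show "B t x $ i \<le> B t y $ i"
      proof (cases "t \<in> G")
        case True
        have "x $ j < q $ j" if "y $ j < q $ j" for j q using xy that by (auto simp: less_eq_vec_def intro: le_less_trans)
        then show ?thesis unfolding B_eq[OF True] by (intro cINF_superset_mono[OF ne bdd[OF True]]) auto
      next
        case False then show ?thesis by (simp add: B_0)
      qed
    qed
    show "(\<Sum>i\<in>UNIV. \<bar>B t y $ i\<bar>) \<le> C t * (1 + norm y)" for t y
    proof (cases "t \<in> G")
      case True
      have "\<bar>B t y $ i\<bar> \<le> C1 t * ((1 + n) * (1 + n)) * (1 + norm y)" for i
      proof -
        obtain q where q: "q \<in> D" "\<And>j. y $ j < q $ j" "\<And>j. q $ j < (y + 1) $ j" proof -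
          have "y $ j < (y + 1) $ j" for j by simp
          from dense[OF this] show thesis using that by blast
        qed
        have qy: "norm q \<le> norm y + n" unfolding n_def
        proof (rule norm_le_if_in_unit_box)
          fix j show "\<bar>q $ j - y $ j\<bar> \<le> 1" using q(2)[of j] q(3)[of j] by simp
        qed
        have mono1: "C1 t * ((1 + n) * (1 + norm z)) \<le> C1 t * ((1 + n) * (1 + n)) * (1 + norm y)" if "norm z \<le> norm y + n" for z :: "real ^ 'd"
        proof -
          have "1 + norm z \<le> (1 + norm y) + n * 1" using that by simp
          also have "\<dots> \<le> (1 + norm y) + n * (1 + norm y)" using n0 by (intro add_left_mono mult_left_mono) auto
          finally have "1 + norm z \<le> (1 + n) * (1 + norm y)" by (simp add: algebra_simps)
          then have "C1 t * ((1 + n) * (1 + norm z)) \<le> C1 t * ((1 + n) * ((1 + n) * (1 + norm y)))"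
            using C1nn[OF True] n0 by (intro mult_left_mono) auto
          then show ?thesis by (simp add: mult.assoc)
        qed
        have "B t y $ i \<le> b t q $ i" by (rule B_upper[OF True q(1,2)])
        also have "\<dots> \<le> C1 t * ((1 + n) * (1 + norm q))" using b_bound[OF True, of q i] by simp
        also have "\<dots> \<le> C1 t * ((1 + n) * (1 + n)) * (1 + norm y)" by (rule mono1[OF qy])
        finally have 1: "B t y $ i \<le> C1 t * ((1 + n) * (1 + n)) * (1 + norm y)" .
        have "- (C1 t * ((1 + n) * (1 + norm y))) \<le> b t y $ i" using b_bound[OF True, of y i] by simp
        also have "\<dots> \<le> B t y $ i" by (rule B_lower[OF True])
        finally have 2: "- (C1 t * ((1 + n) * (1 + norm y))) \<le> B t y $ i" .
        have "C1 t * ((1 + n) * (1 + norm y)) \<le> C1 t * ((1 + n) * (1 + n)) * (1 + norm y)" by (rule mono1) (use n0 in simp)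
        with 1 2 show ?thesis by linarith
      qed
      then have "(\<Sum>i\<in>UNIV. \<bar>B t y $ i\<bar>) \<le> (\<Sum>i\<in>(UNIV :: 'd set). C1 t * ((1 + n) * (1 + n)) * (1 + norm y))"
        by (intro sum_mono)
      also have "\<dots> = C t * (1 + norm y)" using True by (simp add: C_def K_def n_def)
      finally show ?thesis .
    next
      case False then show ?thesis by (simp add: B_0 C_def)
    qed
    have "integrable lborel (\<lambda>t. indicator G t *\<^sub>R C1 t)"
      using Gm by (intro integrable_mult_indicator C1int) simp
    moreover have Ceq: "C = (\<lambda>t. K * (indicator G t *\<^sub>R C1 t))"
      by (auto simp: fun_eq_iff C_def indicator_def)
    ultimately show "integrable lborel C" unfolding Ceq by (intro integrable_mult_right)
    show "0 \<le> C t" for t unfolding C_def K_def using C1nn n0 by simp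
  qed
  moreover have "AE t in lborel. t \<in> {0..T} \<longrightarrow> regularises_at (B t) (b t)"
    using AE_not_in[OF N(2)]
  proof eventually_elim
    case (elim t)
    show ?case
    proof
      assume "t \<in> {0..T}"
      then have "t \<in> G" using elim unfolding G_def by simp
      then show "regularises_at (B t) (b t)" by (rule reg)
    qed
  qed
  ultimately show ?thesis by blast
qed

lemma regularised_between_envelopes:
  fixes b :: "real ^ 'd \<Rightarrow> real ^ 'd"
  assumes "regularises_at B b"
  shows "ereal (B x $ i) \<le> usc_envelope (\<lambda>y. b y $ i) x" "lsc_envelope (\<lambda>y. b y $ i) x \<le> ereal (B x $ i)"
proof -
  have near: "\<exists>y. P y \<and> B x $ i \<le> b y $ i" if "\<forall>\<^sub>F y in nhds x. P y" for P
  proof -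
    obtain e where e: "e > 0" "\<And>y. dist y x < e \<Longrightarrow> P y"
      using \<open>\<forall>\<^sub>F y in nhds x. P y\<close> unfolding eventually_nhds_metric by blast
    define \<delta> where "\<delta> = e / (2 * (norm (1 :: real ^ 'd) + 1))"
    have pos: "norm (1 :: real ^ 'd) + 1 > 0" by (simp add: add_nonneg_pos)
    have \<delta>: "\<delta> > 0" unfolding \<delta>_def using e(1) pos by simp
    have "\<delta> * norm (1 :: real ^ 'd) \<le> \<delta> * (norm (1 :: real ^ 'd) + 1)" using \<delta> by (intro mult_left_mono) auto
    also have "\<dots> = e / 2" using pos unfolding \<delta>_def times_divide_eq_left by (intro frac_eq_eq[THEN iffD2]) auto
    finally have "dist (x + \<delta> *\<^sub>R 1) x < e" using e(1) \<delta> by (simp add: dist_norm)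
    then have "P (x + \<delta> *\<^sub>R 1)" by (rule e(2))
    moreover have "B x \<le> b (x + \<delta> *\<^sub>R 1)" using assms \<delta> unfolding regularises_at_def by blast
    ultimately show ?thesis by (auto simp: less_eq_vec_def)
  qed
  show "ereal (B x $ i) \<le> usc_envelope (\<lambda>y. b y $ i) x"
    unfolding usc_envelope_def Limsup_def
  proof (rule INF_greatest)
    fix P assume "P \<in> {P. eventually P (nhds x)}"
    then obtain y where "P y" "B x $ i \<le> b y $ i" using near by blast
    then show "ereal (B x $ i) \<le> Sup ((\<lambda>y. ereal (b y $ i)) ` Collect P)"
      by (intro SUP_upper2[of y]) auto
  qed
  have "lsc_envelope (\<lambda>y. b y $ i) x \<le> ereal (b x $ i)"
    unfolding lsc_envelope_def Liminf_def
    by (intro SUP_least) (auto intro!: INF_lower dest: eventually_nhds_x_imp_x)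
  also have "\<dots> \<le> ereal (B x $ i)" using assms unfolding regularises_at_def less_eq_vec_def by simp
  finally show "lsc_envelope (\<lambda>y. b y $ i) x \<le> ereal (B x $ i)" .
qed

lemma eventually_nhds_vec_le:
  fixes x q :: "real ^ 'd"
  assumes "\<delta> > 0"
  shows "x + \<delta> *\<^sub>R 1 \<le> q \<Longrightarrow> \<forall>\<^sub>F y in nhds x. y \<le> q" "q + \<delta> *\<^sub>R 1 \<le> x \<Longrightarrow> \<forall>\<^sub>F y in nhds x. q \<le> y"
proof -
  have ev: "\<forall>\<^sub>F y in nhds x. \<forall>i. \<bar>y $ i - x $ i\<bar> < \<delta>"
    unfolding eventually_nhds_metric
  proof (intro exI[of _ \<delta>] conjI allI impI)
    fix y i assume "dist y x < \<delta>"
    then show "\<bar>y $ i - x $ i\<bar> < \<delta>" using component_le_norm_cart[of "y - x" i] by (simp add: dist_norm)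
  qed (fact assms)
  show "\<forall>\<^sub>F y in nhds x. y \<le> q" if q: "x + \<delta> *\<^sub>R 1 \<le> q"
    using ev
  proof eventually_elim
    case (elim y)
    show ?case unfolding less_eq_vec_def
    proof
      fix i
      have "x $ i + \<delta> \<le> q $ i" using q by (simp add: less_eq_vec_def)
      then show "y $ i \<le> q $ i" using elim[rule_format, of i] by linarith
    qed
  qed
  show "\<forall>\<^sub>F y in nhds x. q \<le> y" if q: "q + \<delta> *\<^sub>R 1 \<le> x"
    using ev
  proof eventually_elim
    case (elim y)
    show ?case unfolding less_eq_vec_def
    proof
      fix i
      have "q $ i + \<delta> \<le> x $ i" using q by (simp add: less_eq_vec_def)
      then show "q $ i \<le> y $ i" using elim[rule_format, of i] by linarith
    qed
  qed
qed

text \<open>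
  The velocities allowed by the envelopes at \<open>x\<close> are at most \<open>B x\<close>, and by the next lemma they are at
  least \<open>B y\<close> for \<open>y\<close> strictly below \<open>x\<close>. The latter fails for \<open>y = x\<close>, whence the strict distances
  below.
\<close>

lemma le_regularised_if_le_usc:
  fixes b :: "real ^ 'd \<Rightarrow> real ^ 'd"
  assumes reg: "regularises_at B b" and D: "ereal D \<le> usc_envelope (\<lambda>y. b y $ i) x"
  shows "D \<le> B x $ i"
proof (rule field_le_epsilon)
  fix e :: real assume "e > 0"
  then obtain q \<delta> where q: "\<delta> > 0" "x + \<delta> *\<^sub>R 1 \<le> q" "b q $ i < B x $ i + e"
    using reg unfolding regularises_at_def by blast
  have "ereal D \<le> usc_envelope (\<lambda>y. b y $ i) x" by (rule D)
  also have "\<dots> \<le> ereal (b q $ i)"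
    unfolding usc_envelope_def
  proof (rule Limsup_bounded)
    show "\<forall>\<^sub>F y in nhds x. ereal (b y $ i) \<le> ereal (b q $ i)"
      using eventually_nhds_vec_le(1)[OF q(1,2)]
    proof eventually_elim
      case (elim y)
      then have "b y \<le> b q" using reg unfolding regularises_at_def by (auto dest: monoD)
      then show ?case by (simp add: less_eq_vec_def)
    qed
  qed
  finally show "D \<le> B x $ i + e" using q(3) by simp
qed

lemma regularised_le_if_lsc_le:
  fixes b :: "real ^ 'd \<Rightarrow> real ^ 'd"
  assumes reg: "regularises_at B b" and D: "lsc_envelope (\<lambda>y. b y $ i) x \<le> ereal D"
    and y: "\<delta> > 0" "y + \<delta> *\<^sub>R 1 \<le> x"
  shows "B y $ i \<le> D"
proof -
  define q where "q = y + (\<delta> / 2) *\<^sub>R 1"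
  have q: "q + (\<delta> / 2) *\<^sub>R 1 \<le> x" using y unfolding q_def by (simp add: less_eq_vec_def add.assoc)
  have "\<delta> / 2 > 0" "y + (\<delta> / 2) *\<^sub>R 1 \<le> q" using y(1) unfolding q_def by auto
  then have "B y \<le> b q" using reg unfolding regularises_at_def by blast
  then have "ereal (B y $ i) \<le> ereal (b q $ i)" by (simp add: less_eq_vec_def)
  also have "\<dots> \<le> lsc_envelope (\<lambda>y. b y $ i) x"
    unfolding lsc_envelope_def
  proof (rule Liminf_bounded)
    show "\<forall>\<^sub>F y in nhds x. ereal (b q $ i) \<le> ereal (b y $ i)"
      using eventually_nhds_vec_le(2)[OF \<open>\<delta> / 2 > 0\<close> q]
    proof eventually_elim
      case (elim z)
      then have "b q \<le> b z" using reg unfolding regularises_at_def by (auto dest: monoD)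
      then show ?case by (simp add: less_eq_vec_def)
    qed
  qed
  also have "\<dots> \<le> ereal D" by (rule D)
  finally show ?thesis by simp
qed

lemma has_vector_derivative_vec:
  fixes \<gamma> :: "real \<Rightarrow> real ^ 'd"
  assumes "\<And>i. ((\<lambda>r. \<gamma> r $ i) has_real_derivative D $ i) (at t)"
  shows "(\<gamma> has_vector_derivative D) (at t)"
proof -
  have "((\<lambda>r. \<Sum>i\<in>UNIV. (\<gamma> r $ i) *\<^sub>R axis i 1) has_vector_derivative (\<Sum>i\<in>UNIV. (D $ i) *\<^sub>R (axis i 1 :: real ^ 'd))) (at t)"
  proof (rule has_vector_derivative_sum)
    fix i
    have "((\<lambda>r. (\<gamma> r $ i) *\<^sub>R (axis i 1 :: real ^ 'd)) has_vector_derivative (\<gamma> t $ i) *\<^sub>R 0 + (D $ i) *\<^sub>R axis i 1) (at t)"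
      by (rule has_vector_derivative_scaleR[OF assms has_vector_derivative_const])
    then show "((\<lambda>r. (\<gamma> r $ i) *\<^sub>R (axis i 1 :: real ^ 'd)) has_vector_derivative (D $ i) *\<^sub>R axis i 1) (at t)" by simp
  qed
  moreover have "(\<Sum>i\<in>UNIV. (v $ i) *\<^sub>R axis i 1) = v" for v :: "real ^ 'd"
    using basis_expansion[of v] by (simp add: scalar_mult_eq_scaleR)
  ultimately show ?thesis by simp
qed

lemma tendsto_diag:
  fixes x :: "real ^ 'd"
  assumes "isCont F x"
  shows "(\<lambda>n. F (x - (1 / real (Suc n)) *\<^sub>R 1)) \<longlonglongrightarrow> F x" "(\<lambda>n. F (x + (1 / real (Suc n)) *\<^sub>R 1)) \<longlonglongrightarrow> F x"
proof -
  have lim: "(\<lambda>n. 1 / real (Suc n)) \<longlonglongrightarrow> 0" using LIMSEQ_Suc[OF lim_1_over_n] by simp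
  have "(\<lambda>n. x - (1 / real (Suc n)) *\<^sub>R 1) \<longlonglongrightarrow> x - 0 *\<^sub>R 1" by (intro tendsto_intros lim)
  then show "(\<lambda>n. F (x - (1 / real (Suc n)) *\<^sub>R 1)) \<longlonglongrightarrow> F x"
    by (intro isCont_tendsto_compose[OF assms]) simp
  have "(\<lambda>n. x + (1 / real (Suc n)) *\<^sub>R 1) \<longlonglongrightarrow> x + 0 *\<^sub>R 1" by (intro tendsto_intros lim)
  then show "(\<lambda>n. F (x + (1 / real (Suc n)) *\<^sub>R 1)) \<longlonglongrightarrow> F x"
    by (intro isCont_tendsto_compose[OF assms]) simp
qed

context growth_field
begin

lemma path_extension:
  fixes \<gamma> :: "real \<Rightarrow> real ^ 'd"
  assumes cont: "continuous_on {s..S} \<gamma>" and sS: "s \<le> S"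
  obtains g where "integrable lborel g" "\<And>r. r \<in> {s..S} \<Longrightarrow> g r = B r (\<gamma> r) $ i"
proof -
  have "compact (\<gamma> ` {s..S})" using cont by (intro compact_continuous_image) auto
  then obtain M where M: "\<And>r. r \<in> {s..S} \<Longrightarrow> norm (\<gamma> r) \<le> M"
    using compact_imp_bounded bounded_iff by (metis imageI)
  define c where "c r = max s (min S r)" for r
  have c: "c r \<in> {s..S}" for r unfolding c_def using sS by auto
  have "continuous_on UNIV (\<lambda>r. \<gamma> (c r))"
  proof (rule continuous_on_compose2[OF cont])
    show "continuous_on UNIV c" unfolding c_def[abs_def] by (intro continuous_intros)
  qed (use c in auto)
  from bf.B_path_integrable[OF this, of M i]
  have "integrable lborel (\<lambda>r. B r (\<gamma> (c r)) $ i)"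
    using M[OF c] by (simp add: clamp_vec_id order_trans[OF _ abs_ge_self])
  then show ?thesis by (rule that) (simp add: c_def)
qed

lemma flow_is_flow_curve:
  assumes s: "0 \<le> s" and reg: "AE t in lborel. t \<in> {0..T} \<longrightarrow> regularises_at (B t) (b t)"
  shows "flow_curve T b s x (flow s x)"
  unfolding flow_curve_def
proof (intro conjI)
  show "absolutely_continuous_on s T (flow s x)" by (rule flow_AC)
  show "flow s x s = x" by (rule flow_start) simp
  show "AE t in lebesgue_on {s..T}. \<exists>D. (flow s x has_vector_derivative D) (at t) \<and>
      (\<forall>i. lsc_envelope (\<lambda>y. b t y $ i) (flow s x t) \<le> ereal (D $ i) \<and>
           ereal (D $ i) \<le> usc_envelope (\<lambda>y. b t y $ i) (flow s x t))"
  proof (rule AE_lebesgue_on_if_AE_lborel[OF Icc_sets_lebesgue])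
    show "AE t in lborel. t \<in> {s..T} \<longrightarrow> (\<exists>D. (flow s x has_vector_derivative D) (at t) \<and>
      (\<forall>i. lsc_envelope (\<lambda>y. b t y $ i) (flow s x t) \<le> ereal (D $ i) \<and>
           ereal (D $ i) \<le> usc_envelope (\<lambda>y. b t y $ i) (flow s x t)))"
      using reg flow_deriv_ae[of s x] AE_lborel_singleton[of s]
    proof eventually_elim
      case (elim t)
      show ?case
      proof
        assume t: "t \<in> {s..T}"
        then have st: "s < t" using elim(3) by auto
        have r: "regularises_at (B t) (b t)" using elim(1) t s by auto
        have "(flow s x has_vector_derivative B t (flow s x t)) (at t)"
          using elim(2) st by (intro has_vector_derivative_vec) auto
        then show "\<exists>D. (flow s x has_vector_derivative D) (at t) \<and>
          (\<forall>i. lsc_envelope (\<lambda>y. b t y $ i) (flow s x t) \<le> ereal (D $ i) \<and>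
           ereal (D $ i) \<le> usc_envelope (\<lambda>y. b t y $ i) (flow s x t))"
          using regularised_between_envelopes[OF r] by blast
      qed
    qed
  qed
qed

text \<open>
  The velocities are at most \<open>B\<close> along the curve, so the curve is below its image under the Picard
  operator and thus below the greatest path.
\<close>

lemma flow_curve_le_flow:
  assumes s: "0 \<le> s" and reg: "AE t in lborel. t \<in> {0..T} \<longrightarrow> regularises_at (B t) (b t)"
    and \<gamma>: "flow_curve T b s x \<gamma>" and t: "t \<in> {s..T}"
  shows "\<gamma> t \<le> flow s x t"
proof -
  have AC: "absolutely_continuous_on s T \<gamma>" and start: "\<gamma> s = x"
    and ae: "AE t in lborel. t \<in> {s..T} \<longrightarrow> (\<exists>D. (\<gamma> has_vector_derivative D) (at t) \<and>
          (\<forall>i. lsc_envelope (\<lambda>y. b t y $ i) (\<gamma> t) \<le> ereal (D $ i) \<and>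
               ereal (D $ i) \<le> usc_envelope (\<lambda>y. b t y $ i) (\<gamma> t)))"
    using \<gamma> AE_lborel_if_AE_lebesgue_on[OF Icc_sets_lebesgue] unfolding flow_curve_def by auto
  note cont = AC_continuous_on[OF AC]
  have sT: "s \<le> T" using t by simp
  show ?thesis
  proof (rule subsolution_le_flow[OF cont _ t])
    fix u i assume u: "u \<in> {s..T}"
    obtain g where g: "integrable lborel g" "\<And>r. r \<in> {s..T} \<Longrightarrow> g r = B r (\<gamma> r) $ i"
      using path_extension[OF cont sT, of i] by metis
    note gI = integral_eq_lborel_integral(1)[OF g(1)]
    have eq: "integral {s..u} (\<lambda>r. B r (\<gamma> r) $ i) = integral {s..u} g"
      using u g(2) by (intro Henstock_Kurzweil_Integration.integral_cong) auto
    have g_AC: "absolutely_continuous_on s u (\<lambda>v. integral {s..v} g)"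
    proof (rule AC_if_dominated[OF integrable_abs[OF g(1)]])
      fix v w assume vw: "s \<le> v" "v \<le> w" "w \<le> u"
      have "dist (integral {s..v} g) (integral {s..w} g) = norm (integral {v..w} g)"
        using Henstock_Kurzweil_Integration.integral_combine[OF vw(1,2) gI] by (simp add: dist_real_def)
      also have "\<dots> \<le> integral {v..w} (\<lambda>r. \<bar>g r\<bar>)"
        by (rule integral_norm_bound_integral[OF gI integral_eq_lborel_integral(1)[OF integrable_abs[OF g(1)]]]) simp
      finally show "dist (integral {s..v} g) (integral {s..w} g) \<le> integral {v..w} (\<lambda>r. \<bar>g r\<bar>)" .
    qed simp
    have ACu: "absolutely_continuous_on s u \<gamma>" using AC_subinterval[OF AC, of s u] u by simp
    have c_AC: "absolutely_continuous_on s u (\<lambda>v. \<gamma> v $ i)"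
      by (rule AC_dominated[OF ACu zero_less_one]) (simp add: dist_vec_nth_le)
    have "integral {s..s} g - \<gamma> s $ i \<le> integral {s..u} g - \<gamma> u $ i"
    proof (rule AC_deriv_nonneg_imp_le[OF AC_diff[OF g_AC c_AC]])
      show "AE r in lborel. s < r \<and> r < u \<longrightarrow> (\<exists>D\<ge>0. ((\<lambda>v. integral {s..v} g - \<gamma> v $ i) has_real_derivative D) (at r))"
        using ae reg has_real_derivative_indefinite_integral_ae[OF gI]
      proof eventually_elim
        case (elim r)
        show ?case
        proof
          assume r: "s < r \<and> r < u"
          then have rT: "r \<in> {s..T}" using u by auto
          then obtain D where D: "(\<gamma> has_vector_derivative D) (at r)"
            "ereal (D $ i) \<le> usc_envelope (\<lambda>y. b r y $ i) (\<gamma> r)" using elim(1) by auto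
          have "regularises_at (B r) (b r)" using elim(2) rT s by auto
          then have le: "D $ i \<le> g r" using le_regularised_if_le_usc[OF _ D(2)] g(2)[OF rT] by simp
          have "((\<lambda>r. \<gamma> r $ i) has_vector_derivative D $ i) (at r)"
            using bounded_linear.has_vector_derivative[OF bounded_linear_vec_nth D(1)] .
          then have "((\<lambda>r. \<gamma> r $ i) has_real_derivative D $ i) (at r)"
            by (simp add: has_real_derivative_iff_has_vector_derivative)
          then have "((\<lambda>v. integral {s..v} g - \<gamma> v $ i) has_real_derivative g r - D $ i) (at r)"
            using elim(3) r by (intro DERIV_diff) auto
          then show "\<exists>D\<ge>0. ((\<lambda>v. integral {s..v} g - \<gamma> v $ i) has_real_derivative D) (at r)"
            using le by (intro exI[of _ "g r - D $ i"]) auto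
        qed
      qed
    qed (use u in auto)
    then show "\<gamma> u $ i \<le> x $ i + integral {s..u} (\<lambda>r. B r (\<gamma> r) $ i)" using start eq by simp
  qed
qed

lemma flow_curve_ge_flow:
  assumes s: "0 \<le> s" and reg: "AE t in lborel. t \<in> {0..T} \<longrightarrow> regularises_at (B t) (b t)"
    and \<gamma>: "flow_curve T b s x \<gamma>" and t: "t \<in> {s..T}" and \<tau>: "\<tau> > 0"
  shows "flow s (x - \<tau> *\<^sub>R 1) t + \<tau> *\<^sub>R 1 \<le> \<gamma> t"
proof (rule flow_below_curve[OF _ \<tau> _ _ t])
  show "absolutely_continuous_on s T \<gamma>" using \<gamma> unfolding flow_curve_def by simp
  show "x - \<tau> *\<^sub>R 1 + \<tau> *\<^sub>R 1 \<le> \<gamma> s" using \<gamma> unfolding flow_curve_def by simp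
  have "AE t in lborel. t \<in> {s..T} \<longrightarrow> (\<exists>D. (\<gamma> has_vector_derivative D) (at t) \<and>
          (\<forall>i. lsc_envelope (\<lambda>y. b t y $ i) (\<gamma> t) \<le> ereal (D $ i) \<and>
               ereal (D $ i) \<le> usc_envelope (\<lambda>y. b t y $ i) (\<gamma> t)))"
    using \<gamma> AE_lborel_if_AE_lebesgue_on[OF Icc_sets_lebesgue] unfolding flow_curve_def by auto
  then show "AE r in lborel. s < r \<and> r < T \<longrightarrow> (\<exists>D. (\<gamma> has_vector_derivative D) (at r) \<and>
        (\<forall>y \<delta>. \<delta> > 0 \<longrightarrow> y + \<delta> *\<^sub>R 1 \<le> \<gamma> r \<longrightarrow> B r y \<le> D))"
    using reg
  proof eventually_elim
    case (elim r)
    show ?case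
    proof
      assume r: "s < r \<and> r < T"
      then obtain D where D: "(\<gamma> has_vector_derivative D) (at r)"
        "\<And>i. lsc_envelope (\<lambda>y. b r y $ i) (\<gamma> r) \<le> ereal (D $ i)" using elim(1) by auto
      have reg': "regularises_at (B r) (b r)" using elim(2) r s by auto
      show "\<exists>D. (\<gamma> has_vector_derivative D) (at r) \<and>
        (\<forall>y \<delta>. \<delta> > 0 \<longrightarrow> y + \<delta> *\<^sub>R 1 \<le> \<gamma> r \<longrightarrow> B r y \<le> D)"
      proof (intro exI[of _ D] conjI allI impI)
        fix y \<delta> assume "\<delta> > 0" "y + \<delta> *\<^sub>R 1 \<le> \<gamma> r"
        then show "B r y \<le> D"
          unfolding less_eq_vec_def using regularised_le_if_lsc_le[OF reg' D(2)]
          by (auto simp: less_eq_vec_def)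
      qed (fact D(1))
    qed
  qed
qed

text \<open>
  Where \<open>flow s \<sqdot> q\<close> is continuous in \<open>x\<close>, the lower bound by the flow from \<open>x - \<tau> *\<^sub>R 1\<close> tends to the upper
  bound as \<open>\<tau>\<close> decreases to \<open>0\<close>. Only the rational times \<open>q\<close> are treated this way, to have one null
  set; continuity of the paths does the rest.
\<close>

theorem flow_regular_lagrangian:
  assumes reg: "AE t in lborel. t \<in> {0..T} \<longrightarrow> regularises_at (B t) (b t)"
  shows "regular_lagrangian_flow T b (\<lambda>t s x. flow s x t)"
  unfolding regular_lagrangian_flow_def
proof
  fix s assume s: "s \<in> {0..T}"
  then have s0: "0 \<le> s" and sT: "s \<le> T" by auto
  have "AE x in lborel. \<forall>q\<in>\<rat>. \<forall>i. isCont (\<lambda>y. flow s y q $ i) x"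
    using flow_isCont_ae by (subst AE_ball_countable[OF countable_rat]) auto
  then have "AE x in lebesgue. \<forall>q\<in>\<rat>. \<forall>i. isCont (\<lambda>y. flow s y q $ i) x" by (rule AE_completion)
  then show "AE x in lebesgue. flow_curve T b s x (flow s x) \<and>
        (\<forall>\<gamma>. flow_curve T b s x \<gamma> \<longrightarrow> (\<forall>t\<in>{s..T}. \<gamma> t = flow s x t))"
  proof eventually_elim
    case (elim x)
    show ?case
    proof (intro conjI allI impI ballI)
      show "flow_curve T b s x (flow s x)" by (rule flow_is_flow_curve[OF s0 reg])
      fix \<gamma> t assume \<gamma>: "flow_curve T b s x \<gamma>" and t: "t \<in> {s..T}"
      have rat: "\<gamma> q = flow s x q" if q: "q \<in> \<rat>" "q \<in> {s..T}" for q
      proof (rule antisym)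
        show "\<gamma> q \<le> flow s x q" by (rule flow_curve_le_flow[OF s0 reg \<gamma> q(2)])
        show "flow s x q \<le> \<gamma> q" unfolding less_eq_vec_def
        proof
          fix i
          have c: "isCont (\<lambda>y. flow s y q $ i) x" using elim q(1) by blast
          show "flow s x q $ i \<le> \<gamma> q $ i"
          proof (rule LIMSEQ_le_const2[OF tendsto_diag(1)[OF c]], intro exI[of _ 0] allI impI)
            fix n :: nat
            have "flow s (x - (1 / real (Suc n)) *\<^sub>R 1) q + (1 / real (Suc n)) *\<^sub>R 1 \<le> \<gamma> q"
              by (rule flow_curve_ge_flow[OF s0 reg \<gamma> q(2)]) simp
            then have "flow s (x - (1 / real (Suc n)) *\<^sub>R 1) q $ i + 1 / real (Suc n) \<le> \<gamma> q $ i"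
              by (simp add: less_eq_vec_def)
            moreover have "0 \<le> 1 / real (Suc n)" by simp
            ultimately show "flow s (x - (1 / real (Suc n)) *\<^sub>R 1) q $ i \<le> \<gamma> q $ i" by linarith
          qed
        qed
      qed
      show "\<gamma> t = flow s x t"
      proof (rule ccontr)
        assume ne: "\<gamma> t \<noteq> flow s x t"
        have "s < T"
        proof (rule ccontr)
          assume "\<not> s < T"
          then have "t = s" using t by auto
          then show False using ne \<gamma> flow_start[of s s x] unfolding flow_curve_def by simp
        qed
        have "continuous_on {s..T} (\<lambda>r. norm (\<gamma> r - flow s x r))"
          using \<gamma> unfolding flow_curve_def
          by (intro continuous_intros AC_continuous_on continuous_on_subset[OF flow_continuous]) auto
        then obtain d where d: "d > 0" "\<And>r. r \<in> {s..T} \<Longrightarrow> dist r t < d \<Longrightarrow>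
            dist (norm (\<gamma> r - flow s x r)) (norm (\<gamma> t - flow s x t)) < norm (\<gamma> t - flow s x t)"
          using t ne unfolding continuous_on_iff by (metis right_minus_eq zero_less_norm_iff)
        have "max s (t - d) < min T (t + d)" using \<open>s < T\<close> d(1) t by auto
        then obtain q where q: "q \<in> \<rat>" "max s (t - d) < q" "q < min T (t + d)"
          using Rats_dense_in_real by blast
        then have qm: "q \<in> {s..T}" "dist q t < d" by (auto simp: dist_real_def)
        show False using d(2)[OF qm] rat[OF q(1) qm(1)] by simp
      qed
    qed
  qed
qed

end

section \<open>Sub- and supersolutions along the flow\<close>

text \<open>
  The differential inequality for \<open>f\<close> is known for almost every point \<open>y\<close> and then only while \<open>y\<close> is
  strictly below the path \<open>\<gamma>\<close>; nothing is assumed on the path itself. So the path is lowered by \<open>\<delta>\<close>,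
  and over a short time interval \<open>[u, v]\<close> the movement along the lowered path \<open>x\<close> is split in two:
  first time passes at a fixed good point \<open>y\<close> near \<open>x u\<close>, which stays below \<open>\<gamma>\<close>, then the point
  moves at the fixed time \<open>v\<close>. In both steps the gradient is nearly constant, so the two main terms
  \<open>(\<gamma> v - \<gamma> u) \<bullet> g\<close> cancel and the error is at most \<open>\<eta>\<close> times \<open>m \<integral>\<^sub>u\<^sup>v c\<close>. Errors of this form add up under
  subdivision.
\<close>

lemma lagrangian_monotone:
  fixes f :: "real \<Rightarrow> real ^ 'd \<Rightarrow> real" and G :: "real \<Rightarrow> real ^ 'd \<Rightarrow> real ^ 'd"
  assumes st: "s \<le> t"
    and c: "integrable lborel c" "\<And>r. 0 \<le> c r"
    and \<beta>: "\<And>r i. \<bar>\<beta> r $ i\<bar> \<le> c r" "\<And>u v i. (\<lambda>r. \<beta> r $ i) integrable_on {u..v}"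
    and \<gamma>: "\<And>u v i. s \<le> u \<Longrightarrow> u \<le> v \<Longrightarrow> v \<le> t \<Longrightarrow> \<gamma> v $ i - \<gamma> u $ i = integral {u..v} (\<lambda>r. \<beta> r $ i)"
    and grad: "\<And>r x. r \<in> {s..t} \<Longrightarrow> GDERIV (f r) x :> G r x"
    and Gcont: "\<And>\<tau> x \<eta>. \<tau> \<in> {s..t} \<Longrightarrow> \<eta> > 0 \<Longrightarrow>
      \<exists>d>0. \<forall>r\<in>{s..t}. \<forall>y. dist r \<tau> < d \<longrightarrow> dist y x < d \<longrightarrow> (\<forall>i. \<bar>G r y $ i - G \<tau> x $ i\<bar> < \<eta>)"
    and ae: "AE y in lborel. absolutely_continuous_on s t (\<lambda>r. f r y) \<and>
      (AE r in lborel. s < r \<and> r < t \<longrightarrow> (\<exists>D. ((\<lambda>r. f r y) has_real_derivative D) (at r) \<and>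
        (\<forall>\<delta>>0. y + \<delta> *\<^sub>R 1 \<le> \<gamma> r \<longrightarrow> D \<le> - (\<beta> r \<bullet> G r y))))"
  shows "f t (\<gamma> t) \<le> f s (\<gamma> s)"
proof -
  define n where "n = real CARD('d)"
  have n1: "1 \<le> n" unfolding n_def by (simp add: Suc_leI)
  note cI = integral_eq_lborel_integral(1)[OF c(1)]
  have cnn: "0 \<le> integral {u..v} c" for u v by (intro Henstock_Kurzweil_Integration.integral_nonneg cI c(2))
  have \<gamma>_mod: "\<bar>\<gamma> v $ i - \<gamma> u $ i\<bar> \<le> integral {u..v} c" if "s \<le> u" "u \<le> v" "v \<le> t" for u v i
    unfolding \<gamma>[OF that] using integral_norm_bound_integral[OF \<beta>(2) cI, of u v i] \<beta>(1) by simp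
  have fcont: "isCont (f r) x" if "r \<in> {s..t}" for r x
    using grad[OF that, of x] unfolding gderiv_def by (rule has_derivative_continuous)
  have shifted: "f t (\<gamma> t - \<delta> *\<^sub>R 1) \<le> f s (\<gamma> s - \<delta> *\<^sub>R 1)" if \<delta>: "\<delta> > 0" for \<delta>
  proof -
    define x where "x r = \<gamma> r - \<delta> *\<^sub>R 1" for r
    define m where "m = n + n * n"
    have m0: "0 < m" unfolding m_def using n1 by (simp add: add_pos_nonneg)
    have main: "f t (x t) - f s (x s) \<le> \<eta> * (m * integral {s..t} c)" if \<eta>: "\<eta> > 0" for \<eta>
    proof -
      define P where "P u v \<longleftrightarrow> (s \<le> u \<and> u \<le> v \<and> v \<le> t \<longrightarrow> f v (x v) - f u (x u) \<le> \<eta> * (m * integral {u..v} c))" for u v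
      have "P s t"
        using st
      proof (induction rule: Bolzano)
        case (trans u v w)
        show ?case unfolding P_def
        proof
          assume uw: "s \<le> u \<and> u \<le> w \<and> w \<le> t"
          then have "f v (x v) - f u (x u) \<le> \<eta> * (m * integral {u..v} c)"
            "f w (x w) - f v (x v) \<le> \<eta> * (m * integral {v..w} c)" using trans unfolding P_def by auto
          moreover have "integral {u..w} c = integral {u..v} c + integral {v..w} c"
            using Henstock_Kurzweil_Integration.integral_combine[OF trans(3,4) cI] by simp
          ultimately show "f w (x w) - f u (x u) \<le> \<eta> * (m * integral {u..w} c)" by (simp add: algebra_simps)
        qed
      next
        case (local \<tau>)
        then have \<tau>: "\<tau> \<in> {s..t}" by simp
        \<comment> \<open>the gradient is frozen at the point of the path at the time \<open>\<tau>\<close>\<close>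
        define g where "g = G \<tau> (x \<tau>)"
        obtain d1 where d1: "d1 > 0" "\<And>r y i. r \<in> {s..t} \<Longrightarrow> dist r \<tau> < d1 \<Longrightarrow> dist y (x \<tau>) < d1 \<Longrightarrow> \<bar>G r y $ i - g $ i\<bar> < \<eta>"
          using Gcont[OF \<tau> \<eta>, of "x \<tau>"] unfolding g_def by blast
        define \<epsilon> where "\<epsilon> = min (d1 / 4) (\<delta> / 4)"
        have \<epsilon>: "\<epsilon> > 0" "\<epsilon> \<le> d1 / 4" "\<epsilon> \<le> \<delta> / 4" unfolding \<epsilon>_def using d1(1) \<delta> by auto
        have "continuous_on {s..t} (\<lambda>v. integral {s..v} c)" by (rule indefinite_integral_continuous_1[OF cI])
        moreover have "\<epsilon> / (2 * n) > 0" using \<epsilon>(1) n1 by simp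
        ultimately have "\<exists>d>0. \<forall>v\<in>{s..t}. dist v \<tau> < d \<longrightarrow> dist (integral {s..v} c) (integral {s..\<tau>} c) < \<epsilon> / (2 * n)"
          using \<tau> unfolding continuous_on_iff by blast
        then obtain d2 where d2: "d2 > 0" "\<And>v. v \<in> {s..t} \<Longrightarrow> dist v \<tau> < d2 \<Longrightarrow>
            dist (integral {s..v} c) (integral {s..\<tau>} c) < \<epsilon> / (2 * n)" by blast
        define d where "d = min d1 d2"
        have d: "d > 0" unfolding d_def using d1(1) d2(1) by simp
        have "P u v" if uv: "u \<le> \<tau>" "\<tau> \<le> v" "v - u < d" for u v
          unfolding P_def
        proof
          assume suv: "s \<le> u \<and> u \<le> v \<and> v \<le> t"
          have Iuv: "integral {u..v} c \<le> \<epsilon> / n"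
          proof -
            have "v - u < d2" using uv(3) unfolding d_def by simp
            then have mem: "v \<in> {s..t}" "dist v \<tau> < d2" "u \<in> {s..t}" "dist u \<tau> < d2"
              using suv uv by (auto simp: dist_real_def)
            have "dist (integral {s..v} c) (integral {s..\<tau>} c) < \<epsilon> / (2 * n)"
              "dist (integral {s..u} c) (integral {s..\<tau>} c) < \<epsilon> / (2 * n)"
              by (rule d2(2)[OF mem(1,2)], rule d2(2)[OF mem(3,4)])
            moreover have "integral {s..v} c = integral {s..u} c + integral {u..v} c"
              using Henstock_Kurzweil_Integration.integral_combine[OF _ _ cI, of s u v] suv by simp
            moreover have "\<epsilon> / (2 * n) + \<epsilon> / (2 * n) = \<epsilon> / n" by simp
            ultimately show ?thesis unfolding dist_real_def by linarith
          qed
          have close: "\<bar>\<gamma> r $ i - \<gamma> r' $ i\<bar> \<le> integral {u..v} c" if "r \<in> {u..v}" "r' \<in> {u..v}" for r r' i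
          proof -
            have *: "\<bar>\<gamma> b $ i - \<gamma> a $ i\<bar> \<le> integral {u..v} c" if "u \<le> a" "a \<le> b" "b \<le> v" for a b
              using \<gamma>_mod[of a b i] integral_subset_le[OF _ cI cI, of a b u v] c(2) that suv by fastforce
            show ?thesis using *[of r r'] *[of r' r] that by (cases "r \<le> r'") auto
          qed
          have dist_\<gamma>: "dist (\<gamma> r) (\<gamma> r') \<le> \<epsilon>" and dist_n: "dist (\<gamma> r) (\<gamma> r') \<le> n * integral {u..v} c"
            if "r \<in> {u..v}" "r' \<in> {u..v}" for r r'
          proof -
            show 1: "dist (\<gamma> r) (\<gamma> r') \<le> n * integral {u..v} c"
              unfolding dist_norm n_def by (rule norm_le_card_mult) (use close[OF that] in simp)
            have "n * integral {u..v} c \<le> n * (\<epsilon> / n)" using Iuv n1 by (intro mult_left_mono) auto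
            also have "\<dots> = \<epsilon>" using n1 by simp
            finally show "dist (\<gamma> r) (\<gamma> r') \<le> \<epsilon>" using 1 by linarith
          qed
          have \<tau>uv: "\<tau> \<in> {u..v}" "u \<in> {u..v}" "v \<in> {u..v}" using uv by auto
          have rd: "r \<in> {s..t}" "dist r \<tau> < d1" if "r \<in> {u..v}" for r
            using that suv uv by (auto simp: dist_real_def d_def)
          define K where "K = - ((\<gamma> v - \<gamma> u) \<bullet> g) + \<eta> * (n * integral {u..v} c)"
          \<comment> \<open>time passes at a good point \<open>y\<close>\<close>
          have stepA_generic: "f v y - f u y \<le> K"
            if y: "dist y (x u) < \<epsilon>" and AC: "absolutely_continuous_on s t (\<lambda>r. f r y)"
              and aey: "AE r in lborel. s < r \<and> r < t \<longrightarrow> (\<exists>D. ((\<lambda>r. f r y) has_real_derivative D) (at r) \<and>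
                (\<forall>\<delta>>0. y + \<delta> *\<^sub>R 1 \<le> \<gamma> r \<longrightarrow> D \<le> - (\<beta> r \<bullet> G r y)))" for y
          proof -
            have y\<tau>: "dist y (x \<tau>) < d1"
            proof -
              have "dist (x u) (x \<tau>) \<le> \<epsilon>" using dist_\<gamma>[OF \<tau>uv(2,1)] unfolding x_def by (simp add: dist_norm)
              then show ?thesis using y dist_triangle[of y "x \<tau>" "x u"] \<epsilon> d1(1) by linarith
            qed
            have below: "y + (\<delta> / 4) *\<^sub>R 1 \<le> \<gamma> r" if r: "r \<in> {u..v}" for r
              unfolding less_eq_vec_def
            proof
              fix i
              have "\<bar>y $ i - x u $ i\<bar> < \<epsilon>" using component_le_norm_cart[of "y - x u" i] y by (simp add: dist_norm)
              moreover have "\<bar>\<gamma> u $ i - \<gamma> r $ i\<bar> \<le> \<epsilon>"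
                using component_le_norm_cart[of "\<gamma> u - \<gamma> r" i] dist_\<gamma>[OF \<tau>uv(2) r] by (simp add: dist_norm)
              ultimately show "(y + (\<delta> / 4) *\<^sub>R 1) $ i \<le> \<gamma> r $ i" using \<epsilon>(3) \<delta> unfolding x_def by simp
            qed
            \<comment> \<open>bounds the derivative of \<open>f r y\<close> in \<open>r\<close>\<close>
            define k where "k r = - (\<Sum>i\<in>UNIV. g $ i * \<beta> r $ i) + \<eta> * (n * c r)" for r
            have kI: "k integrable_on {a..b}" for a b
              unfolding k_def[abs_def]
              by (intro integrable_add integrable_neg integrable_sum integrable_on_mult_right \<beta>(2) cI) auto
            have k_int: "integral {u..v} k = K"
            proof -
              have "integral {u..v} k = - (\<Sum>i\<in>UNIV. g $ i * integral {u..v} (\<lambda>r. \<beta> r $ i)) + \<eta> * (n * integral {u..v} c)"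
                unfolding k_def[abs_def]
                by (subst Henstock_Kurzweil_Integration.integral_add;
                    (intro integrable_neg integrable_sum integrable_on_mult_right \<beta>(2) cI)?)
                   (auto simp: Henstock_Kurzweil_Integration.integral_sum integrable_on_mult_right \<beta>(2))
              also have "(\<Sum>i\<in>UNIV. g $ i * integral {u..v} (\<lambda>r. \<beta> r $ i)) = (\<gamma> v - \<gamma> u) \<bullet> g"
                using \<gamma>[of u v] suv by (simp add: inner_vec_def mult.commute)
              finally show ?thesis unfolding K_def .
            qed
            have k_AC: "absolutely_continuous_on u v (\<lambda>w. integral {u..w} k)"
            proof (rule AC_if_dominated)
              show "integrable lborel (\<lambda>r. ((\<Sum>i\<in>UNIV. \<bar>g $ i\<bar>) + \<eta> * n) * c r)" using c(1) by simp
              have co: "0 \<le> (\<Sum>i\<in>UNIV. \<bar>g $ i\<bar>) + \<eta> * n" using \<eta> n1 by (simp add: sum_nonneg)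
              then show "0 \<le> ((\<Sum>i\<in>UNIV. \<bar>g $ i\<bar>) + \<eta> * n) * c r" for r using c(2) by simp
              fix a b assume ab: "u \<le> a" "a \<le> b" "b \<le> v"
              have "dist (integral {u..a} k) (integral {u..b} k) = norm (integral {a..b} k)"
                using Henstock_Kurzweil_Integration.integral_combine[OF ab(1,2) kI] by (simp add: dist_real_def)
              also have "\<dots> \<le> integral {a..b} (\<lambda>r. ((\<Sum>i\<in>UNIV. \<bar>g $ i\<bar>) + \<eta> * n) * c r)"
              proof (rule integral_norm_bound_integral[OF kI integrable_on_mult_right[OF cI]])
                fix r
                have "\<bar>\<Sum>i\<in>UNIV. g $ i * \<beta> r $ i\<bar> \<le> (\<Sum>i\<in>UNIV. \<bar>g $ i * \<beta> r $ i\<bar>)" by (rule sum_abs)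
                also have "\<dots> \<le> (\<Sum>i\<in>UNIV. \<bar>g $ i\<bar> * c r)"
                  unfolding abs_mult using \<beta>(1) by (intro sum_mono mult_left_mono) auto
                finally have "\<bar>\<Sum>i\<in>UNIV. g $ i * \<beta> r $ i\<bar> \<le> (\<Sum>i\<in>UNIV. \<bar>g $ i\<bar>) * c r" by (simp add: sum_distrib_right)
                moreover have "0 \<le> \<eta> * (n * c r)" using \<eta> n1 c(2) by simp
                ultimately show "norm (k r) \<le> ((\<Sum>i\<in>UNIV. \<bar>g $ i\<bar>) + \<eta> * n) * c r"
                  unfolding k_def by (simp add: distrib_right mult.assoc)
              qed
              finally show "dist (integral {u..a} k) (integral {u..b} k)
                  \<le> integral {a..b} (\<lambda>r. ((\<Sum>i\<in>UNIV. \<bar>g $ i\<bar>) + \<eta> * n) * c r)" .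
            qed
            have f_AC: "absolutely_continuous_on u v (\<lambda>r. f r y)" using AC_subinterval[OF AC] suv by simp
            have "integral {u..u} k - f u y \<le> integral {u..v} k - f v y"
            proof (rule AC_deriv_nonneg_imp_le[OF AC_diff[OF k_AC f_AC]])
              show "AE r in lborel. u < r \<and> r < v \<longrightarrow> (\<exists>D\<ge>0. ((\<lambda>w. integral {u..w} k - f w y) has_real_derivative D) (at r))"
                using aey has_real_derivative_indefinite_integral_ae[OF kI]
              proof eventually_elim
                case (elim r)
                show ?case
                proof
                  assume r: "u < r \<and> r < v"
                  then have ruv: "r \<in> {u..v}" by auto
                  obtain D where D: "((\<lambda>r. f r y) has_real_derivative D) (at r)"
                    "\<And>\<delta>. \<delta> > 0 \<Longrightarrow> y + \<delta> *\<^sub>R 1 \<le> \<gamma> r \<Longrightarrow> D \<le> - (\<beta> r \<bullet> G r y)"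
                    using elim(1) r suv by auto
                  have "D \<le> - (\<beta> r \<bullet> G r y)" using \<delta> by (intro D(2)[of "\<delta> / 4"] below[OF ruv]) simp
                  also have "\<dots> \<le> k r"
                  proof -
                    have "(\<Sum>i\<in>UNIV. g $ i * \<beta> r $ i) - \<beta> r \<bullet> G r y = (\<Sum>i\<in>UNIV. \<beta> r $ i * (g $ i - G r y $ i))"
                      by (simp add: inner_vec_def sum_subtractf algebra_simps)
                    also have "\<dots> \<le> (\<Sum>i\<in>(UNIV :: 'd set). c r * \<eta>)"
                    proof (rule sum_mono)
                      fix i
                      have "\<beta> r $ i * (g $ i - G r y $ i) \<le> \<bar>\<beta> r $ i\<bar> * \<bar>g $ i - G r y $ i\<bar>"
                        unfolding abs_mult[symmetric] by (rule abs_ge_self)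
                      also have "\<dots> \<le> c r * \<eta>"
                        using d1(2)[OF rd[OF ruv] y\<tau>, of i] \<beta>(1)[of r i] c(2)[of r]
                        by (intro mult_mono) (auto simp: abs_minus_commute)
                      finally show "\<beta> r $ i * (g $ i - G r y $ i) \<le> c r * \<eta>" .
                    qed
                    finally show ?thesis unfolding k_def n_def by (simp add: algebra_simps)
                  qed
                  finally have "D \<le> k r" .
                  moreover have "((\<lambda>w. integral {u..w} k - f w y) has_real_derivative k r - D) (at r)"
                    using elim(2) r D(1) by (intro DERIV_diff) auto
                  ultimately show "\<exists>D\<ge>0. ((\<lambda>w. integral {u..w} k - f w y) has_real_derivative D) (at r)"
                    by (intro exI[of _ "k r - D"]) auto
                qed
              qed
            qed (use suv in auto)
            then show ?thesis using k_int by simp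
          qed
          \<comment> \<open>good points are dense, and both sides are continuous in the point\<close>
          have stepA: "f v (x u) - f u (x u) \<le> K"
          proof (rule ccontr)
            assume "\<not> ?thesis"
            then have gt: "K < f v (x u) - f u (x u)" by simp
            define F where "F y = f v y - f u y" for y
            have "isCont F (x u)"
              unfolding F_def[abs_def] using fcont[OF rd(1)[OF \<tau>uv(3)]] fcont[OF rd(1)[OF \<tau>uv(2)]] by (intro continuous_intros)
            then have "(F \<longlongrightarrow> F (x u)) (nhds (x u))"
              unfolding isCont_def tendsto_at_iff_tendsto_nhds .
            from order_tendstoD(1)[OF this gt[folded F_def]] obtain U where U: "open U" "x u \<in> U" "\<And>y. y \<in> U \<Longrightarrow> K < f v y - f u y"
              unfolding eventually_nhds F_def by blast
            have "open (U \<inter> ball (x u) \<epsilon>)" "U \<inter> ball (x u) \<epsilon> \<noteq> {}" using U \<epsilon>(1) by auto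
            from ae_meets_open[OF ae this] obtain y where y: "y \<in> U" "dist y (x u) < \<epsilon>"
              "absolutely_continuous_on s t (\<lambda>r. f r y)"
              "AE r in lborel. s < r \<and> r < t \<longrightarrow> (\<exists>D. ((\<lambda>r. f r y) has_real_derivative D) (at r) \<and>
                (\<forall>\<delta>>0. y + \<delta> *\<^sub>R 1 \<le> \<gamma> r \<longrightarrow> D \<le> - (\<beta> r \<bullet> G r y)))"
              by (auto simp: dist_commute)
            show False using stepA_generic[OF y(2,3,4)] U(3)[OF y(1)] by simp
          qed
          \<comment> \<open>the point moves at the time \<open>v\<close>\<close>
          have stepB: "f v (x v) - f v (x u) \<le> (\<gamma> v - \<gamma> u) \<bullet> g + \<eta> * (n * n * integral {u..v} c)"
          proof -
            define w where "w y = f v y - y \<bullet> g" for y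
            have "norm (w (x v) - w (x u)) \<le> (n * \<eta>) * norm (x v - x u)"
            proof (rule differentiable_bound[where S = "closed_segment (x u) (x v)" and f' = "\<lambda>y h. h \<bullet> G v y - h \<bullet> g"])
              fix y assume y: "y \<in> closed_segment (x u) (x v)"
              have "(f v has_derivative (\<lambda>h. h \<bullet> G v y)) (at y within closed_segment (x u) (x v))"
                using grad[OF rd(1)[OF \<tau>uv(3)], of y] unfolding gderiv_def by (rule has_derivative_at_withinI)
              then show "(w has_derivative (\<lambda>h. h \<bullet> G v y - h \<bullet> g)) (at y within closed_segment (x u) (x v))"
                unfolding w_def[abs_def] by (intro has_derivative_diff has_derivative_inner_left has_derivative_ident)
              have yd: "dist y (x \<tau>) < d1"
              proof -
                have "norm (y - x u) \<le> norm (x v - x u)" using segment_bound1[OF y] by (simp add: norm_minus_commute)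
                also have "\<dots> \<le> \<epsilon>" using dist_\<gamma>[OF \<tau>uv(3,2)] unfolding x_def by (simp add: dist_norm)
                finally have "dist y (x u) \<le> \<epsilon>" by (simp add: dist_norm)
                moreover have "dist (x u) (x \<tau>) \<le> \<epsilon>" using dist_\<gamma>[OF \<tau>uv(2,1)] unfolding x_def by (simp add: dist_norm)
                ultimately show ?thesis using dist_triangle[of y "x \<tau>" "x u"] \<epsilon>(2) d1(1) by linarith
              qed
              have "norm (G v y - g) \<le> n * \<eta>"
                unfolding n_def by (rule norm_le_card_mult) (use d1(2)[OF rd[OF \<tau>uv(3)] yd] in \<open>simp add: less_imp_le\<close>)
              then have "norm (h \<bullet> G v y - h \<bullet> g) \<le> n * \<eta> * norm h" for h
                using Cauchy_Schwarz_ineq2[of h "G v y - g"] mult_left_mono[of "norm (G v y - g)" "n * \<eta>" "norm h"]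
                by (simp add: inner_diff_right mult.commute)
              then show "onorm (\<lambda>h. h \<bullet> G v y - h \<bullet> g) \<le> n * \<eta>" by (rule onorm_le)
            qed auto
            also have "\<dots> \<le> (n * \<eta>) * (n * integral {u..v} c)"
              using dist_n[OF \<tau>uv(3,2)] n1 \<eta> unfolding x_def by (intro mult_left_mono) (auto simp: dist_norm)
            finally have "w (x v) - w (x u) \<le> (n * \<eta>) * (n * integral {u..v} c)" by simp
            moreover have "w (x v) - w (x u) = f v (x v) - f v (x u) - (\<gamma> v - \<gamma> u) \<bullet> g"
              unfolding w_def x_def by (simp add: inner_diff_left)
            ultimately show ?thesis by (simp add: algebra_simps)
          qed
          show "f v (x v) - f u (x u) \<le> \<eta> * (m * integral {u..v} c)"
            using stepA stepB unfolding K_def m_def by (simp add: algebra_simps)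
        qed
        then show ?case using d by blast
      qed
      then show ?thesis using st unfolding P_def by simp
    qed
    have "f t (x t) - f s (x s) \<le> 0"
    proof (rule field_le_epsilon)
      fix e :: real assume e: "e > 0"
      define I where "I = m * integral {s..t} c + 1"
      have I: "I > 0" "m * integral {s..t} c \<le> I" unfolding I_def using m0 cnn[of s t] by (auto simp: add_nonneg_pos)
      have "f t (x t) - f s (x s) \<le> (e / I) * (m * integral {s..t} c)" using e I by (intro main) simp
      also have "\<dots> \<le> (e / I) * I" using e I by (intro mult_left_mono) auto
      finally show "f t (x t) - f s (x s) \<le> 0 + e" using I by simp
    qed
    then show ?thesis unfolding x_def by simp
  qed
  show ?thesis
  proof (rule LIMSEQ_le[OF tendsto_diag(1) tendsto_diag(1)])
    show "isCont (f t) (\<gamma> t)" "isCont (f s) (\<gamma> s)" using st by (auto intro!: fcont)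
    show "\<exists>N. \<forall>n\<ge>N. f t (\<gamma> t - (1 / real (Suc n)) *\<^sub>R 1) \<le> f s (\<gamma> s - (1 / real (Suc n)) *\<^sub>R 1)"
      by (intro exI allI impI shifted) simp
  qed
qed

text \<open>
  Values of a decreasing function are bounded by values of its mollification at shifted points, which
  are continuous on the compact time interval.
\<close>

lemma solution_locally_bounded:
  fixes u :: "real \<Rightarrow> real ^ 'd \<Rightarrow> real"
  assumes ker: "kernel \<psi> a b" and u: "\<And>t. t \<in> {0..T} \<Longrightarrow> antimono (u t)"
    and cont: "\<And>y. continuous_on {0..T} (\<lambda>t. convolution (u t) \<psi> y)"
  shows "\<exists>M. \<forall>t\<in>{0..T}. \<forall>y. norm y \<le> r \<longrightarrow> \<bar>u t y\<bar> \<le> M"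
proof -
  let ?p = "\<lambda>t. convolution (u t) \<psi> (- (r *\<^sub>R 1) + a *\<^sub>R 1)" and ?q = "\<lambda>t. convolution (u t) \<psi> (r *\<^sub>R 1 + b *\<^sub>R 1)"
  have "compact (?p ` {0..T})" "compact (?q ` {0..T})" by (intro compact_continuous_image cont compact_Icc)+
  then have "bounded (?p ` {0..T})" "bounded (?q ` {0..T})" by - (rule compact_imp_bounded, assumption)+
  then obtain M1 M2 where M12: "\<forall>y\<in>?p ` {0..T}. norm y \<le> M1" "\<forall>y\<in>?q ` {0..T}. norm y \<le> M2"
    unfolding bounded_iff by blast
  have M: "\<bar>?p t\<bar> \<le> M1" "\<bar>?q t\<bar> \<le> M2" if t: "t \<in> {0..T}" for t
    by (rule bspec[OF M12(1) imageI[OF t], unfolded real_norm_def],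
        rule bspec[OF M12(2) imageI[OF t], unfolded real_norm_def])
  have "\<bar>u t y\<bar> \<le> max M1 M2" if t: "t \<in> {0..T}" and y: "norm y \<le> r" for t y
  proof -
    have "u t y \<le> u t (- (r *\<^sub>R 1))" by (rule antimonoD[OF u[OF t] vec_one_bounds(2)[OF y]])
    also have "\<dots> \<le> ?p t" using conv_between(1)[OF ker u[OF t], of "- (r *\<^sub>R 1) + a *\<^sub>R 1"] by simp
    finally have 1: "u t y \<le> M1" using M(1)[OF t] by simp
    have "?q t \<le> u t (r *\<^sub>R 1)" using conv_between(2)[OF ker u[OF t], of "r *\<^sub>R 1 + b *\<^sub>R 1"] by simp
    also have "\<dots> \<le> u t y" by (rule antimonoD[OF u[OF t] vec_one_bounds(1)[OF y]])
    finally have 2: "- M2 \<le> u t y" using M(2)[OF t] by (simp add: abs_le_iff)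
    have "M1 \<le> max M1 M2" "M2 \<le> max M1 M2" by simp_all
    then show ?thesis using 1 2 unfolding abs_le_iff by linarith
  qed
  then show ?thesis by blast
qed

lemma gderiv_unique:
  assumes "GDERIV f x :> g" "GDERIV f x :> h"
  shows "g = h"
proof -
  have "(\<lambda>k. k \<bullet> g) = (\<lambda>k. k \<bullet> h)" using has_derivative_unique assms unfolding gderiv_def by blast
  from fun_cong[OF this, of "g - h"] have "(g - h) \<bullet> (g - h) = 0" by (simp add: inner_diff_right)
  then show ?thesis by simp
qed

lemma AE_lborel_reflect:
  fixes P :: "real ^ 'd \<Rightarrow> bool"
  assumes "AE y in lborel. P y"
  shows "AE y in lborel. P (- y)"
proof -
  have "lborel = density (distr lborel borel (\<lambda>y :: real ^ 'd. 0 + (-1) *\<^sub>R y)) (\<lambda>_. ennreal (\<bar>- 1\<bar> ^ DIM(real ^ 'd)))"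
    by (rule lborel_affine) simp
  then have eq: "lborel = distr lborel borel (\<lambda>y :: real ^ 'd. - y)" by (simp add: density_1)
  have "AE y in distr lborel borel (\<lambda>y :: real ^ 'd. - y). P y" unfolding eq[symmetric] by (rule assms)
  then show ?thesis by (rule AE_distrD[rotated]) simp
qed

lemma inner_mono_nonpos:
  fixes b c g :: "real ^ 'd"
  assumes "b \<le> c" "\<And>i. g $ i \<le> 0"
  shows "c \<bullet> g \<le> b \<bullet> g"
  unfolding inner_vec_def
proof (rule sum_mono)
  fix i
  have "b $ i \<le> c $ i" using assms(1) by (simp add: less_eq_vec_def)
  from mult_right_mono_neg[OF this assms(2)[of i]]
  show "c $ i \<bullet> g $ i \<le> b $ i \<bullet> g $ i" by simp
qed

lemma AE_time_slices:
  fixes P :: "real \<Rightarrow> real ^ 'd \<Rightarrow> bool"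
  assumes "AE (t, x) in lebesgue_on ({0..T} \<times> UNIV). P t x"
  shows "AE x in lborel. AE t in lborel. t \<in> {0..T} \<longrightarrow> P t x"
proof -
  have Im: "{0..T} \<times> (UNIV :: (real ^ 'd) set) \<in> sets lebesgue"
    by (intro sets_completionI_sets) (simp add: borel_closed closed_Times)
  have "AE z in lebesgue. z \<in> {0..T} \<times> (UNIV :: (real ^ 'd) set) \<longrightarrow> (case z of (t, x) \<Rightarrow> P t x)"
    using assms Im by (subst (asm) AE_restrict_space_iff) auto
  from AE_lebesgue_sections(2)[OF this] show ?thesis by simp
qed

context growth_field
begin

text \<open>
  The speed at a point \<open>y\<close> below the flow is at most the speed of the flow, and the gradient is
  \<open>\<le> 0\<close>, so the inequality at \<open>y\<close> persists with the speed of the flow.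
\<close>

lemma conv_supersolution_along_flow:
  fixes u :: "real \<Rightarrow> real ^ 'd \<Rightarrow> real"
  assumes reg: "AE t in lborel. t \<in> {0..T} \<longrightarrow> regularises_at (B t) (b t)"
    and ker: "kernel \<psi> p q" and u: "\<And>t. t \<in> {0..T} \<Longrightarrow> antimono (u t)"
    and AC: "\<And>x. absolutely_continuous_on 0 T (\<lambda>t. convolution (u t) \<psi> x)"
    and ineq: "AE (t, x) in lebesgue_on ({0..T} \<times> UNIV).
       \<exists>dt grad. ((\<lambda>s. convolution (u s) \<psi> x) has_real_derivative dt) (at t) \<and>
         GDERIV (convolution (u t) \<psi>) x :> grad \<and> - dt - b t x \<bullet> grad \<ge> 0"
    and s: "0 \<le> s" "s \<le> t" "t \<le> T"
  shows "convolution (u t) \<psi> (flow s x t) \<le> convolution (u s) \<psi> x"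
proof -
  note cont = AC_continuous_on[OF AC]
  have "convolution (u t) \<psi> (flow s x t) \<le> convolution (u s) \<psi> (flow s x s)"
  proof (rule lagrangian_monotone[where G = "\<lambda>r. conv_grad (u r) \<psi>" and \<beta> = "\<lambda>r. B r (flow s x r)"
        and c = "\<lambda>r. (1 + rad x) * C r", OF s(2)])
    show "integrable lborel (\<lambda>r. (1 + rad x) * C r)" using C_int by simp
    show "0 \<le> (1 + rad x) * C r" for r using C_nonneg rad_nonneg[of x] by simp
    show "\<bar>B r (flow s x r) $ i\<bar> \<le> (1 + rad x) * C r" for r i by (rule B_flow_bound)
    show "(\<lambda>r. B r (flow s x r) $ i) integrable_on {v..w}" for v w i by (rule flow_B_on)
    show "flow s x w $ i - flow s x v $ i = integral {v..w} (\<lambda>r. B r (flow s x r) $ i)" if "s \<le> v" "v \<le> w" for v w i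
      by (rule flow_component[OF that])
    show "GDERIV (convolution (u r) \<psi>) y :> conv_grad (u r) \<psi> y" if "r \<in> {s..t}" for r y
      using that s by (intro conv_gderiv[OF ker u]) auto
    fix \<tau> y and \<eta> :: real assume \<tau>: "\<tau> \<in> {s..t}" and \<eta>: "\<eta> > 0"
    have \<tau>T: "\<tau> \<in> {0..T}" using \<tau> s by auto
    have "\<exists>d>0. \<forall>r\<in>{0..T}. \<forall>z. dist r \<tau> < d \<longrightarrow> dist z y < d \<longrightarrow>
        (\<forall>i. \<bar>conv_grad (u r) \<psi> z $ i - conv_grad (u \<tau>) \<psi> y $ i\<bar> < \<eta>)"
      using cont \<tau>T \<eta> by (intro conv_grad_continuous_in_time[OF ker u solution_locally_bounded[OF ker u cont]])
        (auto simp: continuous_on_eq_continuous_within)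
    then show "\<exists>d>0. \<forall>r\<in>{s..t}. \<forall>z. dist r \<tau> < d \<longrightarrow> dist z y < d \<longrightarrow>
        (\<forall>i. \<bar>conv_grad (u r) \<psi> z $ i - conv_grad (u \<tau>) \<psi> y $ i\<bar> < \<eta>)"
      using s by (metis atLeastAtMost_iff order_trans)
  next
    show "AE y in lborel. absolutely_continuous_on s t (\<lambda>r. convolution (u r) \<psi> y) \<and>
      (AE r in lborel. s < r \<and> r < t \<longrightarrow> (\<exists>D. ((\<lambda>r. convolution (u r) \<psi> y) has_real_derivative D) (at r) \<and>
        (\<forall>\<delta>>0. y + \<delta> *\<^sub>R 1 \<le> flow s x r \<longrightarrow> D \<le> - (B r (flow s x r) \<bullet> conv_grad (u r) \<psi> y))))"
      using AE_time_slices[OF ineq]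
    proof eventually_elim
      case (elim y)
      have "AE r in lborel. s < r \<and> r < t \<longrightarrow> (\<exists>D. ((\<lambda>r. convolution (u r) \<psi> y) has_real_derivative D) (at r) \<and>
        (\<forall>\<delta>>0. y + \<delta> *\<^sub>R 1 \<le> flow s x r \<longrightarrow> D \<le> - (B r (flow s x r) \<bullet> conv_grad (u r) \<psi> y)))"
        using elim reg
      proof eventually_elim
        case (elim r)
        show ?case
        proof
          assume r: "s < r \<and> r < t"
          then have rT: "r \<in> {0..T}" using s by auto
          then obtain D g where D: "((\<lambda>s. convolution (u s) \<psi> y) has_real_derivative D) (at r)"
            "GDERIV (convolution (u r) \<psi>) y :> g" "- D - b r y \<bullet> g \<ge> 0" using elim(1) by blast
          have g: "g = conv_grad (u r) \<psi> y" by (rule gderiv_unique[OF D(2) conv_gderiv[OF ker u[OF rT]]])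
          have rr: "regularises_at (B r) (b r)" using elim(2) rT by blast
          show "\<exists>D. ((\<lambda>r. convolution (u r) \<psi> y) has_real_derivative D) (at r) \<and>
            (\<forall>\<delta>>0. y + \<delta> *\<^sub>R 1 \<le> flow s x r \<longrightarrow> D \<le> - (B r (flow s x r) \<bullet> conv_grad (u r) \<psi> y))"
          proof (intro exI[of _ D] conjI allI impI)
            fix \<delta> :: real assume \<delta>: "\<delta> > 0" "y + \<delta> *\<^sub>R 1 \<le> flow s x r"
            have "y \<le> y + \<delta> *\<^sub>R 1" using \<delta>(1) by (simp add: less_eq_vec_def)
            then have "y \<le> flow s x r" using \<delta>(2) by (rule order_trans)
            then have "b r y \<le> b r (flow s x r)" using rr unfolding regularises_at_def by (auto dest: monoD)
            also have "\<dots> \<le> B r (flow s x r)" using rr unfolding regularises_at_def by blast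
            finally have "B r (flow s x r) \<bullet> conv_grad (u r) \<psi> y \<le> b r y \<bullet> conv_grad (u r) \<psi> y"
              by (rule inner_mono_nonpos[OF _ conv_grad_nonpos[OF ker u[OF rT]]])
            then show "D \<le> - (B r (flow s x r) \<bullet> conv_grad (u r) \<psi> y)" using D(3) unfolding g by linarith
          qed (fact D(1))
        qed
      qed
      moreover have "absolutely_continuous_on s t (\<lambda>r. convolution (u r) \<psi> y)"
        by (rule AC_subinterval[OF AC]) (use s in auto)
      ultimately show ?case by blast
    qed
  qed
  then show ?thesis by (simp add: flow_start)
qed

text \<open>
  The reflection \<open>y \<mapsto> - y\<close> turns points above the flow into points below the path and, with the sign
  of the function changed, increase into decrease.
\<close>

lemma conv_subsolution_along_flow:
  fixes u :: "real \<Rightarrow> real ^ 'd \<Rightarrow> real"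
  assumes reg: "AE t in lborel. t \<in> {0..T} \<longrightarrow> regularises_at (B t) (b t)"
    and ker: "kernel \<psi> p q" and u: "\<And>t. t \<in> {0..T} \<Longrightarrow> antimono (u t)"
    and AC: "\<And>x. absolutely_continuous_on 0 T (\<lambda>t. convolution (u t) \<psi> x)"
    and ineq: "AE (t, x) in lebesgue_on ({0..T} \<times> UNIV).
       \<exists>dt grad. ((\<lambda>s. convolution (u s) \<psi> x) has_real_derivative dt) (at t) \<and>
         GDERIV (convolution (u t) \<psi>) x :> grad \<and> - dt - b t x \<bullet> grad \<le> 0"
    and s: "0 \<le> s" "s \<le> t" "t \<le> T"
  shows "convolution (u s) \<psi> x \<le> convolution (u t) \<psi> (flow s x t)"
proof -
  note cont = AC_continuous_on[OF AC]
  have "- convolution (u t) \<psi> (- (- flow s x t)) \<le> - convolution (u s) \<psi> (- (- flow s x s))"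
  proof (rule lagrangian_monotone[where f = "\<lambda>r y. - convolution (u r) \<psi> (- y)"
        and G = "\<lambda>r y. conv_grad (u r) \<psi> (- y)" and \<gamma> = "\<lambda>r. - flow s x r" and \<beta> = "\<lambda>r. - B r (flow s x r)"
        and c = "\<lambda>r. (1 + rad x) * C r", OF s(2)])
    show "integrable lborel (\<lambda>r. (1 + rad x) * C r)" using C_int by simp
    show "0 \<le> (1 + rad x) * C r" for r using C_nonneg rad_nonneg[of x] by simp
    show "\<bar>(- B r (flow s x r)) $ i\<bar> \<le> (1 + rad x) * C r" for r i using B_flow_bound[of r s x i] by simp
    show "(\<lambda>r. (- B r (flow s x r)) $ i) integrable_on {v..w}" for v w i
      using integrable_neg[OF flow_B_on[of s x i v w]] by simp
    show "(- flow s x w) $ i - (- flow s x v) $ i = integral {v..w} (\<lambda>r. (- B r (flow s x r)) $ i)" if "s \<le> v" "v \<le> w" for v w i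
      using flow_component[OF that, of x i] by simp
    show "GDERIV (\<lambda>y. - convolution (u r) \<psi> (- y)) y :> conv_grad (u r) \<psi> (- y)" if "r \<in> {s..t}" for r y
    proof -
      have "GDERIV (convolution (u r) \<psi>) (- y) :> conv_grad (u r) \<psi> (- y)"
        using that s by (intro conv_gderiv[OF ker u]) auto
      then have 1: "(convolution (u r) \<psi> has_derivative (\<lambda>h. h \<bullet> conv_grad (u r) \<psi> (- y))) (at (- y))"
        unfolding gderiv_def .
      have "((\<lambda>y. - y) has_derivative (\<lambda>h. - h)) (at y)" by (intro derivative_eq_intros) auto
      from has_derivative_compose[OF this 1]
      have "((\<lambda>y. convolution (u r) \<psi> (- y)) has_derivative (\<lambda>h. (- h) \<bullet> conv_grad (u r) \<psi> (- y))) (at y)" .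
      from has_derivative_minus[OF this] show ?thesis unfolding gderiv_def by simp
    qed
    fix \<tau> y and \<eta> :: real assume \<tau>: "\<tau> \<in> {s..t}" and \<eta>: "\<eta> > 0"
    have \<tau>T: "\<tau> \<in> {0..T}" using \<tau> s by auto
    have "\<exists>d>0. \<forall>r\<in>{0..T}. \<forall>z. dist r \<tau> < d \<longrightarrow> dist z (- y) < d \<longrightarrow>
        (\<forall>i. \<bar>conv_grad (u r) \<psi> z $ i - conv_grad (u \<tau>) \<psi> (- y) $ i\<bar> < \<eta>)"
      using cont \<tau>T \<eta> by (intro conv_grad_continuous_in_time[OF ker u solution_locally_bounded[OF ker u cont]])
        (auto simp: continuous_on_eq_continuous_within)
    then obtain d where d: "d > 0" "\<And>r z i. r \<in> {0..T} \<Longrightarrow> dist r \<tau> < d \<Longrightarrow> dist z (- y) < d \<Longrightarrow>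
        \<bar>conv_grad (u r) \<psi> z $ i - conv_grad (u \<tau>) \<psi> (- y) $ i\<bar> < \<eta>" by blast
    show "\<exists>d>0. \<forall>r\<in>{s..t}. \<forall>z. dist r \<tau> < d \<longrightarrow> dist z y < d \<longrightarrow>
        (\<forall>i. \<bar>conv_grad (u r) \<psi> (- z) $ i - conv_grad (u \<tau>) \<psi> (- y) $ i\<bar> < \<eta>)"
    proof (intro exI[of _ d] conjI ballI allI impI)
      fix r z i assume "r \<in> {s..t}" "dist r \<tau> < d" "dist z y < d"
      then show "\<bar>conv_grad (u r) \<psi> (- z) $ i - conv_grad (u \<tau>) \<psi> (- y) $ i\<bar> < \<eta>"
        using s by (intro d(2)) (auto simp: dist_minus)
    qed (fact d(1))
  next
    have "AE y in lborel. AE r in lborel. r \<in> {0..T} \<longrightarrow>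
      (\<exists>dt grad. ((\<lambda>s. convolution (u s) \<psi> (- y)) has_real_derivative dt) (at r) \<and>
         GDERIV (convolution (u r) \<psi>) (- y) :> grad \<and> - dt - b r (- y) \<bullet> grad \<le> 0)"
      by (rule AE_lborel_reflect[OF AE_time_slices[OF ineq]])
    then show "AE y in lborel. absolutely_continuous_on s t (\<lambda>r. - convolution (u r) \<psi> (- y)) \<and>
      (AE r in lborel. s < r \<and> r < t \<longrightarrow> (\<exists>D. ((\<lambda>r. - convolution (u r) \<psi> (- y)) has_real_derivative D) (at r) \<and>
        (\<forall>\<delta>>0. y + \<delta> *\<^sub>R 1 \<le> - flow s x r \<longrightarrow> D \<le> - ((- B r (flow s x r)) \<bullet> conv_grad (u r) \<psi> (- y)))))"
    proof eventually_elim
      case (elim y)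
      have "AE r in lborel. s < r \<and> r < t \<longrightarrow> (\<exists>D. ((\<lambda>r. - convolution (u r) \<psi> (- y)) has_real_derivative D) (at r) \<and>
        (\<forall>\<delta>>0. y + \<delta> *\<^sub>R 1 \<le> - flow s x r \<longrightarrow> D \<le> - ((- B r (flow s x r)) \<bullet> conv_grad (u r) \<psi> (- y))))"
        using elim reg
      proof eventually_elim
        case (elim r)
        show ?case
        proof
          assume r: "s < r \<and> r < t"
          then have rT: "r \<in> {0..T}" using s by auto
          then obtain D g where D: "((\<lambda>s. convolution (u s) \<psi> (- y)) has_real_derivative D) (at r)"
            "GDERIV (convolution (u r) \<psi>) (- y) :> g" "- D - b r (- y) \<bullet> g \<le> 0" using elim(1) by blast
          have g: "g = conv_grad (u r) \<psi> (- y)" by (rule gderiv_unique[OF D(2) conv_gderiv[OF ker u[OF rT]]])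
          have rr: "regularises_at (B r) (b r)" using elim(2) rT by blast
          show "\<exists>D. ((\<lambda>r. - convolution (u r) \<psi> (- y)) has_real_derivative D) (at r) \<and>
            (\<forall>\<delta>>0. y + \<delta> *\<^sub>R 1 \<le> - flow s x r \<longrightarrow> D \<le> - ((- B r (flow s x r)) \<bullet> conv_grad (u r) \<psi> (- y)))"
          proof (intro exI[of _ "- D"] conjI allI impI)
            show "((\<lambda>r. - convolution (u r) \<psi> (- y)) has_real_derivative - D) (at r)" using D(1) by (rule DERIV_minus)
            fix \<delta> :: real assume \<delta>: "\<delta> > 0" "y + \<delta> *\<^sub>R 1 \<le> - flow s x r"
            have "flow s x r + \<delta> *\<^sub>R 1 \<le> - y" unfolding less_eq_vec_def
            proof
              fix i
              have "y $ i + \<delta> \<le> - flow s x r $ i" using \<delta>(2) by (simp add: less_eq_vec_def)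
              then show "(flow s x r + \<delta> *\<^sub>R 1) $ i \<le> (- y) $ i" by simp
            qed
            then have "B r (flow s x r) \<le> b r (- y)" using rr \<delta>(1) unfolding regularises_at_def by blast
            then have "b r (- y) \<bullet> conv_grad (u r) \<psi> (- y) \<le> B r (flow s x r) \<bullet> conv_grad (u r) \<psi> (- y)"
              by (rule inner_mono_nonpos[OF _ conv_grad_nonpos[OF ker u[OF rT]]])
            then show "- D \<le> - ((- B r (flow s x r)) \<bullet> conv_grad (u r) \<psi> (- y))" using D(3) unfolding g by simp
          qed
        qed
      qed
      moreover have "absolutely_continuous_on s t (\<lambda>r. - convolution (u r) \<psi> (- y))"
      proof (rule AC_dominated[OF AC_subinterval[OF AC] zero_less_one])
        show "dist (- convolution (u v) \<psi> (- y)) (- convolution (u w) \<psi> (- y)) \<le> 1 * dist (convolution (u v) \<psi> (- y)) (convolution (u w) \<psi> (- y))" for v w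
          by (simp add: dist_minus)
      qed (use s in auto)
      ultimately show ?case by blast
    qed
  qed
  then show ?thesis by (simp add: flow_start)
qed

end

section \<open>The transported terminal datum\<close>

lemma jointly_continuous_if_antimono:
  fixes f :: "real \<Rightarrow> real ^ 'd \<Rightarrow> real"
  assumes anti: "\<And>t. antimono (f t)" and cx: "isCont (f t) x" and ct: "\<And>y. isCont (\<lambda>t. f t y) t"
  shows "isCont (\<lambda>z. f (fst z) (snd z)) (t, x)"
  unfolding continuous_at_eps_delta
proof (intro allI impI)
  fix e :: real assume e: "e > 0"
  have e2: "e / 2 > 0" using e by simp
  have "\<forall>\<^sub>F n in sequentially. dist (f t (x - (1 / real (Suc n)) *\<^sub>R 1)) (f t x) < e / 2 \<and>
      dist (f t (x + (1 / real (Suc n)) *\<^sub>R 1)) (f t x) < e / 2"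
    using tendstoD[OF tendsto_diag(1)[OF cx] e2] tendstoD[OF tendsto_diag(2)[OF cx] e2] by eventually_elim simp
  then obtain n where n: "dist (f t (x - (1 / real (Suc n)) *\<^sub>R 1)) (f t x) < e / 2"
      "dist (f t (x + (1 / real (Suc n)) *\<^sub>R 1)) (f t x) < e / 2"
    using eventually_happens'[OF sequentially_bot] by blast
  define \<delta> where "\<delta> = 1 / real (Suc n)"
  have \<delta>: "\<delta> > 0" unfolding \<delta>_def by simp
  obtain d1 where d1: "d1 > 0" "\<And>s. dist s t < d1 \<Longrightarrow> dist (f s (x - \<delta> *\<^sub>R 1)) (f t (x - \<delta> *\<^sub>R 1)) < e / 2"
    using ct[of "x - \<delta> *\<^sub>R 1", unfolded continuous_at_eps_delta, rule_format, OF e2] by auto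
  obtain d2 where d2: "d2 > 0" "\<And>s. dist s t < d2 \<Longrightarrow> dist (f s (x + \<delta> *\<^sub>R 1)) (f t (x + \<delta> *\<^sub>R 1)) < e / 2"
    using ct[of "x + \<delta> *\<^sub>R 1", unfolded continuous_at_eps_delta, rule_format, OF e2] by auto
  show "\<exists>d>0. \<forall>z. dist z (t, x) < d \<longrightarrow> dist (f (fst z) (snd z)) (f (fst (t, x)) (snd (t, x))) < e"
  proof (intro exI[of _ "min \<delta> (min d1 d2)"] conjI allI impI)
    show "0 < min \<delta> (min d1 d2)" using \<delta> d1(1) d2(1) by simp
    fix z :: "real \<times> (real ^ 'd)" assume z: "dist z (t, x) < min \<delta> (min d1 d2)"
    have dt: "dist (fst z) t < d1" "dist (fst z) t < d2" using z dist_fst_le[of z "(t, x)"] by auto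
    have dx: "norm (snd z - x) \<le> \<delta>" using z dist_snd_le[of z "(t, x)"] by (auto simp: dist_norm)
    have "snd z - x \<le> \<delta> *\<^sub>R 1" "- (\<delta> *\<^sub>R 1) \<le> snd z - x" by (rule vec_one_bounds[OF dx])+
    then have "snd z \<le> x + \<delta> *\<^sub>R 1" "x - \<delta> *\<^sub>R 1 \<le> snd z" by (auto simp: less_eq_vec_def algebra_simps) 
    then have "f (fst z) (x + \<delta> *\<^sub>R 1) \<le> f (fst z) (snd z)" "f (fst z) (snd z) \<le> f (fst z) (x - \<delta> *\<^sub>R 1)"
      by (auto intro: antimonoD[OF anti])
    then show "dist (f (fst z) (snd z)) (f (fst (t, x)) (snd (t, x))) < e"
      using d1(2)[OF dt(1)] d2(2)[OF dt(2)] n unfolding \<delta>_def[symmetric] dist_real_def fst_conv snd_conv by linarith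
  qed
qed

text \<open>
  By continuity, the Cauchy criterion for difference quotients needs to be checked for rational
  increments only.
\<close>

lemma differentiability_set_borel:
  fixes F :: "real \<Rightarrow> 'a::euclidean_space \<Rightarrow> real"
  assumes cont: "\<And>z. isCont (\<lambda>z. F (fst z) (snd z)) z"
  shows "{z. \<exists>D. ((\<lambda>s. F s (snd z)) has_real_derivative D) (at (fst z))} \<in> sets borel"
proof -
  have contF: "continuous_on UNIV (\<lambda>z. F (fst z) (snd z))"
    using cont by (simp add: continuous_on_eq_continuous_at)
  define q where "q h z = (F (fst z + h) (snd z) - F (fst z) (snd z)) / h" for h and z :: "real \<times> 'a"
  have qc: "continuous_on UNIV (q h)" if "h \<noteq> 0" for h
  proof -
    have "continuous_on UNIV (\<lambda>z :: real \<times> 'a. F (fst (fst z + h, snd z)) (snd (fst z + h, snd z)))"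
      by (rule continuous_on_compose2[OF contF]) (auto intro!: continuous_intros)
    then show ?thesis unfolding q_def[abs_def] using that contF by (intro continuous_intros) auto
  qed
  have qh: "continuous_on {h. h \<noteq> 0} (\<lambda>h. q h z)" for z
  proof -
    have "continuous_on UNIV (\<lambda>h. F (fst (fst z + h, snd z)) (snd (fst z + h, snd z)))"
      by (rule continuous_on_compose2[OF contF]) (auto intro!: continuous_intros)
    then have "continuous_on {h. h \<noteq> 0} (\<lambda>h. F (fst z + h) (snd z))" unfolding fst_conv snd_conv by (rule continuous_on_subset) auto
    then show ?thesis unfolding q_def by (intro continuous_intros) auto
  qed
  define Q where "Q m = {p. fst p \<in> \<rat> \<and> snd p \<in> \<rat> \<and> fst p \<noteq> 0 \<and> snd p \<noteq> 0 \<and> \<bar>fst p\<bar> < 1 / real (Suc m) \<and> \<bar>snd p\<bar> < 1 / real (Suc m)}" for m :: nat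
  have Qc: "countable (Q m)" for m
    by (rule countable_subset[of _ "\<rat> \<times> \<rat>"]) (auto simp: Q_def countable_rat)
  define A where "A = (\<Inter>k::nat. \<Union>m::nat. \<Inter>p\<in>Q m. {z. \<bar>q (fst p) z - q (snd p) z\<bar> \<le> 1 / real (Suc k)})"
  have closed: "closed (\<Inter>p\<in>Q m. {z. \<bar>q (fst p) z - q (snd p) z\<bar> \<le> 1 / real (Suc k)})" for m k
  proof (rule closed_INT, rule ballI)
    fix p assume "p \<in> Q m"
    then have "fst p \<noteq> 0" "snd p \<noteq> 0" unfolding Q_def by auto
    then show "closed {z. \<bar>q (fst p) z - q (snd p) z\<bar> \<le> 1 / real (Suc k)}"
      by (intro closed_Collect_le continuous_intros qc)
  qed
  have "A \<in> sets borel"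
    unfolding A_def by (intro sets.countable_INT'' sets.countable_UN') (use borel_closed[OF closed] in auto)
  moreover have "A = {z. \<exists>D. ((\<lambda>s. F s (snd z)) has_real_derivative D) (at (fst z))}"
  proof (rule set_eqI)
    fix z
    have deriv_iff: "((\<lambda>s. F s (snd z)) has_real_derivative D) (at (fst z)) \<longleftrightarrow> ((\<lambda>h. q h z) \<longlongrightarrow> D) (at 0)" for D
      unfolding DERIV_def q_def by simp
    show "z \<in> A \<longleftrightarrow> z \<in> {z. \<exists>D. ((\<lambda>s. F s (snd z)) has_real_derivative D) (at (fst z))}"
    proof
      assume "z \<in> {z. \<exists>D. ((\<lambda>s. F s (snd z)) has_real_derivative D) (at (fst z))}"
      then obtain D where D: "((\<lambda>h. q h z) \<longlongrightarrow> D) (at 0)" using deriv_iff by auto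
      have "\<exists>m. \<forall>p\<in>Q m. \<bar>q (fst p) z - q (snd p) z\<bar> \<le> 1 / real (Suc k)" for k
      proof -
        define c where "c = 1 / real (Suc k)"
        have "0 < c / 2" unfolding c_def by simp
        from tendstoD[OF D this] obtain d where d: "d > 0" "\<And>h. h \<noteq> 0 \<Longrightarrow> dist h 0 < d \<Longrightarrow> dist (q h z) D < c / 2"
          unfolding eventually_at by auto
        obtain m where m: "inverse (real (Suc m)) < d" using reals_Archimedean[OF d(1)] by blast
        have "\<bar>q (fst p) z - q (snd p) z\<bar> \<le> 1 / real (Suc k)" if "p \<in> Q m" for p
        proof -
          have "dist (fst p) 0 < d" "dist (snd p) 0 < d" "fst p \<noteq> 0" "snd p \<noteq> 0"
            using that m unfolding Q_def by (auto simp: inverse_eq_divide)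
          then have "dist (q (fst p) z) D < c / 2" "dist (q (snd p) z) D < c / 2" using d(2) by blast+
          then show ?thesis unfolding dist_real_def c_def[symmetric] by linarith
        qed
        then show ?thesis by blast
      qed
      then show "z \<in> A" unfolding A_def by auto
    next
      assume zA: "z \<in> A"
      have rat: "\<exists>m. \<forall>p\<in>Q m. \<bar>q (fst p) z - q (snd p) z\<bar> \<le> 1 / real (Suc k)" for k
        using zA unfolding A_def by auto
      have real: "\<exists>m. \<forall>h h'. h \<noteq> 0 \<longrightarrow> h' \<noteq> 0 \<longrightarrow> \<bar>h\<bar> < 1 / real (Suc m) \<longrightarrow> \<bar>h'\<bar> < 1 / real (Suc m) \<longrightarrow>
          \<bar>q h z - q h' z\<bar> \<le> 1 / real (Suc k)" for k
      proof -
        obtain m where m: "\<And>p. p \<in> Q m \<Longrightarrow> \<bar>q (fst p) z - q (snd p) z\<bar> \<le> 1 / real (Suc k)" using rat[of k] by blast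
        define U where "U = {h :: real. h \<noteq> 0 \<and> \<bar>h\<bar> < 1 / real (Suc m)}"
        have Uo: "open U" unfolding U_def by (intro open_Collect_conj open_Collect_neq open_Collect_less continuous_intros)
        have approx: "\<exists>h'. h' \<in> \<rat> \<and> h' \<in> U \<and> \<bar>q h' z - q h z\<bar> < e" if h: "h \<in> U" and e: "e > 0" for h e
        proof -
          have "continuous_on U (\<lambda>h. q h z)" by (rule continuous_on_subset[OF qh]) (auto simp: U_def)
          then have "open (U \<inter> (\<lambda>h. q h z) -` ball (q h z) e)" using Uo by (intro continuous_open_preimage) auto
          moreover have "h \<in> U \<inter> (\<lambda>h. q h z) -` ball (q h z) e" using h e by simp
          ultimately obtain d where d: "d > 0" "ball h d \<subseteq> U \<inter> (\<lambda>h. q h z) -` ball (q h z) e" using openE by blast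
          obtain h' where h': "h' \<in> \<rat>" "h < h'" "h' < h + d" using Rats_dense_in_real[of h "h + d"] d(1) by auto
          then have "h' \<in> ball h d" by (simp add: dist_real_def)
          then have "h' \<in> U" "dist (q h z) (q h' z) < e" using d(2) by auto
          then show ?thesis using h'(1) by (auto simp: dist_real_def abs_minus_commute)
        qed
        have "\<bar>q h z - q h' z\<bar> \<le> 1 / real (Suc k)" if hh: "h \<in> U" "h' \<in> U" for h h'
        proof (rule field_le_epsilon)
          fix e :: real assume "e > 0"
          then have e2: "e / 2 > 0" by simp
          obtain r where r: "r \<in> \<rat>" "r \<in> U" "\<bar>q r z - q h z\<bar> < e / 2" using approx[OF hh(1) e2] by blast
          obtain r' where r': "r' \<in> \<rat>" "r' \<in> U" "\<bar>q r' z - q h' z\<bar> < e / 2" using approx[OF hh(2) e2] by blast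
          have "(r, r') \<in> Q m" using r r' unfolding Q_def U_def by simp
          from m[OF this] have "\<bar>q r z - q r' z\<bar> \<le> 1 / real (Suc k)" by simp
          moreover have "\<bar>q h z - q h' z\<bar> \<le> \<bar>q r z - q r' z\<bar> + \<bar>q r z - q h z\<bar> + \<bar>q r' z - q h' z\<bar>" by linarith
          ultimately show "\<bar>q h z - q h' z\<bar> \<le> 1 / real (Suc k) + e" using r(3) r'(3) field_sum_of_halves[of e] by linarith
        qed
        then show ?thesis unfolding U_def by blast
      qed
      define a where "a n = q (1 / real (Suc (Suc n))) z" for n
      have small: "\<bar>1 / real (Suc (Suc n))\<bar> < 1 / real (Suc m)" if "m \<le> n" for m n
        using that by (simp add: frac_less2)
      have "Cauchy a"
      proof (rule metric_CauchyI)
        fix e :: real assume "e > 0"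
        then obtain k where k: "inverse (real (Suc k)) < e" using reals_Archimedean by blast
        obtain m where m: "\<And>h h'. h \<noteq> 0 \<Longrightarrow> h' \<noteq> 0 \<Longrightarrow> \<bar>h\<bar> < 1 / real (Suc m) \<Longrightarrow> \<bar>h'\<bar> < 1 / real (Suc m) \<Longrightarrow>
          \<bar>q h z - q h' z\<bar> \<le> 1 / real (Suc k)" using real[of k] by blast
        have "dist (a i) (a j) < e" if "m \<le> i" "m \<le> j" for i j
        proof -
          have "\<bar>a i - a j\<bar> \<le> 1 / real (Suc k)" unfolding a_def by (rule m) (use small that in auto)
          then show ?thesis using k by (simp add: dist_real_def inverse_eq_divide)
        qed
        then show "\<exists>M. \<forall>m\<ge>M. \<forall>n\<ge>M. dist (a m) (a n) < e" by blast
      qed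
      then obtain D where D: "a \<longlonglongrightarrow> D" using Cauchy_convergent convergent_def by blast
      have "((\<lambda>h. q h z) \<longlongrightarrow> D) (at 0)"
      proof (rule tendstoI)
        fix e :: real assume "e > 0"
        then obtain k where k: "inverse (real (Suc k)) < e" using reals_Archimedean by blast
        obtain m where m: "\<And>h h'. h \<noteq> 0 \<Longrightarrow> h' \<noteq> 0 \<Longrightarrow> \<bar>h\<bar> < 1 / real (Suc m) \<Longrightarrow> \<bar>h'\<bar> < 1 / real (Suc m) \<Longrightarrow>
          \<bar>q h z - q h' z\<bar> \<le> 1 / real (Suc k)" using real[of k] by blast
        have "dist (q h z) D < e" if h: "h \<noteq> 0" "dist h 0 < 1 / real (Suc m)" for h
        proof -
          have lim: "(\<lambda>n. \<bar>q h z - a n\<bar>) \<longlonglongrightarrow> \<bar>q h z - D\<bar>" by (intro tendsto_intros D)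
          have "\<bar>q h z - D\<bar> \<le> 1 / real (Suc k)"
          proof (rule LIMSEQ_le_const2[OF lim], intro exI[of _ m] allI impI)
            fix n assume "m \<le> n"
            then show "\<bar>q h z - a n\<bar> \<le> 1 / real (Suc k)" unfolding a_def using h small by (intro m) auto
          qed
          then show ?thesis using k by (simp add: dist_real_def inverse_eq_divide)
        qed
        then show "\<forall>\<^sub>F h in at 0. dist (q h z) D < e" unfolding eventually_at by (intro exI[of _ "1 / real (Suc m)"]) auto
      qed
      then show "z \<in> {z. \<exists>D. ((\<lambda>s. F s (snd z)) has_real_derivative D) (at (fst z))}" using deriv_iff by auto
    qed
  qed
  ultimately show ?thesis by simp
qed

lemma AE_pair_if_AE_time:
  fixes A :: "(real \<times> 'a::euclidean_space) set"
  assumes A: "A \<in> sets borel" and ae: "\<And>x. AE t in lborel. (t, x) \<in> A"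
  shows "AE z in lborel. z \<in> A"
proof -
  have cA: "- A \<in> sets (lborel \<Otimes>\<^sub>M lborel)" using A unfolding lborel_prod by simp
  have "emeasure lborel (- A) = emeasure (lborel \<Otimes>\<^sub>M lborel) (- A)" unfolding lborel_prod ..
  also have "\<dots> = (\<integral>\<^sup>+x. emeasure lborel ((\<lambda>t. (t, x)) -` (- A)) \<partial>lborel)"
    by (rule lborel_pair.emeasure_pair_measure_alt2[OF cA])
  also have "\<dots> = (\<integral>\<^sup>+(x :: 'a). 0 \<partial>lborel)"
  proof (rule nn_integral_cong)
    fix x :: 'a
    have "{t \<in> space lborel. \<not> (t, x) \<in> A} = (\<lambda>t. (t, x)) -` (- A)" by auto
    moreover have "(\<lambda>t. (t, x)) -` (- A) \<in> sets lborel" by (rule sets_Pair2[OF cA])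
    ultimately show "emeasure lborel ((\<lambda>t. (t, x)) -` (- A)) = 0" using ae[of x] AE_iff_measurable[of "(\<lambda>t. (t, x)) -` (- A)" lborel "\<lambda>t. (t, x) \<in> A"] by simp
  qed
  also have "\<dots> = 0" by simp
  finally have "- A \<in> null_sets lborel" using A by (intro null_setsI) auto
  from AE_not_in[OF this] show ?thesis by simp
qed

lemma AE_pair_if_AE_space:
  fixes A :: "(real \<times> 'a::euclidean_space) set"
  assumes A: "A \<in> sets borel" and ae: "\<And>t. AE x in lborel. (t, x) \<in> A"
  shows "AE z in lborel. z \<in> A"
proof -
  have cA: "- A \<in> sets (lborel \<Otimes>\<^sub>M lborel)" using A unfolding lborel_prod by simp
  have "emeasure lborel (- A) = emeasure (lborel \<Otimes>\<^sub>M lborel) (- A)" unfolding lborel_prod ..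
  also have "\<dots> = (\<integral>\<^sup>+t. emeasure lborel (Pair t -` (- A)) \<partial>lborel)"
    by (rule lborel.emeasure_pair_measure_alt[OF cA])
  also have "\<dots> = (\<integral>\<^sup>+(t :: real). 0 \<partial>lborel)"
  proof (rule nn_integral_cong)
    fix t :: real
    have "{x \<in> space lborel. \<not> (t, x) \<in> A} = Pair t -` (- A)" by auto
    moreover have "Pair t -` (- A) \<in> sets lborel" by (rule sets_Pair1[OF cA])
    ultimately show "emeasure lborel (Pair t -` (- A)) = 0" using ae[of t] AE_iff_measurable[of "Pair t -` (- A)" lborel "\<lambda>x. (t, x) \<in> A"] by simp
  qed
  also have "\<dots> = 0" by simp
  finally have "- A \<in> null_sets lborel" using A by (intro null_setsI) auto
  from AE_not_in[OF this] show ?thesis by simp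
qed

lemma AE_fst:
  assumes "AE t in lborel. P t"
  shows "AE z in (lborel :: (real \<times> 'a::euclidean_space) measure). P (fst z)"
proof -
  obtain N where N: "\<And>t. t \<in> space lborel - N \<Longrightarrow> P t" "N \<in> null_sets lborel" using AE_E3[OF assms] by blast
  have "fst \<in> borel_measurable (borel :: (real \<times> 'a) measure)" by (intro borel_measurable_continuous_onI continuous_intros)
  from measurable_sets[OF this, of "- N"] N(2) have m: "fst -` (- N) \<in> sets (borel :: (real \<times> 'a) measure)" by auto
  have "AE z in (lborel :: (real \<times> 'a) measure). z \<in> fst -` (- N)"
    by (rule AE_pair_if_AE_time[OF m]) (use AE_not_in[OF N(2)] in simp)
  then show ?thesis by (rule eventually_mono) (use N(1) in auto)
qed

context growth_field
begin

text \<open>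
  The solution operator of the flow, applied to \<open>g\<close>.
\<close>

definition transported :: "real \<Rightarrow> (real ^ 'd \<Rightarrow> real) \<Rightarrow> real \<Rightarrow> real ^ 'd \<Rightarrow> real" where
  "transported T g t x = g (flow t x T)"

lemma transported_antimono: "antimono g \<Longrightarrow> antimono (transported T g t)"
  unfolding transported_def using flow_mono by (auto simp: antimono_def)

lemma transported_after: "T \<le> t \<Longrightarrow> transported T g t = g"
  unfolding transported_def by (auto simp: flow_start)

lemma transported_along_flow:
  "s \<le> t \<Longrightarrow> t \<le> T \<Longrightarrow> transported T g s y = transported T g t (flow s y t)"
  unfolding transported_def by (simp add: flow_semigroup)

text \<open>
  Expansion compares the translate of the path from \<open>x\<close> to a starting point \<open>y\<close> with the path from \<open>y\<close>
  itself.
\<close>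

lemma transported_shift:
  assumes g: "antimono g" and st: "s \<le> t" "t \<le> T"
  shows "y \<le> x \<Longrightarrow> transported T g t ((flow s x t - x) + y) \<le> transported T g s y"
    "x \<le> y \<Longrightarrow> transported T g s y \<le> transported T g t ((flow s x t - x) + y)"
proof -
  show "transported T g t ((flow s x t - x) + y) \<le> transported T g s y" if "y \<le> x"
  proof -
    have "flow s y t \<le> (flow s x t - x) + y"
      using flow_expanding[OF that, of s t] by (auto simp: less_eq_vec_def algebra_simps)
    then show ?thesis unfolding transported_along_flow[OF st, of g y] by (rule antimonoD[OF transported_antimono[OF g]])
  qed
  show "transported T g s y \<le> transported T g t ((flow s x t - x) + y)" if "x \<le> y"
  proof -
    have "(flow s x t - x) + y \<le> flow s y t"
      using flow_expanding[OF that, of s t] by (auto simp: less_eq_vec_def algebra_simps)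
    then show ?thesis unfolding transported_along_flow[OF st, of g y] by (rule antimonoD[OF transported_antimono[OF g]])
  qed
qed

text \<open>
  With \<open>0 \<le> p\<close> the mollification at \<open>x\<close> sees only points \<open>y \<le> x\<close>, for which the previous lemma
  compares \<open>transported T g s\<close> with a translate of \<open>transported T g t\<close>.
\<close>

lemma conv_transported_lower:
  assumes g: "antimono g" and ker: "kernel \<psi> p q" and "0 \<le> p" and st: "s \<le> t" "t \<le> T"
  shows "convolution (transported T g t) \<psi> (flow s x t) \<le> convolution (transported T g s) \<psi> x"
proof -
  have "convolution (\<lambda>y. transported T g t ((flow s x t - x) + y)) \<psi> x \<le> convolution (transported T g s) \<psi> x"
  proof (rule conv_mono[OF ker antimono_translate[OF transported_antimono[OF g]] transported_antimono[OF g]])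
    fix y assume "\<psi> (x - y) \<noteq> 0"
    then have "p *\<^sub>R 1 \<le> x - y" using ker unfolding kernel_def by blast
    then have yi: "p \<le> x $ i - y $ i" for i by (simp add: less_eq_vec_def)
    have "y \<le> x" unfolding less_eq_vec_def
    proof
      fix i show "y $ i \<le> x $ i" using yi[of i] \<open>0 \<le> p\<close> by linarith
    qed
    then show "transported T g t ((flow s x t - x) + y) \<le> transported T g s y" by (rule transported_shift(1)[OF g st])
  qed
  then show ?thesis using conv_translate[OF ker transported_antimono[OF g], of T t "flow s x t - x" x] by simp
qed

lemma conv_transported_upper:
  assumes g: "antimono g" and ker: "kernel \<psi> p q" and "q \<le> 0" and st: "s \<le> t" "t \<le> T"
  shows "convolution (transported T g s) \<psi> x \<le> convolution (transported T g t) \<psi> (flow s x t)"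
proof -
  have "convolution (transported T g s) \<psi> x \<le> convolution (\<lambda>y. transported T g t ((flow s x t - x) + y)) \<psi> x"
  proof (rule conv_mono[OF ker transported_antimono[OF g] antimono_translate[OF transported_antimono[OF g]]])
    fix y assume "\<psi> (x - y) \<noteq> 0"
    then have "x - y \<le> q *\<^sub>R 1" using ker unfolding kernel_def by blast
    then have yi: "x $ i - y $ i \<le> q" for i by (simp add: less_eq_vec_def)
    have "x \<le> y" unfolding less_eq_vec_def
    proof
      fix i show "x $ i \<le> y $ i" using yi[of i] \<open>q \<le> 0\<close> by linarith
    qed
    then show "transported T g s y \<le> transported T g t ((flow s x t - x) + y)" by (rule transported_shift(2)[OF g st])
  qed
  then show ?thesis using conv_translate[OF ker transported_antimono[OF g], of T t "flow s x t - x" x] by simp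
qed

lemma transported_locally_bounded:
  assumes g: "antimono g"
  obtains M where "0 \<le> M" "\<And>t y. norm y \<le> r \<Longrightarrow> \<bar>transported T g t y\<bar> \<le> M"
proof -
  obtain M where M: "0 \<le> M" "\<And>y. norm y \<le> (1 + r) * exp Ctot \<Longrightarrow> \<bar>g y\<bar> \<le> M"
    by (rule antimono_locally_bounded[OF g, where Q = "(1 + r) * exp Ctot"]) blast
  have "\<bar>transported T g t y\<bar> \<le> M" if "norm y \<le> r" for t y
  proof -
    have "norm (flow t y T) \<le> rad y" by (rule norm_flow_le_rad)
    also have "\<dots> \<le> (1 + r) * exp Ctot" unfolding rad_def using that by (intro mult_right_mono) auto
    finally show ?thesis unfolding transported_def by (rule M(2))
  qed
  with M(1) show ?thesis by (rule that)
qed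

text \<open>
  The extreme corners of the support around \<open>x\<close> play the role of \<open>x\<close> in \<open>transported_shift\<close>, one for each
  inequality. They move by at most \<open>k \<integral>\<^sub>s\<^sup>t C\<close> in each coordinate, and the mollification is Lipschitz
  in space.
\<close>

lemma conv_transported_modulus:
  fixes x :: "real ^ 'd"
  assumes g: "antimono g" and ker: "kernel \<psi> p q"
  obtains L where "0 \<le> L"
    "\<And>s t. s \<le> t \<Longrightarrow> \<bar>convolution (transported T g t) \<psi> x - convolution (transported T g s) \<psi> x\<bar> \<le> integral {s..t} (\<lambda>r. L * C r)"
proof -
  obtain L Q where LQ: "0 \<le> L" "0 \<le> Q"
    "\<And>f M r x x'. \<lbrakk>f \<in> borel_measurable lebesgue; 0 \<le> M; \<And>y. norm y \<le> r + Q \<Longrightarrow> \<bar>f y\<bar> \<le> M; norm x \<le> r; norm x' \<le> r\<rbrakk> \<Longrightarrow>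
       \<bar>convolution f \<psi> x - convolution f \<psi> x'\<bar> \<le> M * L * measure lborel (cball (0 :: real ^ 'd) (r + Q)) * norm (x - x')"
    by (rule conv_estimates[OF ker]) blast
  define x0 where "x0 = x - p *\<^sub>R 1"
  define x1 where "x1 = x - q *\<^sub>R 1"
  define k where "k = (1 + rad x0) + (1 + rad x1)"
  have k: "0 \<le> k" "1 + rad x0 \<le> k" "1 + rad x1 \<le> k" unfolding k_def using rad_nonneg[of x0] rad_nonneg[of x1] by auto
  define N where "N = norm (1 :: real ^ 'd)"
  define r where "r = norm x + k * Ctot * N"
  have Ctot0: "0 \<le> Ctot" using CI_nonneg[of 0 0] CI_le_Ctot[of 0 0] by linarith
  obtain M where M: "0 \<le> M" "\<And>t y. norm y \<le> r + Q \<Longrightarrow> \<bar>transported T g t y\<bar> \<le> M"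
    by (rule transported_locally_bounded[OF g, where r = "r + Q"]) blast
  define A where "A = M * L * measure lborel (cball (0 :: real ^ 'd) (r + Q))"
  have A0: "0 \<le> A" unfolding A_def using M(1) LQ(1) by simp
  note meas = antimono_lebesgue_measurable[OF transported_antimono[OF g]]
  have main: "\<bar>convolution (transported T g t) \<psi> x - convolution (transported T g s) \<psi> x\<bar> \<le> (A * (k * N)) * integral {s..t} C"
    if st: "s \<le> t" "t \<le> T" for s t
  proof -
    define m where "m = k * integral {s..t} C"
    have m0: "0 \<le> m" unfolding m_def using k(1) CI_nonneg by simp
    have mN: "norm (m *\<^sub>R (1 :: real ^ 'd)) \<le> k * Ctot * N"
      unfolding m_def N_def using k(1) CI_le_Ctot[of s t] CI_nonneg[of s t] by (simp add: mult_right_mono mult_left_mono abs_mult)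
    have near: "norm (x + m *\<^sub>R 1) \<le> r" "norm (x - m *\<^sub>R 1) \<le> r" "norm x \<le> r"
      using norm_triangle_ineq[of x "m *\<^sub>R 1"] norm_triangle_ineq4[of x "m *\<^sub>R 1"] mN
        norm_ge_zero[of "m *\<^sub>R (1 :: real ^ 'd)"]
      unfolding r_def by linarith+
    have lip: "\<bar>convolution (transported T g t) \<psi> y - convolution (transported T g t) \<psi> x\<bar> \<le> A * (m * N)"
      if "norm y \<le> r" "norm (y - x) = m * N" for y
      using LQ(3)[OF meas M(1) M(2) that(1) near(3)] that(2) unfolding A_def by simp
    have mod0: "(flow s x0 t - x0) $ i \<le> m" for i
    proof -
      have "\<bar>flow s x0 t $ i - flow s x0 s $ i\<bar> \<le> (1 + rad x0) * integral {s..t} C" by (rule flow_modulus) (use st in auto)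
      also have "\<dots> \<le> m" unfolding m_def using k CI_nonneg by (intro mult_right_mono) auto
      finally show ?thesis by (simp add: flow_start)
    qed
    have mod1: "- m \<le> (flow s x1 t - x1) $ i" for i
    proof -
      have "\<bar>flow s x1 t $ i - flow s x1 s $ i\<bar> \<le> (1 + rad x1) * integral {s..t} C" by (rule flow_modulus) (use st in auto)
      also have "\<dots> \<le> m" unfolding m_def using k CI_nonneg by (intro mult_right_mono) auto
      finally show ?thesis by (simp add: flow_start)
    qed
    have "convolution (\<lambda>y. transported T g t (m *\<^sub>R 1 + y)) \<psi> x \<le> convolution (transported T g s) \<psi> x"
    proof (rule conv_mono[OF ker antimono_translate[OF transported_antimono[OF g]] transported_antimono[OF g]])
      fix y assume "\<psi> (x - y) \<noteq> 0"
      then have "p *\<^sub>R 1 \<le> x - y" using ker unfolding kernel_def by blast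
      then have "y \<le> x0" unfolding x0_def by (simp add: less_eq_vec_def algebra_simps)
      then have "transported T g t ((flow s x0 t - x0) + y) \<le> transported T g s y" by (rule transported_shift(1)[OF g st])
      moreover have "(flow s x0 t - x0) + y \<le> m *\<^sub>R 1 + y" using mod0 by (simp add: less_eq_vec_def)
      then have "transported T g t (m *\<^sub>R 1 + y) \<le> transported T g t ((flow s x0 t - x0) + y)"
        by (rule antimonoD[OF transported_antimono[OF g]])
      ultimately show "transported T g t (m *\<^sub>R 1 + y) \<le> transported T g s y" by linarith
    qed
    then have lo: "convolution (transported T g t) \<psi> (x + m *\<^sub>R 1) \<le> convolution (transported T g s) \<psi> x"
      using conv_translate[OF ker transported_antimono[OF g], of T t "m *\<^sub>R 1" x] by (simp add: add.commute)
    have "convolution (transported T g s) \<psi> x \<le> convolution (\<lambda>y. transported T g t (- (m *\<^sub>R 1) + y)) \<psi> x"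
    proof (rule conv_mono[OF ker transported_antimono[OF g] antimono_translate[OF transported_antimono[OF g]]])
      fix y assume "\<psi> (x - y) \<noteq> 0"
      then have "x - y \<le> q *\<^sub>R 1" using ker unfolding kernel_def by blast
      then have "x1 \<le> y" unfolding x1_def by (simp add: less_eq_vec_def algebra_simps)
      then have "transported T g s y \<le> transported T g t ((flow s x1 t - x1) + y)" by (rule transported_shift(2)[OF g st])
      moreover have "- (m *\<^sub>R 1) + y \<le> (flow s x1 t - x1) + y" using mod1 by (simp add: less_eq_vec_def)
      then have "transported T g t ((flow s x1 t - x1) + y) \<le> transported T g t (- (m *\<^sub>R 1) + y)"
        by (rule antimonoD[OF transported_antimono[OF g]])
      ultimately show "transported T g s y \<le> transported T g t (- (m *\<^sub>R 1) + y)" by linarith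
    qed
    then have hi: "convolution (transported T g s) \<psi> x \<le> convolution (transported T g t) \<psi> (x - m *\<^sub>R 1)"
      using conv_translate[OF ker transported_antimono[OF g], of T t "- (m *\<^sub>R 1)" x] by simp
    have "norm ((x + m *\<^sub>R 1) - x) = m * N" "norm ((x - m *\<^sub>R 1) - x) = m * N" unfolding N_def using m0 by simp_all
    then have "\<bar>convolution (transported T g t) \<psi> x - convolution (transported T g s) \<psi> x\<bar> \<le> A * (m * N)"
      using lip[OF near(1)] lip[OF near(2)] lo hi by linarith
    then show ?thesis unfolding m_def by (simp add: mult.assoc mult.left_commute mult.commute)
  qed
  show ?thesis
  proof (rule that[of "A * (k * N)"])
    show AkN: "0 \<le> A * (k * N)" using A0 k(1) unfolding N_def by simp
    fix s t :: real assume st: "s \<le> t"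
    have "\<bar>convolution (transported T g t) \<psi> x - convolution (transported T g s) \<psi> x\<bar> \<le> (A * (k * N)) * integral {s..t} C"
    proof (cases "t \<le> T")
      case True then show ?thesis by (rule main[OF st])
    next
      case False
      then have t: "transported T g t = transported T g T" by (simp add: transported_after)
      show ?thesis
      proof (cases "s \<le> T")
        case True
        have "\<bar>convolution (transported T g T) \<psi> x - convolution (transported T g s) \<psi> x\<bar> \<le> (A * (k * N)) * integral {s..T} C"
          by (rule main[OF True order_refl])
        also have "\<dots> \<le> (A * (k * N)) * integral {s..t} C"
          using AkN False by (intro mult_left_mono CI_mono) auto
        finally show ?thesis unfolding t .
      next
        case False
        then have "transported T g s = transported T g T" by (simp add: transported_after)
        then show ?thesis unfolding t using AkN CI_nonneg[of s t] by simp
      qed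
    qed
    then show "\<bar>convolution (transported T g t) \<psi> x - convolution (transported T g s) \<psi> x\<bar> \<le> integral {s..t} (\<lambda>r. A * (k * N) * C r)" by simp
  qed
qed

end

lemma le_if_le_add_mult:
  fixes a b c :: real
  assumes "\<And>e. e > 0 \<Longrightarrow> a \<le> b + e * c" and "0 \<le> c"
  shows "a \<le> b"
proof (rule field_le_epsilon)
  fix e :: real assume e: "e > 0"
  have "0 < e / (c + 1)" using e assms(2) by simp
  from assms(1)[OF this] have "a \<le> b + e / (c + 1) * c" .
  also have "e / (c + 1) * c \<le> e"
    using e assms(2) by (simp add: field_simps)
  finally show "a \<le> b + e" by simp
qed

context growth_field
begin

lemma conv_transported_AC:
  assumes g: "antimono g" and ker: "kernel \<psi> p q"
  shows "absolutely_continuous_on a c (\<lambda>t. convolution (transported T g t) \<psi> x)"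
proof -
  obtain L where L: "0 \<le> L"
    "\<And>s t. s \<le> t \<Longrightarrow> \<bar>convolution (transported T g t) \<psi> x - convolution (transported T g s) \<psi> x\<bar> \<le> integral {s..t} (\<lambda>r. L * C r)"
    by (rule conv_transported_modulus[OF g ker, where T = T and x = x]) blast
  have "integrable lborel (\<lambda>r. L * C r)" using C_int by simp
  then show ?thesis
    by (rule AC_if_dominated) (use L C_nonneg in \<open>auto simp: dist_real_def abs_minus_commute\<close>)
qed

text \<open>
  For each point the mollification is differentiable at almost every time. To exchange the
  quantifiers, the set of differentiability has to be Borel.
\<close>

lemma conv_transported_differentiable_ae:
  assumes g: "antimono g" and ker: "kernel \<psi> p q"
  shows "AE z in lborel. \<exists>D. ((\<lambda>s. convolution (transported T g s) \<psi> (snd z)) has_real_derivative D) (at (fst z))"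
proof -
  let ?F = "\<lambda>s x. convolution (transported T g s) \<psi> x"
  have dom: "\<exists>L\<ge>0. \<forall>s t. s \<le> t \<longrightarrow> \<bar>?F t x - ?F s x\<bar> \<le> integral {s..t} (\<lambda>r. L * C r)" for x
  proof -
    obtain L where "0 \<le> L" "\<And>s t. s \<le> t \<Longrightarrow> \<bar>?F t x - ?F s x\<bar> \<le> integral {s..t} (\<lambda>r. L * C r)"
      by (rule conv_transported_modulus[OF g ker, where T = T and x = x]) blast
    then show ?thesis by blast
  qed
  have G: "integrable lborel (\<lambda>r. L * C r)" for L using C_int by simp
  have ct: "isCont (\<lambda>t. ?F t y) t" for y t
  proof -
    obtain L where L: "0 \<le> L" "\<forall>s t. s \<le> t \<longrightarrow> \<bar>?F t y - ?F s y\<bar> \<le> integral {s..t} (\<lambda>r. L * C r)" using dom by blast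
    have "continuous_on UNIV (\<lambda>t. ?F t y)" by (rule continuous_if_dominated[OF G]) (use L C_nonneg in auto)
    then show ?thesis by (simp add: continuous_on_eq_continuous_at)
  qed
  have cx: "isCont (?F t) x" for t x
    using conv_gderiv[OF ker transported_antimono[OF g], of T t x] unfolding gderiv_def by (rule has_derivative_continuous)
  have "isCont (\<lambda>z. ?F (fst z) (snd z)) z" for z
  proof -
    have "isCont (\<lambda>z. ?F (fst z) (snd z)) (fst z, snd z)"
      by (rule jointly_continuous_if_antimono[OF conv_antimono[OF ker transported_antimono[OF g]] cx ct])
    then show ?thesis by simp
  qed
  then have m: "{z. \<exists>D. ((\<lambda>s. ?F s (snd z)) has_real_derivative D) (at (fst z))} \<in> sets borel"
    by (rule differentiability_set_borel)
  have "AE z in lborel. z \<in> {z. \<exists>D. ((\<lambda>s. ?F s (snd z)) has_real_derivative D) (at (fst z))}"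
  proof (rule AE_pair_if_AE_time[OF m])
    fix x :: "real ^ 'd"
    obtain L where L: "0 \<le> L" "\<forall>s t. s \<le> t \<longrightarrow> \<bar>?F t x - ?F s x\<bar> \<le> integral {s..t} (\<lambda>r. L * C r)" using dom by blast
    have "AE t in lborel. \<exists>D. ((\<lambda>s. ?F s x) has_real_derivative D) (at t)"
      by (rule ae_differentiable_if_dominated[OF G]) (use L C_nonneg in auto)
    then show "AE t in lborel. (t, x) \<in> {z. \<exists>D. ((\<lambda>s. ?F s (snd z)) has_real_derivative D) (at (fst z))}" by simp
  qed
  then show ?thesis by simp
qed

lemma B_const_on: "(\<lambda>r. B r q $ i) integrable_on {u..v}"
proof -
  have "(\<lambda>r :: real. (r, q)) \<in> borel_measurable borel"
    by (intro borel_measurable_continuous_onI continuous_intros)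
  from measurable_compose[OF this B_meas] have m: "(\<lambda>r. B r q $ i) \<in> borel_measurable lborel"
    by (simp add: borel_measurable_vec_nth)
  have "integrable lborel (\<lambda>r. B r q $ i)"
  proof (rule Bochner_Integration.integrable_bound[OF _ m])
    show "integrable lborel (\<lambda>r. C r * (1 + norm q))" using C_int by simp
    show "AE r in lborel. norm (B r q $ i) \<le> norm (C r * (1 + norm q))"
      using B_comp_growth[of _ q i] C_nonneg by (simp add: abs_mult)
  qed
  then show ?thesis by (rule integral_eq_lborel_integral(1))
qed

lemma flow_stays_near:
  assumes \<delta>: "\<delta> > 0"
  shows "\<forall>\<^sub>F v in at_right t. \<forall>r\<in>{t..v}. \<forall>i.
    \<bar>flow t (x - (v - t) *\<^sub>R P) r $ i - x $ i\<bar> \<le> \<delta>"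
proof -
  define k where "k = (1 + (norm x + 1)) * exp Ctot + 1"
  have k: "k > 0" unfolding k_def by (intro add_nonneg_pos mult_nonneg_nonneg) auto
  have lim: "((\<lambda>v. (v - t) * norm P) \<longlongrightarrow> (t - t) * norm P) (at_right t)"
    by (intro tendsto_intros)
  have lim2: "((\<lambda>v. k * integral {t..v} C) \<longlongrightarrow> k * 0) (at_right t)"
    by (intro tendsto_intros tendsto_integral_at_right C_on)
  have 1: "\<forall>\<^sub>F v in at_right t. (v - t) * norm P < min 1 (\<delta> / 2)"
    by (rule order_tendstoD(2)[OF lim]) (use \<delta> in simp)
  have 2: "\<forall>\<^sub>F v in at_right t. k * integral {t..v} C < \<delta> / 2"
    by (rule order_tendstoD(2)[OF lim2]) (use \<delta> in simp)
  have 3: "\<forall>\<^sub>F v in at_right t. t < v" by (simp add: eventually_at_right_less)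
  show ?thesis using 1 2 3
  proof eventually_elim
    case (elim v)
    let ?y = "x - (v - t) *\<^sub>R P"
    have nP: "norm ((v - t) *\<^sub>R P) = (v - t) * norm P" using elim(3) by simp
    have "norm ?y \<le> norm x + 1" using norm_triangle_ineq4[of x "(v - t) *\<^sub>R P"] elim(1) unfolding nP by linarith
    then have "rad ?y \<le> (1 + (norm x + 1)) * exp Ctot" unfolding rad_def by (intro mult_right_mono) auto
    then have ky: "1 + rad ?y \<le> k" unfolding k_def by simp
    show ?case
    proof (intro ballI allI)
      fix r i assume r: "r \<in> {t..v}"
      have "\<bar>flow t ?y r $ i - flow t ?y t $ i\<bar> \<le> (1 + rad ?y) * integral {t..r} C"
        by (rule flow_modulus) (use r in auto)
      also have "\<dots> \<le> k * integral {t..v} C"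
        by (intro mult_mono ky CI_mono CI_nonneg) (use r k in auto)
      finally have "\<bar>flow t ?y r $ i - ?y $ i\<bar> < \<delta> / 2" using elim(2) by (simp add: flow_start)
      moreover have "\<bar>((v - t) *\<^sub>R P) $ i\<bar> < \<delta> / 2"
        using component_le_norm_cart[of "(v - t) *\<^sub>R P" i] elim(1) unfolding nP by linarith
      moreover have "?y $ i = x $ i - ((v - t) *\<^sub>R P) $ i" by simp
      ultimately show "\<bar>flow t ?y r $ i - x $ i\<bar> \<le> \<delta>" by linarith
    qed
  qed
qed

lemma average_near_lebesgue_point:
  assumes D: "((\<lambda>s. integral {a..s} (\<lambda>r. B r q $ i)) has_real_derivative B t q $ i) (at t)" and "a < t" "\<eta> > 0"
  shows "\<forall>\<^sub>F v in at_right t. \<bar>integral {t..v} (\<lambda>r. B r q $ i) - (v - t) * B t q $ i\<bar> \<le> (v - t) * \<eta>"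
proof -
  let ?K = "\<lambda>s. integral {a..s} (\<lambda>r. B r q $ i)"
  have "((\<lambda>v. (?K v - ?K t) / (v - t)) \<longlongrightarrow> B t q $ i) (at_right t)"
    using has_field_derivative_at_within[OF D, of "{t<..}"] unfolding has_field_derivative_iff .
  from tendstoD[OF this \<open>\<eta> > 0\<close>] have "\<forall>\<^sub>F v in at_right t. dist ((?K v - ?K t) / (v - t)) (B t q $ i) < \<eta>" .
  moreover have "\<forall>\<^sub>F v in at_right t. t < v" by (simp add: eventually_at_right_less)
  ultimately show ?thesis
  proof eventually_elim
    case (elim v)
    have "?K v = ?K t + integral {t..v} (\<lambda>r. B r q $ i)"
      by (rule Henstock_Kurzweil_Integration.integral_combine[symmetric]) (use \<open>a < t\<close> elim B_const_on in auto)
    then have "\<bar>integral {t..v} (\<lambda>r. B r q $ i) / (v - t) - B t q $ i\<bar> < \<eta>" using elim(1) by (simp add: dist_real_def)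
    moreover have "integral {t..v} (\<lambda>r. B r q $ i) - (v - t) * B t q $ i
        = (v - t) * (integral {t..v} (\<lambda>r. B r q $ i) / (v - t) - B t q $ i)"
      using elim(2) by (simp add: field_simps)
    ultimately show ?case using elim(2) by (simp add: abs_mult)
  qed
qed

text \<open>
  The velocity along the flow is compared with the velocity at a fixed point \<open>q\<close> above or below, for
  which almost every time is a Lebesgue point. The path starts at time \<open>t\<close> so far from \<open>x\<close> that it would
  reach \<open>x\<close> at time \<open>v\<close> with the constant speed \<open>B t q \<plusminus> \<eta>\<close>.
\<close>

lemma flow_speed_near_point:
  assumes leb: "\<And>i. ((\<lambda>s. integral {t - 1..s} (\<lambda>r. B r q $ i)) has_real_derivative B t q $ i) (at t)"
    and \<delta>: "\<delta> > 0" and \<eta>: "\<eta> > 0"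
  shows "x + \<delta> *\<^sub>R 1 \<le> q \<Longrightarrow> \<forall>\<^sub>F v in at_right t. flow t (x - (v - t) *\<^sub>R (B t q + \<eta> *\<^sub>R 1)) v \<le> x"
    "q + \<delta> *\<^sub>R 1 \<le> x \<Longrightarrow> \<forall>\<^sub>F v in at_right t. x \<le> flow t (x - (v - t) *\<^sub>R (B t q - \<eta> *\<^sub>R 1)) v"
proof -
  have avg: "\<forall>\<^sub>F v in at_right t. \<forall>i. \<bar>integral {t..v} (\<lambda>r. B r q $ i) - (v - t) * B t q $ i\<bar> \<le> (v - t) * \<eta>"
    by (rule eventually_all_finite) (rule average_near_lebesgue_point[OF leb _ \<eta>], simp)
  have later: "\<forall>\<^sub>F v in at_right t. t < v" by (simp add: eventually_at_right_less)
  show "\<forall>\<^sub>F v in at_right t. flow t (x - (v - t) *\<^sub>R (B t q + \<eta> *\<^sub>R 1)) v \<le> x" if q: "x + \<delta> *\<^sub>R 1 \<le> q"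
    using avg flow_stays_near[OF \<delta>, of t x "B t q + \<eta> *\<^sub>R 1"] later
  proof eventually_elim
    case (elim v)
    let ?y = "x - (v - t) *\<^sub>R (B t q + \<eta> *\<^sub>R 1)"
    have box: "flow t ?y r \<le> q" if "r \<in> {t..v}" for r
      unfolding less_eq_vec_def
    proof
      fix i
      have "x $ i + \<delta> \<le> q $ i" using q by (simp add: less_eq_vec_def)
      moreover have "\<bar>flow t ?y r $ i - x $ i\<bar> \<le> \<delta>" using elim(2) that by blast
      ultimately show "flow t ?y r $ i \<le> q $ i" by linarith
    qed
    show ?case
      unfolding less_eq_vec_def
    proof
      fix i
      have "flow t ?y v $ i = ?y $ i + integral {t..v} (\<lambda>r. B r (flow t ?y r) $ i)" by (rule flow_eq)
      also have "integral {t..v} (\<lambda>r. B r (flow t ?y r) $ i) \<le> integral {t..v} (\<lambda>r. B r q $ i)"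
        by (intro integral_le flow_B_on B_const_on) (use B_mono[OF box] in \<open>auto simp: less_eq_vec_def\<close>)
      also have "\<dots> \<le> (v - t) * B t q $ i + (v - t) * \<eta>" using spec[OF elim(1), of i] by linarith
      finally show "flow t ?y v $ i \<le> x $ i" by (simp add: algebra_simps)
    qed
  qed
  show "\<forall>\<^sub>F v in at_right t. x \<le> flow t (x - (v - t) *\<^sub>R (B t q - \<eta> *\<^sub>R 1)) v" if q: "q + \<delta> *\<^sub>R 1 \<le> x"
    using avg flow_stays_near[OF \<delta>, of t x "B t q - \<eta> *\<^sub>R 1"] later
  proof eventually_elim
    case (elim v)
    let ?y = "x - (v - t) *\<^sub>R (B t q - \<eta> *\<^sub>R 1)"
    have box: "q \<le> flow t ?y r" if "r \<in> {t..v}" for r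
      unfolding less_eq_vec_def
    proof
      fix i
      have "q $ i + \<delta> \<le> x $ i" using q by (simp add: less_eq_vec_def)
      moreover have "\<bar>flow t ?y r $ i - x $ i\<bar> \<le> \<delta>" using elim(2) that by blast
      ultimately show "q $ i \<le> flow t ?y r $ i" by linarith
    qed
    show ?case
      unfolding less_eq_vec_def
    proof
      fix i
      have "(v - t) * B t q $ i - (v - t) * \<eta> \<le> integral {t..v} (\<lambda>r. B r q $ i)"
        using spec[OF elim(1), of i] by linarith
      also have "\<dots> \<le> integral {t..v} (\<lambda>r. B r (flow t ?y r) $ i)"
        by (intro integral_le flow_B_on B_const_on) (use B_mono[OF box] in \<open>auto simp: less_eq_vec_def\<close>)
      finally have "?y $ i + ((v - t) * B t q $ i - (v - t) * \<eta>) \<le> flow t ?y v $ i"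
        using flow_eq[of t ?y v i] by linarith
      then show "x $ i \<le> flow t ?y v $ i" by (simp add: algebra_simps)
    qed
  qed
qed

text \<open>
  Countably many \<open>q\<close> suffice, at the price of an error that is small at the points where \<open>B t\<close> is
  continuous, hence almost everywhere. Continuity is expressed by the oscillation over the cubes of
  half-width \<open>c m\<close>, which is a jointly Borel function.
\<close>

lemma flow_speed_ae:
  fixes b :: "real \<Rightarrow> real ^ 'd \<Rightarrow> real ^ 'd"
  assumes reg: "AE t in lborel. t \<in> {0..T} \<longrightarrow> regularises_at (B t) (b t)"
  shows "AE z in lborel. fst z \<in> {0..T} \<longrightarrow> (\<forall>e>0.
    (\<exists>P. (\<forall>i. P $ i \<le> b (fst z) (snd z) $ i + e) \<and>
      (\<forall>\<^sub>F v in at_right (fst z). flow (fst z) (snd z - (v - fst z) *\<^sub>R P) v \<le> snd z)) \<and>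
    (\<exists>P. (\<forall>i. b (fst z) (snd z) $ i - e \<le> P $ i) \<and>
      (\<forall>\<^sub>F v in at_right (fst z). snd z \<le> flow (fst z) (snd z - (v - fst z) *\<^sub>R P) v)))"
proof -
  obtain Q :: "(real ^ 'd) set" where Q: "countable Q" "\<And>X. open X \<Longrightarrow> X \<noteq> {} \<Longrightarrow> \<exists>d\<in>Q. d \<in> X"
    using countable_dense_exists by blast
  have leb: "AE t in lborel. \<forall>q\<in>Q. \<forall>i. ((\<lambda>s. integral {t - 1..s} (\<lambda>r. B r q $ i)) has_real_derivative B t q $ i) (at t)"
    unfolding AE_ball_countable[OF Q(1)]
  proof
    fix q
    have "AE t in lborel. ((\<lambda>s. integral {t - 1..s} (\<lambda>r. B r q $ i)) has_real_derivative B t q $ i) (at t)" for i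
      using has_real_derivative_indefinite_integral_ae[OF B_const_on[of q i]] by eventually_elim simp
    then show "AE t in lborel. \<forall>i. ((\<lambda>s. integral {t - 1..s} (\<lambda>r. B r q $ i)) has_real_derivative B t q $ i) (at t)"
      by (rule eventually_all_finite)
  qed
  define c where "c m = 1 / real (Suc m)" for m
  have c: "c m > 0" for m unfolding c_def by simp
  define osc where "osc m z = (\<Sum>i\<in>UNIV. B (fst z) (snd z + c m *\<^sub>R 1) $ i - B (fst z) (snd z - c m *\<^sub>R 1) $ i)" for m and z :: "real \<times> (real ^ 'd)"
  have mB: "(\<lambda>z. B (fst z) (snd z + a *\<^sub>R 1) $ i) \<in> borel_measurable borel" for a i
  proof (rule borel_measurable_vec_nth)
    have "(\<lambda>z :: real \<times> (real ^ 'd). (fst z, snd z + a *\<^sub>R 1)) \<in> borel_measurable borel"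
      by (intro borel_measurable_continuous_onI continuous_intros)
    from measurable_compose[OF this B_meas] show "(\<lambda>z. B (fst z) (snd z + a *\<^sub>R 1)) \<in> borel_measurable borel" by simp
  qed
  have mosc: "osc m \<in> borel_measurable borel" for m
  proof -
    have "(\<lambda>z. \<Sum>i\<in>UNIV. B (fst z) (snd z + c m *\<^sub>R 1) $ i - B (fst z) (snd z + (- c m) *\<^sub>R 1) $ i)
        \<in> borel_measurable borel"
      by (intro borel_measurable_sum borel_measurable_diff mB)
    then show ?thesis unfolding osc_def[abs_def] by simp
  qed
  define Osc where "Osc = (\<Inter>n. \<Union>m. {z. osc m z < c n})"
  have mOsc: "Osc \<in> sets borel"
  proof -
    have "{z. osc m z < c n} \<in> sets borel" for m n using borel_measurable_less[of "osc m" borel "\<lambda>_. c n"] mosc by simp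
    then show ?thesis unfolding Osc_def by (intro sets.countable_INT'' sets.countable_UN') auto
  qed
  have "AE z in lborel. z \<in> Osc"
  proof (rule AE_pair_if_AE_space[OF mOsc])
    fix t :: real
    have "AE x in lborel. \<forall>i. isCont (\<lambda>y. B t y $ i) x"
      by (rule eventually_all_finite, rule isCont_ae_if_mono) (use B_mono in \<open>auto simp: less_eq_vec_def\<close>)
    then show "AE x in lborel. (t, x) \<in> Osc"
    proof eventually_elim
      case (elim x)
      have "(\<lambda>m. osc m (t, x)) \<longlonglongrightarrow> (\<Sum>i\<in>UNIV. B t x $ i - B t x $ i)"
        unfolding osc_def c_def fst_conv snd_conv
        using elim by (intro tendsto_sum tendsto_diff tendsto_diag) auto
      then have lim: "(\<lambda>m. osc m (t, x)) \<longlonglongrightarrow> 0" by simp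
      have "\<exists>m. osc m (t, x) < c n" for n
        using eventually_happens'[OF sequentially_bot order_tendstoD(2)[OF lim c[of n]]] by blast
      then show ?case unfolding Osc_def by simp
    qed
  qed
  moreover note AE_fst[OF leb, where 'a = "real ^ 'd"] AE_fst[OF reg, where 'a = "real ^ 'd"]
  ultimately show ?thesis
  proof eventually_elim
    case (elim z)
    obtain t x where z: "z = (t, x)" by (cases z)
    show ?case unfolding z fst_conv snd_conv
    proof (intro impI allI)
      fix e :: real assume t: "t \<in> {0..T}" and e: "e > 0"
      have rg: "regularises_at (B t) (b t)" using elim(3) t unfolding z by simp
      have L: "\<And>q i. q \<in> Q \<Longrightarrow> ((\<lambda>s. integral {t - 1..s} (\<lambda>r. B r q $ i)) has_real_derivative B t q $ i) (at t)"
        using elim(2) unfolding z by simp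
      obtain n where n: "c n < e / 2" using reals_Archimedean[of "e / 2"] e unfolding c_def by (auto simp: inverse_eq_divide)
      obtain m where m: "osc m (t, x) < c n" using elim(1) unfolding z Osc_def by blast
      have le: "x - c m *\<^sub>R 1 \<le> x + c m *\<^sub>R 1" using c[of m] by (simp add: less_eq_vec_def)
      have small: "B t (x + c m *\<^sub>R 1) $ i - B t (x - c m *\<^sub>R 1) $ i < e / 2" for i
      proof -
        have "B t (x + c m *\<^sub>R 1) $ i - B t (x - c m *\<^sub>R 1) $ i \<le> osc m (t, x)"
          unfolding osc_def fst_conv snd_conv
          by (rule member_le_sum[of i UNIV "\<lambda>i. B t (x + c m *\<^sub>R 1) $ i - B t (x - c m *\<^sub>R 1) $ i"])
            (use B_mono[OF le, of t] in \<open>auto simp: less_eq_vec_def\<close>)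
        then show ?thesis using m n by linarith
      qed
      have blo: "B t (x - c m *\<^sub>R 1) $ i \<le> b t x $ i" for i
      proof -
        have "B t (x - c m *\<^sub>R 1) \<le> b t x" using rg c[of m] unfolding regularises_at_def by force
        then show ?thesis by (simp add: less_eq_vec_def)
      qed
      have bhi: "b t x $ i \<le> B t (x + c m *\<^sub>R 1) $ i" for i
      proof -
        have "b t x \<le> B t x" using rg unfolding regularises_at_def by blast
        also have "\<dots> \<le> B t (x + c m *\<^sub>R 1)" by (rule B_mono) (use c[of m] in \<open>simp add: less_eq_vec_def\<close>)
        finally show ?thesis by (simp add: less_eq_vec_def)
      qed
      have inbox: "x + (c m / 2) *\<^sub>R 1 \<in> box x (x + c m *\<^sub>R 1)" "x - (c m / 2) *\<^sub>R 1 \<in> box (x - c m *\<^sub>R 1) x"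
        using c[of m] by (auto simp: mem_box_cart)
      have gap: "\<exists>\<delta>>0. \<forall>i. y $ i + \<delta> \<le> y' $ i" if yy: "\<And>i. y $ i < y' $ i" for y y' :: "real ^ 'd"
      proof -
        have "\<forall>\<^sub>F \<delta> in at_right 0. \<forall>i. y $ i + \<delta> < y' $ i"
        proof (rule eventually_all_finite)
          fix i
          have "((\<lambda>\<delta>. y $ i + \<delta>) \<longlongrightarrow> y $ i + 0) (at_right 0)" by (intro tendsto_intros)
          then show "\<forall>\<^sub>F \<delta> in at_right 0. y $ i + \<delta> < y' $ i" by (rule order_tendstoD(2)) (use yy in simp)
        qed
        then have "\<forall>\<^sub>F \<delta> in at_right 0. 0 < \<delta> \<and> (\<forall>i. y $ i + \<delta> < y' $ i)"
          using eventually_at_right_less[of "0 :: real"] by eventually_elim simp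
        then obtain \<delta> where "0 < \<delta> \<and> (\<forall>i. y $ i + \<delta> < y' $ i)"
          using eventually_happens'[OF trivial_limit_at_right_real] by blast
        then show ?thesis by (intro exI[of _ \<delta>]) (auto intro: less_imp_le)
      qed
      have e4: "e / 2 > 0" using e by simp
      show "(\<exists>P. (\<forall>i. P $ i \<le> b t x $ i + e) \<and> (\<forall>\<^sub>F v in at_right t. flow t (x - (v - t) *\<^sub>R P) v \<le> x)) \<and>
        (\<exists>P. (\<forall>i. b t x $ i - e \<le> P $ i) \<and> (\<forall>\<^sub>F v in at_right t. x \<le> flow t (x - (v - t) *\<^sub>R P) v))"
      proof
        obtain q where q: "q \<in> Q" "q \<in> box x (x + c m *\<^sub>R 1)" using Q(2)[OF open_box] inbox(1) by blast
        obtain \<delta> where \<delta>: "\<delta> > 0" "\<forall>i. x $ i + \<delta> \<le> q $ i" using gap[of x q] q(2) by (auto simp: mem_box_cart)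
        have "x + \<delta> *\<^sub>R 1 \<le> q" using \<delta>(2) by (simp add: less_eq_vec_def)
        from flow_speed_near_point(1)[OF L[OF q(1)] \<delta>(1) e4 this]
        have ev: "\<forall>\<^sub>F v in at_right t. flow t (x - (v - t) *\<^sub>R (B t q + (e / 2) *\<^sub>R 1)) v \<le> x" .
        have "B t q \<le> B t (x + c m *\<^sub>R 1)" by (rule B_mono) (use q(2) in \<open>auto simp: mem_box_cart less_eq_vec_def intro: less_imp_le\<close>)
        then have Bq: "B t q $ i \<le> B t (x + c m *\<^sub>R 1) $ i" for i by (simp add: less_eq_vec_def)
        have "(B t q + (e / 2) *\<^sub>R 1) $ i \<le> b t x $ i + e" for i
          using Bq[of i] small[of i] blo[of i] by simp
        then show "\<exists>P. (\<forall>i. P $ i \<le> b t x $ i + e) \<and> (\<forall>\<^sub>F v in at_right t. flow t (x - (v - t) *\<^sub>R P) v \<le> x)"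
          using ev by blast
      next
        obtain q where q: "q \<in> Q" "q \<in> box (x - c m *\<^sub>R 1) x" using Q(2)[OF open_box] inbox(2) by blast
        obtain \<delta> where \<delta>: "\<delta> > 0" "\<forall>i. q $ i + \<delta> \<le> x $ i" using gap[of q x] q(2) by (auto simp: mem_box_cart)
        have "q + \<delta> *\<^sub>R 1 \<le> x" using \<delta>(2) by (simp add: less_eq_vec_def)
        from flow_speed_near_point(2)[OF L[OF q(1)] \<delta>(1) e4 this]
        have ev: "\<forall>\<^sub>F v in at_right t. x \<le> flow t (x - (v - t) *\<^sub>R (B t q - (e / 2) *\<^sub>R 1)) v" .
        have "B t (x - c m *\<^sub>R 1) \<le> B t q" by (rule B_mono) (use q(2) in \<open>auto simp: mem_box_cart less_eq_vec_def intro: less_imp_le\<close>)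
        then have Bq: "B t (x - c m *\<^sub>R 1) $ i \<le> B t q $ i" for i by (simp add: less_eq_vec_def)
        have "b t x $ i - e \<le> (B t q - (e / 2) *\<^sub>R 1) $ i" for i
          using Bq[of i] small[of i] bhi[of i] by simp
        then show "\<exists>P. (\<forall>i. b t x $ i - e \<le> P $ i) \<and> (\<forall>\<^sub>F v in at_right t. x \<le> flow t (x - (v - t) *\<^sub>R P) v)"
          using ev by blast
      qed
    qed
  qed
qed

end

lemma deriv_along_line:
  fixes F :: "real ^ 'd \<Rightarrow> real"
  assumes "GDERIV F x :> g"
  shows "((\<lambda>v. F (x - (v - t) *\<^sub>R P)) has_real_derivative - (P \<bullet> g)) (at t)"
proof -
  have "((\<lambda>v. x - (v - t) *\<^sub>R P) has_derivative (\<lambda>h. - (h *\<^sub>R P))) (at t)"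
    by (auto intro!: derivative_eq_intros)
  moreover have "(F has_derivative (\<lambda>h. h \<bullet> g)) (at (x - (t - t) *\<^sub>R P))"
    using assms unfolding gderiv_def by (simp add: inner_commute)
  ultimately have "((\<lambda>v. F (x - (v - t) *\<^sub>R P)) has_derivative (\<lambda>h. (- (h *\<^sub>R P)) \<bullet> g)) (at t)"
    by (rule has_derivative_compose)
  moreover have "(\<lambda>h. (- (h *\<^sub>R P)) \<bullet> g) = (*) (- (P \<bullet> g))" by (auto simp: fun_eq_iff)
  ultimately show ?thesis unfolding has_field_derivative_def by simp
qed

lemma deriv_le_if_eventually_le:
  fixes f h :: "real \<Rightarrow> real"
  assumes f: "(f has_real_derivative a) (at t)" and h: "(h has_real_derivative c) (at t)"
    and eq: "f t = h t" and le: "\<forall>\<^sub>F v in at_right t. f v \<le> h v"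
  shows "a \<le> c"
proof (rule tendsto_le)
  show "((\<lambda>v. (h v - h t) / (v - t)) \<longlongrightarrow> c) (at_right t)"
    using has_field_derivative_at_within[OF h, of "{t<..}"] unfolding has_field_derivative_iff .
  show "((\<lambda>v. (f v - f t) / (v - t)) \<longlongrightarrow> a) (at_right t)"
    using has_field_derivative_at_within[OF f, of "{t<..}"] unfolding has_field_derivative_iff .
  have "\<forall>\<^sub>F v in at_right t. t < v" by (simp add: eventually_at_right_less)
  with le show "\<forall>\<^sub>F v in at_right t. (f v - f t) / (v - t) \<le> (h v - h t) / (v - t)"
    by eventually_elim (simp add: eq divide_right_mono)
qed (rule trivial_limit_at_right_real)

context growth_field
begin

text \<open>
  Let \<open>P\<close> be a speed such that the path from \<open>x - (v - t) *\<^sub>R P\<close> at time \<open>t\<close> is below \<open>x\<close> at time \<open>v\<close>.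
  Then monotonicity along the flow compares the value at \<open>(v, x)\<close> with the value at \<open>(t, x - (v - t) *\<^sub>R P)\<close>, and
  the derivatives at \<open>v = t\<close> give the inequality with \<open>P\<close> in place of \<open>b t x\<close>. The starting point is
  moved rather than the end point so that only the gradient at the time \<open>t\<close> is involved.
\<close>

lemma conv_transported_inequality:
  fixes b :: "real \<Rightarrow> real ^ 'd \<Rightarrow> real ^ 'd"
  assumes reg: "AE t in lborel. t \<in> {0..T} \<longrightarrow> regularises_at (B t) (b t)"
    and g: "antimono g" and ker: "kernel \<psi> p q"
  shows "AE (t, x) in lebesgue_on ({0..T} \<times> UNIV).
     \<exists>dt grad. ((\<lambda>s. convolution (transported T g s) \<psi> x) has_real_derivative dt) (at t) \<and>
       GDERIV (convolution (transported T g t) \<psi>) x :> grad \<and>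
       (0 \<le> p \<longrightarrow> - dt - b t x \<bullet> grad \<ge> 0) \<and> (q \<le> 0 \<longrightarrow> - dt - b t x \<bullet> grad \<le> 0)"
proof (rule AE_lebesgue_on_if_AE_lborel)
  show "{0..T} \<times> UNIV \<in> sets lebesgue" by (intro sets_completionI_sets) (simp add: borel_closed closed_Times)
next
  let ?F = "\<lambda>s x. convolution (transported T g s) \<psi> x"
  have "AE t in lborel. t \<noteq> T" by (rule AE_lborel_singleton)
  from AE_fst[OF this, where 'a = "real ^ 'd"] conv_transported_differentiable_ae[OF g ker, of T] flow_speed_ae[OF reg]
  show "AE z in lborel. z \<in> {0..T} \<times> UNIV \<longrightarrow> (case z of (t, x) \<Rightarrow> \<exists>dt grad. ((\<lambda>s. ?F s x) has_real_derivative dt) (at t) \<and>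
       GDERIV (?F t) x :> grad \<and> (0 \<le> p \<longrightarrow> - dt - b t x \<bullet> grad \<ge> 0) \<and> (q \<le> 0 \<longrightarrow> - dt - b t x \<bullet> grad \<le> 0))"
  proof eventually_elim
    case (elim z)
    obtain t x where z: "z = (t, x)" by (cases z)
    show ?case unfolding z prod.case
    proof
      assume "(t, x) \<in> {0..T} \<times> (UNIV :: (real ^ 'd) set)"
      then have t: "t \<in> {0..T}" "t < T" using elim(1) unfolding z by auto
      obtain dt where dt: "((\<lambda>s. ?F s x) has_real_derivative dt) (at t)" using elim(2) unfolding z by auto
      define G where "G = conv_grad (transported T g t) \<psi> x"
      have GD: "GDERIV (?F t) x :> G" unfolding G_def by (rule conv_gderiv[OF ker transported_antimono[OF g]])
      have G0: "G $ i \<le> 0" for i unfolding G_def by (rule conv_grad_nonpos[OF ker transported_antimono[OF g]])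
      have oneG: "0 \<le> - (1 \<bullet> G)" unfolding inner_vec_def using G0 by (simp add: sum_nonpos)
      have am: "antimono (?F v)" for v by (rule conv_antimono[OF ker transported_antimono[OF g]])
      have before: "\<forall>\<^sub>F v in at_right t. t < v \<and> v < T"
        using eventually_at_right_less[of t] order_tendstoD(2)[OF tendsto_ident_at t(2), of "{t<..}"] by eventually_elim simp
      have up: "- dt - b t x \<bullet> G \<ge> 0" if p: "0 \<le> p"
      proof -
        have "dt \<le> - (b t x \<bullet> G) + e * - (1 \<bullet> G)" if e: "e > 0" for e
        proof -
          obtain P where P: "\<forall>i. P $ i \<le> b t x $ i + e" "\<forall>\<^sub>F v in at_right t. flow t (x - (v - t) *\<^sub>R P) v \<le> x"
            using elim(3) t(1) e unfolding z by auto
          have "\<forall>\<^sub>F v in at_right t. ?F v x \<le> ?F t (x - (v - t) *\<^sub>R P)"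
            using P(2) before
          proof eventually_elim
            case (elim v)
            have "?F v x \<le> ?F v (flow t (x - (v - t) *\<^sub>R P) v)" by (rule antimonoD[OF am elim(1)])
            also have "\<dots> \<le> ?F t (x - (v - t) *\<^sub>R P)" by (rule conv_transported_lower[OF g ker p]) (use elim(2) in auto)
            finally show ?case .
          qed
          then have "dt \<le> - (P \<bullet> G)" by (rule deriv_le_if_eventually_le[OF dt deriv_along_line[OF GD], rotated]) simp
          also have "P \<le> b t x + e *\<^sub>R 1" using P(1) by (simp add: less_eq_vec_def)
          then have "- (P \<bullet> G) \<le> - ((b t x + e *\<^sub>R 1) \<bullet> G)" using inner_mono_nonpos[OF _ G0] by simp
          also have "\<dots> = - (b t x \<bullet> G) + e * - (1 \<bullet> G)" by (simp add: inner_add_left)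
          finally show ?thesis .
        qed
        then have "dt \<le> - (b t x \<bullet> G)" by (rule le_if_le_add_mult) (use oneG in auto)
        then show ?thesis by simp
      qed
      have down: "- dt - b t x \<bullet> G \<le> 0" if q: "q \<le> 0"
      proof -
        have "- (b t x \<bullet> G) \<le> dt + e * - (1 \<bullet> G)" if e: "e > 0" for e
        proof -
          obtain P where P: "\<forall>i. b t x $ i - e \<le> P $ i" "\<forall>\<^sub>F v in at_right t. x \<le> flow t (x - (v - t) *\<^sub>R P) v"
            using elim(3) t(1) e unfolding z by auto
          have "\<forall>\<^sub>F v in at_right t. ?F t (x - (v - t) *\<^sub>R P) \<le> ?F v x"
            using P(2) before
          proof eventually_elim
            case (elim v)
            have "?F t (x - (v - t) *\<^sub>R P) \<le> ?F v (flow t (x - (v - t) *\<^sub>R P) v)" by (rule conv_transported_upper[OF g ker q]) (use elim(2) in auto)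
            also have "\<dots> \<le> ?F v x" by (rule antimonoD[OF am elim(1)])
            finally show ?case .
          qed
          then have "- (P \<bullet> G) \<le> dt" by (rule deriv_le_if_eventually_le[OF deriv_along_line[OF GD] dt, rotated]) simp
          moreover have "b t x - e *\<^sub>R 1 \<le> P" using P(1) by (simp add: less_eq_vec_def)
          then have "- ((b t x - e *\<^sub>R 1) \<bullet> G) \<le> - (P \<bullet> G)" using inner_mono_nonpos[OF _ G0] by simp
          ultimately have "- ((b t x - e *\<^sub>R 1) \<bullet> G) \<le> dt" by linarith
          then show ?thesis by (simp add: inner_diff_left)
        qed
        then have "- (b t x \<bullet> G) \<le> dt" by (rule le_if_le_add_mult) (use oneG in auto)
        then show ?thesis by simp
      qed
      show "\<exists>dt grad. ((\<lambda>s. ?F s x) has_real_derivative dt) (at t) \<and>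
       GDERIV (?F t) x :> grad \<and> (0 \<le> p \<longrightarrow> - dt - b t x \<bullet> grad \<ge> 0) \<and> (q \<le> 0 \<longrightarrow> - dt - b t x \<bullet> grad \<le> 0)"
        using dt GD up down by blast
    qed
  qed
qed

theorem transported_solution:
  assumes reg: "AE t in lborel. t \<in> {0..T} \<longrightarrow> regularises_at (B t) (b t)"
    and \<rho>: "mollifier \<rho>" and g: "antimono g"
  shows "TE_solution \<rho> T b (transported T g)"
  unfolding TE_solution_def TE_subsolution_def TE_supersolution_def Let_def
proof (intro conjI ballI allI impI transported_antimono[OF g])
  fix \<epsilon> :: real assume \<epsilon>: "\<epsilon> > 0"
  note lo = kernel_moll_lower[OF \<rho> \<epsilon>] and up = kernel_moll_upper[OF \<rho> \<epsilon>]
  show "absolutely_continuous_on 0 T (\<lambda>t. convolution (transported T g t) (moll_lower \<rho> \<epsilon>) x)" for x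
    by (rule conv_transported_AC[OF g lo])
  show "absolutely_continuous_on 0 T (\<lambda>t. convolution (transported T g t) (moll_upper \<rho> \<epsilon>) x)" for x
    by (rule conv_transported_AC[OF g up])
  show "AE (t, x) in lebesgue_on ({0..T} \<times> UNIV). \<exists>dt grad.
      ((\<lambda>s. convolution (transported T g s) (moll_lower \<rho> \<epsilon>) x) has_real_derivative dt) (at t) \<and>
      GDERIV (convolution (transported T g t) (moll_lower \<rho> \<epsilon>)) x :> grad \<and> 0 \<le> - dt - b t x \<bullet> grad"
    using conv_transported_inequality[OF reg g lo]
  proof eventually_elim
    case (elim z)
    obtain t x where z: "z = (t, x)" by (cases z)
    show ?case using elim order_refl[of "0 :: real"] unfolding z prod.case by blast
  qed
  show "AE (t, x) in lebesgue_on ({0..T} \<times> UNIV). \<exists>dt grad.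
      ((\<lambda>s. convolution (transported T g s) (moll_upper \<rho> \<epsilon>) x) has_real_derivative dt) (at t) \<and>
      GDERIV (convolution (transported T g t) (moll_upper \<rho> \<epsilon>)) x :> grad \<and> - dt - b t x \<bullet> grad \<le> 0"
    using conv_transported_inequality[OF reg g up]
  proof eventually_elim
    case (elim z)
    obtain t x where z: "z = (t, x)" by (cases z)
    show ?case using elim order_refl[of "0 :: real"] unfolding z prod.case by blast
  qed
qed

end

section \<open>Uniqueness, continuity and comparison\<close>

lemma mollified_bounds:
  fixes f :: "real ^ 'd \<Rightarrow> real"
  assumes \<rho>: "mollifier \<rho>" and \<epsilon>: "\<epsilon> > 0" and f: "antimono f"
  shows "f x \<le> convolution f (moll_lower \<rho> \<epsilon>) x" "convolution f (moll_lower \<rho> \<epsilon>) x \<le> f (x - (2 * \<epsilon>) *\<^sub>R 1)"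
    "f (x + (2 * \<epsilon>) *\<^sub>R 1) \<le> convolution f (moll_upper \<rho> \<epsilon>) x" "convolution f (moll_upper \<rho> \<epsilon>) x \<le> f x"
  using conv_between[OF kernel_moll_lower[OF \<rho> \<epsilon>] f, of x] conv_between[OF kernel_moll_upper[OF \<rho> \<epsilon>] f, of x] by simp_all

text \<open>
  The one-sided mollifications of scale \<open>\<epsilon>\<close> look as far as \<open>2 \<epsilon>\<close>; with this scale that distance is
  \<open>1 / (n + 1)\<close>.
\<close>

definition moll_scale :: "nat \<Rightarrow> real" where "moll_scale n = 1 / real (Suc n) / 2"

lemma moll_scale: "moll_scale n > 0" "2 * moll_scale n = 1 / real (Suc n)"
  unfolding moll_scale_def by (simp_all add: field_simps)

lemma mollified_tendsto:
  fixes f :: "real ^ 'd \<Rightarrow> real"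
  assumes \<rho>: "mollifier \<rho>" and f: "antimono f" and cont: "isCont f x"
  shows "(\<lambda>n. convolution f (moll_lower \<rho> (moll_scale n)) x) \<longlonglongrightarrow> f x"
    "(\<lambda>n. convolution f (moll_upper \<rho> (moll_scale n)) x) \<longlonglongrightarrow> f x"
proof -
  note bounds = mollified_bounds[OF \<rho> moll_scale(1) f, unfolded moll_scale(2)]
  show "(\<lambda>n. convolution f (moll_lower \<rho> (moll_scale n)) x) \<longlonglongrightarrow> f x"
    by (rule tendsto_sandwich[OF always_eventually always_eventually tendsto_const tendsto_diag(1)[OF cont]]) (use bounds in auto)
  show "(\<lambda>n. convolution f (moll_upper \<rho> (moll_scale n)) x) \<longlonglongrightarrow> f x"
    by (rule tendsto_sandwich[OF always_eventually always_eventually tendsto_diag(2)[OF cont] tendsto_const]) (use bounds in auto)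
qed

lemma solution_antimono:
  "TE_subsolution \<rho> T b u \<Longrightarrow> t \<in> {0..T} \<Longrightarrow> antimono (u t)"
  "TE_supersolution \<rho> T b u \<Longrightarrow> t \<in> {0..T} \<Longrightarrow> antimono (u t)"
  unfolding TE_subsolution_def TE_supersolution_def by blast+

lemma mollified_AC:
  assumes "\<epsilon> > 0"
  shows "TE_subsolution \<rho> T b u \<Longrightarrow> absolutely_continuous_on 0 T (\<lambda>t. convolution (u t) (moll_upper \<rho> \<epsilon>) x)"
    "TE_supersolution \<rho> T b u \<Longrightarrow> absolutely_continuous_on 0 T (\<lambda>t. convolution (u t) (moll_lower \<rho> \<epsilon>) x)"
  using assms unfolding TE_subsolution_def TE_supersolution_def Let_def by blast+

text \<open>
  At times near \<open>t\<close> and points near \<open>x\<close>, the solution lies between its mollifications at the two points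
  \<open>x \<plusminus> \<delta>\<close>. These are continuous in time, and at time \<open>t\<close> they lie between the values of the solution at
  \<open>x \<plusminus> 2 \<delta>\<close>.
\<close>

lemma solution_isCont_if_isCont_section:
  fixes u :: "real \<Rightarrow> real ^ 'd \<Rightarrow> real"
  assumes \<rho>: "mollifier \<rho>" and u: "TE_solution \<rho> T b u" and T: "0 \<le> T"
    and cx: "isCont (u (max 0 (min T t))) x"
  shows "isCont (\<lambda>z. u (max 0 (min T (fst z))) (snd z)) (t, x)"
  unfolding continuous_at_eps_delta
proof (intro allI impI)
  fix e :: real assume "e > 0"
  then have e2: "e / 2 > 0" by simp
  define cl where "cl t = max 0 (min T t)" for t
  have cl: "cl s \<in> {0..T}" "dist (cl s) (cl r) \<le> dist s r" for s r using T unfolding cl_def dist_real_def by auto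
  have sub: "TE_subsolution \<rho> T b u" and super: "TE_supersolution \<rho> T b u" using u unfolding TE_solution_def by auto
  note anti = solution_antimono(1)[OF sub]
  note lim = tendsto_diag[OF cx, folded cl_def]
  have "\<forall>\<^sub>F n in sequentially. dist (u (cl t) (x - (1 / real (Suc n)) *\<^sub>R 1)) (u (cl t) x) < e / 2 \<and>
      dist (u (cl t) (x + (1 / real (Suc n)) *\<^sub>R 1)) (u (cl t) x) < e / 2"
    using tendstoD[OF lim(1) e2] tendstoD[OF lim(2) e2] by eventually_elim simp
  then obtain n where n: "dist (u (cl t) (x - (1 / real (Suc n)) *\<^sub>R 1)) (u (cl t) x) < e / 2"
      "dist (u (cl t) (x + (1 / real (Suc n)) *\<^sub>R 1)) (u (cl t) x) < e / 2"
    using eventually_happens'[OF sequentially_bot] by blast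
  define \<delta> where "\<delta> = 1 / real (Suc n) / 2"
  have \<delta>: "\<delta> > 0" "1 / real (Suc n) = 2 * \<delta>" unfolding \<delta>_def by (simp_all add: field_simps)
  have \<delta>2: "\<delta> / 2 > 0" using \<delta>(1) by simp
  note n' = n[unfolded \<delta>(2)]
  define lo where "lo s = convolution (u s) (moll_lower \<rho> (\<delta> / 2)) (x - \<delta> *\<^sub>R 1)" for s
  define up where "up s = convolution (u s) (moll_upper \<rho> (\<delta> / 2)) (x + \<delta> *\<^sub>R 1)" for s
  have two: "\<delta> *\<^sub>R (1 :: real ^ 'd) + \<delta> *\<^sub>R 1 = (2 * \<delta>) *\<^sub>R 1" by (simp add: scaleR_add_left[symmetric])
  have lo1: "u s (x - \<delta> *\<^sub>R 1) \<le> lo s" and up1: "up s \<le> u s (x + \<delta> *\<^sub>R 1)" if "s \<in> {0..T}" for s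
    using mollified_bounds(1,4)[OF \<rho> \<delta>2 anti[OF that]] unfolding lo_def up_def by auto
  have lo2: "lo (cl t) \<le> u (cl t) (x - (2 * \<delta>) *\<^sub>R 1)" and up2: "u (cl t) (x + (2 * \<delta>) *\<^sub>R 1) \<le> up (cl t)"
    using mollified_bounds(2)[OF \<rho> \<delta>2 anti[OF cl(1)[of t]], of "x - \<delta> *\<^sub>R 1"]
      mollified_bounds(3)[OF \<rho> \<delta>2 anti[OF cl(1)[of t]], of "x + \<delta> *\<^sub>R 1"]
    unfolding lo_def up_def two[symmetric] by (simp_all add: algebra_simps)
  have "continuous_on {0..T} lo" "continuous_on {0..T} up"
    unfolding lo_def up_def
    by (rule AC_continuous_on, rule mollified_AC(2)[OF \<delta>2 super], rule AC_continuous_on, rule mollified_AC(1)[OF \<delta>2 sub])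
  then obtain d1 d2 where d1: "d1 > 0" "\<And>s. s \<in> {0..T} \<Longrightarrow> dist s (cl t) < d1 \<Longrightarrow> dist (lo s) (lo (cl t)) < e / 2"
      and d2: "d2 > 0" "\<And>s. s \<in> {0..T} \<Longrightarrow> dist s (cl t) < d2 \<Longrightarrow> dist (up s) (up (cl t)) < e / 2"
    using cl(1)[of t] e2 unfolding continuous_on_iff by metis
  show "\<exists>d>0. \<forall>z. dist z (t, x) < d \<longrightarrow>
      dist (u (max 0 (min T (fst z))) (snd z)) (u (max 0 (min T (fst (t, x)))) (snd (t, x))) < e"
    unfolding cl_def[symmetric] fst_conv snd_conv
  proof (intro exI[of _ "min \<delta> (min d1 d2)"] conjI allI impI)
    show "0 < min \<delta> (min d1 d2)" using \<delta> d1(1) d2(1) by simp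
    fix z :: "real \<times> (real ^ 'd)" assume z: "dist z (t, x) < min \<delta> (min d1 d2)"
    have "dist (cl (fst z)) (cl t) \<le> dist z (t, x)" using cl(2)[of "fst z" t] dist_fst_le[of z "(t, x)"] by simp
    then have dt: "dist (cl (fst z)) (cl t) < d1" "dist (cl (fst z)) (cl t) < d2" using z by auto
    have dx: "norm (snd z - x) \<le> \<delta>" using z dist_snd_le[of z "(t, x)"] by (auto simp: dist_norm)
    have "snd z - x \<le> \<delta> *\<^sub>R 1" "- (\<delta> *\<^sub>R 1) \<le> snd z - x" by (rule vec_one_bounds[OF dx])+
    then have "snd z \<le> x + \<delta> *\<^sub>R 1" "x - \<delta> *\<^sub>R 1 \<le> snd z" by (auto simp: less_eq_vec_def algebra_simps)
    then have "u (cl (fst z)) (x + \<delta> *\<^sub>R 1) \<le> u (cl (fst z)) (snd z)" "u (cl (fst z)) (snd z) \<le> u (cl (fst z)) (x - \<delta> *\<^sub>R 1)"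
      by (auto intro: antimonoD[OF anti[OF cl(1)]])
    then show "dist (u (cl (fst z)) (snd z)) (u (cl t) x) < e"
      using d1(2)[OF cl(1) dt(1)] d2(2)[OF cl(1) dt(2)] n' lo1[OF cl(1)[of "fst z"]] up1[OF cl(1)[of "fst z"]] lo2 up2
      unfolding dist_real_def by linarith
  qed
qed

lemma solution_continuous_ae:
  fixes u :: "real \<Rightarrow> real ^ 'd \<Rightarrow> real"
  assumes \<rho>: "mollifier \<rho>" and u: "TE_solution \<rho> T b u" and T: "0 \<le> T"
  shows "AE z in lebesgue_on ({0..T} \<times> UNIV). continuous (at z within {0..T} \<times> UNIV) (\<lambda>(t, x). u t x)"
proof (rule AE_lebesgue_on_if_AE_lborel)
  show "{0..T} \<times> UNIV \<in> sets lebesgue" by (intro sets_completionI_sets) (simp add: borel_closed closed_Times)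
  let ?g = "\<lambda>z. u (max 0 (min T (fst z))) (snd z)"
  have "AE z in lborel. z \<in> {z. isCont ?g z}"
  proof (rule AE_pair_if_AE_space[OF isCont_borel])
    fix t :: real
    have "max 0 (min T t) \<in> {0..T}" using T by auto
    then have "antimono (u (max 0 (min T t)))" using u solution_antimono(1) unfolding TE_solution_def by blast
    then have "AE x in lborel. isCont (u (max 0 (min T t))) x" by (rule antimono_isCont_ae)
    then show "AE x in lborel. (t, x) \<in> {z. isCont ?g z}"
      by (rule eventually_mono) (use solution_isCont_if_isCont_section[OF \<rho> u T] in auto)
  qed
  then show "AE z in lborel. z \<in> {0..T} \<times> UNIV \<longrightarrow> continuous (at z within {0..T} \<times> UNIV) (\<lambda>(t, x). u t x)"
  proof (rule eventually_mono, intro impI)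
    fix z assume "z \<in> {z. isCont ?g z}" and z: "z \<in> {0..T} \<times> (UNIV :: (real ^ 'd) set)"
    then have "continuous (at z within {0..T} \<times> UNIV) ?g" by (simp add: continuous_at_imp_continuous_at_within)
    then show "continuous (at z within {0..T} \<times> UNIV) (\<lambda>(t, x). u t x)"
      by (rule continuous_transform_within[OF _ zero_less_one z]) auto
  qed
qed

lemma antimono_ae_eq_bounds:
  fixes f g :: "real ^ 'd \<Rightarrow> real"
  assumes f: "antimono f" and g: "antimono g" and eq: "AE x in lborel. f x = g x" and \<delta>: "\<delta> > 0"
  shows "g (y + \<delta> *\<^sub>R 1) \<le> f y"
proof -
  obtain z where z: "z \<in> box y (y + \<delta> *\<^sub>R 1)" "f z = g z"
    using ae_meets_box[OF eq, of y "y + \<delta> *\<^sub>R 1"] \<delta> by auto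
  have "y \<le> z" "z \<le> y + \<delta> *\<^sub>R 1" using z(1) by (auto simp: mem_box_cart less_eq_vec_def intro: less_imp_le)
  then have "g (y + \<delta> *\<^sub>R 1) \<le> g z" "f z \<le> f y" using f g by (auto simp: antimono_def)
  then show ?thesis using z(2) by simp
qed

lemma antimono_eq_ae_if_interlaced:
  fixes f g :: "real ^ 'd \<Rightarrow> real"
  assumes f: "antimono f" and g: "antimono g"
    and fg: "\<And>x \<delta>. \<delta> > 0 \<Longrightarrow> f (x + \<delta> *\<^sub>R 1) \<le> g (x - \<delta> *\<^sub>R 1)"
    and gf: "\<And>x \<delta>. \<delta> > 0 \<Longrightarrow> g (x + \<delta> *\<^sub>R 1) \<le> f (x - \<delta> *\<^sub>R 1)"
  shows "AE x in lborel. f x = g x"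
  using antimono_isCont_ae[OF f] antimono_isCont_ae[OF g]
proof eventually_elim
  case (elim x)
  have pos: "0 < 1 / real (Suc n)" for n by simp
  have "f x \<le> g x" by (rule LIMSEQ_le[OF tendsto_diag(2)[OF elim(1)] tendsto_diag(1)[OF elim(2)]]) (use fg[OF pos] in blast)
  moreover have "g x \<le> f x" by (rule LIMSEQ_le[OF tendsto_diag(2)[OF elim(2)] tendsto_diag(1)[OF elim(1)]]) (use gf[OF pos] in blast)
  ultimately show ?case by simp
qed

context growth_field
begin

lemma mollified_along_flow:
  assumes reg: "AE t in lborel. t \<in> {0..T} \<longrightarrow> regularises_at (B t) (b t)"
    and \<rho>: "mollifier \<rho>" and \<epsilon>: "\<epsilon> > 0" and s: "0 \<le> s" "s \<le> t" "t \<le> T"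
  shows "TE_subsolution \<rho> T b u \<Longrightarrow>
      convolution (u s) (moll_upper \<rho> \<epsilon>) x \<le> convolution (u t) (moll_upper \<rho> \<epsilon>) (flow s x t)"
    "TE_supersolution \<rho> T b u \<Longrightarrow>
      convolution (u t) (moll_lower \<rho> \<epsilon>) (flow s x t) \<le> convolution (u s) (moll_lower \<rho> \<epsilon>) x"
proof -
  show "convolution (u s) (moll_upper \<rho> \<epsilon>) x \<le> convolution (u t) (moll_upper \<rho> \<epsilon>) (flow s x t)" if u: "TE_subsolution \<rho> T b u"
    by (rule conv_subsolution_along_flow[OF reg kernel_moll_upper[OF \<rho> \<epsilon>] solution_antimono(1)[OF u] mollified_AC(1)[OF \<epsilon> u] _ s])
      (use u \<epsilon> in \<open>auto simp: TE_subsolution_def Let_def\<close>)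
  show "convolution (u t) (moll_lower \<rho> \<epsilon>) (flow s x t) \<le> convolution (u s) (moll_lower \<rho> \<epsilon>) x" if u: "TE_supersolution \<rho> T b u"
    by (rule conv_supersolution_along_flow[OF reg kernel_moll_lower[OF \<rho> \<epsilon>] solution_antimono(2)[OF u] mollified_AC(2)[OF \<epsilon> u] _ s])
      (use u \<epsilon> in \<open>auto simp: TE_supersolution_def Let_def\<close>)
qed

text \<open>
  Values at \<open>(t, x)\<close> and \<open>(T, flow t x T)\<close> are compared up to shifts by \<open>\<delta>\<close>, which stem from the
  mollification and from the fact that \<open>u T\<close> equals \<open>g\<close> almost everywhere only. By expansion a shift of the
  end point is dominated by the same shift of the starting point.
\<close>

lemma solution_unique:
  assumes reg: "AE t in lborel. t \<in> {0..T} \<longrightarrow> regularises_at (B t) (b t)"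
    and \<rho>: "mollifier \<rho>" and u: "TE_solution \<rho> T b u" and g: "antimono g"
    and final: "AE x in lebesgue. u T x = g x" and t: "t \<in> {0..T}"
  shows "AE x in lebesgue. u t x = g (flow t x T)"
proof -
  have sub: "TE_subsolution \<rho> T b u" and super: "TE_supersolution \<rho> T b u" using u unfolding TE_solution_def by auto
  have TT: "T \<in> {0..T}" using t by simp
  note anti = solution_antimono(1)[OF sub]
  have eq: "AE x in lborel. u T x = g x" using final unfolding AE_completion_iff .
  then have eq': "AE x in lborel. g x = u T x" by eventually_elim simp
  note W = transported_antimono[OF g, of T t]
  have "AE x in lborel. u t x = transported T g t x"
  proof (rule antimono_eq_ae_if_interlaced[OF anti[OF t] W])
    fix x :: "real ^ 'd" and \<delta> :: real assume \<delta>: "\<delta> > 0"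
    then have \<delta>2: "\<delta> / 2 > 0" by simp
    note moll = mollified_bounds[OF \<rho> \<delta>2, simplified]
    have le: "x - \<delta> *\<^sub>R 1 \<le> x" "x \<le> x + \<delta> *\<^sub>R 1"
      using less_imp_le[OF \<delta>] by (simp_all add: less_eq_vec_def)
    have "u t (x + \<delta> *\<^sub>R 1) \<le> convolution (u t) (moll_upper \<rho> (\<delta> / 2)) x" by (rule moll(3)[OF anti[OF t]])
    also have "\<dots> \<le> convolution (u T) (moll_upper \<rho> (\<delta> / 2)) (flow t x T)"
      by (rule mollified_along_flow(1)[OF reg \<rho> \<delta>2 _ _ _ sub]) (use t in auto)
    also have "\<dots> \<le> u T (flow t x T)" by (rule moll(4)[OF anti[OF TT]])
    also have "\<dots> \<le> g (flow t x T - \<delta> *\<^sub>R 1)"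
      using antimono_ae_eq_bounds[OF g anti[OF TT] eq' \<delta>, of "flow t x T - \<delta> *\<^sub>R 1"] by simp
    also have "flow t (x - \<delta> *\<^sub>R 1) T \<le> flow t x T - \<delta> *\<^sub>R 1"
      using flow_expanding[OF le(1), of t T] by (simp add: less_eq_vec_def algebra_simps)
    then have "g (flow t x T - \<delta> *\<^sub>R 1) \<le> transported T g t (x - \<delta> *\<^sub>R 1)"
      unfolding transported_def by (rule antimonoD[OF g])
    finally show "u t (x + \<delta> *\<^sub>R 1) \<le> transported T g t (x - \<delta> *\<^sub>R 1)" .
    have "flow t x T + \<delta> *\<^sub>R 1 \<le> flow t (x + \<delta> *\<^sub>R 1) T"
      using flow_expanding[OF le(2), of t T] by (simp add: less_eq_vec_def algebra_simps)
    then have "transported T g t (x + \<delta> *\<^sub>R 1) \<le> g (flow t x T + \<delta> *\<^sub>R 1)"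
      unfolding transported_def by (rule antimonoD[OF g])
    also have "\<dots> \<le> u T (flow t x T)" by (rule antimono_ae_eq_bounds[OF anti[OF TT] g eq \<delta>])
    also have "\<dots> \<le> convolution (u T) (moll_lower \<rho> (\<delta> / 2)) (flow t x T)" by (rule moll(1)[OF anti[OF TT]])
    also have "\<dots> \<le> convolution (u t) (moll_lower \<rho> (\<delta> / 2)) x"
      by (rule mollified_along_flow(2)[OF reg \<rho> \<delta>2 _ _ _ super]) (use t in auto)
    also have "\<dots> \<le> u t (x - \<delta> *\<^sub>R 1)" by (rule moll(2)[OF anti[OF t]])
    finally show "transported T g t (x + \<delta> *\<^sub>R 1) \<le> u t (x - \<delta> *\<^sub>R 1)" .
  qed
  then show ?thesis unfolding transported_def by (rule AE_completion)
qed

text \<open>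
  How far the flow can leave the ball of radius \<open>R\<close> during the last \<open>h\<close> units of time.
\<close>

definition spread :: "real \<Rightarrow> real \<Rightarrow> real \<Rightarrow> real" where
  "spread T R h = (1 + R) * (exp (integral {T - h..T} C) - 1)"

lemma spread_modulus:
  assumes "R > 0"
  shows "modulus_of_continuity (spread T R)"
proof -
  have "continuous_on UNIV (\<lambda>s. integral {s..T} C)"
  proof (rule continuous_if_dominated[OF C_int C_nonneg])
    fix u v :: real assume uv: "u \<le> v"
    show "\<bar>integral {v..T} C - integral {u..T} C\<bar> \<le> integral {u..v} C"
    proof (cases "v \<le> T")
      case True
      have "integral {u..v} C + integral {v..T} C = integral {u..T} C"
        by (rule Henstock_Kurzweil_Integration.integral_combine) (use uv True C_on in auto)
      then show ?thesis using CI_nonneg[of u v] by simp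
    next
      case False
      then have "integral {v..T} C = 0" by simp
      moreover have "integral {u..T} C \<le> integral {u..v} C" using False by (intro CI_mono) auto
      ultimately show ?thesis using CI_nonneg[of u T] by simp
    qed
  qed
  then have "continuous_on {0..} (\<lambda>h. integral {T - h..T} C)"
    by (rule continuous_on_compose2) (auto intro!: continuous_intros)
  then have "continuous_on {0..} (spread T R)" unfolding spread_def[abs_def] by (intro continuous_intros)
  moreover have "mono_on {0..} (spread T R)"
  proof (rule mono_onI)
    fix h k :: real assume "h \<le> k"
    then have "integral {T - h..T} C \<le> integral {T - k..T} C" by (intro CI_mono) auto
    then show "spread T R h \<le> spread T R k" unfolding spread_def using \<open>R > 0\<close> by (intro mult_left_mono) auto
  qed
  ultimately show ?thesis unfolding modulus_of_continuity_def by (simp add: spread_def)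
qed

lemma flow_in_spread_ball:
  assumes "x \<in> ball 0 R" and "t \<le> T"
  shows "flow t x T \<in> ball 0 (R + spread T R (T - t))"
proof -
  have "1 + norm (flow t x T) \<le> (1 + norm x) * exp (integral {t..T} C)" by (rule flow_bound[OF assms(2)])
  also have "\<dots> < (1 + R) * exp (integral {t..T} C)" using assms(1) by simp
  finally show ?thesis unfolding spread_def by (simp add: algebra_simps)
qed

text \<open>
  The mollifications are needed for more than differentiability: they make the integrand at time \<open>T\<close>
  lower semicontinuous. On the right they are replaced by \<open>u T\<close> and \<open>v T\<close> at once, as the mollified
  subsolution is at most \<open>u\<close> and the mollified supersolution at least \<open>v\<close>.
\<close>

lemma mollified_comparison:
  assumes reg: "AE t in lborel. t \<in> {0..T} \<longrightarrow> regularises_at (B t) (b t)"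
    and \<rho>: "mollifier \<rho>" and \<epsilon>: "\<epsilon> > 0"
    and u: "TE_subsolution \<rho> T b u" and v: "TE_supersolution \<rho> T b v"
    and t: "t \<in> {0..T}" and p: "p \<ge> 1"
  shows "(\<integral>\<^sup>+x. indicator (ball 0 R) x *
        ennreal (max (convolution (u t) (moll_upper \<rho> \<epsilon>) x - convolution (v t) (moll_lower \<rho> \<epsilon>) x) 0 powr p) \<partial>lborel)
      \<le> (\<integral>\<^sup>+x. indicator (ball 0 (R + spread T R (T - t))) x * ennreal (max (u T x - v T x) 0 powr p) \<partial>lborel)"
proof -
  have TT: "T \<in> {0..T}" using t by simp
  define F where "F s x = max (convolution (u s) (moll_upper \<rho> \<epsilon>) x - convolution (v s) (moll_lower \<rho> \<epsilon>) x) 0 powr p" for s x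
  define U where "U = ball (0 :: real ^ 'd) (R + spread T R (T - t))"
  define G where "G x = indicator U x * ennreal (F T x)" for x
  have cont: "continuous_on UNIV (convolution f \<psi>)" if "kernel \<psi> a c" "antimono f" for f \<psi> a c
  proof -
    have "isCont (convolution f \<psi>) x" for x
      using conv_gderiv[OF that, of x] unfolding gderiv_def by (rule has_derivative_continuous)
    then show ?thesis by (simp add: continuous_on_eq_continuous_at)
  qed
  have contF: "continuous_on UNIV (F T)"
    unfolding F_def[abs_def] using p
    by (intro continuous_on_powr' continuous_on_max continuous_on_diff continuous_on_const
        cont[OF kernel_moll_upper[OF \<rho> \<epsilon>] solution_antimono(1)[OF u TT]]
        cont[OF kernel_moll_lower[OF \<rho> \<epsilon>] solution_antimono(2)[OF v TT]]) auto
  have Gm: "G \<in> borel_measurable borel"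
    unfolding G_def[abs_def] U_def
    by (intro borel_measurable_times_ennreal borel_measurable_indicator borel_open open_ball
        measurable_compose[OF borel_measurable_continuous_onI[OF contF] measurable_ennreal])
  have G_lsc: "\<forall>\<^sub>F z in nhds y. e < G z" if e: "e < G y" for y e
  proof -
    have "y \<in> U" using e unfolding G_def by (cases "y \<in> U") auto
    then have y: "y \<in> U" "e < ennreal (F T y)" using e unfolding G_def by auto
    have "continuous_on UNIV (\<lambda>z. ennreal (F T z))" by (rule continuous_on_ennreal[OF contF])
    then have "((\<lambda>z. ennreal (F T z)) \<longlongrightarrow> ennreal (F T y)) (nhds y)"
      by (simp add: continuous_on_eq_continuous_at continuous_at tendsto_nhds_iff)
    from order_tendstoD(1)[OF this y(2)] eventually_nhds_in_open[of U y] show ?thesis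
      using y(1) unfolding U_def G_def by (auto elim: eventually_elim2)
  qed
  have "(\<integral>\<^sup>+x. indicator (ball 0 R) x * ennreal (F t x) \<partial>lborel)
      \<le> (\<integral>\<^sup>+x. indicator (ball 0 R) x * G (flow t x T) \<partial>lborel)"
  proof (rule nn_integral_mono)
    fix x :: "real ^ 'd"
    have "convolution (u t) (moll_upper \<rho> \<epsilon>) x \<le> convolution (u T) (moll_upper \<rho> \<epsilon>) (flow t x T)"
      by (rule mollified_along_flow(1)[OF reg \<rho> \<epsilon> _ _ _ u]) (use t in auto)
    moreover have "convolution (v T) (moll_lower \<rho> \<epsilon>) (flow t x T) \<le> convolution (v t) (moll_lower \<rho> \<epsilon>) x"
      by (rule mollified_along_flow(2)[OF reg \<rho> \<epsilon> _ _ _ v]) (use t in auto)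
    ultimately have FF: "F t x \<le> F T (flow t x T)" unfolding F_def using p by (intro powr_mono2 max.mono) auto
    show "indicator (ball 0 R) x * ennreal (F t x) \<le> indicator (ball 0 R) x * G (flow t x T)"
    proof (cases "x \<in> ball 0 R")
      case True
      have "flow t x T \<in> U" unfolding U_def by (rule flow_in_spread_ball[OF True]) (use t in simp)
      then show ?thesis unfolding G_def using FF True by (simp add: ennreal_leI)
    qed simp
  qed
  also have "\<dots> \<le> (\<integral>\<^sup>+x. G x \<partial>lborel)"
    by (rule nn_integral_flow_ball_le[OF _ Gm G_lsc]) (use t in auto)
  also have "\<dots> \<le> (\<integral>\<^sup>+x. indicator U x * ennreal (max (u T x - v T x) 0 powr p) \<partial>lborel)"
  proof (rule nn_integral_mono)
    fix x :: "real ^ 'd"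
    have "convolution (u T) (moll_upper \<rho> \<epsilon>) x \<le> u T x" "v T x \<le> convolution (v T) (moll_lower \<rho> \<epsilon>) x"
      by (rule mollified_bounds[OF \<rho> \<epsilon>] solution_antimono[OF _ TT] u v)+
    then have "F T x \<le> max (u T x - v T x) 0 powr p" unfolding F_def using p by (intro powr_mono2 max.mono) auto
    then show "G x \<le> indicator U x * ennreal (max (u T x - v T x) 0 powr p)"
      unfolding G_def by (intro mult_left_mono ennreal_leI) auto
  qed
  finally show ?thesis unfolding F_def U_def .
qed

lemma comparison_nn:
  assumes reg: "AE t in lborel. t \<in> {0..T} \<longrightarrow> regularises_at (B t) (b t)"
    and \<rho>: "mollifier \<rho>"
    and u: "TE_subsolution \<rho> T b u" and v: "TE_supersolution \<rho> T b v"
    and t: "t \<in> {0..T}" and p: "p \<ge> 1"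
  shows "(\<integral>\<^sup>+x. indicator (ball 0 R) x * ennreal (max (u t x - v t x) 0 powr p) \<partial>lborel)
      \<le> (\<integral>\<^sup>+x. indicator (ball 0 (R + spread T R (T - t))) x * ennreal (max (u T x - v T x) 0 powr p) \<partial>lborel)"
    (is "_ \<le> ?rhs")
proof -
  define D where "D n x = convolution (u t) (moll_upper \<rho> (moll_scale n)) x - convolution (v t) (moll_lower \<rho> (moll_scale n)) x" for n x
  define H where "H n x = indicator (ball 0 R) x * ennreal (max (D n x) 0 powr p)" for n and x :: "real ^ 'd"
  note ut = solution_antimono(1)[OF u t] and vt = solution_antimono(2)[OF v t]
  have Hm: "H n \<in> borel_measurable lebesgue" for n
  proof -
    have "D n \<in> borel_measurable lebesgue" unfolding D_def[abs_def]
      by (intro borel_measurable_diff antimono_lebesgue_measurable conv_antimono[OF kernel_moll_upper[OF \<rho> moll_scale(1)] ut]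
          conv_antimono[OF kernel_moll_lower[OF \<rho> moll_scale(1)] vt])
    then show ?thesis unfolding H_def[abs_def]
      by (intro borel_measurable_times_ennreal borel_measurable_indicator sets_completionI_sets
          measurable_compose[OF _ measurable_ennreal] powr_real_measurable borel_measurable_max borel_measurable_const) auto
  qed
  have "(\<integral>\<^sup>+x. indicator (ball 0 R) x * ennreal (max (u t x - v t x) 0 powr p) \<partial>lebesgue) \<le> (\<integral>\<^sup>+x. liminf (\<lambda>n. H n x) \<partial>lebesgue)"
  proof (rule nn_integral_mono_AE)
    from AE_completion[OF antimono_isCont_ae[OF ut]] AE_completion[OF antimono_isCont_ae[OF vt]]
    show "AE x in lebesgue. indicator (ball 0 R) x * ennreal (max (u t x - v t x) 0 powr p) \<le> liminf (\<lambda>n. H n x)"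
    proof eventually_elim
      case (elim x)
      have "(\<lambda>n. D n x) \<longlonglongrightarrow> u t x - v t x" unfolding D_def
        by (intro tendsto_diff mollified_tendsto \<rho> ut vt elim)
      then have "(\<lambda>n. max (D n x) 0 powr p) \<longlonglongrightarrow> max (u t x - v t x) 0 powr p"
        using p by (intro tendsto_powr' tendsto_max tendsto_const) auto
      then have "(\<lambda>n. H n x) \<longlonglongrightarrow> indicator (ball 0 R) x * ennreal (max (u t x - v t x) 0 powr p)"
        unfolding H_def by (cases "x \<in> ball 0 R") (auto intro: tendsto_ennrealI)
      from lim_imp_Liminf[OF sequentially_bot this] show ?case by simp
    qed
  qed
  also have "\<dots> \<le> liminf (\<lambda>n. \<integral>\<^sup>+x. H n x \<partial>lebesgue)" by (rule nn_integral_liminf[OF Hm])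
  also have "\<dots> \<le> ?rhs"
  proof (rule Liminf_le[OF sequentially_bot always_eventually, rule_format])
    fix n
    show "(\<integral>\<^sup>+x. H n x \<partial>lebesgue) \<le> ?rhs"
      unfolding H_def D_def nn_integral_completion by (rule mollified_comparison[OF reg \<rho> moll_scale(1) u v t p])
  qed
  finally show ?thesis unfolding nn_integral_completion .
qed

lemma power_difference_integral:
  fixes f g :: "real ^ 'd \<Rightarrow> real"
  assumes f: "antimono f" and g: "antimono g" and p: "p \<ge> 1"
  shows "ennreal (LINT x:ball 0 r|lebesgue. max (f x - g x) 0 powr p)
      = (\<integral>\<^sup>+x. indicator (ball 0 r) x * ennreal (max (f x - g x) 0 powr p) \<partial>lborel)"
proof -
  let ?h = "\<lambda>x. max (f x - g x) 0 powr p"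
  obtain M where M: "0 \<le> M" "\<And>y. norm y \<le> \<bar>r\<bar> \<Longrightarrow> \<bar>f y\<bar> \<le> M" by (rule antimono_locally_bounded[OF f, where Q = "\<bar>r\<bar>"]) blast
  obtain N where N: "0 \<le> N" "\<And>y. norm y \<le> \<bar>r\<bar> \<Longrightarrow> \<bar>g y\<bar> \<le> N" by (rule antimono_locally_bounded[OF g, where Q = "\<bar>r\<bar>"]) blast
  have "integrable lebesgue (\<lambda>y. ?h y * indicator (ball 0 r) y)"
  proof (rule integral_bounded_support(1)[where Q = "\<bar>r\<bar>" and M = "(M + N) powr p" and c = 1])
    show "?h \<in> borel_measurable lebesgue" using antimono_lebesgue_measurable[OF f] antimono_lebesgue_measurable[OF g] by measurable
    show "\<bar>?h y\<bar> \<le> (M + N) powr p" if "norm y \<le> \<bar>r\<bar>" for y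
    proof -
      have "max (f y - g y) 0 \<le> M + N" using M(1) N(1) M(2)[OF that] N(2)[OF that] by (simp add: abs_le_iff)
      then show ?thesis using p by (simp add: powr_mono2)
    qed
  qed (auto simp: indicator_def)
  then have "integrable lebesgue (\<lambda>x. indicator (ball 0 r) x *\<^sub>R ?h x)" by (simp add: mult.commute)
  then have "(\<integral>\<^sup>+x. ennreal (indicator (ball 0 r) x *\<^sub>R ?h x) \<partial>lebesgue) = ennreal (LINT x|lebesgue. indicator (ball 0 r) x *\<^sub>R ?h x)"
    by (rule nn_integral_eq_integral) simp
  moreover have "ennreal (indicator (ball 0 r) x *\<^sub>R ?h x) = indicator (ball 0 r) x * ennreal (?h x)" for x
    by (simp add: indicator_def)
  ultimately show ?thesis unfolding set_lebesgue_integral_def by (simp add: nn_integral_completion)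
qed

theorem comparison:
  assumes reg: "AE t in lborel. t \<in> {0..T} \<longrightarrow> regularises_at (B t) (b t)"
    and \<rho>: "mollifier \<rho>"
    and u: "TE_subsolution \<rho> T b u" and v: "TE_supersolution \<rho> T b v"
    and t: "t \<in> {0..T}" and p: "p \<ge> 1"
  shows "(LINT x:ball 0 R|lebesgue. max (u t x - v t x) 0 powr p)
      \<le> (LINT x:ball 0 (R + spread T R (T - t))|lebesgue. max (u T x - v T x) 0 powr p)"
proof -
  have TT: "T \<in> {0..T}" using t by simp
  have "ennreal (LINT x:ball 0 R|lebesgue. max (u t x - v t x) 0 powr p)
      \<le> ennreal (LINT x:ball 0 (R + spread T R (T - t))|lebesgue. max (u T x - v T x) 0 powr p)"
    unfolding power_difference_integral[OF solution_antimono(1)[OF u t] solution_antimono(2)[OF v t] p]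
      power_difference_integral[OF solution_antimono(1)[OF u TT] solution_antimono(2)[OF v TT] p]
    by (rule comparison_nn[OF reg \<rho> u v t p])
  moreover have "0 \<le> (LINT x:ball 0 (R + spread T R (T - t))|lebesgue. max (u T x - v T x) 0 powr p)"
    unfolding set_lebesgue_integral_def by (intro integral_nonneg_AE) simp
  ultimately show ?thesis by (simp add: ennreal_le_iff)
qed

end

theorem theorem4p2:
  fixes T :: real
    and b :: "real \<Rightarrow> real ^ 'd \<Rightarrow> real ^ 'd"
    and C\<^sub>0 :: "real \<Rightarrow> real"
    and \<rho> :: "real ^ 'd \<Rightarrow> real"
  assumes "T > 0"
    and "mollifier \<rho>"
    and "(\<lambda>(t, y). b t y) \<in> borel_measurable (lebesgue_on ({0..T} \<times> UNIV))"
    and "\<forall>t\<in>{0..T}. 0 \<le> C\<^sub>0 t"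
    and "integrable (lebesgue_on {0..T}) C\<^sub>0"
    and "AE (t, y) in lebesgue_on ({0..T} \<times> UNIV). norm (b t y) \<le> C\<^sub>0 t * (1 + norm y)"
    and "AE t in lebesgue_on {0..T}. mono (b t)"
  shows "(\<forall>R>0. \<exists>\<omega>. modulus_of_continuity \<omega> \<and>
           (\<forall>u v. TE_subsolution \<rho> T b u \<longrightarrow> TE_supersolution \<rho> T b v \<longrightarrow>
              (\<forall>t\<in>{0..T}. \<forall>p\<ge>1.
                 (LINT x:ball 0 R|lebesgue. max (u t x - v t x) 0 powr p)
                 \<le> (LINT x:ball 0 (R + \<omega> (T - t))|lebesgue. max (u T x - v T x) 0 powr p)))) \<and>
         (\<exists>\<phi>. regular_lagrangian_flow T b \<phi> \<and>
           (\<forall>u\<^sub>T. antimono u\<^sub>T \<longrightarrow>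
              (\<exists>u. TE_solution \<rho> T b u \<and> u T = u\<^sub>T) \<and>
              (\<forall>u v. TE_solution \<rho> T b u \<and> (AE x in lebesgue. u T x = u\<^sub>T x) \<and>
                     TE_solution \<rho> T b v \<and> (AE x in lebesgue. v T x = u\<^sub>T x) \<longrightarrow>
                 (\<forall>t\<in>{0..T}. AE x in lebesgue. u t x = v t x)) \<and>
              (\<forall>u. TE_solution \<rho> T b u \<and> (AE x in lebesgue. u T x = u\<^sub>T x) \<longrightarrow>
                 (\<forall>t\<in>{0..T}. AE x in lebesgue. u t x = solution_operator \<phi> t T u\<^sub>T x) \<and>
                 (AE z in lebesgue_on ({0..T} \<times> UNIV).
                    continuous (at z within {0..T} \<times> UNIV) (\<lambda>(t, x). u t x)))))"
proof -
  obtain B C where BC: "growth_field B C"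
      and reg: "AE t in lborel. t \<in> {0..T} \<longrightarrow> regularises_at (B t) (b t)"
    using ex_regularised_field[OF assms(1,3-7)] by blast
  interpret growth_field B C by (rule BC)
  note \<rho> = assms(2)
  show ?thesis
  proof (rule conjI)
    show "\<forall>R>0. \<exists>\<omega>. modulus_of_continuity \<omega> \<and>
           (\<forall>u v. TE_subsolution \<rho> T b u \<longrightarrow> TE_supersolution \<rho> T b v \<longrightarrow>
              (\<forall>t\<in>{0..T}. \<forall>p\<ge>1.
                 (LINT x:ball 0 R|lebesgue. max (u t x - v t x) 0 powr p)
                 \<le> (LINT x:ball 0 (R + \<omega> (T - t))|lebesgue. max (u T x - v T x) 0 powr p)))"
    proof (intro allI impI)
      fix R :: real assume "R > 0"
      then show "\<exists>\<omega>. modulus_of_continuity \<omega> \<and>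
           (\<forall>u v. TE_subsolution \<rho> T b u \<longrightarrow> TE_supersolution \<rho> T b v \<longrightarrow>
              (\<forall>t\<in>{0..T}. \<forall>p\<ge>1.
                 (LINT x:ball 0 R|lebesgue. max (u t x - v t x) 0 powr p)
                 \<le> (LINT x:ball 0 (R + \<omega> (T - t))|lebesgue. max (u T x - v T x) 0 powr p)))"
        by (intro exI[of _ "spread T R"] conjI spread_modulus allI impI ballI comparison[OF reg \<rho>])
    qed
    have operator: "solution_operator (\<lambda>t s x. flow s x t) t T g x = g (flow t x T)" for g :: "real ^ 'd \<Rightarrow> real" and t x
      unfolding solution_operator_def ..
    show "\<exists>\<phi>. regular_lagrangian_flow T b \<phi> \<and>
           (\<forall>u\<^sub>T. antimono u\<^sub>T \<longrightarrow>
              (\<exists>u. TE_solution \<rho> T b u \<and> u T = u\<^sub>T) \<and>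
              (\<forall>u v. TE_solution \<rho> T b u \<and> (AE x in lebesgue. u T x = u\<^sub>T x) \<and>
                     TE_solution \<rho> T b v \<and> (AE x in lebesgue. v T x = u\<^sub>T x) \<longrightarrow>
                 (\<forall>t\<in>{0..T}. AE x in lebesgue. u t x = v t x)) \<and>
              (\<forall>u. TE_solution \<rho> T b u \<and> (AE x in lebesgue. u T x = u\<^sub>T x) \<longrightarrow>
                 (\<forall>t\<in>{0..T}. AE x in lebesgue. u t x = solution_operator \<phi> t T u\<^sub>T x) \<and>
                 (AE z in lebesgue_on ({0..T} \<times> UNIV).
                    continuous (at z within {0..T} \<times> UNIV) (\<lambda>(t, x). u t x))))"
    proof (intro exI[of _ "\<lambda>t s x. flow s x t"] conjI allI impI ballI flow_regular_lagrangian[OF reg])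
      fix g :: "real ^ 'd \<Rightarrow> real" assume g: "antimono g"
      show "\<exists>u. TE_solution \<rho> T b u \<and> u T = g"
        by (intro exI[of _ "transported T g"] conjI transported_solution[OF reg \<rho> g] transported_after order_refl)
      fix u assume u: "TE_solution \<rho> T b u \<and> (AE x in lebesgue. u T x = g x)"
      show "AE x in lebesgue. u t x = solution_operator (\<lambda>t s x. flow s x t) t T g x" if "t \<in> {0..T}" for t
        unfolding operator using u by (intro solution_unique[OF reg \<rho> _ g _ that]) auto
      show "AE z in lebesgue_on ({0..T} \<times> UNIV). continuous (at z within {0..T} \<times> UNIV) (\<lambda>(t, x). u t x)"
        using u assms(1) by (intro solution_continuous_ae[OF \<rho>]) auto
    next
      fix g u v t assume g: "antimono g" and t: "t \<in> {0..T}"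
        and uv: "TE_solution \<rho> T b u \<and> (AE x in lebesgue. u T x = g x) \<and> TE_solution \<rho> T b v \<and> (AE x in lebesgue. v T x = g x)"
      have "AE x in lebesgue. u t x = g (flow t x T)" "AE x in lebesgue. v t x = g (flow t x T)"
        by (rule solution_unique[OF reg \<rho> _ g _ t]; use uv in blast)+
      then show "AE x in lebesgue. u t x = v t x" by eventually_elim simp
    qed
  qed
qed

end
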